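(* Let $a_1,a_2,a_3$ be nonzero integers with $\gcd(a_1,a_2,a_3)=1$. Then $$\gamma_{a_1,a_2,a_3}=\sup_{q}\gamma_{a_1,a_2,a_3}(q),$$ where the supremum is over all positive integers $q$. Moreover, the supremum may be restricted to those positive integers $q$ all of whose prime factors divide $a_1a_2a_3$; that is, the supremum over such $q$ is also equal to $\gamma_{a_1,a_2,a_3}$.
   Context: For a finite set $S\subset\mathbb{Z}$, let $T_{a_1,a_2,a_3}(S)=\#\{(x_1,x_2,x_3)\in S^3: a_1x_1+a_2x_2+a_3x_3=0\}$, and let $\gamma_{a_1,a_2,a_3}=\limsup_{|S|\to+\infty}T_{a_1,a_2,a_3}(S)/|S|^2$, the limsup being over finite sets $S\subset\mathbb{Z}$. For $\alpha,\beta,\gamma\ge 0$, let $G(\alpha,\beta,\gamma)$ be the area of the region $\{(x,y)\in\mathbb{R}^2: |x|\le \alpha/2,\ |y|\le\beta/2,\ |x+y|\le\gamma/2\}$. For a positive integer $q$ and a function $g:\mathbb{Z}/q\mathbb{Z}\to[0,1]$ with $\sum_r g(r)=1$, define $$\gamma_{a_1,a_2,a_3}(g)=\frac{1}{|a_1a_2a_3|}\sum_{\substack{r_1,r_2,r_3 \in \mathbb{Z}/q\mathbb{Z}\\ a_1r_1+a_2r_2+a_3r_3\equiv 0 \ (\mathrm{mod}\ q)}}G(|a_1|g(r_1),|a_2|g(r_2),|a_3|g(r_3)).$$ Let $\gamma_{a_1,a_2,a_3}(q)$ be the maximum of $\gamma_{a_1,a_2,a_3}(g)$ over all functions $g:\mathbb{Z}/q\mathbb{Z}\to[0,1]$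 with $\sum_r g(r)=1$. *)

theory Defs
  imports "HOL-Analysis.Analysis" "HOL-Number_Theory.Cong" "HOL-Computational_Algebra.Primes"
begin

definition num_solutions :: "int \<Rightarrow> int \<Rightarrow> int \<Rightarrow> int set \<Rightarrow> nat" where
  "num_solutions a1 a2 a3 S =
     card {(x1, x2, x3) \<in> S \<times> S \<times> S. a1 * x1 + a2 * x2 + a3 * x3 = 0}"

text \<open>
  The limit superior along finite sets of integers whose cardinality tends to infinity.
  It is taken in the extended reals so that no boundedness has to be presupposed.
\<close>

definition limsup_density :: "int \<Rightarrow> int \<Rightarrow> int \<Rightarrow> ereal" where
  "limsup_density a1 a2 a3 =
     Limsup (inf (filtercomap card at_top) (principal {S :: int set. finite S}))
       (\<lambda>S. ereal (real (num_solutions a1 a2 a3 S) / (real (card S))\<^sup>2))"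

definition hexagon_area :: "real \<Rightarrow> real \<Rightarrow> real \<Rightarrow> real" where
  "hexagon_area \<alpha> \<beta> \<gamma> =
     measure lborel {(x :: real, y :: real). \<bar>x\<bar> \<le> \<alpha> / 2 \<and> \<bar>y\<bar> \<le> \<beta> / 2 \<and> \<bar>x + y\<bar> \<le> \<gamma> / 2}"

text \<open>
  Residue classes modulo \<open>q\<close> are represented by \<open>0, \<dots>, q - 1\<close>; the values of a weight
  outside this range are irrelevant.
\<close>

definition residue_weight :: "nat \<Rightarrow> (int \<Rightarrow> real) \<Rightarrow> bool" where
  "residue_weight q g \<longleftrightarrow>
     (\<forall>r \<in> {0..<int q}. 0 \<le> g r \<and> g r \<le> 1) \<and> (\<Sum>r \<in> {0..<int q}. g r) = 1"

definition weight_density :: "int \<Rightarrow> int \<Rightarrow> int \<Rightarrow> nat \<Rightarrow> (int \<Rightarrow> real) \<Rightarrow> real" where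
  "weight_density a1 a2 a3 q g =
     1 / real_of_int \<bar>a1 * a2 * a3\<bar> *
     (\<Sum>(r1, r2, r3) \<in> {(r1, r2, r3) \<in> {0..<int q} \<times> {0..<int q} \<times> {0..<int q}.
                         [a1 * r1 + a2 * r2 + a3 * r3 = 0] (mod int q)}.
        hexagon_area (\<bar>a1\<bar> * g r1) (\<bar>a2\<bar> * g r2) (\<bar>a3\<bar> * g r3))"

text \<open>
  The maximum over all weights modulo \<open>q\<close>. For \<open>q > 0\<close> it is attained, since
  \<^const>\<open>hexagon_area\<close> is continuous on nonnegative arguments and the weights form a
  nonempty compact simplex.
\<close>

definition max_weight_density :: "int \<Rightarrow> int \<Rightarrow> int \<Rightarrow> nat \<Rightarrow> real" where
  "max_weight_density a1 a2 a3 q =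
     (GREATEST v. \<exists>g. residue_weight q g \<and> v = weight_density a1 a2 a3 q g)"

end

theory Submission
  imports Defs
begin

text \<open>
  For the lower bound, a weight \<open>g\<close> modulo \<open>q\<close> is blown up to the set of all \<open>x\<close> with
  \<open>\<bar>x div q\<bar> \<le> N * g (x mod q) / 2\<close>: by counting lattice points, each triple of residue
  classes contributes its hexagon area, up to an error linear in \<open>N\<close>.

  For the upper bound, let \<open>S\<close> be a large set that almost maximises \<open>T(S) - \<kappa> * (card S)^2\<close>, with
  \<open>\<kappa>\<close> slightly below the limit superior. Pollard's inequality bounds the number of solutions in
  three sets of integers by a hexagon area plus \<open>1 / 4\<close>, so, with \<open>D = \<bar>a1 * a2 * a3\<bar>\<close>, it suffices
  to find a modulus \<open>q\<close> composed of primes dividing \<open>D\<close> and subsets \<open>S1, S2, S3\<close> of \<open>S\<close>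
  that carry almost all solutions, such that \<open>ai * Si\<close> occupies boundedly many classes modulo \<open>q * D\<close>
  and is almost uniform inside most of its classes: then the hexagon areas add up to the density of
  the weight \<open>r \<mapsto> cnt S q r / card S\<close>.

  Such a modulus comes from an energy that decreases when the modulus is refined. If refining by
  \<open>m = D ^ Suc l\<close> hardly lowers it, then by the near equality case of Cauchy-Schwarz the children of
  most classes are almost uniform on a coset of a subgroup of the integers modulo \<open>m\<close>. Whenever all
  three sets are concentrated modulo a further prime, that prime is absorbed into the modulus at no
  cost, so at the final modulus this no longer happens. Almost extremality makes the sizes of the
  classes of \<open>S\<close> comparable to one another, to every modulus; this rules out
  that one set, but not the others, is concentrated modulo a large prime power, and one more
  refinement by \<open>D ^ l\<close> makes the distribution uniform.
\<close>

section \<open>The hexagon area\<close>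

text \<open>The quantity to be bounded is the number of occupied residue classes, not the modulus.
  Pollard's inequality costs \<open>1 / 4\<close> for each pair of occupied classes, which is
  harmless against the square of \<open>card S\<close> as long as their number is bounded; but sets
  supported on few classes modulo a high prime power admit no bound on the modulus. Therefore moduli
  are graded by their number of classes, and a step along which all three sets stay concentrated is
  free.

  The obstacle is that the three sets \<open>ai * Si\<close> come from one set dilated by different
  integers, so an element may see a different subgroup in each role. The roles can be compared only
  through the class sizes of \<open>S\<close> itself. Extremality confines these to a factor
  \<open>K ^ J\<close> that is fixed before the exponent \<open>l\<close>; a prime power
  \<open>p ^ l\<close> is then too large to divide the subgroup index in one role and to be absent
  in another. The spare factor \<open>D\<close> in \<open>D ^ Suc l\<close> is there because
  dilation by \<open>a\<close> turns a modulus \<open>q\<close> into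
  \<open>\<bar>a\<bar> * q\<close>, and \<open>\<bar>a\<bar>\<close> divides
  \<open>D\<close>.\<close>

lemma borel_measurable_fst_snd [measurable]:
  "(fst :: real \<times> real \<Rightarrow> real) \<in> borel_measurable borel"
  "(snd :: real \<times> real \<Rightarrow> real) \<in> borel_measurable borel"
  by (auto intro!: borel_measurable_continuous_onI continuous_intros)

definition hexset :: "real \<Rightarrow> real \<Rightarrow> real \<Rightarrow> (real \<times> real) set" where
  "hexset a b c = {(x, y). \<bar>x\<bar> \<le> a / 2 \<and> \<bar>y\<bar> \<le> b / 2 \<and> \<bar>x + y\<bar> \<le> c / 2}"

lemma closed_hexset: "closed (hexset a b c)"
proof -
  have "hexset a b c = {p. \<bar>fst p\<bar> \<le> a / 2} \<inter> {p. \<bar>snd p\<bar> \<le> b / 2} \<inter> {p. \<bar>fst p + snd p\<bar> \<le> c / 2}"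
    by (auto simp: hexset_def)
  moreover have "closed {p::real \<times> real. \<bar>fst p\<bar> \<le> a / 2}" "closed {p::real \<times> real. \<bar>snd p\<bar> \<le> b / 2}"
    "closed {p::real \<times> real. \<bar>fst p + snd p\<bar> \<le> c / 2}"
    by (auto intro!: closed_Collect_le continuous_intros)
  ultimately show ?thesis by auto
qed

lemma sets_hexset [measurable]: "hexset a b c \<in> sets borel"
  by (simp add: closed_hexset)

lemma emeasure_lborel_slices_le:
  fixes A :: "(real \<times> real) set"
  assumes A: "A \<in> sets borel" and "0 \<le> b" "0 \<le> l"
    and le: "\<And>y. \<bar>y\<bar> \<le> b / 2 \<Longrightarrow> emeasure lborel {x. (x, y) \<in> A} \<le> ennreal l"
    and out: "\<And>x y. (x, y) \<in> A \<Longrightarrow> \<bar>y\<bar> \<le> b / 2"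
  shows "emeasure lborel A \<le> ennreal (l * b)"
proof -
  have A': "A \<in> sets (lborel \<Otimes>\<^sub>M lborel)" using A by (metis lborel_prod sets_lborel)
  have "emeasure lborel A = emeasure (lborel \<Otimes>\<^sub>M lborel) A" by (simp add: lborel_prod)
  also have "\<dots> = (\<integral>\<^sup>+y. emeasure lborel ((\<lambda>x. (x, y)) -` A) \<partial>lborel)"
    by (rule lborel_pair.emeasure_pair_measure_alt2[OF A'])
  also have "\<dots> \<le> (\<integral>\<^sup>+y. ennreal l * indicator {-b/2..b/2} y \<partial>lborel)"
  proof (rule nn_integral_mono)
    fix y :: real
    show "emeasure lborel ((\<lambda>x. (x, y)) -` A) \<le> ennreal l * indicator {-b/2..b/2} y"
    proof (cases "\<bar>y\<bar> \<le> b / 2")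
      case True
      then have "indicator {-b/2..b/2} y = (1::ennreal)" by (auto simp: indicator_def)
      then show ?thesis using le[OF True] by (simp add: vimage_def)
    next
      case False
      then have "(\<lambda>x. (x, y)) -` A = {}" using out by auto
      then show ?thesis by simp
    qed
  qed
  also have "\<dots> = ennreal l * ennreal b"
    using assms by (simp add: nn_integral_cmult)
  finally show ?thesis using assms by (simp add: ennreal_mult)
qed

lemma emeasure_lborel_slices_eq:
  fixes A :: "(real \<times> real) set"
  assumes A: "A \<in> sets borel" and "0 \<le> b" "0 \<le> l"
    and le: "\<And>y. \<bar>y\<bar> \<le> b / 2 \<Longrightarrow> emeasure lborel {x. (x, y) \<in> A} = ennreal l"
    and out: "\<And>x y. (x, y) \<in> A \<Longrightarrow> \<bar>y\<bar> \<le> b / 2"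
  shows "emeasure lborel A = ennreal (l * b)"
proof -
  have A': "A \<in> sets (lborel \<Otimes>\<^sub>M lborel)" using A by (metis lborel_prod sets_lborel)
  have "emeasure lborel A = emeasure (lborel \<Otimes>\<^sub>M lborel) A" by (simp add: lborel_prod)
  also have "\<dots> = (\<integral>\<^sup>+y. emeasure lborel ((\<lambda>x. (x, y)) -` A) \<partial>lborel)"
    by (rule lborel_pair.emeasure_pair_measure_alt2[OF A'])
  also have "\<dots> = (\<integral>\<^sup>+y. ennreal l * indicator {-b/2..b/2} y \<partial>lborel)"
  proof (rule nn_integral_cong)
    fix y :: real
    show "emeasure lborel ((\<lambda>x. (x, y)) -` A) = ennreal l * indicator {-b/2..b/2} y"
    proof (cases "\<bar>y\<bar> \<le> b / 2")
      case True
      then have "indicator {-b/2..b/2} y = (1::ennreal)" by (auto simp: indicator_def)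
      then show ?thesis using le[OF True] by (simp add: vimage_def)
    next
      case False
      then have "(\<lambda>x. (x, y)) -` A = {}" "indicator {-b/2..b/2} y = (0::ennreal)" using out by (auto simp: indicator_def)
      then show ?thesis by simp
    qed
  qed
  also have "\<dots> = ennreal l * ennreal b"
    using assms by (simp add: nn_integral_cmult)
  finally show ?thesis using assms by (simp add: ennreal_mult)
qed

lemma hexagon_area_eq: "hexagon_area a b c = measure lborel (hexset a b c)"
  by (simp add: hexagon_area_def hexset_def)

lemma emeasure_hexset_finite: "emeasure lborel (hexset a b c) < \<infinity>"
proof (rule emeasure_bounded_finite)
  have "hexset a b c \<subseteq> {-\<bar>a\<bar>..\<bar>a\<bar>} \<times> {-\<bar>b\<bar>..\<bar>b\<bar>}" by (auto simp: hexset_def)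
  then show "bounded (hexset a b c)" by (rule bounded_subset[rotated]) (simp add: bounded_Times)
qed

lemma fmeasurable_hexset [measurable, simp]: "hexset a b c \<in> fmeasurable lborel"
  by (intro fmeasurableI emeasure_hexset_finite) auto

lemma hexagon_area_nonneg [simp]: "0 \<le> hexagon_area a b c"
  by (simp add: hexagon_area_eq)

lemma hexagon_area_mono:
  assumes "a \<le> a'" "b \<le> b'" "c \<le> c'"
  shows "hexagon_area a b c \<le> hexagon_area a' b' c'"
  unfolding hexagon_area_eq
proof (rule measure_mono_fmeasurable)
  show "hexset a b c \<subseteq> hexset a' b' c'" using assms by (auto simp: hexset_def)
qed auto

lemma measure_le_of_emeasure_le: "emeasure M A \<le> ennreal r \<Longrightarrow> 0 \<le> r \<Longrightarrow> measure M A \<le> r"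
  by (simp add: measure_def enn2real_leI)

text \<open>Lets side parameters be reduced by error terms even below zero, so that the estimates
  with shrunken hexagons need no case distinction for small weights.\<close>

lemma hexagon_area_neg: "a < 0 \<or> b < 0 \<or> c < 0 \<Longrightarrow> hexagon_area a b c = 0"
proof -
  assume neg: "a < 0 \<or> b < 0 \<or> c < 0"
  have "hexset a b c = {}"
  proof (rule ccontr)
    assume "hexset a b c \<noteq> {}"
    then obtain x y where "\<bar>x\<bar> \<le> a / 2" "\<bar>y\<bar> \<le> b / 2" "\<bar>x + y\<bar> \<le> c / 2"
      by (auto simp: hexset_def)
    with neg show False by linarith
  qed
  then show ?thesis by (simp add: hexagon_area_eq)
qed

lemma hexagon_area_commute: "hexagon_area a b c = hexagon_area b a c"
proof -
  have "emeasure lborel (hexset a b c) = emeasure (lborel \<Otimes>\<^sub>M lborel) (hexset a b c)" by (simp add: lborel_prod)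
  also have "\<dots> = emeasure (distr (lborel \<Otimes>\<^sub>M lborel) (lborel \<Otimes>\<^sub>M lborel) (\<lambda>(x, y). (y, x))) (hexset a b c)"
    by (subst lborel_pair.distr_pair_swap) rule
  also have "\<dots> = emeasure (lborel \<Otimes>\<^sub>M lborel) ((\<lambda>(x, y). (y, x)) -` (hexset a b c) \<inter> space (lborel \<Otimes>\<^sub>M lborel))"
  proof (rule emeasure_distr)
    show "(\<lambda>(x, y). (y, x)) \<in> lborel \<Otimes>\<^sub>M lborel \<rightarrow>\<^sub>M lborel \<Otimes>\<^sub>M lborel"
      by (rule measurable_pair_swap')
    show "hexset a b c \<in> sets (lborel \<Otimes>\<^sub>M lborel)"
      by (metis lborel_prod sets_hexset sets_lborel)
  qed
  also have "(\<lambda>(x, y). (y, x)) -` (hexset a b c) \<inter> space (lborel \<Otimes>\<^sub>M lborel) = hexset b a c"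
    by (auto simp: hexset_def space_pair_measure add.commute)
  finally show ?thesis by (simp add: hexagon_area_eq measure_def lborel_prod)
qed

section \<open>Lipschitz bounds for the hexagon area\<close>

lemma hexagon_area_diff_le:
  assumes S: "hexset a b c \<subseteq> hexset a' b' c' \<union> A" and A: "A \<in> sets borel"
    and le: "emeasure lborel A \<le> ennreal r" "0 \<le> r"
  shows "hexagon_area a b c \<le> hexagon_area a' b' c' + r"
proof -
  have "A \<in> fmeasurable lborel"
    using A le(1) by (intro fmeasurableI) (auto intro: le_less_trans)
  then have "measure lborel (hexset a b c) \<le> measure lborel (hexset a' b' c' \<union> A)"
    using A by (intro measure_mono_fmeasurable[OF S]) (auto intro: fmeasurable.Un)
  also have "\<dots> \<le> measure lborel (hexset a' b' c') + measure lborel A"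
    using A by (intro measure_Un_le) auto
  also have "measure lborel A \<le> r" using le by (rule measure_le_of_emeasure_le)
  finally show ?thesis by (simp add: hexagon_area_eq)
qed

text \<open>The lost points lie in two vertical strips of total width \<open>a - a'\<close> and
  height \<open>b\<close>. The bound for the third parameter is the sheared version, with two
  intervals of total length \<open>c - c'\<close> in every slice of constant
  \<open>y\<close>.\<close>

lemma hexagon_area_shrink1:
  assumes "0 \<le> a" "0 \<le> b" "a' \<le> a"
  shows "hexagon_area a b c \<le> hexagon_area a' b c + (a - a') * b"
proof (rule hexagon_area_diff_le)
  let ?A = "{(x, y). a' / 2 < \<bar>x\<bar> \<and> \<bar>x\<bar> \<le> a / 2 \<and> \<bar>y\<bar> \<le> b / 2}"
  show "hexset a b c \<subseteq> hexset a' b c \<union> ?A" by (auto simp: hexset_def)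
  show A: "?A \<in> sets borel" unfolding case_prod_unfold by measurable
  show "emeasure lborel ?A \<le> ennreal ((a - a') * b)"
  proof (rule emeasure_lborel_slices_le[OF A])
    fix y :: real
    show "emeasure lborel {x. (x, y) \<in> ?A} \<le> ennreal (a - a')"
    proof (cases "0 \<le> a'")
      case True
      have "emeasure lborel {x. (x, y) \<in> ?A} \<le> emeasure lborel ({-a/2..<-a'/2} \<union> {a'/2<..a/2})"
        by (rule emeasure_mono) auto
      also have "\<dots> \<le> emeasure lborel {-a/2..<-a'/2} + emeasure lborel {a'/2<..a/2}"
        by (rule emeasure_subadditive) auto
      also have "\<dots> = ennreal (a - a')"
        using assms by (simp flip: ennreal_plus add: field_simps)
      finally show ?thesis .
    next
      case False
      have "emeasure lborel {x. (x, y) \<in> ?A} \<le> emeasure lborel {-a/2..a/2}"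
        by (rule emeasure_mono) auto
      also have "\<dots> = ennreal a" using assms by simp
      also have "\<dots> \<le> ennreal (a - a')" using False by (simp add: ennreal_leI)
      finally show ?thesis .
    qed
  qed (use assms in auto)
qed (use assms in auto)

lemma hexagon_area_shrink2:
  assumes "0 \<le> a" "0 \<le> b" "b' \<le> b"
  shows "hexagon_area a b c \<le> hexagon_area a b' c + (b - b') * a"
  using hexagon_area_shrink1[OF assms(2,1,3)] by (simp add: hexagon_area_commute)

lemma hexagon_area_shrink3:
  assumes "0 \<le> c" "0 \<le> b" "c' \<le> c"
  shows "hexagon_area a b c \<le> hexagon_area a b c' + (c - c') * b"
proof (rule hexagon_area_diff_le)
  let ?A = "{(x, y). c' / 2 < \<bar>x + y\<bar> \<and> \<bar>x + y\<bar> \<le> c / 2 \<and> \<bar>y\<bar> \<le> b / 2}"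
  show "hexset a b c \<subseteq> hexset a b c' \<union> ?A" by (auto simp: hexset_def)
  show A: "?A \<in> sets borel" unfolding case_prod_unfold by measurable
  show "emeasure lborel ?A \<le> ennreal ((c - c') * b)"
  proof (rule emeasure_lborel_slices_le[OF A])
    fix y :: real
    show "emeasure lborel {x. (x, y) \<in> ?A} \<le> ennreal (c - c')"
    proof (cases "0 \<le> c'")
      case True
      have "emeasure lborel {x. (x, y) \<in> ?A} \<le> emeasure lborel ({-c/2-y..<-c'/2-y} \<union> {c'/2-y<..c/2-y})"
      proof (rule emeasure_mono)
        have "x \<in> {-c/2-y..<-c'/2-y} \<union> {c'/2-y<..c/2-y}" if "(x, y) \<in> ?A" for x
        proof (cases "0 \<le> x + y")
          case True
          then show ?thesis using that by auto
        next
          case False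
          then have "c' / 2 < - (x + y)" "- (x + y) \<le> c / 2" using that by auto
          then have "-c/2-y \<le> x" "x < -c'/2-y" by linarith+
          then show ?thesis by simp
        qed
        then show "{x. (x, y) \<in> ?A} \<subseteq> {-c/2-y..<-c'/2-y} \<union> {c'/2-y<..c/2-y}" by blast
      qed auto
      also have "\<dots> \<le> emeasure lborel {-c/2-y..<-c'/2-y} + emeasure lborel {c'/2-y<..c/2-y}"
        by (rule emeasure_subadditive) auto
      also have "\<dots> = ennreal (c - c')"
        using assms by (simp flip: ennreal_plus add: field_simps)
      finally show ?thesis .
    next
      case False
      have "emeasure lborel {x. (x, y) \<in> ?A} \<le> emeasure lborel {-c/2-y..c/2-y}"
      proof (rule emeasure_mono)
        have "x \<in> {-c/2-y..c/2-y}" if "(x, y) \<in> ?A" for x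
        proof -
          have "\<bar>x + y\<bar> \<le> c / 2" using that by auto
          then have "-c/2-y \<le> x" "x \<le> c/2-y" by linarith+
          then show ?thesis by simp
        qed
        then show "{x. (x, y) \<in> ?A} \<subseteq> {-c/2-y..c/2-y}" by blast
      qed auto
      also have "\<dots> = ennreal c" using assms by simp
      also have "\<dots> \<le> ennreal (c - c')" using False by (simp add: ennreal_leI)
      finally show ?thesis .
    qed
  qed (use assms in auto)
qed (use assms in auto)

lemma hexagon_area_shrink:
  assumes "0 \<le> a" "0 \<le> b" "0 \<le> c" "a' \<le> a" "b' \<le> b" "c' \<le> c"
  shows "hexagon_area a b c \<le> hexagon_area a' b' c' + (a - a') * b + (b - b') * a + (c - c') * b"
proof -
  have "hexagon_area a b c \<le> hexagon_area a b c' + (c - c') * b"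
    using assms by (intro hexagon_area_shrink3)
  moreover have "hexagon_area a b c' \<le> hexagon_area a b' c' + (b - b') * a"
    using assms by (intro hexagon_area_shrink2)
  moreover have "hexagon_area a b' c' \<le> hexagon_area a' b' c' + (a - a') * b"
  proof (cases "0 \<le> b'")
    case True
    have "hexagon_area a b' c' \<le> hexagon_area a' b' c' + (a - a') * b'"
      using assms True by (intro hexagon_area_shrink1)
    moreover have "(a - a') * b' \<le> (a - a') * b" using assms by (intro mult_left_mono) auto
    ultimately show ?thesis by linarith
  next
    case False
    then show ?thesis using assms by (simp add: hexagon_area_neg)
  qed
  ultimately show ?thesis by linarith
qed

lemma emeasure_lborel_affine:
  fixes t :: "'a::euclidean_space"
  assumes c: "c \<noteq> 0" and A: "A \<in> sets borel"
  shows "emeasure lborel A = ennreal (\<bar>c\<bar> ^ DIM('a)) * emeasure lborel ((\<lambda>x. t + c *\<^sub>R x) -` A)"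
proof -
  have "emeasure lborel A = emeasure (density (distr lborel borel (\<lambda>x. t + c *\<^sub>R x)) (\<lambda>_. \<bar>c\<bar>^DIM('a))) A"
    by (subst lborel_affine[OF c, of t]) rule
  also have "\<dots> = ennreal (\<bar>c\<bar> ^ DIM('a)) * emeasure (distr lborel borel (\<lambda>x. t + c *\<^sub>R x)) A"
    using A by (subst emeasure_density_const) auto
  also have "emeasure (distr lborel borel (\<lambda>x. t + c *\<^sub>R x)) A = emeasure lborel ((\<lambda>x. t + c *\<^sub>R x) -` A)"
    using A by (subst emeasure_distr) auto
  finally show ?thesis .
qed

lemma hexagon_area_scale:
  assumes "0 < t"
  shows "hexagon_area (t * a) (t * b) (t * c) = t\<^sup>2 * hexagon_area a b c"
proof -
  have "(\<lambda>x. 0 + t *\<^sub>R x) -` hexset (t * a) (t * b) (t * c) = hexset a b c"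
    using assms by (auto simp: hexset_def abs_mult simp flip: distrib_left times_divide_eq_right)
  then have "emeasure lborel (hexset (t * a) (t * b) (t * c)) = ennreal (t\<^sup>2) * emeasure lborel (hexset a b c)"
    using emeasure_lborel_affine[of t "hexset (t * a) (t * b) (t * c)" 0] assms by (simp add: power2_eq_square)
  then show ?thesis using assms by (simp add: hexagon_area_eq measure_def enn2real_mult)
qed

text \<open>The constraint on \<open>x + y\<close> cuts two opposite corners off the
  \<open>a\<close> by \<open>b\<close> rectangle, each a right isosceles triangle with legs
  \<open>t\<close>. A translation makes the second triangle complement the first inside one square
  of side \<open>t\<close>, so together they cost at most the square of \<open>t\<close>.\<close>

lemma hexagon_area_ge_diff_square:
  assumes "0 \<le> a" "0 \<le> b" "0 \<le> c" "c \<le> a + b"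
  shows "a * b - (a + b - c)\<^sup>2 / 4 \<le> hexagon_area a b c"
proof -
  define t where "t = (a + b - c) / 2"
  let ?R = "{-a/2..a/2} \<times> {-b/2..b/2}"
  let ?P = "{(x, y). x \<le> a/2 \<and> y \<le> b/2 \<and> c/2 < x + y}"
  let ?Q = "{(x, y). -a/2 \<le> x \<and> -b/2 \<le> y \<and> x + y < -c/2}"
  let ?Q' = "{(x, y). a/2 - t \<le> x \<and> b/2 - t \<le> y \<and> x + y < c/2}"
  let ?S = "{a/2-t..a/2} \<times> {b/2-t..b/2}"
  have "0 \<le> t" using assms by (simp add: t_def)
  have meas: "?P \<in> sets borel" "?Q \<in> sets borel" "?Q' \<in> sets borel" "?R \<in> sets borel" "?S \<in> sets borel"
    unfolding case_prod_unfold by (measurable, simp_all add: borel_closed closed_Times)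
  have R: "emeasure lborel ?R = ennreal (a * b)"
    using assms by (simp flip: lborel_prod add: lborel.emeasure_pair_measure_Times ennreal_mult)
  have S: "emeasure lborel ?S = ennreal (t * t)"
    using \<open>0 \<le> t\<close> by (simp flip: lborel_prod add: lborel.emeasure_pair_measure_Times ennreal_mult)
  have "(\<lambda>p. (t - a, t - b) + 1 *\<^sub>R p) -` ?Q = ?Q'"
    by (auto simp: t_def field_simps)
  then have "emeasure lborel ?Q = emeasure lborel ?Q'"
    using emeasure_lborel_affine[of 1 ?Q "(t - a, t - b)"] meas(2) by (simp add: ennreal_1 del: one_ennreal_def)
  then have "emeasure lborel ?P + emeasure lborel ?Q = emeasure lborel (?P \<union> ?Q')"
    using meas by (subst plus_emeasure[symmetric]) auto
  also have "\<dots> \<le> emeasure lborel ?S"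
    by (rule emeasure_mono) (use meas in \<open>auto simp: t_def field_simps\<close>)
  finally have PQ: "emeasure lborel ?P + emeasure lborel ?Q \<le> ennreal (t * t)" by (simp add: S)
  have "?R \<subseteq> hexset a b c \<union> (?P \<union> ?Q)"
  proof
    fix p assume "p \<in> ?R"
    then obtain x y where p: "p = (x, y)" "-a/2 \<le> x" "x \<le> a/2" "-b/2 \<le> y" "y \<le> b/2" by auto
    have "\<bar>x + y\<bar> \<le> c / 2 \<or> c / 2 < x + y \<or> x + y < -c/2" by linarith
    moreover have "\<bar>x\<bar> \<le> a / 2" "\<bar>y\<bar> \<le> b / 2" using p by linarith+
    ultimately show "p \<in> hexset a b c \<union> (?P \<union> ?Q)" using p unfolding hexset_def by blast
  qed
  then have "emeasure lborel ?R \<le> emeasure lborel (hexset a b c \<union> (?P \<union> ?Q))"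
    using meas by (intro emeasure_mono) auto
  also have "\<dots> \<le> emeasure lborel (hexset a b c) + emeasure lborel (?P \<union> ?Q)"
    using meas by (intro emeasure_subadditive) auto
  also have "emeasure lborel (?P \<union> ?Q) \<le> emeasure lborel ?P + emeasure lborel ?Q"
    using meas by (intro emeasure_subadditive) auto
  also have "\<dots> \<le> ennreal (t * t)" by (rule PQ)
  finally have "ennreal (a * b) \<le> emeasure lborel (hexset a b c) + ennreal (t * t)"
    unfolding R by (simp add: add_left_mono)
  also have "emeasure lborel (hexset a b c) = ennreal (hexagon_area a b c)"
    unfolding hexagon_area_eq using emeasure_hexset_finite[of a b c]
    by (intro emeasure_eq_ennreal_measure) (auto simp: less_top)
  finally have "a * b \<le> hexagon_area a b c + t * t"
    by (simp flip: ennreal_plus)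
  then show ?thesis by (simp add: t_def power2_eq_square field_simps)
qed

lemma hexagon_area_ge_rectangle:
  assumes "0 \<le> a" "0 \<le> b" "a + b \<le> c"
  shows "a * b \<le> hexagon_area a b c"
proof -
  have "a * b = a * b - (a + b - (a + b))\<^sup>2 / 4" by simp
  also have "\<dots> \<le> hexagon_area a b (a + b)" using assms by (intro hexagon_area_ge_diff_square) auto
  also have "\<dots> \<le> hexagon_area a b c" using assms by (intro hexagon_area_mono) auto
  finally show ?thesis .
qed

text \<open>For \<open>b + c \<le> a\<close> the constraint on \<open>x\<close> follows from the
  other two, and what remains is a parallelogram whose slices of constant \<open>y\<close> are
  intervals of length \<open>c\<close>.\<close>

lemma hexagon_area_ge_sheared:
  assumes "0 \<le> b" "0 \<le> c" "b + c \<le> a"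
  shows "b * c \<le> hexagon_area a b c"
proof -
  have "emeasure lborel (hexset a b c) = ennreal (c * b)"
  proof (rule emeasure_lborel_slices_eq)
    fix y :: real assume y: "\<bar>y\<bar> \<le> b / 2"
    have "{x. (x, y) \<in> hexset a b c} = {-c/2-y..c/2-y}"
    proof (rule set_eqI)
      fix x :: real
      have "\<bar>x + y\<bar> \<le> c / 2 \<longleftrightarrow> -c/2-y \<le> x \<and> x \<le> c/2-y" by linarith
      moreover have "\<bar>x + y\<bar> \<le> c / 2 \<Longrightarrow> \<bar>x\<bar> \<le> a / 2" using y assms by linarith
      ultimately show "x \<in> {x. (x, y) \<in> hexset a b c} \<longleftrightarrow> x \<in> {-c/2-y..c/2-y}"
        using y by (auto simp: hexset_def)
    qed
    then show "emeasure lborel {x. (x, y) \<in> hexset a b c} = ennreal c" using assms by simp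
  next
    show "hexset a b c \<in> sets borel" by measurable
  qed (use assms in \<open>auto simp: hexset_def\<close>)
  then show ?thesis using assms by (simp add: hexagon_area_eq measure_def mult.commute)
qed

section \<open>Pollard's inequality for solutions in integer sets\<close>

definition sumrep :: "int set \<Rightarrow> int set \<Rightarrow> int \<Rightarrow> nat" where
  "sumrep X Y n = card {x \<in> X. n - x \<in> Y}"

lemma sum_sumrep_le:
  assumes "finite X" "finite Y" "finite N" "\<And>x y. x \<in> X \<Longrightarrow> y \<in> Y \<Longrightarrow> x + y \<in> N"
  shows "(\<Sum>n\<in>N. sumrep X Y n) = card X * card Y"
proof -
  have "(\<Sum>n\<in>N. sumrep X Y n) = (\<Sum>n\<in>N. \<Sum>x\<in>X. if n - x \<in> Y then 1 else 0)"
    using assms by (simp add: sumrep_def sum.If_cases Int_def)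
  also have "\<dots> = (\<Sum>x\<in>X. \<Sum>n\<in>N. if n - x \<in> Y then 1 else 0)" by (rule sum.swap)
  also have "\<dots> = (\<Sum>x\<in>X. card Y)"
  proof (rule sum.cong[OF refl])
    fix x assume x: "x \<in> X"
    have "(\<Sum>n\<in>N. if n - x \<in> Y then 1 else 0) = card {n \<in> N. n - x \<in> Y}"
      using assms by (simp add: sum.If_cases Int_def)
    also have "{n \<in> N. n - x \<in> Y} = (\<lambda>y. x + y) ` Y"
    proof (intro equalityI subsetI)
      fix n assume "n \<in> {n \<in> N. n - x \<in> Y}"
      then have "n = x + (n - x)" "n - x \<in> Y" by auto
      then show "n \<in> (\<lambda>y. x + y) ` Y" by blast
    qed (use assms(4) x in auto)
    also have "card \<dots> = card Y" by (rule card_image) auto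
    finally show "(\<Sum>n\<in>N. if n - x \<in> Y then 1 else 0) = card Y" .
  qed
  finally show ?thesis by simp
qed

text \<open>
  The integer analogue of Pollard's theorem: removing \<open>Min X\<close> and \<open>Max Y\<close> deletes exactly one
  representation of each element of a set of \<open>card X + card Y - 1\<close> sums.
\<close>

lemma sum_min_sumrep_ge:
  assumes "finite X" "finite Y" "finite N" "\<And>x y. x \<in> X \<Longrightarrow> y \<in> Y \<Longrightarrow> x + y \<in> N"
    and "t \<le> card X" "t \<le> card Y"
  shows "int t * (int (card X) + int (card Y) - int t) \<le> (\<Sum>n\<in>N. int (min t (sumrep X Y n)))"
  using assms
proof (induction t arbitrary: X Y)
  case 0
  then show ?case by simp
next
  case (Suc t)
  define x0 y1 where "x0 = Min X" and "y1 = Max Y"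
  have ne: "X \<noteq> {}" "Y \<noteq> {}" using Suc.prems by auto
  have x0: "x0 \<in> X" "\<And>x. x \<in> X \<Longrightarrow> x0 \<le> x" and y1: "y1 \<in> Y" "\<And>y. y \<in> Y \<Longrightarrow> y \<le> y1"
    using Suc.prems ne by (auto simp: x0_def y1_def)
  define X' Y' where "X' = X - {x0}" and "Y' = Y - {y1}"
  \<comment> \<open>The sums \<open>x0 + y\<close> lose the representation through
    \<open>x0\<close>, the sums \<open>x + y1\<close> the one through \<open>y1\<close>. The two
    families are disjoint, since \<open>x0 + y = x + y1\<close> with \<open>x0 < x\<close> would
    force \<open>y1 < y\<close>.\<close>
  define H where "H = (\<lambda>y. x0 + y) ` Y \<union> (\<lambda>x. x + y1) ` X'"
  have cX: "card X = Suc (card X')" and cY: "card Y = Suc (card Y')"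
    unfolding X'_def Y'_def using Suc.prems x0 y1 by (metis card_Suc_Diff1)+
  have fin: "finite X'" "finite Y'" using Suc.prems by (auto simp: X'_def Y'_def)
  have "card H = card ((\<lambda>y. x0 + y) ` Y) + card ((\<lambda>x. x + y1) ` X')"
    unfolding H_def
  proof (rule card_Un_disjoint)
    show "(\<lambda>y. x0 + y) ` Y \<inter> (\<lambda>x. x + y1) ` X' = {}"
    proof (rule ccontr)
      assume "\<not> ?thesis"
      then obtain x y where xy: "x \<in> X'" "y \<in> Y" "x0 + y = x + y1" by auto
      then have "x0 \<le> x" "y \<le> y1" "x \<noteq> x0" using x0(2) y1(2) by (auto simp: X'_def)
      with xy show False by linarith
    qed
  qed (use Suc.prems fin in auto)
  also have "\<dots> = card Y + card X'" by (subst (1 2) card_image) (auto simp: inj_on_def)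
  finally have cH: "card H = card Y + card X'" .
  have HN: "H \<subseteq> N" using Suc.prems(4) x0 y1 by (auto simp: H_def X'_def)
  have step: "int (min t (sumrep X' Y' n)) + (if n \<in> H then 1 else 0) \<le> int (min (Suc t) (sumrep X Y n))" for n
  proof -
    have sub: "{x \<in> X'. n - x \<in> Y'} \<subseteq> {x \<in> X. n - x \<in> Y}" by (auto simp: X'_def Y'_def)
    have le: "sumrep X' Y' n \<le> sumrep X Y n"
      unfolding sumrep_def by (rule card_mono[OF _ sub]) (use Suc.prems in auto)
    have "sumrep X' Y' n < sumrep X Y n" if H: "n \<in> H"
      unfolding sumrep_def
    proof (rule psubset_card_mono)
      have "\<exists>x. x \<in> {x \<in> X. n - x \<in> Y} - {x \<in> X'. n - x \<in> Y'}"
      proof (cases "n \<in> (\<lambda>y. x0 + y) ` Y")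
        case True
        then show ?thesis using x0 by (intro exI[of _ x0]) (auto simp: X'_def)
      next
        case False
        then have "n \<in> (\<lambda>x. x + y1) ` X'" using H by (auto simp: H_def)
        then show ?thesis using y1 by (intro exI[of _ "n - y1"]) (auto simp: Y'_def X'_def)
      qed
      with sub show "{x \<in> X'. n - x \<in> Y'} \<subset> {x \<in> X. n - x \<in> Y}" by blast
    qed (use Suc.prems in auto)
    with le show ?thesis by auto
  qed
  have "int t * (int (card X') + int (card Y') - int t) + (int (card Y) + int (card X'))
    \<le> (\<Sum>n\<in>N. int (min t (sumrep X' Y' n))) + (\<Sum>n\<in>N. if n \<in> H then 1 else 0)"
  proof (rule add_mono)
    show "int t * (int (card X') + int (card Y') - int t) \<le> (\<Sum>n\<in>N. int (min t (sumrep X' Y' n)))"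
      by (rule Suc.IH) (use Suc.prems fin cX cY in \<open>auto simp: X'_def Y'_def\<close>)
    have "(\<Sum>n\<in>N. if n \<in> H then 1 else 0) = int (card H)"
      using HN Suc.prems by (simp add: sum.If_cases Int_absorb1)
    then show "int (card Y) + int (card X') \<le> (\<Sum>n\<in>N. if n \<in> H then 1 else 0)" by (simp add: cH)
  qed
  also have "\<dots> \<le> (\<Sum>n\<in>N. int (min (Suc t) (sumrep X Y n)))"
    unfolding sum.distrib[symmetric] by (rule sum_mono) (rule step)
  finally show ?case using cX cY by (simp add: algebra_simps)
qed

text \<open>A pair encodes the triple with third entry \<open>- u - v\<close>. The symmetry in the
  three sets, hidden by this encoding, is recovered by the rotation and swap lemmas.\<close>

definition sols :: "int set \<Rightarrow> int set \<Rightarrow> int set \<Rightarrow> (int \<times> int) set" where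
  "sols A B C = {(u, v). u \<in> A \<and> v \<in> B \<and> - u - v \<in> C}"

lemma finite_sols [simp]: "finite A \<Longrightarrow> finite B \<Longrightarrow> finite (sols A B C)"
  by (rule finite_subset[of _ "A \<times> B"]) (auto simp: sols_def)

lemma card_sols_rotate: "card (sols A B C) = card (sols B C A)"
proof (rule bij_betw_same_card[of "\<lambda>(u, v). (v, - u - v)"])
  show "bij_betw (\<lambda>(u, v). (v, - u - v)) (sols A B C) (sols B C A)"
    by (rule bij_betw_byWitness[where f' = "\<lambda>(v, w). (- v - w, v)"]) (auto simp: sols_def)
qed

lemma card_sols_swap: "card (sols A B C) = card (sols B A C)"
proof (rule bij_betw_same_card[of "\<lambda>(u, v). (v, u)"])
  show "bij_betw (\<lambda>(u, v). (v, u)) (sols A B C) (sols B A C)"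
    by (intro bij_betw_byWitness[where f' = "\<lambda>(v, u). (u, v)"]) (auto simp: sols_def minus_diff_commute)
qed

lemma card_sols_le: "finite A \<Longrightarrow> finite B \<Longrightarrow> card (sols A B C) \<le> card A * card B"
  unfolding card_cartesian_product[symmetric] by (rule card_mono) (auto simp: sols_def)

lemma card_sols_eq_sum_sumrep:
  assumes "finite A" "finite B" "finite C"
  shows "card (sols A B C) = (\<Sum>n\<in>uminus ` C. sumrep A B n)"
proof -
  have "bij_betw (\<lambda>(u, v). (u + v, u)) (sols A B C) (SIGMA n : uminus ` C. {x \<in> A. n - x \<in> B})"
  proof (rule bij_betw_byWitness[where f' = "\<lambda>(n, x). (x, n - x)"])
    show "(\<lambda>(u, v). (u + v, u)) ` sols A B C \<subseteq> (SIGMA n : uminus ` C. {x \<in> A. n - x \<in> B})"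
    proof
      fix p assume "p \<in> (\<lambda>(u, v). (u + v, u)) ` sols A B C"
      then obtain u v where p: "p = (u + v, u)" and "(u, v) \<in> sols A B C" by auto
      then have uv: "u \<in> A" "v \<in> B" "- u - v \<in> C" by (simp_all add: sols_def)
      have "u + v = - (- u - v)" by simp
      then have "u + v \<in> uminus ` C" using uv(3) by (rule image_eqI)
      with uv p show "p \<in> (SIGMA n : uminus ` C. {x \<in> A. n - x \<in> B})" by simp
    qed
  qed (auto simp: sols_def)
  then have "card (sols A B C) = card (SIGMA n : uminus ` C. {x \<in> A. n - x \<in> B})"
    by (rule bij_betw_same_card)
  then show ?thesis using assms by (simp add: sumrep_def)
qed

text \<open>Over the elements of \<open>- C\<close>, the part of the representation counts below the
  cap \<open>t\<close> contributes at most \<open>t * card C\<close>. The part above the cap is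
  bounded by the total excess over all sums, which Pollard's inequality controls.\<close>

lemma card_sols_le_pollard:
  assumes fin: "finite A" "finite B" "finite C" and t: "t \<le> card A" "t \<le> card B"
  shows "int (card (sols A B C)) \<le> int (card A) * int (card B) - int t * (int (card A) + int (card B) - int (card C) - int t)"
proof -
  define N where "N = uminus ` C \<union> (\<lambda>(x, y). x + y) ` (A \<times> B)"
  have N: "finite N" "\<And>x y. x \<in> A \<Longrightarrow> y \<in> B \<Longrightarrow> x + y \<in> N" using fin by (auto simp: N_def)
  have "int (card (sols A B C)) = (\<Sum>n\<in>uminus ` C. int (sumrep A B n))"
    by (simp add: card_sols_eq_sum_sumrep fin)
  also have "\<dots> \<le> (\<Sum>n\<in>uminus ` C. int t + (int (sumrep A B n) - int (min t (sumrep A B n))))"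
    by (rule sum_mono) auto
  also have "\<dots> = int t * int (card C) + (\<Sum>n\<in>uminus ` C. (int (sumrep A B n) - int (min t (sumrep A B n))))"
    by (simp add: sum.distrib card_image)
  also have "(\<Sum>n\<in>uminus ` C. (int (sumrep A B n) - int (min t (sumrep A B n))))
     \<le> (\<Sum>n\<in>N. (int (sumrep A B n) - int (min t (sumrep A B n))))"
  proof (rule sum_mono2[OF N(1)])
    show "uminus ` C \<subseteq> N" unfolding N_def by blast
  qed simp
  also have "\<dots> = int (card A * card B) - (\<Sum>n\<in>N. int (min t (sumrep A B n)))"
    using sum_sumrep_le[OF fin(1,2) N] by (simp add: sum_subtractf flip: of_nat_sum of_nat_mult)
  also have "\<dots> \<le> int (card A * card B) - int t * (int (card A) + int (card B) - int t)"
    using sum_min_sumrep_ge[OF fin(1,2) N t] by simp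
  finally show ?thesis by (simp add: algebra_simps)
qed

text \<open>The best cap is half of \<open>s = card A + card B - card C\<close>, and then the bound
  becomes that of \<open>hexagon_area_ge_diff_square\<close>; rounding for odd \<open>s\<close>
  costs the \<open>1 / 4\<close>. If one cardinality is at least the sum of the other two, the
  trivial product bound is already below the area.\<close>

lemma card_sols_le_hexagon_area:
  assumes fin: "finite A" "finite B" "finite C"
  shows "real (card (sols A B C)) \<le> hexagon_area (card A) (card B) (card C) + 1 / 4"
proof -
  let ?a = "real (card A)" and ?b = "real (card B)" and ?c = "real (card C)"
  consider "?a + ?b \<le> ?c" | "?b + ?c \<le> ?a" | "?a + ?c \<le> ?b"
    | "?c < ?a + ?b" "?a < ?b + ?c" "?b < ?a + ?c" by linarith
  then show ?thesis
  proof cases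
    case 1
    have "real (card (sols A B C)) \<le> ?a * ?b"
      using card_sols_le[OF fin(1,2), of C] by (simp flip: of_nat_mult)
    also have "\<dots> \<le> hexagon_area ?a ?b ?c" using 1 by (intro hexagon_area_ge_rectangle) auto
    finally show ?thesis by simp
  next
    case 2
    have "real (card (sols A B C)) \<le> ?b * ?c"
      using card_sols_le[OF fin(2,3), of A] card_sols_rotate[of A B C] by (simp flip: of_nat_mult)
    also have "\<dots> \<le> hexagon_area ?a ?b ?c" using 2 by (intro hexagon_area_ge_sheared) auto
    finally show ?thesis by simp
  next
    case 3
    have "real (card (sols A B C)) \<le> ?a * ?c"
      using card_sols_le[OF fin(1,3), of B] card_sols_rotate[of B A C] card_sols_swap[of A B C]
      by (simp flip: of_nat_mult)
    also have "\<dots> \<le> hexagon_area ?b ?a ?c" using 3 by (intro hexagon_area_ge_sheared) auto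
    finally show ?thesis by (simp add: hexagon_area_commute)
  next
    case 4
    define s where "s = card A + card B - card C"
    define t where "t = s div 2"
    have s: "int s = int (card A) + int (card B) - int (card C)" using 4 by (simp add: s_def)
    have t: "t \<le> card A" "t \<le> card B" using 4 by (auto simp: t_def s_def)
    have "int s * int s - 1 \<le> 4 * (int t * (int s - int t))"
    proof -
      have "s = 2 * t \<or> s = 2 * t + 1" by (auto simp: t_def)
      then show ?thesis by (auto simp: algebra_simps)
    qed
    then have "real_of_int (int s * int s - 1) \<le> real_of_int (4 * (int t * (int s - int t)))"
      by (simp only: of_int_le_iff)
    then have ts: "(real s)\<^sup>2 / 4 - 1 / 4 \<le> real t * (real s - real t)" by (simp add: power2_eq_square)
    have "real_of_int (int (card (sols A B C))) \<le> real_of_int (int (card A) * int (card B) - int t * (int s - int t))"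
      using card_sols_le_pollard[OF fin t] s by (simp only: of_int_le_iff)
    then have "real (card (sols A B C)) \<le> ?a * ?b - real t * (real s - real t)" by simp
    also have "\<dots> \<le> ?a * ?b - (real s)\<^sup>2 / 4 + 1 / 4" using ts by simp
    also have "real s = ?a + ?b - ?c" using 4 by (simp add: s_def)
    also have "?a * ?b - (?a + ?b - ?c)\<^sup>2 / 4 + 1 / 4 \<le> hexagon_area ?a ?b ?c + 1 / 4"
      using hexagon_area_ge_diff_square[of ?a ?b ?c] 4 by simp
    finally show ?thesis by simp
  qed
qed

section \<open>An energy that decreases under refinement of the modulus\<close>

definition cls :: "int set \<Rightarrow> int \<Rightarrow> int \<Rightarrow> int set" where
  "cls A q u = {v \<in> A. [v = u] (mod q)}"

definition cnt :: "int set \<Rightarrow> int \<Rightarrow> int \<Rightarrow> real" where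
  "cnt A q u = real (card (cls A q u))"

lemma cls_subset: "cls A q u \<subseteq> A" by (auto simp: cls_def)

lemma finite_cls [simp]: "finite A \<Longrightarrow> finite (cls A q u)"
  by (rule finite_subset[OF cls_subset])

lemma cls_cong: "[u = u'] (mod q) \<Longrightarrow> cls A q u = cls A q u'"
  by (auto simp: cls_def dest: cong_trans cong_sym)

lemma cnt_cong: "[u = u'] (mod q) \<Longrightarrow> cnt A q u = cnt A q u'"
  by (simp add: cnt_def cls_cong)

lemma cnt_nonneg [simp]: "0 \<le> cnt A q u" by (simp add: cnt_def)

lemma cls_self: "u \<in> A \<Longrightarrow> u \<in> cls A q u" by (simp add: cls_def)

lemma cnt_pos: "finite A \<Longrightarrow> u \<in> A \<Longrightarrow> 0 < cnt A q u"
  using cls_self[of u A q] by (auto simp: cnt_def card_gt_0_iff)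

lemma cls_mono: "A \<subseteq> B \<Longrightarrow> cls A q u \<subseteq> cls B q u" by (auto simp: cls_def)

lemma cnt_mono: "finite B \<Longrightarrow> A \<subseteq> B \<Longrightarrow> cnt A q u \<le> cnt B q u"
  unfolding cnt_def by (simp add: card_mono cls_mono)

lemma cnt_dvd_mono: "finite A \<Longrightarrow> q dvd w \<Longrightarrow> cnt A w u \<le> cnt A q u"
  unfolding cnt_def by (auto intro!: card_mono simp: cls_def intro: cong_dvd_modulus)

lemma cnt_eq_sum: "finite A \<Longrightarrow> cnt A q u = (\<Sum>v\<in>A. if [v = u] (mod q) then 1 else 0)"
  by (simp add: cnt_def cls_def sum.If_cases Int_def)

text \<open>Every \<open>v'\<close> is counted by all members of its own class, each time with
  weight one over the class size. This replaces summands by class means without choosing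
  representatives of the classes.\<close>

lemma sum_cls_average:
  fixes F :: "int \<Rightarrow> real"
  assumes A: "finite A"
  shows "(\<Sum>v\<in>A. (\<Sum>v'\<in>cls A q v. F v') / cnt A q v) = (\<Sum>v\<in>A. F v)"
proof -
  have "(\<Sum>v\<in>A. (\<Sum>v'\<in>cls A q v. F v') / cnt A q v)
      = (\<Sum>v\<in>A. \<Sum>v'\<in>A. if [v' = v] (mod q) then F v' / cnt A q v' else 0)"
  proof (rule sum.cong[OF refl])
    fix v assume "v \<in> A"
    have "(\<Sum>v'\<in>cls A q v. F v') / cnt A q v = (\<Sum>v'\<in>cls A q v. F v' / cnt A q v')"
      unfolding sum_divide_distrib
      by (rule sum.cong) (auto simp: cls_def intro!: arg_cong2[where f="(/)"] cnt_cong cong_sym)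
    also have "\<dots> = (\<Sum>v'\<in>A. if [v' = v] (mod q) then F v' / cnt A q v' else 0)"
      using A by (simp add: cls_def sum.If_cases Int_def)
    finally show "(\<Sum>v'\<in>cls A q v. F v') / cnt A q v = \<dots>" .
  qed
  also have "\<dots> = (\<Sum>v'\<in>A. \<Sum>v\<in>A. if [v' = v] (mod q) then F v' / cnt A q v' else 0)"
    by (rule sum.swap)
  also have "\<dots> = (\<Sum>v'\<in>A. F v')"
  proof (rule sum.cong[OF refl])
    fix v' assume v': "v' \<in> A"
    have "(\<Sum>v\<in>A. if [v' = v] (mod q) then F v' / cnt A q v' else 0)
      = (\<Sum>v\<in>A. (F v' / cnt A q v') * (if [v = v'] (mod q) then 1 else 0))"
      by (rule sum.cong) (auto simp: cong_sym_eq)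
    also have "\<dots> = (F v' / cnt A q v') * cnt A q v'"
      unfolding sum_distrib_left[symmetric] cnt_eq_sum[OF A] by simp
    also have "\<dots> = F v'" using cnt_pos[OF A v', of q] by simp
    finally show "(\<Sum>v\<in>A. if [v' = v] (mod q) then F v' / cnt A q v' else 0) = F v'" .
  qed
  finally show ?thesis .
qed

lemma cong_child_iff:
  fixes q h :: int
  assumes "0 < q" "0 < h"
  shows "[x = u + q * i] (mod q * h) \<longleftrightarrow> (\<exists>k. x = u + q * k \<and> [k = i] (mod h))"
proof
  assume "[x = u + q * i] (mod q * h)"
  then obtain c where "x - (u + q * i) = q * h * c" by (auto simp: cong_iff_dvd_diff)
  then have "x = u + q * (i + h * c)" by (simp add: algebra_simps)
  then show "\<exists>k. x = u + q * k \<and> [k = i] (mod h)"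
    by (intro exI[of _ "i + h * c"]) (auto simp: cong_iff_dvd_diff)
next
  assume "\<exists>k. x = u + q * k \<and> [k = i] (mod h)"
  then obtain k where "x = u + q * k" "h dvd k - i" by (auto simp: cong_iff_dvd_diff)
  then have "x - (u + q * i) = q * (k - i)" "q * h dvd q * (k - i)"
    by (simp add: right_diff_distrib, intro mult_dvd_mono) auto
  then show "[x = u + q * i] (mod q * h)" by (simp only: cong_iff_dvd_diff)
qed

lemma cls_eq_Union_children:
  assumes "0 < q" "0 < h"
  shows "cls A q v = (\<Union>j\<in>{0..<h}. cls A (q * h) (v + q * j))"
proof (intro equalityI subsetI)
  fix x assume "x \<in> cls A q v"
  then obtain k where k: "x \<in> A" "x = v + q * k" by (auto simp: cls_def cong_iff_dvd_diff dvd_def algebra_simps)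
  then have "x \<in> cls A (q * h) (v + q * (k mod h))"
    unfolding cls_def using cong_child_iff[OF assms, of x v "k mod h"] by (auto intro!: exI[of _ k] simp: cong_def)
  moreover have "k mod h \<in> {0..<h}" using assms by simp
  ultimately show "x \<in> (\<Union>j\<in>{0..<h}. cls A (q * h) (v + q * j))" by blast
next
  fix x assume "x \<in> (\<Union>j\<in>{0..<h}. cls A (q * h) (v + q * j))"
  then obtain j where "x \<in> A" "[x = v + q * j] (mod q * h)" by (auto simp: cls_def)
  then show "x \<in> cls A q v"
    using cong_child_iff[OF assms, of x v j] by (auto simp: cls_def cong_iff_dvd_diff)
qed

lemma sum_cls_children:
  fixes F :: "int \<Rightarrow> real"
  assumes A: "finite A" and qh: "0 < q" "0 < h"
  shows "(\<Sum>v'\<in>cls A q v. F v') = (\<Sum>j\<in>{0..<h}. \<Sum>v'\<in>cls A (q * h) (v + q * j). F v')"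
  unfolding cls_eq_Union_children[OF qh]
proof (rule sum.UNION_disjoint)
  show "\<forall>i\<in>{0..<h}. \<forall>j\<in>{0..<h}. i \<noteq> j \<longrightarrow> cls A (q * h) (v + q * i) \<inter> cls A (q * h) (v + q * j) = {}"
  proof (intro ballI impI, rule ccontr)
    fix i j assume ij: "i \<in> {0..<h}" "j \<in> {0..<h}" "i \<noteq> j" "cls A (q * h) (v + q * i) \<inter> cls A (q * h) (v + q * j) \<noteq> {}"
    then obtain x where "[x = v + q * i] (mod q * h)" "[x = v + q * j] (mod q * h)" by (auto simp: cls_def)
    then obtain k k' where "x = v + q * k" "[k = i] (mod h)" "x = v + q * k'" "[k' = j] (mod h)"
      using cong_child_iff[OF qh] by blast
    then have "[i = j] (mod h)" using qh by (auto dest: cong_trans cong_sym)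
    then have "i = j" using ij by (auto simp: cong_def)
    with ij show False by simp
  qed
qed (use A in auto)

lemma cnt_children:
  assumes "finite A" "0 < q" "0 < h"
  shows "cnt A q v = (\<Sum>j\<in>{0..<h}. cnt A (q * h) (v + q * j))"
  using sum_cls_children[OF assms, of "\<lambda>_. 1"] by (simp add: cnt_def)

text \<open>The conditional distribution of the class of \<open>u\<close> over its children modulo
  \<open>q * h\<close>. The index is relative to \<open>u\<close>: another base point in the same
  class shifts it, which is why sums over children need shift and reflection invariance of periodic
  sums.\<close>

definition ratio :: "int set \<Rightarrow> int \<Rightarrow> int \<Rightarrow> int \<Rightarrow> int \<Rightarrow> real" where
  "ratio A q h u i = cnt A (q * h) (u + q * i) / cnt A q u"

lemma ratio_nonneg [simp]: "0 \<le> ratio A q h u i" by (simp add: ratio_def)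

lemma ratio_periodic: "[i = j] (mod h) \<Longrightarrow> ratio A q h u i = ratio A q h u j"
proof -
  assume "[i = j] (mod h)"
  then have "[u + q * i = u + q * j] (mod q * h)"
    by (simp add: cong_iff_dvd_diff flip: right_diff_distrib)
  then show ?thesis by (simp add: ratio_def cnt_cong)
qed

lemma sum_ratio:
  assumes "finite A" "0 < q" "0 < h" "0 < cnt A q u"
  shows "(\<Sum>j\<in>{0..<h}. ratio A q h u j) = 1"
  using assms by (simp add: ratio_def cnt_children[OF assms(1-3)] flip: sum_divide_distrib)

lemma sum_periodic_shift:
  fixes f :: "int \<Rightarrow> 'a::comm_monoid_add"
  assumes h: "0 < h" and per: "\<And>i j. [i = j] (mod h) \<Longrightarrow> f i = f j"
  shows "(\<Sum>j\<in>{0..<h}. f (j + c)) = (\<Sum>j\<in>{0..<h}. f j)"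
proof (rule sum.reindex_bij_witness[where i = "\<lambda>j. (j - c) mod h" and j = "\<lambda>j. (j + c) mod h"])
  fix a assume "a \<in> {0..<h}"
  then show "((a + c) mod h - c) mod h = a" "((a - c) mod h + c) mod h = a"
    by (simp_all add: mod_simps)
  show "f ((a + c) mod h) = f (a + c)" by (rule per) (simp add: cong_def)
qed (use h in auto)

lemma sum_periodic_uminus:
  fixes f :: "int \<Rightarrow> 'a::comm_monoid_add"
  assumes h: "0 < h" and per: "\<And>i j. [i = j] (mod h) \<Longrightarrow> f i = f j"
  shows "(\<Sum>j\<in>{0..<h}. f (c - j)) = (\<Sum>j\<in>{0..<h}. f j)"
proof (rule sum.reindex_bij_witness[where i = "\<lambda>j. (c - j) mod h" and j = "\<lambda>j. (c - j) mod h"])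
  fix a assume "a \<in> {0..<h}"
  then show "(c - (c - a) mod h) mod h = a" "(c - (c - a) mod h) mod h = a"
    by (simp_all add: mod_simps)
  show "f ((c - a) mod h) = f (c - a)" by (rule per) (simp add: cong_def)
qed (use h in auto)

lemma sum_sqrt_mult_le:
  fixes f g :: "'b \<Rightarrow> real"
  assumes "\<And>i. i \<in> I \<Longrightarrow> 0 \<le> f i" "\<And>i. i \<in> I \<Longrightarrow> 0 \<le> g i"
  shows "(\<Sum>i\<in>I. sqrt (f i * g i)) \<le> sqrt ((\<Sum>i\<in>I. f i) * (\<Sum>i\<in>I. g i))"
proof (rule real_le_rsqrt)
  have "(\<Sum>i\<in>I. sqrt (f i) * sqrt (g i))\<^sup>2 \<le> (\<Sum>i\<in>I. (sqrt (f i))\<^sup>2) * (\<Sum>i\<in>I. (sqrt (g i))\<^sup>2)"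
    by (rule Cauchy_Schwarz_ineq_sum)
  also have "\<dots> = (\<Sum>i\<in>I. f i) * (\<Sum>i\<in>I. g i)" using assms by simp
  finally show "(\<Sum>i\<in>I. sqrt (f i * g i))\<^sup>2 \<le> (\<Sum>i\<in>I. f i) * (\<Sum>i\<in>I. g i)"
    by (simp add: real_sqrt_mult)
qed

lemma mult_sqrt_divide: "0 \<le> b \<Longrightarrow> b * sqrt (c / b) = sqrt (b * c)"
proof (cases "b = 0")
  case False
  assume "0 \<le> b"
  then have "sqrt (b * c) = sqrt (b * b * (c / b))" using False by simp
  also have "\<dots> = b * sqrt (c / b)" using \<open>0 \<le> b\<close> by (subst real_sqrt_mult) simp
  finally show ?thesis by simp
qed simp

text \<open>
  For each \<open>u\<close> the inner sum is the Bhattacharyya overlap, over the classes modulo \<open>q\<close>, of \<open>B\<close> and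
  \<open>- u - C\<close>; by Cauchy-Schwarz it drops when the modulus is refined.
\<close>

definition energy :: "int set \<Rightarrow> int set \<Rightarrow> int set \<Rightarrow> int \<Rightarrow> real" where
  "energy A B C q = (\<Sum>u\<in>A. \<Sum>v\<in>B. sqrt (cnt C q (- u - v) / cnt B q v))"

text \<open>For probability vectors the inner bracket is half the squared Hellinger distance between
  \<open>\<beta>\<close> and the reflected translate of \<open>\<gamma>\<close> at \<open>i\<close>.
  A vanishing defect therefore means that \<open>\<beta>\<close> coincides with every reflected
  translate of \<open>\<gamma>\<close> that \<open>\<alpha>\<close> charges.\<close>

definition defect :: "(int \<Rightarrow> real) \<Rightarrow> (int \<Rightarrow> real) \<Rightarrow> (int \<Rightarrow> real) \<Rightarrow> int \<Rightarrow> real" where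
  "defect \<alpha> \<beta> \<gamma> h = (\<Sum>i\<in>{0..<h}. \<alpha> i * (1 - (\<Sum>j\<in>{0..<h}. sqrt (\<beta> j * \<gamma> (- i - j)))))"

definition loss :: "int set \<Rightarrow> int set \<Rightarrow> int set \<Rightarrow> int \<Rightarrow> int \<Rightarrow> int \<Rightarrow> int \<Rightarrow> real" where
  "loss A B C q h u v = defect (ratio A q h u) (ratio B q h v) (ratio C q h (- u - v)) h"

lemma energy_nonneg: "0 \<le> energy A B C q"
  unfolding energy_def by (intro sum_nonneg) auto

locale refinement =
  fixes A B C :: "int set" and q h :: int
  assumes fin: "finite A" "finite B" "finite C" and qh: "0 < q" "0 < h"
begin

text \<open>The unnormalised overlap of \<open>B\<close> and \<open>- u - C\<close> inside one class
  modulo \<open>q\<close>, measured modulo \<open>q * h\<close>. By Cauchy-Schwarz it is at most its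
  value before refinement, and \<open>dev\<close> is the relative deficit.\<close>

definition corr :: "int \<Rightarrow> int \<Rightarrow> real" where
  "corr u v = (\<Sum>j\<in>{0..<h}. sqrt (cnt B (q * h) (v + q * j) * cnt C (q * h) (- u - v - q * j)))"

definition dev :: "int \<Rightarrow> int \<Rightarrow> real" where
  "dev u v = 1 - corr u v / sqrt (cnt B q v * cnt C q (- u - v))"

lemma corr_le: "corr u v \<le> sqrt (cnt B q v * cnt C q (- u - v))"
proof -
  let ?f = "\<lambda>j. cnt C (q * h) (- u - v + q * j)"
  have per: "?f i = ?f j" if "[i = j] (mod h)" for i j
  proof (rule cnt_cong)
    show "[- u - v + q * i = - u - v + q * j] (mod q * h)"
      using that by (simp add: cong_iff_dvd_diff flip: right_diff_distrib)
  qed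
  have "corr u v \<le> sqrt ((\<Sum>j\<in>{0..<h}. cnt B (q * h) (v + q * j)) * (\<Sum>j\<in>{0..<h}. cnt C (q * h) (- u - v - q * j)))"
    unfolding corr_def by (rule sum_sqrt_mult_le) auto
  also have "(\<Sum>j\<in>{0..<h}. cnt C (q * h) (- u - v - q * j)) = (\<Sum>j\<in>{0..<h}. ?f j)"
  proof -
    have "(\<Sum>j\<in>{0..<h}. ?f (0 - j)) = (\<Sum>j\<in>{0..<h}. ?f j)"
      by (rule sum_periodic_uminus[OF qh(2)]) (rule per)
    then show ?thesis by simp
  qed
  finally show ?thesis by (simp flip: cnt_children[OF fin(2) qh] cnt_children[OF fin(3) qh])
qed

lemma corr_nonneg: "0 \<le> corr u v"
  unfolding corr_def by (intro sum_nonneg) auto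

lemma corr_cong2: "[v = v'] (mod q) \<Longrightarrow> corr u v = corr u v'"
proof -
  assume "[v = v'] (mod q)"
  then obtain k where k: "v = v' + q * k" by (auto simp: cong_iff_dvd_diff dvd_def algebra_simps)
  let ?f = "\<lambda>j. sqrt (cnt B (q * h) (v' + q * j) * cnt C (q * h) (- u - v' - q * j))"
  have per: "?f i = ?f j" if "[i = j] (mod h)" for i j
  proof -
    have "cnt B (q * h) (v' + q * i) = cnt B (q * h) (v' + q * j)"
      using that by (intro cnt_cong) (simp add: cong_iff_dvd_diff flip: right_diff_distrib)
    moreover have "[- u - v' - q * i = - u - v' - q * j] (mod q * h)"
      using that by (simp add: cong_iff_dvd_diff dvd_diff_commute flip: right_diff_distrib)
    then have "cnt C (q * h) (- u - v' - q * i) = cnt C (q * h) (- u - v' - q * j)" by (rule cnt_cong)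
    ultimately show ?thesis by simp
  qed
  have "corr u v = (\<Sum>j\<in>{0..<h}. ?f (j + k))"
    unfolding corr_def k by (intro sum.cong) (auto simp: algebra_simps)
  also have "\<dots> = corr u v'"
    unfolding corr_def by (rule sum_periodic_shift[OF qh(2) per])
  finally show ?thesis .
qed

lemma corr_cong1: "[u = u'] (mod q * h) \<Longrightarrow> corr u v = corr u' v"
proof -
  assume u: "[u = u'] (mod q * h)"
  have "cnt C (q * h) (- u - v - q * j) = cnt C (q * h) (- u' - v - q * j)" for j
    using u by (intro cnt_cong cong_diff cong_refl) (simp add: cong_minus_minus_iff)
  then show ?thesis by (simp add: corr_def)
qed

lemma dev_cong2: "[v = v'] (mod q) \<Longrightarrow> dev u v = dev u v'"
  unfolding dev_def using corr_cong2[of v v' u] cnt_cong[of v v' q B]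
    cnt_cong[OF cong_diff[OF cong_refl, of v v' q "- u"], of C] by simp

lemma dev_cong1: "[u = u'] (mod q * h) \<Longrightarrow> dev u v = dev u' v"
proof -
  assume u: "[u = u'] (mod q * h)"
  then have "[u = u'] (mod q)" by (rule cong_dvd_modulus) simp
  then have "cnt C q (- u - v) = cnt C q (- u' - v)"
    by (intro cnt_cong cong_diff cong_refl) (simp add: cong_minus_minus_iff)
  with corr_cong1[OF u] show ?thesis by (simp add: dev_def)
qed

lemma dev_nonneg: "0 \<le> dev u v"
proof (cases "sqrt (cnt B q v * cnt C q (- u - v)) = 0")
  case False
  then have "0 < sqrt (cnt B q v * cnt C q (- u - v))" by (simp add: less_le)
  then show ?thesis unfolding dev_def using corr_le[of u v] by simp
next
  case True
  show ?thesis unfolding dev_def True by simp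
qed

text \<open>Weighting the deficits by \<open>ratio A q h u\<close> amounts to averaging
  \<open>dev\<close> over the class of \<open>u\<close>. In this form the loss visibly does not
  depend on the base point chosen in that class.\<close>

lemma loss_eq: "loss A B C q h u v = (\<Sum>u'\<in>cls A q u. dev u' v) / cnt A q u"
proof -
  have inner: "(\<Sum>j\<in>{0..<h}. sqrt (ratio B q h v j * ratio C q h (- u - v) (- i - j)))
    = corr (u + q * i) v / sqrt (cnt B q v * cnt C q (- (u + q * i) - v))" for i
  proof -
    have "cnt C q (- (u + q * i) - v) = cnt C q (- u - v)"
      by (rule cnt_cong) (simp add: cong_iff_dvd_diff)
    moreover have "- u - v + q * (- i - j) = - (u + q * i) - v - q * j"
      "v + q * j = v + q * j" for j by (simp_all add: algebra_simps)
    ultimately show ?thesis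
      unfolding corr_def ratio_def sum_divide_distrib
      by (simp only: real_sqrt_divide real_sqrt_mult times_divide_times_eq)
  qed
  have "loss A B C q h u v = (\<Sum>i\<in>{0..<h}. ratio A q h u i * dev (u + q * i) v)"
    unfolding loss_def defect_def inner dev_def ..
  also have "\<dots> = (\<Sum>i\<in>{0..<h}. \<Sum>u'\<in>cls A (q * h) (u + q * i). dev u' v) / cnt A q u"
    unfolding sum_divide_distrib
  proof (rule sum.cong[OF refl])
    fix i
    have "(\<Sum>u'\<in>cls A (q * h) (u + q * i). dev u' v) = (\<Sum>u'\<in>cls A (q * h) (u + q * i). dev (u + q * i) v)"
      by (rule sum.cong[OF refl], rule dev_cong1) (simp add: cls_def)
    then have "(\<Sum>u'\<in>cls A (q * h) (u + q * i). dev u' v) = cnt A (q * h) (u + q * i) * dev (u + q * i) v"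
      by (simp add: cnt_def)
    then show "ratio A q h u i * dev (u + q * i) v = (\<Sum>u'\<in>cls A (q * h) (u + q * i). dev u' v / cnt A q u)"
      by (simp add: ratio_def flip: sum_divide_distrib)
  qed
  finally show ?thesis by (simp flip: sum_cls_children[OF fin(1) qh])
qed

lemma loss_nonneg: "0 \<le> loss A B C q h u v"
  unfolding loss_eq by (intro divide_nonneg_nonneg sum_nonneg dev_nonneg) auto

lemma loss_cong2: "[v = v'] (mod q) \<Longrightarrow> loss A B C q h u v = loss A B C q h u v'"
  unfolding loss_eq using dev_cong2 by simp

lemma energy_refined: "energy A B C (q * h) = (\<Sum>u\<in>A. \<Sum>v\<in>B. corr u v / cnt B q v)"
  unfolding energy_def
proof (rule sum.cong[OF refl])
  fix u
  let ?W = "q * h"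
  let ?F = "\<lambda>v. sqrt (cnt C ?W (- u - v) / cnt B ?W v)"
  have "(\<Sum>v\<in>B. ?F v) = (\<Sum>v\<in>B. (\<Sum>v'\<in>cls B q v. ?F v') / cnt B q v)"
    by (rule sum_cls_average[OF fin(2), symmetric])
  also have "\<dots> = (\<Sum>v\<in>B. corr u v / cnt B q v)"
  proof (rule sum.cong[OF refl], rule arg_cong2[where f="(/)"])
    fix v
    have "(\<Sum>v'\<in>cls B q v. ?F v') = (\<Sum>j\<in>{0..<h}. \<Sum>v'\<in>cls B ?W (v + q * j). ?F v')"
      by (rule sum_cls_children[OF fin(2) qh])
    also have "\<dots> = corr u v"
      unfolding corr_def
    proof (rule sum.cong[OF refl])
      fix j
      have "?F v' = ?F (v + q * j)" if "v' \<in> cls B ?W (v + q * j)" for v'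
      proof -
        have c: "[v' = v + q * j] (mod ?W)" using that by (simp add: cls_def)
        have "cnt C ?W (- u - v') = cnt C ?W (- u - (v + q * j))"
          by (rule cnt_cong[OF cong_diff[OF cong_refl c]])
        then show ?thesis using cnt_cong[OF c, of B] by simp
      qed
      then have "(\<Sum>v'\<in>cls B ?W (v + q * j). ?F v') = cnt B ?W (v + q * j) * ?F (v + q * j)"
        by (simp add: cnt_def)
      also have "\<dots> = sqrt (cnt B ?W (v + q * j) * cnt C ?W (- u - v - q * j))"
        using mult_sqrt_divide[OF cnt_nonneg, of B ?W "v + q * j" "cnt C ?W (- u - (v + q * j))"]
        by (simp only: diff_diff_eq)
      finally show "(\<Sum>v'\<in>cls B ?W (v + q * j). ?F v') = sqrt (cnt B ?W (v + q * j) * cnt C ?W (- u - v - q * j))" .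
    qed
    finally show "(\<Sum>v'\<in>cls B q v. ?F v') = corr u v" .
  qed simp
  finally show "(\<Sum>v\<in>B. ?F v) = (\<Sum>v\<in>B. corr u v / cnt B q v)" .
qed

text \<open>For fixed \<open>u\<close>, the solutions with \<open>v\<close> in a given class number
  at most the smaller of the two class sizes in \<open>B\<close> and \<open>C\<close>, hence at most
  their geometric mean, which is what the energy attaches to that class. So the indicator of
  solutions may be replaced by the energy weight \<open>?f\<close>. Averaging over the class of
  \<open>u\<close> turns the loss into \<open>dev\<close>, and \<open>?f * dev\<close> is exactly
  the difference of the two energy summands.\<close>

lemma sum_loss_le: "(\<Sum>(u, v)\<in>sols A B C. loss A B C q h u v) \<le> energy A B C q - energy A B C (q * h)"
proof -
  let ?L = "loss A B C q h"
  let ?f = "\<lambda>u v. sqrt (cnt C q (- u - v) / cnt B q v)"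
  let ?I = "\<lambda>u v. if - u - v \<in> C then 1 else 0 :: real"
  have fS: "finite (sols A B C)" using fin by simp
  have "(\<Sum>(u, v)\<in>sols A B C. ?L u v) = (\<Sum>(u, v)\<in>A \<times> B. ?I u v * ?L u v)"
    by (rule sum.mono_neutral_cong_left) (use fin in \<open>auto simp: sols_def split: if_splits\<close>)
  also have "\<dots> = (\<Sum>u\<in>A. \<Sum>v\<in>B. ?I u v * ?L u v)" by (rule sum.cartesian_product[symmetric])
  also have "\<dots> \<le> (\<Sum>u\<in>A. \<Sum>v\<in>B. ?f u v * ?L u v)"
  proof (rule sum_mono)
    fix u
    have "(\<Sum>v\<in>B. ?I u v * ?L u v) = (\<Sum>v\<in>B. (\<Sum>v'\<in>cls B q v. ?I u v' * ?L u v') / cnt B q v)"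
      by (rule sum_cls_average[OF fin(2), symmetric])
    also have "\<dots> \<le> (\<Sum>v\<in>B. ?f u v * ?L u v)"
    proof (rule sum_mono)
      fix v assume v: "v \<in> B"
      have "(\<Sum>v'\<in>cls B q v. ?I u v' * ?L u v') = (\<Sum>v'\<in>cls B q v. ?I u v' * ?L u v)"
      proof (rule sum.cong[OF refl])
        fix v' assume "v' \<in> cls B q v"
        then have "?L u v' = ?L u v" by (intro loss_cong2) (simp add: cls_def)
        then show "?I u v' * ?L u v' = ?I u v' * ?L u v" by simp
      qed
      also have "\<dots> = real (card {v' \<in> cls B q v. - u - v' \<in> C}) * ?L u v"
        using fin by (simp add: sum.If_cases Int_def flip: sum_distrib_right)
      also have "real (card {v' \<in> cls B q v. - u - v' \<in> C}) \<le> sqrt (cnt B q v * cnt C q (- u - v))"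
      proof (rule real_le_rsqrt)
        let ?K = "{v' \<in> cls B q v. - u - v' \<in> C}"
        have "real (card ?K) \<le> cnt B q v" unfolding cnt_def using fin by (auto intro!: card_mono)
        moreover have "card ?K = card ((\<lambda>v'. - u - v') ` ?K)" by (rule card_image[symmetric]) (auto simp: inj_on_def)
        moreover have "(\<lambda>v'. - u - v') ` ?K \<subseteq> cls C q (- u - v)" by (auto simp: cls_def intro: cong_diff)
        then have "card ((\<lambda>v'. - u - v') ` ?K) \<le> card (cls C q (- u - v))" using fin by (intro card_mono) auto
        ultimately have "real (card ?K) \<le> cnt B q v" "real (card ?K) \<le> cnt C q (- u - v)" by (simp_all add: cnt_def)
        then show "(real (card ?K))\<^sup>2 \<le> cnt B q v * cnt C q (- u - v)"
          unfolding power2_eq_square by (intro mult_mono) auto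
      qed
      finally have "(\<Sum>v'\<in>cls B q v. ?I u v' * ?L u v') / cnt B q v
          \<le> sqrt (cnt B q v * cnt C q (- u - v)) * ?L u v / cnt B q v"
        using loss_nonneg by (simp add: divide_right_mono mult_right_mono)
      also have "\<dots> = ?f u v * ?L u v"
        using cnt_pos[OF fin(2) v, of q]
          mult_sqrt_divide[OF cnt_nonneg, of B q v "cnt C q (- u - v)"] by (simp add: field_simps)
      finally show "(\<Sum>v'\<in>cls B q v. ?I u v' * ?L u v') / cnt B q v \<le> ?f u v * ?L u v" .
    qed
    finally show "(\<Sum>v\<in>B. ?I u v * ?L u v) \<le> (\<Sum>v\<in>B. ?f u v * ?L u v)" .
  qed
  also have "\<dots> = (\<Sum>v\<in>B. \<Sum>u\<in>A. ?f u v * ?L u v)" by (rule sum.swap)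
  also have "\<dots> = (\<Sum>v\<in>B. \<Sum>u\<in>A. ?f u v * dev u v)"
  proof (rule sum.cong[OF refl])
    fix v
    have "(\<Sum>u\<in>A. ?f u v * ?L u v) = (\<Sum>u\<in>A. (\<Sum>u'\<in>cls A q u. ?f u' v * dev u' v) / cnt A q u)"
    proof (rule sum.cong[OF refl])
      fix u
      have "?f u' v = ?f u v" if "u' \<in> cls A q u" for u'
      proof -
        have "cnt C q (- u' - v) = cnt C q (- u - v)"
          using that by (intro cnt_cong cong_diff cong_refl) (simp add: cls_def cong_minus_minus_iff)
        then show ?thesis by simp
      qed
      then have "(\<Sum>u'\<in>cls A q u. ?f u' v * dev u' v) = ?f u v * (\<Sum>u'\<in>cls A q u. dev u' v)"
        unfolding sum_distrib_left by (intro sum.cong refl) simp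
      then show "?f u v * ?L u v = (\<Sum>u'\<in>cls A q u. ?f u' v * dev u' v) / cnt A q u"
        by (simp add: loss_eq)
    qed
    also have "\<dots> = (\<Sum>u\<in>A. ?f u v * dev u v)" by (rule sum_cls_average[OF fin(1)])
    finally show "(\<Sum>u\<in>A. ?f u v * ?L u v) = (\<Sum>u\<in>A. ?f u v * dev u v)" .
  qed
  also have "\<dots> = (\<Sum>u\<in>A. \<Sum>v\<in>B. ?f u v * dev u v)" by (rule sum.swap)
  also have "\<dots> = (\<Sum>u\<in>A. \<Sum>v\<in>B. ?f u v - corr u v / cnt B q v)"
  proof (intro sum.cong refl)
    fix u v assume v: "v \<in> B"
    have b: "0 < cnt B q v" by (rule cnt_pos[OF fin(2) v])
    show "?f u v * dev u v = ?f u v - corr u v / cnt B q v"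
    proof (cases "cnt C q (- u - v) = 0")
      case True
      then have "corr u v = 0" using corr_le[of u v] corr_nonneg[of u v] by simp
      then show ?thesis using True by simp
    next
      case False
      then have c: "0 < cnt C q (- u - v)" using cnt_nonneg[of C q "- u - v"] by linarith
      have "sqrt (cnt B q v) * sqrt (cnt B q v) = cnt B q v" by simp
      then show ?thesis using b c unfolding dev_def
        by (simp add: real_sqrt_mult real_sqrt_divide right_diff_distrib)
    qed
  qed
  also have "\<dots> = energy A B C q - energy A B C (q * h)"
    unfolding energy_refined by (simp add: sum_subtractf energy_def)
  finally show ?thesis .
qed

lemma energy_refined_le: "energy A B C (q * h) \<le> energy A B C q"
proof -
  have "0 \<le> (\<Sum>(u, v)\<in>sols A B C. loss A B C q h u v)"
    using loss_nonneg by (auto intro: sum_nonneg)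
  with sum_loss_le show ?thesis by linarith
qed

end

lemma energy_1: "finite A \<Longrightarrow> finite B \<Longrightarrow> finite C \<Longrightarrow> energy A B C 1 \<le> card A * sqrt (card B * card C)"
proof -
  assume fin: "finite A" "finite B" "finite C"
  have "cls X 1 u = X" for X u by (auto simp: cls_def)
  then have "energy A B C 1 = card A * (card B * sqrt (card C / card B))" by (simp add: energy_def cnt_def)
  also have "card B * sqrt (card C / card B) = sqrt (card B * card C)"
    using mult_sqrt_divide[of "real (card B)" "real (card C)"] by simp
  finally show ?thesis by simp
qed

text \<open>At every \<open>i\<close> other than \<open>- j0 - k0\<close> the two peaks miss each
  other: the peak of \<open>\<beta>\<close> meets at most \<open>1 / 16\<close> of
  \<open>\<gamma>\<close>, and the remaining \<open>1 / 16\<close> of \<open>\<beta>\<close> meets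
  at most everything. The overlap is then at most \<open>1 / 4 + 1 / 4\<close>, so each such
  \<open>i\<close> contributes at least half of its \<open>\<alpha>\<close>-mass.\<close>

lemma defect_ge_concentrated:
  fixes \<alpha> \<beta> \<gamma> :: "int \<Rightarrow> real"
  assumes h: "0 < h"
    and nn: "\<And>i. 0 \<le> \<alpha> i" "\<And>i. 0 \<le> \<beta> i" "\<And>i. 0 \<le> \<gamma> i"
    and per: "\<And>i j. [i = j] (mod h) \<Longrightarrow> \<gamma> i = \<gamma> j" "\<And>i j. [i = j] (mod h) \<Longrightarrow> \<alpha> i = \<alpha> j"
    and sum: "(\<Sum>j\<in>{0..<h}. \<alpha> j) = 1" "(\<Sum>j\<in>{0..<h}. \<beta> j) = 1" "(\<Sum>j\<in>{0..<h}. \<gamma> j) = 1"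
    and j0: "j0 \<in> {0..<h}" "15 / 16 \<le> \<beta> j0" and k0: "k0 \<in> {0..<h}" "15 / 16 \<le> \<gamma> k0"
  shows "(1 - \<alpha> (- j0 - k0)) / 2 \<le> defect \<alpha> \<beta> \<gamma> h"
proof -
  let ?s = "\<lambda>i. (\<Sum>j\<in>{0..<h}. sqrt (\<beta> j * \<gamma> (- i - j)))"
  let ?i = "(- j0 - k0) mod h"
  have gsum: "(\<Sum>j\<in>{0..<h}. \<gamma> (- i - j)) = 1" for i
  proof -
    have "(\<Sum>j\<in>{0..<h}. \<gamma> (- i - j)) = (\<Sum>j\<in>{0..<h}. \<gamma> j)"
      by (rule sum_periodic_uminus[OF h]) (rule per)
    then show ?thesis by (simp add: sum)
  qed
  have s1: "?s i \<le> 1" for i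
  proof -
    have "?s i \<le> sqrt ((\<Sum>j\<in>{0..<h}. \<beta> j) * (\<Sum>j\<in>{0..<h}. \<gamma> (- i - j)))"
      by (rule sum_sqrt_mult_le) (use nn in auto)
    then show ?thesis by (simp add: sum gsum)
  qed
  have s2: "?s i \<le> 1 / 2" if i: "i \<in> {0..<h}" "i \<noteq> ?i" for i
  proof -
    have "\<not> [- i - j0 = k0] (mod h)"
    proof
      assume "[- i - j0 = k0] (mod h)"
      then have "[i = - j0 - k0] (mod h)" by (simp add: cong_iff_dvd_diff) (metis dvd_minus_iff minus_diff_eq diff_add_eq diff_diff_eq2 add.commute diff_minus_eq_add minus_add_distrib)
      then show False using i by (simp add: cong_def)
    qed
    then have ne: "(- i - j0) mod h \<noteq> k0" using k0 by (auto simp: cong_def)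
    have "\<gamma> ((- i - j0) mod h) + \<gamma> k0 \<le> (\<Sum>j\<in>{0..<h}. \<gamma> j)"
    proof -
      have "(\<Sum>j\<in>{(- i - j0) mod h, k0}. \<gamma> j) \<le> (\<Sum>j\<in>{0..<h}. \<gamma> j)"
        by (rule sum_mono2) (use h k0 nn in auto)
      then show ?thesis using ne by simp
    qed
    moreover have "\<gamma> (- i - j0) = \<gamma> ((- i - j0) mod h)" by (rule per) (simp add: cong_def)
    ultimately have g: "\<gamma> (- i - j0) \<le> 1 / 16" using sum k0 by simp
    have b1: "\<beta> j0 \<le> 1"
      using member_le_sum[of j0 "{0..<h}" \<beta>] j0 nn sum by simp
    have bs: "(\<Sum>j\<in>{0..<h} - {j0}. \<beta> j) = 1 - \<beta> j0"
      using sum(2) j0(1) by (simp add: sum_diff1)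
    have gs: "(\<Sum>j\<in>{0..<h} - {j0}. \<gamma> (- i - j)) \<le> 1"
      using gsum[of i] j0(1) nn(3) by (simp add: sum_diff1)
    have "?s i = sqrt (\<beta> j0 * \<gamma> (- i - j0)) + (\<Sum>j\<in>{0..<h} - {j0}. sqrt (\<beta> j * \<gamma> (- i - j)))"
      using j0 by (simp add: sum.remove)
    also have "sqrt (\<beta> j0 * \<gamma> (- i - j0)) \<le> sqrt (1 * (1 / 16))"
      by (intro real_sqrt_le_mono mult_mono) (use b1 g nn in auto)
    also have "(\<Sum>j\<in>{0..<h} - {j0}. sqrt (\<beta> j * \<gamma> (- i - j)))
      \<le> sqrt ((\<Sum>j\<in>{0..<h} - {j0}. \<beta> j) * (\<Sum>j\<in>{0..<h} - {j0}. \<gamma> (- i - j)))"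
      by (rule sum_sqrt_mult_le) (use nn in auto)
    also have "\<dots> \<le> sqrt ((1 / 16) * 1)"
      unfolding bs by (intro real_sqrt_le_mono mult_mono gs) (use j0 b1 nn in \<open>auto intro: sum_nonneg\<close>)
    also have "sqrt (1 * (1 / 16)) + sqrt (1 / 16 * 1) = (1/2 :: real)"
      by (simp add: real_sqrt_divide)
    finally show ?thesis by simp
  qed
  have "(1 - \<alpha> ?i) / 2 = (\<Sum>i\<in>{0..<h} - {?i}. \<alpha> i) / 2"
    using sum(1) h by (simp add: sum_diff1)
  also have "\<dots> = (\<Sum>i\<in>{0..<h} - {?i}. \<alpha> i * (1 / 2))" by (simp add: sum_divide_distrib)
  also have "\<dots> \<le> (\<Sum>i\<in>{0..<h} - {?i}. \<alpha> i * (1 - ?s i))"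
    by (intro sum_mono mult_left_mono) (use s2 nn in force)+
  also have "\<dots> \<le> defect \<alpha> \<beta> \<gamma> h"
    unfolding defect_def by (rule sum_mono2) (use s1 nn in auto)
  also have "\<alpha> ?i = \<alpha> (- j0 - k0)" by (rule per) (simp add: cong_def)
  finally show ?thesis .
qed

section \<open>Concentration modulo a refinement\<close>

text \<open>On \<open>M\<close>, a class modulo \<open>q\<close> does not split modulo \<open>w\<close>.\<close>

definition conc :: "int set \<Rightarrow> int \<Rightarrow> int \<Rightarrow> int set \<Rightarrow> bool" where
  "conc A q w M \<longleftrightarrow> M \<subseteq> A \<and> (\<forall>x\<in>M. \<forall>y\<in>M. [x = y] (mod q) \<longrightarrow> [x = y] (mod w))"

lemma conc_trans: "conc A q w M \<Longrightarrow> conc A w w' M' \<Longrightarrow> conc A q w' (M \<inter> M')"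
  unfolding conc_def by blast

lemma conc_refl: "conc A q q A"
  unfolding conc_def by blast

text \<open>The threshold leaves at least \<open>15 / 16\<close> of the class in \<open>M\<close>,
  hence in a single child when \<open>M\<close> is concentrated; this is the peak height required by
  \<open>defect_ge_concentrated\<close>.\<close>

definition settled :: "int set \<Rightarrow> int \<Rightarrow> int set \<Rightarrow> int \<Rightarrow> bool" where
  "settled A q M v \<longleftrightarrow> cnt (A - M) q v \<le> cnt A q v / 16"

text \<open>Markov's inequality: the share of its class lying outside \<open>M\<close>, summed over
  all elements of \<open>A\<close>, is \<open>card (A - M)\<close>.\<close>

lemma card_not_settled_le:
  assumes "finite A"
  shows "real (card {v \<in> A. \<not> settled A q M v}) \<le> 16 * real (card (A - M))"
proof -
  have "real (card {v \<in> A. \<not> settled A q M v}) = (\<Sum>v\<in>A. if settled A q M v then 0 else 1)"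
    using assms by (simp add: sum.If_cases Int_def)
  also have "\<dots> \<le> (\<Sum>v\<in>A. 16 * (cnt (A - M) q v / cnt A q v))"
  proof (rule sum_mono)
    fix v assume "v \<in> A"
    then have "0 < cnt A q v" using assms by (rule cnt_pos[rotated])
    then show "(if settled A q M v then 0 else 1) \<le> 16 * (cnt (A - M) q v / cnt A q v)"
      by (auto simp: settled_def field_simps)
  qed
  also have "\<dots> = 16 * (\<Sum>v\<in>A. (\<Sum>v'\<in>cls A q v. if v' \<in> A - M then 1 else 0) / cnt A q v)"
  proof -
    have "cnt (A - M) q v = (\<Sum>v'\<in>cls A q v. if v' \<in> A - M then 1 else 0)" for v
    proof -
      have "cls (A - M) q v = {v' \<in> cls A q v. v' \<in> A - M}" by (auto simp: cls_def)
      then show ?thesis using assms by (simp add: cnt_def sum.If_cases Int_def)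
    qed
    then show ?thesis by (simp add: sum_distrib_left)
  qed
  also have "\<dots> = 16 * (\<Sum>v\<in>A. if v \<in> A - M then 1 else 0)"
    by (simp only: sum_cls_average[OF assms])
  also have "\<dots> = 16 * real (card (A - M))"
    using assms by (simp add: sum.If_cases Int_def Diff_eq)
  finally show ?thesis .
qed

lemma settled_child:
  assumes A: "finite A" and qh: "0 < q" "0 < h" and M: "conc A q (q * h) M"
    and v: "0 < cnt A q v" and f: "settled A q M v"
  shows "\<exists>j\<in>{0..<h}. 15 / 16 \<le> ratio A q h v j"
proof -
  have "cls A q v = cls (A - M) q v \<union> cls (A \<inter> M) q v" by (auto simp: cls_def)
  moreover have "cls (A - M) q v \<inter> cls (A \<inter> M) q v = {}" by (auto simp: cls_def)
  ultimately have "cnt A q v = cnt (A - M) q v + cnt (A \<inter> M) q v"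
    using A by (simp add: cnt_def card_Un_disjoint)
  with f have M15: "15 / 16 * cnt A q v \<le> cnt (A \<inter> M) q v" by (simp add: settled_def)
  then have "0 < cnt (A \<inter> M) q v" using v by simp
  then have "cls (A \<inter> M) q v \<noteq> {}" by (auto simp: cnt_def card_gt_0_iff)
  then obtain x where x: "x \<in> cls (A \<inter> M) q v" by blast
  then have "x \<in> cls A q v" by (auto simp: cls_def)
  then obtain j where j: "j \<in> {0..<h}" "x \<in> cls A (q * h) (v + q * j)"
    using cls_eq_Union_children[OF qh, of A v] by auto
  have "cls (A \<inter> M) q v \<subseteq> cls A (q * h) (v + q * j)"
  proof
    fix y assume y: "y \<in> cls (A \<inter> M) q v"
    then have "[y = x] (mod q)" using x by (auto simp: cls_def intro: cong_trans cong_sym)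
    then have "[y = x] (mod q * h)" using M x y by (auto simp: conc_def cls_def)
    then show "y \<in> cls A (q * h) (v + q * j)" using j y by (auto simp: cls_def intro: cong_trans)
  qed
  then have "cnt (A \<inter> M) q v \<le> cnt A (q * h) (v + q * j)" using A by (simp add: cnt_def card_mono)
  then have "15 / 16 \<le> ratio A q h v j" using M15 v by (simp add: ratio_def field_simps)
  with j show ?thesis by blast
qed

definition rich :: "int set \<Rightarrow> int set \<Rightarrow> int set \<Rightarrow> real \<Rightarrow> bool" where
  "rich A B C r \<longleftrightarrow> (\<forall>u\<in>A. r \<le> real (card {v \<in> B. - u - v \<in> C}))"

lemma finite_has_greatest_value:
  fixes f :: "'b \<Rightarrow> real"
  assumes "finite S" "S \<noteq> {}"
  shows "\<exists>x\<in>S. \<forall>y\<in>S. f y \<le> f x"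
proof -
  have "Max (f ` S) \<in> f ` S" using assms by simp
  then obtain x where "x \<in> S" "f x = Max (f ` S)" by auto
  then show ?thesis using assms by (intro bexI[of _ x]) auto
qed

text \<open>\<open>M\<close> keeps the most populated child of every class modulo \<open>q\<close>.
  A function \<open>f\<close> has to dominate \<open>1 - ratio\<close> at some child only, so
  applications need not know which child is the largest.\<close>

lemma exists_best_conc:
  assumes A: "finite A" and qh: "0 < q" "0 < h"
  shows "\<exists>M. conc A q (q * h) M \<and>
    (\<forall>f. (\<forall>u\<in>A. \<exists>i. 1 - ratio A q h u i \<le> f u) \<longrightarrow> real (card (A - M)) \<le> (\<Sum>u\<in>A. f u))"
proof -
  have "\<exists>x. x \<in> cls A q u \<and> (\<forall>y\<in>cls A q u. cnt A (q * h) y \<le> cnt A (q * h) x)" if "u \<in> A" for u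
  proof -
    have "finite (cls A q u)" "cls A q u \<noteq> {}" using A that cls_self[of u A q] by auto
    then show ?thesis using finite_has_greatest_value by blast
  qed
  then have "\<exists>m. \<forall>r\<in>(\<lambda>u. u mod q) ` A. m r \<in> cls A q r \<and> (\<forall>y\<in>cls A q r. cnt A (q * h) y \<le> cnt A (q * h) (m r))"
    by (intro bchoice) (auto simp: cls_def)
  then obtain m where m: "\<And>u. u \<in> A \<Longrightarrow> m (u mod q) \<in> cls A q u"
    "\<And>u y. u \<in> A \<Longrightarrow> y \<in> cls A q u \<Longrightarrow> cnt A (q * h) y \<le> cnt A (q * h) (m (u mod q))"
    by (auto simp: cls_def)
  define M where "M = {u \<in> A. [u = m (u mod q)] (mod q * h)}"
  have "conc A q (q * h) M"
    unfolding conc_def M_def by (auto simp: cong_def[of _ _ q] intro: cong_trans cong_sym)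
  moreover have "real (card (A - M)) \<le> (\<Sum>u\<in>A. f u)" if f: "\<And>u. u \<in> A \<Longrightarrow> \<exists>i. 1 - ratio A q h u i \<le> f u" for f
  proof -
    have "real (card (A - M)) = (\<Sum>v\<in>A. if v \<in> A - M then 1 else 0)"
      using A by (simp add: sum.If_cases Int_def Diff_eq)
    also have "\<dots> = (\<Sum>v\<in>A. (\<Sum>v'\<in>cls A q v. if v' \<in> A - M then 1 else 0) / cnt A q v)"
      by (rule sum_cls_average[OF A, symmetric])
    also have "\<dots> \<le> (\<Sum>u\<in>A. f u)"
    proof (rule sum_mono)
      fix u assume u: "u \<in> A"
      have c: "0 < cnt A q u" by (rule cnt_pos[OF A u])
      have "(\<Sum>v'\<in>cls A q u. if v' \<in> A - M then 1 else (0::real)) = (\<Sum>v'\<in>cls A q u. 1 - (if v' \<in> cls A (q * h) (m (u mod q)) then 1 else 0))"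
      proof (rule sum.cong[OF refl])
        fix v' assume v': "v' \<in> cls A q u"
        then have "v' mod q = u mod q" by (simp add: cls_def cong_def)
        then show "(if v' \<in> A - M then 1 else (0::real)) = 1 - (if v' \<in> cls A (q * h) (m (u mod q)) then 1 else 0)"
          using v' by (auto simp: M_def cls_def)
      qed
      also have "\<dots> = cnt A q u - real (card {v' \<in> cls A q u. v' \<in> cls A (q * h) (m (u mod q))})"
        using A by (simp add: sum_subtractf sum.If_cases Int_def cnt_def)
      also have "{v' \<in> cls A q u. v' \<in> cls A (q * h) (m (u mod q))} = cls A (q * h) (m (u mod q))"
      proof -
        have "[x = u] (mod q)" if "[x = m (u mod q)] (mod q * h)" for x
          using cong_dvd_modulus[OF that, of q] m(1)[OF u] by (auto simp: cls_def intro: cong_trans)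
        then show ?thesis by (auto simp: cls_def)
      qed
      finally have eq: "(\<Sum>v'\<in>cls A q u. if v' \<in> A - M then 1 else (0::real)) = cnt A q u - cnt A (q * h) (m (u mod q))"
        by (simp add: cnt_def)
      obtain i where i: "1 - ratio A q h u i \<le> f u" using f[OF u] by blast
      have "cnt A (q * h) (u + q * i) \<le> cnt A (q * h) (m (u mod q))"
      proof (cases "cls A (q * h) (u + q * i) = {}")
        case True
        then show ?thesis by (simp add: cnt_def)
      next
        case False
        then obtain y where y: "y \<in> A" "[y = u + q * i] (mod q * h)" by (auto simp: cls_def)
        then have "[y = u + q * i] (mod q)" by (auto intro: cong_dvd_modulus)
        then have "y \<in> cls A q u" using y by (auto simp: cls_def cong_def)
        then have "cnt A (q * h) y \<le> cnt A (q * h) (m (u mod q))" by (rule m(2)[OF u])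
        then show ?thesis using cnt_cong[OF y(2), of A] by simp
      qed
      then have "(cnt A q u - cnt A (q * h) (m (u mod q))) / cnt A q u \<le> 1 - ratio A q h u i"
        using c by (simp add: ratio_def field_simps)
      then show "(\<Sum>v'\<in>cls A q u. if v' \<in> A - M then 1 else 0) / cnt A q u \<le> f u"
        unfolding eq using i by linarith
    qed
    finally show ?thesis .
  qed
  ultimately show ?thesis by (intro exI[of _ M]) auto
qed

text \<open>
  Self-improvement: once all three sets are roughly concentrated, the few remaining elements
  cause a loss of energy proportional to their number.
\<close>

lemma conc_improve:
  assumes fin: "finite A" "finite B" "finite C" and qh: "0 < q" "0 < h"
    and rich: "rich A B C r" and r: "0 < r"
    and M: "conc B q (q * h) MB" "conc C q (q * h) MC"
    and small: "64 * real (card (B - MB)) \<le> r" "64 * real (card (C - MC)) \<le> r"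
    and loss: "energy A B C q - energy A B C (q * h) \<le> e"
  shows "\<exists>MA. conc A q (q * h) MA \<and> real (card (A - MA)) * r \<le> 4 * e"
proof -
  interpret refinement A B C q h using fin qh by unfold_locales
  let ?L = "loss A B C q h"
  define P where "P u = {v \<in> B. - u - v \<in> C \<and> settled B q MB v \<and> settled C q MC (- u - v)}" for u
  define f where "f u = 4 / r * (\<Sum>v\<in>P u. ?L u v)" for u
  have P: "r / 2 \<le> real (card (P u))" if u: "u \<in> A" for u
  proof -
    let ?T = "{v \<in> B. - u - v \<in> C}" and ?NB = "{v \<in> B. \<not> settled B q MB v}"
      and ?NC = "{w \<in> C. \<not> settled C q MC w}"
    have "?T \<subseteq> P u \<union> (?NB \<union> (\<lambda>w. - u - w) ` ?NC)"
    proof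
      fix v assume v: "v \<in> ?T"
      show "v \<in> P u \<union> (?NB \<union> (\<lambda>w. - u - w) ` ?NC)"
      proof (cases "settled C q MC (- u - v)")
        case False
        then have "- u - (- u - v) \<in> (\<lambda>w. - u - w) ` ?NC" using v by blast
        then show ?thesis by simp
      qed (use v in \<open>auto simp: P_def\<close>)
    qed
    then have "card ?T \<le> card (P u \<union> (?NB \<union> (\<lambda>w. - u - w) ` ?NC))"
      using fin by (intro card_mono) (auto simp: P_def)
    also have "\<dots> \<le> card (P u) + card (?NB \<union> (\<lambda>w. - u - w) ` ?NC)" by (rule card_Un_le)
    also have "card (?NB \<union> (\<lambda>w. - u - w) ` ?NC) \<le> card ?NB + card ((\<lambda>w. - u - w) ` ?NC)" by (rule card_Un_le)
    also have "card ((\<lambda>w. - u - w) ` ?NC) \<le> card ?NC" using fin by (intro card_image_le) auto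
    finally have "real (card ?T) \<le> real (card (P u)) + real (card ?NB) + real (card ?NC)" by linarith
    moreover have "r \<le> real (card ?T)" using rich u by (auto simp: rich_def)
    moreover have "real (card ?NB) \<le> r / 4" using card_not_settled_le[OF fin(2), of q MB] small by linarith
    moreover have "real (card ?NC) \<le> r / 4" using card_not_settled_le[OF fin(3), of q MC] small by linarith
    ultimately show ?thesis by linarith
  qed
  have ex: "\<exists>i. 1 - ratio A q h u i \<le> f u" if u: "u \<in> A" for u
  proof -
    have one: "\<exists>i\<in>{0..<h}. (1 - ratio A q h u i) / 2 \<le> ?L u v" if v: "v \<in> P u" for v
    proof -
      have vB: "v \<in> B" "- u - v \<in> C" "settled B q MB v" "settled C q MC (- u - v)" using v by (auto simp: P_def)
      have c: "0 < cnt A q u" "0 < cnt B q v" "0 < cnt C q (- u - v)" using cnt_pos fin u vB by auto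
      obtain j0 where j0: "j0 \<in> {0..<h}" "15 / 16 \<le> ratio B q h v j0"
        using settled_child[OF fin(2) qh M(1) c(2) vB(3)] by blast
      obtain k0 where k0: "k0 \<in> {0..<h}" "15 / 16 \<le> ratio C q h (- u - v) k0"
        using settled_child[OF fin(3) qh M(2) c(3) vB(4)] by blast
      have "(1 - ratio A q h u (- j0 - k0)) / 2 \<le> ?L u v"
        unfolding loss_def
        by (rule defect_ge_concentrated[where ?j0.0 = j0 and ?k0.0 = k0])
           (use j0 k0 qh(2) sum_ratio[OF fin(1) qh c(1)] sum_ratio[OF fin(2) qh c(2)] sum_ratio[OF fin(3) qh c(3)] in
             \<open>auto intro: ratio_periodic\<close>)
      moreover have "ratio A q h u (- j0 - k0) = ratio A q h u ((- j0 - k0) mod h)"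
        by (rule ratio_periodic) (simp add: cong_def)
      ultimately show ?thesis using qh by (intro bexI[of _ "(- j0 - k0) mod h"]) auto
    qed
    have "{0..<h} \<noteq> {}" using qh by auto
    \<comment> \<open>The child found in \<open>one\<close> varies with \<open>v\<close>. Passing to
      the child of largest ratio makes the lower bound for the loss uniform in
      \<open>v\<close>.\<close>
    then obtain i where i: "i \<in> {0..<h}" "\<And>i'. i' \<in> {0..<h} \<Longrightarrow> ratio A q h u i' \<le> ratio A q h u i"
      using finite_has_greatest_value[of "{0..<h}" "ratio A q h u"] by auto
    have le: "(1 - ratio A q h u i) / 2 \<le> ?L u v" if "v \<in> P u" for v
      using one[OF that] i(2) by force
    have "ratio A q h u i \<le> 1"
      using member_le_sum[of i "{0..<h}" "ratio A q h u"] i sum_ratio[OF fin(1) qh cnt_pos[OF fin(1) u]] by simp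
    then have "r / 2 * ((1 - ratio A q h u i) / 2) \<le> real (card (P u)) * ((1 - ratio A q h u i) / 2)"
      using P[OF u] by (intro mult_right_mono) auto
    also have "\<dots> \<le> (\<Sum>v\<in>P u. ?L u v)"
      using sum_mono[OF le, of "P u" "\<lambda>v. v"] by simp
    finally have "1 - ratio A q h u i \<le> f u" using r by (simp add: f_def field_simps)
    then show ?thesis by blast
  qed
  obtain MA where MA: "conc A q (q * h) MA" "real (card (A - MA)) \<le> (\<Sum>u\<in>A. f u)"
    using exists_best_conc[OF fin(1) qh] ex by metis
  have "(\<Sum>u\<in>A. \<Sum>v\<in>P u. ?L u v) = (\<Sum>(u, v)\<in>(SIGMA u:A. P u). ?L u v)"
    using fin by (intro sum.Sigma) (auto simp: P_def)
  also have "\<dots> \<le> (\<Sum>(u, v)\<in>sols A B C. ?L u v)"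
    by (rule sum_mono2[OF finite_sols[OF fin(1,2)]]) (use loss_nonneg in \<open>auto simp: P_def sols_def\<close>)
  also have "\<dots> \<le> e" using sum_loss_le loss by linarith
  finally have "(\<Sum>u\<in>A. f u) \<le> 4 / r * e"
    unfolding f_def sum_distrib_left[symmetric] using r by (intro mult_left_mono) auto
  with MA have "real (card (A - MA)) \<le> 4 / r * e" by linarith
  then have "real (card (A - MA)) * r \<le> 4 * e" using r by (simp add: field_simps)
  with MA show ?thesis by blast
qed

section \<open>Near equality in Cauchy-Schwarz\<close>

lemma subgroup_int_multiples:
  fixes H :: "int set"
  assumes m: "m \<in> H" "0 < m" and diff: "\<And>x y. x \<in> H \<Longrightarrow> y \<in> H \<Longrightarrow> x - y \<in> H"
  shows "\<exists>d>0. d dvd m \<and> H = {x. d dvd x}"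
proof -
  have zero: "0 \<in> H" using diff[OF m(1) m(1)] by simp
  have neg: "- x \<in> H" if "x \<in> H" for x using diff[OF zero that] by simp
  have add: "x + y \<in> H" if "x \<in> H" "y \<in> H" for x y using diff[OF that(1) neg[OF that(2)]] by simp
  have nmul: "int n * x \<in> H" if "x \<in> H" for x n
    by (induction n) (use zero add that in \<open>auto simp: algebra_simps\<close>)
  have mul: "k * x \<in> H" if "x \<in> H" for k x
    using nmul[OF that, of "nat k"] nmul[OF neg[OF that], of "nat (- k)"] by (cases "0 \<le> k") auto
  define n where "n = (LEAST n::nat. 0 < n \<and> int n \<in> H)"
  have "0 < n \<and> int n \<in> H"
    unfolding n_def by (rule LeastI[of _ "nat m"]) (use m in auto)
  then have n: "0 < n" "int n \<in> H" by auto
  have least: "n \<le> k" if "0 < k" "int k \<in> H" for k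
    unfolding n_def by (rule Least_le) (use that in simp)
  have "int n dvd x" if "x \<in> H" for x
  proof (rule ccontr)
    assume "\<not> int n dvd x"
    then have pos: "0 < x mod int n" using n by (metis dvd_eq_mod_eq_0 of_nat_0_less_iff order_less_le pos_mod_sign)
    have "x mod int n = x - (x div int n) * int n" by (simp add: minus_div_mult_eq_mod)
    then have "x mod int n \<in> H" using diff[OF that mul[OF n(2)]] by simp
    then have "n \<le> nat (x mod int n)" using pos by (intro least) auto
    moreover have "x mod int n < int n" using n by simp
    ultimately show False using pos by linarith
  qed
  moreover have "x \<in> H" if "int n dvd x" for x using mul[OF n(2)] that by (auto simp: dvd_def mult.commute)
  ultimately show ?thesis using n m by (intro exI[of _ "int n"]) auto
qed

lemma sqrt_diff_squares:
  fixes x y :: real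
  assumes "0 \<le> x" "x \<le> 1" "0 \<le> y" "y \<le> 1"
  shows "\<bar>x - y\<bar> \<le> 2 * \<bar>sqrt x - sqrt y\<bar>"
proof -
  have "x - y = (sqrt x - sqrt y) * (sqrt x + sqrt y)" using assms by (simp add: algebra_simps)
  then have "\<bar>x - y\<bar> = \<bar>sqrt x - sqrt y\<bar> * (sqrt x + sqrt y)" using assms by (simp add: abs_mult)
  also have "\<dots> \<le> \<bar>sqrt x - sqrt y\<bar> * 2"
  proof (rule mult_left_mono)
    have "sqrt x \<le> 1" "sqrt y \<le> 1" using assms by simp_all
    then show "sqrt x + sqrt y \<le> 2" by linarith
  qed simp
  finally show ?thesis by simp
qed

definition prob_vec :: "int \<Rightarrow> (int \<Rightarrow> real) \<Rightarrow> bool" where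
  "prob_vec m \<alpha> \<longleftrightarrow> (\<forall>i. 0 \<le> \<alpha> i) \<and> (\<forall>i j. [i = j] (mod m) \<longrightarrow> \<alpha> i = \<alpha> j) \<and> (\<Sum>i\<in>{0..<m}. \<alpha> i) = 1"

lemma prob_vec_nonneg: "prob_vec m \<alpha> \<Longrightarrow> 0 \<le> \<alpha> i"
  unfolding prob_vec_def by blast

lemma prob_vec_cong: "prob_vec m \<alpha> \<Longrightarrow> [i = j] (mod m) \<Longrightarrow> \<alpha> i = \<alpha> j"
  unfolding prob_vec_def by blast

lemma prob_vec_sum: "prob_vec m \<alpha> \<Longrightarrow> (\<Sum>i\<in>{0..<m}. \<alpha> i) = 1"
  unfolding prob_vec_def by blast

lemma prob_vec_le_1: "prob_vec m \<alpha> \<Longrightarrow> 0 < m \<Longrightarrow> \<alpha> i \<le> 1"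
proof -
  assume a: "prob_vec m \<alpha>" and m: "0 < m"
  have "\<alpha> (i mod m) \<le> (\<Sum>i\<in>{0..<m}. \<alpha> i)"
    by (rule member_le_sum) (use prob_vec_nonneg[OF a] m in auto)
  moreover have "\<alpha> i = \<alpha> (i mod m)" by (rule prob_vec_cong[OF a]) (simp add: cong_def)
  ultimately show ?thesis using prob_vec_sum[OF a] by simp
qed

lemma prob_vec_ge:
  assumes a: "prob_vec m \<alpha>" and m: "0 < m"
  shows "\<exists>i\<in>{0..<m}. 1 / m \<le> \<alpha> i"
proof (rule ccontr)
  assume "\<not> ?thesis"
  then have "(\<Sum>i\<in>{0..<m}. \<alpha> i) < (\<Sum>i\<in>{0..<m}. 1 / real_of_int m)"
    using m by (intro sum_strict_mono) (auto simp: not_le)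
  also have "\<dots> = 1" using m by simp
  finally show False using prob_vec_sum[OF a] by simp
qed

text \<open>The index \<open>i\<close> enters the defect with weight at least \<open>t\<close>, so
  the squared Hellinger distance \<open>d\<close> at \<open>i\<close> is at most
  \<open>2 * e / t\<close>, hence at most a quarter of the square of \<open>s\<close>. Each pair of
  square roots then differs by at most \<open>s / 2\<close>, and numbers in the unit interval by at
  most twice that.\<close>

lemma defect_small_imp_close:
  assumes a: "prob_vec m \<alpha>" and b: "prob_vec m \<beta>" and c: "prob_vec m \<gamma>" and m: "0 < m"
    and le: "defect \<alpha> \<beta> \<gamma> m \<le> e" and i: "t \<le> \<alpha> i" "0 < t" and s: "0 \<le> s" "8 * e \<le> t * s\<^sup>2"
  shows "\<bar>\<beta> j - \<gamma> (- i - j)\<bar> \<le> s"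
proof -
  define d where "d i = (\<Sum>j\<in>{0..<m}. (sqrt (\<beta> j) - sqrt (\<gamma> (- i - j)))\<^sup>2)" for i
  have nn: "0 \<le> \<alpha> i" "0 \<le> \<beta> i" "0 \<le> \<gamma> i" for i using a b c by (auto intro: prob_vec_nonneg)
  have per: "\<alpha> i = \<alpha> (i mod m)" "\<beta> i = \<beta> (i mod m)" for i
    by (rule prob_vec_cong[OF a] prob_vec_cong[OF b]; simp add: cong_def)+
  have perc: "\<gamma> i = \<gamma> j" if "i mod m = j mod m" for i j
    by (rule prob_vec_cong[OF c]) (simp add: cong_def that)
  have gsum: "(\<Sum>j\<in>{0..<m}. \<gamma> (i - j)) = 1" for i
  proof -
    have "(\<Sum>j\<in>{0..<m}. \<gamma> (i - j)) = (\<Sum>j\<in>{0..<m}. \<gamma> j)"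
      by (rule sum_periodic_uminus[OF m]) (rule prob_vec_cong[OF c])
    then show ?thesis using prob_vec_sum[OF c] by simp
  qed
  have d_eq: "1 - (\<Sum>j\<in>{0..<m}. sqrt (\<beta> j * \<gamma> (- i - j))) = d i / 2" for i
  proof -
    have "d i = (\<Sum>j\<in>{0..<m}. \<beta> j + \<gamma> (- i - j) - 2 * sqrt (\<beta> j * \<gamma> (- i - j)))"
      unfolding d_def by (intro sum.cong refl) (simp add: power2_diff nn real_sqrt_mult)
    also have "\<dots> = 2 - 2 * (\<Sum>j\<in>{0..<m}. sqrt (\<beta> j * \<gamma> (- i - j)))"
      using prob_vec_sum[OF b] by (simp add: sum_subtractf sum.distrib gsum flip: sum_distrib_left)
    finally show ?thesis by simp
  qed
  have d0: "0 \<le> d i" for i unfolding d_def by (intro sum_nonneg) auto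
  let ?i = "i mod m" and ?j = "j mod m"
  have "\<alpha> ?i * (d ?i / 2) \<le> defect \<alpha> \<beta> \<gamma> m"
    unfolding defect_def d_eq by (rule member_le_sum) (use m nn d0 in auto)
  then have "t * (d ?i / 2) \<le> e"
    using le i per(1)[of i] d0[of ?i] mult_right_mono[of t "\<alpha> ?i" "d ?i / 2"] by linarith
  then have "t * (4 * d ?i) \<le> t * s\<^sup>2" using s by linarith
  then have "4 * d ?i \<le> s\<^sup>2" using i by simp
  moreover have "(sqrt (\<beta> ?j) - sqrt (\<gamma> (- ?i - ?j)))\<^sup>2 \<le> d ?i"
    unfolding d_def by (rule member_le_sum) (use m in auto)
  ultimately have "(2 * \<bar>sqrt (\<beta> ?j) - sqrt (\<gamma> (- ?i - ?j))\<bar>)\<^sup>2 \<le> s\<^sup>2" by (simp add: power_mult_distrib)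
  then have "2 * \<bar>sqrt (\<beta> ?j) - sqrt (\<gamma> (- ?i - ?j))\<bar> \<le> s" using s(1) by (rule power2_le_imp_le)
  then have "\<bar>\<beta> ?j - \<gamma> (- ?i - ?j)\<bar> \<le> s"
    using sqrt_diff_squares[of "\<beta> ?j" "\<gamma> (- ?i - ?j)"] nn prob_vec_le_1[OF b m] prob_vec_le_1[OF c m] by force
  moreover have "\<gamma> (- ?i - ?j) = \<gamma> (- i - j)"   proof (rule perc)
    have "- ?i - ?j = - i - j + m * (i div m + j div m)"
      by (simp add: distrib_left minus_mult_div_eq_mod[symmetric])
    then show "(- ?i - ?j) mod m = (- i - j) mod m" by simp
  qed
  ultimately show ?thesis using per(2)[of j] by simp
qed

lemma card_multiples_atLeastLessThan:
  fixes d m :: int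
  assumes "0 < d" "d dvd m" "0 < m"
  shows "real (card {i\<in>{0..<m}. [i = c] (mod d)}) = m / d"
proof -
  obtain k where k: "m = d * k" using assms by auto
  have "{i\<in>{0..<m}. [i = c] (mod d)} = (\<lambda>t. c mod d + d * t) ` {0..<k}"
  proof (intro equalityI subsetI)
    fix i assume i: "i \<in> {i\<in>{0..<m}. [i = c] (mod d)}"
    then have i': "0 \<le> i" "i < d * k" "i mod d = c mod d" using k by (auto simp: cong_def)
    have "i = i mod d + d * (i div d)" by simp
    then have i_eq: "i = c mod d + d * (i div d)" using i'(3) by simp
    moreover have "i div d \<in> {0..<k}"
    proof -
      have "0 \<le> c mod d" using assms by simp
      then have "d * (i div d) < d * k" using i_eq i'(2) by linarith
      then show ?thesis using assms i'(1) by (simp add: pos_imp_zdiv_nonneg_iff)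
    qed
    ultimately show "i \<in> (\<lambda>t. c mod d + d * t) ` {0..<k}" by blast
  next
    fix i assume "i \<in> (\<lambda>t. c mod d + d * t) ` {0..<k}"
    then obtain t where t: "i = c mod d + d * t" "t \<in> {0..<k}" by blast
    then have t: "i = c mod d + d * t" "0 \<le> t" "t + 1 \<le> k" by simp_all
    have "0 \<le> c mod d" "c mod d < d" using assms by auto
    moreover have "d * t + d \<le> d * k" using t(3) assms mult_left_mono[of "t + 1" k d] by (simp add: algebra_simps)
    moreover have "0 \<le> d * t" using t(2) assms by simp
    ultimately have "0 \<le> i" "i < m" unfolding t(1) k by linarith+
    moreover have "[i = c] (mod d)" using t(1) by (simp add: cong_def)
    ultimately show "i \<in> {i\<in>{0..<m}. [i = c] (mod d)}" by simp
  qed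
  also have "card \<dots> = card {0..<k}" by (rule card_image) (use assms in \<open>auto simp: inj_on_def\<close>)
  also have "real (card {0..<k}) = m / d"
  proof -
    have "0 \<le> k" using assms k by (simp add: zero_less_mult_iff)
    then show ?thesis using assms k by simp
  qed
  finally show ?thesis .
qed

text \<open>
  The stable equality case: if the energy loss is tiny, the three child distributions are almost
  uniform on cosets of a common subgroup of the integers modulo \<open>m\<close>.
\<close>

lemma defects_small_imp_cosets:
  fixes m :: int and t e :: real
  assumes m: "0 < m" and t: "0 < t" "t \<le> 1 / (8 * m)"
    and e: "0 \<le> e" "8 * e \<le> t * t\<^sup>2"
    and a: "prob_vec m \<alpha>" and b: "prob_vec m \<beta>" and c: "prob_vec m \<gamma>"
    and le: "defect \<alpha> \<beta> \<gamma> m \<le> e" "defect \<beta> \<gamma> \<alpha> m \<le> e" "defect \<gamma> \<alpha> \<beta> m \<le> e"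
  shows "\<exists>d>0. d dvd m \<and> (\<exists>c0. \<forall>i. \<bar>\<alpha> i - (if [i = c0] (mod d) then d / m else 0)\<bar> \<le> (8 + m) * t)"
proof -
  have t1: "1 / m \<ge> 8 * t" using t m by (simp add: field_simps)
  have A: "\<bar>\<beta> j - \<gamma> (- i - j)\<bar> \<le> t" if "t \<le> \<alpha> i" for i j
    by (rule defect_small_imp_close[OF a b c m le(1) that t(1)]) (use t e in auto)
  have B: "\<bar>\<gamma> k - \<alpha> (- j - k)\<bar> \<le> t" if "t \<le> \<beta> j" for j k
    by (rule defect_small_imp_close[OF b c a m le(2) that t(1)]) (use t e in auto)
  have C: "\<bar>\<alpha> i - \<beta> (- k - i)\<bar> \<le> t" if "t \<le> \<gamma> k" for k i
    by (rule defect_small_imp_close[OF c a b m le(3) that t(1)]) (use t e in auto)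
  obtain i0 where i0: "1 / m \<le> \<alpha> i0" using prob_vec_ge[OF a m] by blast
  obtain j0 where j0: "1 / m \<le> \<beta> j0" using prob_vec_ge[OF b m] by blast
  have i0t: "t \<le> \<alpha> i0" and j0t: "t \<le> \<beta> j0" using i0 j0 t1 t by linarith+
  \<comment> \<open>A gap in the values: comparison through \<open>j0\<close>, where
    \<open>\<beta>\<close> is at least \<open>8 * t\<close>, loses \<open>t\<close> twice. Hence
    being at least \<open>t\<close> already means being at least \<open>6 * t\<close>, a property
    that survives the errors, and the heavy indices obey the same closure rules as in the exact
    equality case.\<close>
  have big_a: "6 * t \<le> \<alpha> i" if "t \<le> \<alpha> i" for i
    using A[OF that, of j0] B[OF j0t, of "- i - j0"] j0 t1 by (simp add: algebra_simps)
  have big_b: "6 * t \<le> \<beta> j" if "t \<le> \<beta> j" for j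
    using B[OF that, of "- i0 - j"] A[OF i0t, of j] i0 t1 by (simp add: algebra_simps)
  have ab: "t \<le> \<gamma> (- i - j)" if "t \<le> \<alpha> i" "t \<le> \<beta> j" for i j
    using A[OF that(1), of j] big_b[OF that(2)] t by linarith
  have ac: "t \<le> \<beta> (- i - k)" if "t \<le> \<alpha> i" "t \<le> \<gamma> k" for i k
  proof -
    have "- i - k = - k - i" by simp
    then show ?thesis using C[OF that(2), of i] big_a[OF that(1)] t by (simp only: abs_le_iff) linarith
  qed
  have bc: "t \<le> \<alpha> (- j - k)" if "t \<le> \<beta> j" "t \<le> \<gamma> k" for j k
  proof -
    have "\<bar>\<beta> j - \<gamma> (- i0 - j)\<bar> \<le> t" by (rule A[OF i0t])
    have "\<bar>\<alpha> (- j - k) - \<beta> j\<bar> \<le> t" using C[OF that(2), of "- j - k"] by simp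
    then show ?thesis using big_b[OF that(1)] t by linarith
  qed
  define I where "I = {i. t \<le> \<alpha> i}"
  \<comment> \<open>The periods of the heavy set of \<open>\<beta>\<close>. Differences of heavy
    indices of \<open>\<alpha>\<close> are such periods, and conversely a period moves heavy indices
    of \<open>\<alpha>\<close> to heavy ones, so these form a single coset of
    \<open>H\<close>.\<close>
  define H where "H = {h. \<forall>j. t \<le> \<beta> j \<longleftrightarrow> t \<le> \<beta> (j + h)}"
  have "\<exists>d>0. d dvd m \<and> H = {x. d dvd x}"
  proof (rule subgroup_int_multiples)
    have "\<beta> (j + m) = \<beta> j" for j by (rule prob_vec_cong[OF b]) (simp add: cong_def)
    then show "m \<in> H" by (simp add: H_def)
    fix x y assume x: "x \<in> H" and y: "y \<in> H"
    have "t \<le> \<beta> j \<longleftrightarrow> t \<le> \<beta> (j + (x - y))" for j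
    proof -
      have "t \<le> \<beta> (j + (x - y)) \<longleftrightarrow> t \<le> \<beta> (j + (x - y) + y)" using y unfolding H_def by blast
      also have "\<dots> \<longleftrightarrow> t \<le> \<beta> j" using x unfolding H_def by (simp add: algebra_simps)
      finally show ?thesis by simp
    qed
    then show "x - y \<in> H" by (simp add: H_def)
  qed (rule m)
  then obtain d where d: "0 < d" "d dvd m" "H = {x. d dvd x}" by blast
  have shift: "t \<le> \<beta> (j + (i - i'))" if "t \<le> \<alpha> i" "t \<le> \<alpha> i'" "t \<le> \<beta> j" for i i' j
    using ac[OF that(2) ab[OF that(1,3)]] by (simp add: algebra_simps)
  have I_eq: "t \<le> \<alpha> i \<longleftrightarrow> [i = i0] (mod d)" for i
  proof
    assume i: "t \<le> \<alpha> i"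
    have "i - i0 \<in> H"
      unfolding H_def
    proof (intro CollectI allI iffI)
      fix j assume "t \<le> \<beta> (j + (i - i0))"
      from shift[OF i0t i this] show "t \<le> \<beta> j" by simp
    qed (rule shift[OF i i0t])
    then show "[i = i0] (mod d)" using d by (simp add: cong_iff_dvd_diff)
  next
    assume "[i = i0] (mod d)"
    then have "i0 - i \<in> H" using d by (simp add: cong_iff_dvd_diff dvd_diff_commute)
    then have "t \<le> \<beta> (j0 + (i0 - i))" using j0t unfolding H_def by blast
    from bc[OF this ab[OF i0t j0t]] show "t \<le> \<alpha> i" by (simp add: algebra_simps)
  qed
  \<comment> \<open>Both values are compared with \<open>\<beta> j0\<close> by way of
    \<open>\<gamma>\<close>, at the price of two errors each.\<close>
  have eqv: "\<bar>\<alpha> i - \<alpha> i0\<bar> \<le> 4 * t" if "t \<le> \<alpha> i" for i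
  proof -
    have "\<bar>\<beta> j0 - \<gamma> (- i - j0)\<bar> \<le> t" by (rule A[OF that])
    moreover have "\<bar>\<gamma> (- i - j0) - \<alpha> i\<bar> \<le> t" using B[OF j0t, of "- i - j0"] by simp
    moreover have "\<bar>\<beta> j0 - \<gamma> (- i0 - j0)\<bar> \<le> t" by (rule A[OF i0t])
    moreover have "\<bar>\<gamma> (- i0 - j0) - \<alpha> i0\<bar> \<le> t" using B[OF j0t, of "- i0 - j0"] by simp
    ultimately show ?thesis by linarith
  qed
  have nn: "0 \<le> \<alpha> i" for i using a by (rule prob_vec_nonneg)
  let ?I = "{i\<in>{0..<m}. [i = i0] (mod d)}"
  have cI: "real (card ?I) = m / d" by (rule card_multiples_atLeastLessThan[OF d(1,2) m])
  have cI0: "0 < real (card ?I)" unfolding cI using m d by simp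
  have "1 = (\<Sum>i\<in>{0..<m}. \<alpha> i)" using prob_vec_sum[OF a] by simp
  also have "{0..<m} = ?I \<union> {i\<in>{0..<m}. \<not> [i = i0] (mod d)}" by auto
  also have "(\<Sum>i\<in>\<dots>. \<alpha> i) = (\<Sum>i\<in>?I. \<alpha> i) + (\<Sum>i\<in>{i\<in>{0..<m}. \<not> [i = i0] (mod d)}. \<alpha> i)"
    by (rule sum.union_disjoint) (auto intro: finite_subset[OF _ finite_atLeastLessThan_int[of 0 m]])
  finally have split: "1 = \<dots>" .
  have rest: "(\<Sum>i\<in>{i\<in>{0..<m}. \<not> [i = i0] (mod d)}. \<alpha> i) \<le> m * t"
  proof -
    have "(\<Sum>i\<in>{i\<in>{0..<m}. \<not> [i = i0] (mod d)}. \<alpha> i) \<le> (\<Sum>i\<in>{i\<in>{0..<m}. \<not> [i = i0] (mod d)}. t)"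
    proof (rule sum_mono)
      fix i assume "i \<in> {i\<in>{0..<m}. \<not> [i = i0] (mod d)}"
      then have "\<not> t \<le> \<alpha> i" using I_eq[of i] by simp
      then show "\<alpha> i \<le> t" by linarith
    qed
    also have "\<dots> \<le> (\<Sum>i\<in>{0..<m}. t)" by (rule sum_mono2) (use t in auto)
    finally show ?thesis using m by simp
  qed
  have rest0: "0 \<le> (\<Sum>i\<in>{i\<in>{0..<m}. \<not> [i = i0] (mod d)}. \<alpha> i)" by (intro sum_nonneg nn)
  \<comment> \<open>Light indices carry at most \<open>m * t\<close> of the mass, and heavy values
    differ from each other by at most \<open>8 * t\<close>. So each heavy value is within
    \<open>(8 + m) * t\<close> of the reciprocal of the number of heavy indices, which is
    \<open>d / m\<close>.\<close>
  have "\<bar>\<alpha> i - d / m\<bar> \<le> (8 + m) * t" if i: "t \<le> \<alpha> i" for i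
  proof -
    let ?n = "real (card ?I)" and ?S = "\<Sum>i'\<in>?I. \<alpha> i'"
    have close: "\<bar>\<alpha> i' - \<alpha> i\<bar> \<le> 8 * t" if "i' \<in> ?I" for i'
      using that I_eq[of i'] eqv[of i'] eqv[OF i] by auto
    have "\<bar>?S - ?n * \<alpha> i\<bar> = \<bar>\<Sum>i'\<in>?I. \<alpha> i' - \<alpha> i\<bar>" by (simp add: sum_subtractf)
    also have "\<dots> \<le> (\<Sum>i'\<in>?I. \<bar>\<alpha> i' - \<alpha> i\<bar>)" by (rule sum_abs)
    also have "\<dots> \<le> ?n * (8 * t)" using sum_mono[OF close, of ?I "\<lambda>x. x"] by simp
    finally have 1: "\<bar>?S - ?n * \<alpha> i\<bar> \<le> ?n * (8 * t)" .
    have n1: "1 \<le> ?n" using cI0 by simp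
    have "m * t \<le> ?n * (m * t)" using n1 m t mult_right_mono[of 1 ?n "m * t"] by simp
    then have "\<bar>1 - ?S\<bar> \<le> ?n * (m * t)" using split rest rest0 by linarith
    with 1 have "\<bar>1 - ?n * \<alpha> i\<bar> \<le> ?n * ((8 + m) * t)" by (simp add: algebra_simps)
    then have "\<bar>1 - ?n * \<alpha> i\<bar> / ?n \<le> (8 + m) * t" using cI0 by (simp add: field_simps)
    moreover have "\<bar>1 - ?n * \<alpha> i\<bar> / ?n = \<bar>(1 - ?n * \<alpha> i) / ?n\<bar>" by (simp add: abs_divide)
    moreover have "(1 - ?n * \<alpha> i) / ?n = 1 / ?n - \<alpha> i" using cI0 by (simp add: field_simps)
    ultimately have "\<bar>1 / ?n - \<alpha> i\<bar> \<le> (8 + m) * t" by (simp only:)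
    moreover have "1 / ?n = d / m" unfolding cI by simp
    ultimately show ?thesis by (simp only: abs_minus_commute)
  qed
  moreover have "\<bar>\<alpha> i\<bar> \<le> (8 + m) * t" if "\<not> t \<le> \<alpha> i" for i
  proof -
    have "1 * t \<le> (8 + m) * t" using m t by (intro mult_right_mono) auto
    with that nn[of i] show ?thesis by linarith
  qed
  ultimately show ?thesis using d(1,2) I_eq by (intro exI[of _ d] conjI exI[of _ i0]) auto
qed

section \<open>A smooth modulus with stable energy\<close>

definition dsmooth :: "int \<Rightarrow> int \<Rightarrow> bool" where
  "dsmooth D q \<longleftrightarrow> 0 < q \<and> (\<forall>p. prime p \<and> p dvd q \<longrightarrow> p dvd D)"

lemma dsmooth_mult: "dsmooth D q \<Longrightarrow> dsmooth D h \<Longrightarrow> dsmooth D (q * h)"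
  by (auto simp: dsmooth_def prime_dvd_mult_iff)

lemma dsmooth_1: "dsmooth D 1"
  by (auto simp: dsmooth_def)

lemma dsmooth_dvd: "dsmooth D q \<Longrightarrow> h dvd q \<Longrightarrow> 0 < h \<Longrightarrow> dsmooth D h"
  by (auto simp: dsmooth_def)

section \<open>Number of occupied residue classes\<close>

definition ncls :: "int set \<Rightarrow> int \<Rightarrow> nat" where
  "ncls A q = card ((\<lambda>u. u mod q) ` A)"

lemma ncls_1: "ncls A 1 \<le> 1"
proof -
  have "(\<lambda>u. u mod 1) ` A \<subseteq> {0::int}" by auto
  then have "card ((\<lambda>u. u mod 1) ` A) \<le> card {0::int}" by (rule card_mono[rotated]) auto
  then show ?thesis by (simp add: ncls_def)
qed

lemma ncls_mult_le:
  assumes "finite A" "0 < h"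
  shows "ncls A (q * h) \<le> nat h * ncls A q"
proof -
  have "(\<lambda>u. u mod (q * h)) ` A \<subseteq> (\<lambda>(r, j). q * j + r) ` (((\<lambda>u. u mod q) ` A) \<times> {0..<h})"
  proof (intro image_subsetI)
    fix u assume u: "u \<in> A"
    have "u mod (q * h) = q * (u div q mod h) + u mod q"
      using assms by (simp add: zmod_zmult2_eq)
    then show "u mod (q * h) \<in> (\<lambda>(r, j). q * j + r) ` (((\<lambda>u. u mod q) ` A) \<times> {0..<h})"
      using u assms by (auto intro!: image_eqI[of _ _ "(u mod q, u div q mod h)"])
  qed
  then have "ncls A (q * h) \<le> card ((\<lambda>(r, j). q * j + r) ` (((\<lambda>u. u mod q) ` A) \<times> {0..<h}))"
    unfolding ncls_def using assms by (intro card_mono) auto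
  also have "\<dots> \<le> card (((\<lambda>u. u mod q) ` A) \<times> {0..<h})" using assms by (intro card_image_le) auto
  finally show ?thesis by (simp add: card_cartesian_product ncls_def mult.commute)
qed

lemma ncls_conc_le:
  assumes "finite A" "conc A q w M"
  shows "ncls M w \<le> ncls A q"
proof -
  define g where "g r = (SOME u. u \<in> M \<and> u mod q = r) mod w" for r
  have "(\<lambda>u. u mod w) ` M \<subseteq> g ` ((\<lambda>u. u mod q) ` A)"
  proof (intro image_subsetI)
    fix u assume u: "u \<in> M"
    let ?x = "SOME x. x \<in> M \<and> x mod q = u mod q"
    have "?x \<in> M \<and> ?x mod q = u mod q" by (rule someI[of _ u]) (use u in simp)
    then have "?x \<in> M" "[?x = u] (mod q)" by (simp_all only: cong_def)
    then have "[?x = u] (mod w)" using assms u unfolding conc_def by blast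
    then have "u mod w = g (u mod q)" by (simp add: g_def cong_def)
    moreover have "u \<in> A" using assms u by (auto simp: conc_def)
    ultimately show "u mod w \<in> g ` ((\<lambda>u. u mod q) ` A)" by blast
  qed
  then have "ncls M w \<le> card (g ` ((\<lambda>u. u mod q) ` A))"
    unfolding ncls_def using assms by (intro card_mono) auto
  also have "\<dots> \<le> ncls A q" unfolding ncls_def using assms by (intro card_image_le) auto
  finally show ?thesis .
qed

text \<open>Fewer than \<open>r\<close> of the solutions through \<open>u\<close> use an element
  outside \<open>MB\<close> or \<open>MC\<close>, so \<open>u\<close> is minus a sum of an element
  of \<open>MB\<close> and one of \<open>MC\<close>. This controls the classes of all of
  \<open>A\<close>, exceptional elements included, and is the reason for the squaring in
  \<open>cell_bound\<close>.\<close>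

lemma ncls_rich_le:
  assumes fin: "finite A" "finite B" "finite C" and rich: "rich A B C r"
    and small: "real (card (B - MB)) + real (card (C - MC)) < r"
    and M: "MB \<subseteq> B" "MC \<subseteq> C"
  shows "ncls A w \<le> ncls MB w * ncls MC w"
proof -
  have "(\<lambda>u. u mod w) ` A \<subseteq> (\<lambda>(x, y). (- x - y) mod w) ` (((\<lambda>u. u mod w) ` MB) \<times> ((\<lambda>u. u mod w) ` MC))"
  proof (intro image_subsetI)
    fix u assume u: "u \<in> A"
    let ?T = "{v \<in> B. - u - v \<in> C}"
    have "\<exists>v\<in>MB. - u - v \<in> MC"
    proof (rule ccontr)
      assume no: "\<not> ?thesis"
      have "?T \<subseteq> (B - MB) \<union> (\<lambda>w. - u - w) ` (C - MC)"
      proof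
        fix v assume v: "v \<in> ?T"
        then have "v = - u - (- u - v)" "v \<notin> MB \<or> - u - v \<in> C - MC" using no by auto
        then show "v \<in> (B - MB) \<union> (\<lambda>w. - u - w) ` (C - MC)" using v by blast
      qed
      then have "card ?T \<le> card ((B - MB) \<union> (\<lambda>w. - u - w) ` (C - MC))" using fin by (intro card_mono) auto
      also have "\<dots> \<le> card (B - MB) + card ((\<lambda>w. - u - w) ` (C - MC))" by (rule card_Un_le)
      also have "card ((\<lambda>w. - u - w) ` (C - MC)) \<le> card (C - MC)" using fin by (intro card_image_le) auto
      finally have "real (card ?T) < r" using small by linarith
      then show False using rich u by (auto simp: rich_def)
    qed
    then obtain v where v: "v \<in> MB" "- u - v \<in> MC" by blast
    have "- (v mod w) - (- u - v) mod w = u + w * (v div w + (- u - v) div w)"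
      by (simp add: distrib_left minus_mult_div_eq_mod[symmetric])
    then have "u mod w = (- (v mod w) - (- u - v) mod w) mod w" by simp
    then show "u mod w \<in> (\<lambda>(x, y). (- x - y) mod w) ` (((\<lambda>u. u mod w) ` MB) \<times> ((\<lambda>u. u mod w) ` MC))"
      using v by (intro image_eqI[of _ _ "(v mod w, (- u - v) mod w)"]) auto
  qed
  moreover have "finite MB" "finite MC" using M fin finite_subset by blast+
  ultimately have "ncls A w \<le> card ((\<lambda>(x, y). (- x - y) mod w) ` (((\<lambda>u. u mod w) ` MB) \<times> ((\<lambda>u. u mod w) ` MC)))"
    unfolding ncls_def by (intro card_mono) auto
  also have "\<dots> \<le> card (((\<lambda>u. u mod w) ` MB) \<times> ((\<lambda>u. u mod w) ` MC))"
    using \<open>finite MB\<close> \<open>finite MC\<close> by (intro card_image_le) auto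
  finally show ?thesis by (simp add: card_cartesian_product ncls_def)
qed

text \<open>A modulus exceeding twice all absolute values separates the elements. A large set with
  few occupied classes therefore bounds the modulus, which makes a largest admissible modulus
  available.\<close>

lemma ncls_large:
  assumes "\<And>u. u \<in> A \<Longrightarrow> \<bar>u\<bar> \<le> X" "2 * X < q"
  shows "ncls A q = card A"
  unfolding ncls_def
proof (rule card_image, rule inj_onI)
  fix u v assume "u \<in> A" "v \<in> A" "u mod q = v mod q"
  then have "q dvd u - v" "\<bar>u - v\<bar> < q"
    using assms(1)[of u] assms(1)[of v] assms(2) by (auto simp: mod_eq_dvd_iff)
  then have "u - v = 0" using zdvd_imp_le[of q "\<bar>u - v\<bar>"] by (cases "u - v = 0") auto
  then show "u = v" by simp
qed

definition energy3 :: "int set \<Rightarrow> int set \<Rightarrow> int set \<Rightarrow> int \<Rightarrow> real" where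
  "energy3 A B C q = energy A B C q + energy B C A q + energy C A B q"

definition conc_le :: "int set \<Rightarrow> int \<Rightarrow> int \<Rightarrow> real \<Rightarrow> bool" where
  "conc_le A q w r \<longleftrightarrow> (\<exists>M. conc A q w M \<and> real (card (A - M)) \<le> r)"

lemma conc_le_trans:
  assumes "finite A" "conc_le A q w r" "conc_le A w w' r'"
  shows "conc_le A q w' (r + r')"
proof -
  obtain M M' where M: "conc A q w M" "real (card (A - M)) \<le> r" "conc A w w' M'" "real (card (A - M')) \<le> r'"
    using assms by (auto simp: conc_le_def)
  have "card (A - M \<inter> M') \<le> card (A - M) + card (A - M')"
    using card_Un_le[of "A - M" "A - M'"] by (simp add: Diff_Int)
  then have "real (card (A - M \<inter> M')) \<le> r + r'" using M by linarith
  with conc_trans[OF M(1,3)] show ?thesis by (auto simp: conc_le_def)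
qed

text \<open>Exceptional sets of size \<open>2 * \<epsilon> * N\<close> in two of the sets become one
  of size \<open>\<epsilon> * N\<close> in the third. This undoes the doubling caused by
  \<open>conc_le_trans\<close> when a prime is added, so that the error stays the same however many
  primes are absorbed.\<close>

lemma conc_le_improve:
  assumes fin: "finite A" "finite B" "finite C" and qh: "0 < q" "0 < h"
    and rich: "rich A B C (\<rho> * N)" and pos: "0 < \<rho>" "0 < N"
    and c: "conc_le B q (q * h) (2 * \<epsilon> * N)" "conc_le C q (q * h) (2 * \<epsilon> * N)"
    and small: "128 * \<epsilon> \<le> \<rho>" "4 * \<eta> \<le> \<epsilon> * \<rho>"
    and loss: "energy A B C q - energy A B C (q * h) \<le> \<eta> * N\<^sup>2"
  shows "conc_le A q (q * h) (\<epsilon> * N)"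
proof -
  obtain MB MC where M: "conc B q (q * h) MB" "real (card (B - MB)) \<le> 2 * \<epsilon> * N"
     "conc C q (q * h) MC" "real (card (C - MC)) \<le> 2 * \<epsilon> * N"
    using c by (auto simp: conc_le_def)
  have "128 * \<epsilon> * N \<le> \<rho> * N" using small pos by (intro mult_right_mono) auto
  then obtain MA where MA: "conc A q (q * h) MA" "real (card (A - MA)) * (\<rho> * N) \<le> 4 * (\<eta> * N\<^sup>2)"
  proof -
    have "64 * real (card (B - MB)) \<le> \<rho> * N" "64 * real (card (C - MC)) \<le> \<rho> * N"
      using M \<open>128 * \<epsilon> * N \<le> \<rho> * N\<close> by linarith+
    then show ?thesis using conc_improve[OF fin qh rich _ M(1,3) _ _ loss] pos that by auto
  qed
  have "4 * \<eta> * N\<^sup>2 \<le> \<epsilon> * \<rho> * N\<^sup>2" using small by (intro mult_right_mono) auto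
  with MA(2) have "real (card (A - MA)) * (\<rho> * N) \<le> (\<epsilon> * N) * (\<rho> * N)"
    by (simp add: power2_eq_square algebra_simps)
  then have "real (card (A - MA)) \<le> \<epsilon> * N" using pos by simp
  with MA show ?thesis by (auto simp: conc_le_def)
qed

lemma ncls_concentrated_le:
  assumes fin: "finite A" "finite B" "finite C"
    and rich: "rich A B C r" and c: "conc_le B q w e" "conc_le C q w e" and "2 * e < r"
    and n: "ncls B q \<le> K" "ncls C q \<le> K"
  shows "ncls A w \<le> K\<^sup>2"
proof -
  obtain MB MC where M: "conc B q w MB" "real (card (B - MB)) \<le> e"
     "conc C q w MC" "real (card (C - MC)) \<le> e"
    using c by (auto simp: conc_le_def)
  have "ncls A w \<le> ncls MB w * ncls MC w"
    by (rule ncls_rich_le[OF fin rich]) (use M assms in \<open>auto simp: conc_def\<close>)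
  also have "\<dots> \<le> K * K"
    using ncls_conc_le[OF fin(2) M(1)] ncls_conc_le[OF fin(3) M(3)] n by (intro mult_le_mono) auto
  finally show ?thesis by (simp add: power2_eq_square)
qed

text \<open>The square pays for controlling whole sets instead of their concentrated parts
  (\<open>ncls_concentrated_le\<close>), the factor \<open>m\<close> for one refinement by at most
  \<open>m\<close>.\<close>

primrec cell_bound :: "nat \<Rightarrow> nat \<Rightarrow> nat" where
  "cell_bound m 0 = 1"
| "cell_bound m (Suc k) = m * (cell_bound m k)\<^sup>2"

lemma cell_bound_ge_1: "1 \<le> m \<Longrightarrow> 1 \<le> cell_bound m k"
  by (induction k) (auto simp: Suc_le_eq)

lemma cell_bound_square_le: "1 \<le> m \<Longrightarrow> (cell_bound m k)\<^sup>2 \<le> cell_bound m (Suc k)"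
  by simp

lemma cell_bound_le_Suc: "1 \<le> m \<Longrightarrow> cell_bound m k \<le> cell_bound m (Suc k)"
proof -
  assume m: "1 \<le> m"
  have "cell_bound m k * 1 \<le> cell_bound m k * cell_bound m k" using cell_bound_ge_1[OF m] by (intro mult_le_mono) auto
  also have "\<dots> \<le> cell_bound m (Suc k)" using cell_bound_square_le[OF m, of k] by (simp add: power2_eq_square)
  finally show ?thesis by simp
qed

lemma cell_bound_mono: "1 \<le> m \<Longrightarrow> k \<le> l \<Longrightarrow> cell_bound m k \<le> cell_bound m l"
  using lift_Suc_mono_le[of "cell_bound m" k l] cell_bound_le_Suc by blast

lemma exists_small_decrement:
  fixes u :: "nat \<Rightarrow> real"
  assumes "0 < n" "0 \<le> u n" "u 0 \<le> x"
  shows "\<exists>k<n. u k - u (Suc k) \<le> x / n"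
proof (rule ccontr)
  assume "\<not> ?thesis"
  then have "(\<Sum>k<n. x / n) < (\<Sum>k<n. u k - u (Suc k))"
    using assms by (intro sum_strict_mono) auto
  also have "\<dots> = u 0 - u n" by (simp add: sum_lessThan_telescope')
  finally show False using assms by simp
qed

lemma energy_refined_le:
  assumes "finite A" "finite B" "finite C" "0 < q" "0 < h"
  shows "energy A B C (q * h) \<le> energy A B C q"
  using assms refinement.energy_refined_le[of A B C q h] by (simp add: refinement_def)

text \<open>With moduli graded by their number of classes, the least energy drops only a little at
  some level \<open>k\<close>. A near minimiser \<open>q\<close> of that level is enlarged to the
  largest modulus \<open>Q\<close> at which the three sets are still concentrated. This only squares
  the class bound, so refining \<open>Q\<close> by \<open>m\<close> stays within level
  \<open>Suc k\<close> and is nearly free, while one more common prime would contradict the choice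
  of \<open>Q\<close>.\<close>

lemma exists_stable_modulus:
  fixes A B C :: "int set" and m D :: int and \<rho> \<epsilon> \<eta> N :: real and n :: nat
  assumes fin: "finite A" "finite B" "finite C"
    and card: "real (card A) \<le> N" "real (card B) \<le> N" "real (card C) \<le> N"
    and m: "dsmooth D m" and pos: "0 < \<rho>" "0 < \<epsilon>" "0 < \<eta>" "0 < N"
    and small: "128 * \<epsilon> \<le> \<rho>" "4 * \<eta> \<le> \<epsilon> * \<rho>" and n: "6 / \<eta> \<le> real n"
    and large: "real (cell_bound (nat m) n) < \<rho> * N"
    and rich: "rich A B C (\<rho> * N)" "rich B C A (\<rho> * N)" "rich C A B (\<rho> * N)" and ne: "A \<noteq> {}"
  shows "\<exists>q. dsmooth D q \<and> ncls A q \<le> cell_bound (nat m) n \<and> ncls B q \<le> cell_bound (nat m) n \<and> ncls C q \<le> cell_bound (nat m) n \<and>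
     energy3 A B C q - energy3 A B C (q * m) \<le> \<eta> * N\<^sup>2 \<and>
     (\<forall>p. prime p \<and> p dvd m \<longrightarrow>
        \<not> (conc_le A q (q * p) (\<epsilon> * N) \<and> conc_le B q (q * p) (\<epsilon> * N) \<and> conc_le C q (q * p) (\<epsilon> * N)))"
proof -
  let ?c = "cell_bound (nat m)"
  have m0: "0 < m" and m1: "1 \<le> nat m" using m by (auto simp: dsmooth_def)
  define S where "S k = {q. dsmooth D q \<and> ncls A q \<le> ?c k \<and> ncls B q \<le> ?c k \<and> ncls C q \<le> ?c k}" for k
  define E where "E = energy3 A B C"
  define u where "u k = Inf (E ` S k)" for k
  have E0: "0 \<le> E q" for q unfolding E_def energy3_def using energy_nonneg by (simp add: add_nonneg_nonneg)
  have bdd: "bdd_below (E ` S k)" for k using E0 by (auto intro: bdd_belowI[of _ 0])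
  have one: "1 \<in> S k" for k
    using ncls_1[of A] ncls_1[of B] ncls_1[of C] cell_bound_ge_1[OF m1, of k] dsmooth_1 by (auto simp: S_def)
  have E1: "E 1 \<le> 3 * N\<^sup>2"
  proof -
    have "energy X Y Z 1 \<le> N\<^sup>2"
      if "finite X" "finite Y" "finite Z" "real (card X) \<le> N" "real (card Y) \<le> N" "real (card Z) \<le> N" for X Y Z
    proof -
      have "energy X Y Z 1 \<le> card X * sqrt (card Y * card Z)" by (rule energy_1) (use that in auto)
      also have "\<dots> \<le> N * sqrt (N * N)"
        using that pos by (intro mult_mono real_sqrt_le_mono) (auto intro: mult_mono)
      finally show ?thesis using pos by (simp add: power2_eq_square)
    qed
    from this[OF fin card] this[OF fin(2,3,1) card(2,3,1)] this[OF fin(3,1,2) card(3,1,2)]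
    show ?thesis by (simp add: E_def energy3_def)
  qed
  have u_le: "u k \<le> E q" if "q \<in> S k" for k q
    unfolding u_def by (rule cInf_lower) (use that bdd in auto)
  have "0 \<le> u n" unfolding u_def by (rule cInf_greatest) (use one E0 in auto)
  have n0: "0 < n" using n pos by (cases n) (auto simp: field_simps)
  \<comment> \<open>The three energies start below three times the square of \<open>N\<close>. With
    \<open>6 / \<eta>\<close> levels, half of the permitted loss goes to this drop and the other
    half to the near minimality of \<open>q\<close>.\<close>
  obtain k where k: "k < n" "u k - u (Suc k) \<le> 3 * N\<^sup>2 / n"
    using exists_small_decrement[of n u "3 * N\<^sup>2"] n0 \<open>0 \<le> u n\<close> u_le[OF one, of 0] E1 by force
  have "3 * N\<^sup>2 / n \<le> \<eta> * N\<^sup>2 / 2"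
  proof -
    have "6 \<le> \<eta> * real n" using n pos by (simp add: field_simps)
    then have "6 * N\<^sup>2 \<le> \<eta> * real n * N\<^sup>2" by (intro mult_right_mono) auto
    then show ?thesis using n0 by (simp add: field_simps)
  qed
  with k have dec: "u k - u (Suc k) \<le> \<eta> * N\<^sup>2 / 2" by simp
  have "\<exists>x\<in>E ` S k. x < u k + \<eta> * N\<^sup>2 / 2"
    unfolding u_def by (rule cInf_lessD) (use one pos in auto)
  then obtain q where q: "q \<in> S k" "E q < u k + \<eta> * N\<^sup>2 / 2" by blast
  have Ediff: "E q - E w \<le> \<eta> * N\<^sup>2" if "w \<in> S (Suc k)" for w
    using u_le[OF that] q dec by linarith
  have q0: "0 < q" "dsmooth D q" using q by (auto simp: S_def dsmooth_def)
  \<comment> \<open>Concentration is measured from \<open>q\<close> itself and not along a chain of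
    refinements, so that exceptional sets do not add up.\<close>
  define P where "P w \<longleftrightarrow> q dvd w \<and> dsmooth D w \<and> conc_le A q w (\<epsilon> * N) \<and> conc_le B q w (\<epsilon> * N) \<and> conc_le C q w (\<epsilon> * N)" for w
  have eN: "2 * (\<epsilon> * N) < \<rho> * N"
  proof -
    have "2 * \<epsilon> < \<rho>" using small pos by linarith
    then show ?thesis using pos by (simp flip: mult.assoc)
  qed
  have Pn: "ncls A w \<le> (?c k)\<^sup>2" "ncls B w \<le> (?c k)\<^sup>2" "ncls C w \<le> (?c k)\<^sup>2" if "P w" for w
  proof -
    have nq: "ncls A q \<le> ?c k" "ncls B q \<le> ?c k" "ncls C q \<le> ?c k" using q by (auto simp: S_def)
    show "ncls A w \<le> (?c k)\<^sup>2"
      by (rule ncls_concentrated_le[OF fin rich(1) _ _ eN nq(2,3)]) (use that in \<open>auto simp: P_def\<close>)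
    show "ncls B w \<le> (?c k)\<^sup>2"
      by (rule ncls_concentrated_le[OF fin(2,3,1) rich(2) _ _ eN nq(3,1)]) (use that in \<open>auto simp: P_def\<close>)
    show "ncls C w \<le> (?c k)\<^sup>2"
      by (rule ncls_concentrated_le[OF fin(3,1,2) rich(3) _ _ eN nq(1,2)]) (use that in \<open>auto simp: P_def\<close>)
  qed
  have ck: "(?c k)\<^sup>2 \<le> ?c n"
    using cell_bound_square_le[OF m1, of k] cell_bound_mono[OF m1, of "Suc k" n] k by linarith
  obtain X where X: "\<And>v. v \<in> B \<Longrightarrow> \<bar>v\<bar> \<le> X"
  proof
    show "\<bar>v\<bar> \<le> Max (insert 0 (abs ` B))" if "v \<in> B" for v using that fin by auto
  qed
  \<comment> \<open>Beyond \<open>2 * X\<close> the elements of \<open>B\<close> lie in distinct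
    classes. Then \<open>B\<close> would have at most \<open>cell_bound (nat m) n\<close> elements,
    whereas richness gives it at least \<open>\<rho> * N\<close>.\<close>
  have Pbound: "w \<le> 2 * X" if "P w" for w
  proof (rule ccontr)
    assume "\<not> w \<le> 2 * X"
    then have "ncls B w = card B" using X by (intro ncls_large[of B X]) auto
    then have "card B \<le> ?c n" using Pn(2)[OF that] ck by linarith
    moreover obtain a where a: "a \<in> A" using ne by blast
    then have "\<rho> * N \<le> real (card {v \<in> B. - a - v \<in> C})" using rich(1) by (auto simp: rich_def)
    moreover have "card {v \<in> B. - a - v \<in> C} \<le> card B" using fin by (intro card_mono) auto
    ultimately show False using large by linarith
  qed
  have eN0: "0 \<le> \<epsilon> * N" using pos by simp
  have "P q" using q0 conc_refl eN0 by (auto simp: P_def conc_le_def intro!: exI)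
  have "finite {w. P w}"
    by (rule finite_subset[of _ "{0..2 * X}"]) (use Pbound in \<open>auto simp: P_def dsmooth_def\<close>)
  define Q where "Q = Max {w. P w}"
  have PQ: "P Q" and Qmax: "\<And>w. P w \<Longrightarrow> w \<le> Q"
    using \<open>finite {w. P w}\<close> \<open>P q\<close> Max_in[of "{w. P w}"] by (auto simp: Q_def)
  have Q0: "0 < Q" "dsmooth D Q" "q dvd Q" using PQ by (auto simp: P_def dsmooth_def)
  then obtain h where h: "Q = q * h" by auto
  then have h0: "0 < h" using Q0 q0 by (simp add: zero_less_mult_iff)
  \<comment> \<open>Passing to \<open>Q\<close> has used the square in \<open>cell_bound\<close>,
    and the factor \<open>m\<close> is left for one more refinement. Both \<open>g = m\<close> and a
    prime \<open>g\<close> dividing \<open>m\<close> are needed.\<close>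
  have inS: "Q * g \<in> S (Suc k)" if g: "dsmooth D g" "g \<le> m" for g
  proof -
    have g0: "0 < g" using g by (simp add: dsmooth_def)
    have "ncls Y (Q * g) \<le> ?c (Suc k)" if "finite Y" "ncls Y Q \<le> (?c k)\<^sup>2" for Y
    proof -
      have "ncls Y (Q * g) \<le> nat g * ncls Y Q" by (rule ncls_mult_le[OF that(1) g0])
      also have "\<dots> \<le> nat m * (?c k)\<^sup>2" using that g by (intro mult_le_mono) auto
      finally show ?thesis by simp
    qed
    then show ?thesis using Pn[OF PQ] fin dsmooth_mult[OF Q0(2) g(1)] by (auto simp: S_def)
  qed
  have "E Q \<le> E q"
    unfolding E_def energy3_def h
    by (intro add_mono energy_refined_le fin q0 h0)
  then have main: "E Q - E (Q * m) \<le> \<eta> * N\<^sup>2" using Ediff[OF inS[OF m]] by simp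
  have "False" if p: "prime p" "p dvd m"
    and cc: "conc_le A Q (Q * p) (\<epsilon> * N)" "conc_le B Q (Q * p) (\<epsilon> * N)" "conc_le C Q (Q * p) (\<epsilon> * N)" for p
  proof -
    have p0: "1 < p" using p prime_gt_1_int by auto
    have pm: "p \<le> m" using p m0 zdvd_imp_le by auto
    have ps: "dsmooth D p" by (rule dsmooth_dvd[OF m p(2)]) (use p0 in simp)
    have hp: "0 < h * p" using h0 p0 by simp
    have w: "Q * p = q * (h * p)" by (simp add: h)
    have E3: "energy3 A B C q - energy3 A B C (q * (h * p)) \<le> \<eta> * N\<^sup>2"
      using Ediff[OF inS[OF ps pm]] by (simp add: E_def w)
    have mono: "energy A B C (q * (h * p)) \<le> energy A B C q" "energy B C A (q * (h * p)) \<le> energy B C A q"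
      "energy C A B (q * (h * p)) \<le> energy C A B q"
      by (intro energy_refined_le fin q0 hp)+
    \<comment> \<open>Composing the steps from \<open>q\<close> to \<open>Q\<close> and from
      \<open>Q\<close> to \<open>Q * p\<close> doubles the exceptional sets. The step from
      \<open>q\<close> to \<open>Q * p\<close> as a whole still has small energy loss, so
      \<open>conc_le_improve\<close> restores \<open>\<epsilon>\<close> and \<open>Q * p\<close>
      would satisfy \<open>P\<close>.\<close>
    have two: "\<epsilon> * N + \<epsilon> * N = 2 * \<epsilon> * N" by simp
    have "conc_le Y q (q * (h * p)) (2 * \<epsilon> * N)"
      if "finite Y" "conc_le Y q Q (\<epsilon> * N)" "conc_le Y Q (Q * p) (\<epsilon> * N)" for Y
      using conc_le_trans[OF that] unfolding two w .
    then have c2: "conc_le A q (q * (h * p)) (2 * \<epsilon> * N)" "conc_le B q (q * (h * p)) (2 * \<epsilon> * N)"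
      "conc_le C q (q * (h * p)) (2 * \<epsilon> * N)"
      using fin cc PQ unfolding P_def by blast+
    have "conc_le A q (q * (h * p)) (\<epsilon> * N)"
      by (rule conc_le_improve[OF fin q0(1) hp rich(1) pos(1,4) c2(2,3) small]) (use E3 mono in \<open>simp add: energy3_def\<close>)
    moreover have "conc_le B q (q * (h * p)) (\<epsilon> * N)"
      by (rule conc_le_improve[OF fin(2,3,1) q0(1) hp rich(2) pos(1,4) c2(3,1) small]) (use E3 mono in \<open>simp add: energy3_def\<close>)
    moreover have "conc_le C q (q * (h * p)) (\<epsilon> * N)"
      by (rule conc_le_improve[OF fin(3,1,2) q0(1) hp rich(3) pos(1,4) c2(1,2) small]) (use E3 mono in \<open>simp add: energy3_def\<close>)
    ultimately have "P (Q * p)"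
      unfolding P_def w using dsmooth_mult[OF Q0(2) ps] w by simp
    then have "Q * p \<le> Q" by (rule Qmax)
    then show False using Q0 p0 by simp
  qed
  then show ?thesis
    using Q0(2) Pn[OF PQ] ck main unfolding E_def by (intro exI[of _ Q] conjI) auto
qed

text \<open>The children of \<open>u\<close> modulo \<open>q * m\<close> are almost uniform on the subgroup generated by \<open>d\<close>.\<close>

definition typed :: "int set \<Rightarrow> int \<Rightarrow> int \<Rightarrow> real \<Rightarrow> int \<Rightarrow> int \<Rightarrow> bool" where
  "typed A q m e d u \<longleftrightarrow> 0 < d \<and> d dvd m \<and> (\<forall>i. \<bar>ratio A q m u i - (if d dvd i then d / m else 0)\<bar> \<le> e)"

lemma prob_vec_ratio:
  assumes "finite A" "0 < q" "0 < m" "0 < cnt A q u"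
  shows "prob_vec m (ratio A q m u)"
  using sum_ratio[OF assms] by (auto simp: prob_vec_def intro: ratio_periodic)

text \<open>Each of the \<open>m\<close> children of a class can hold at most a share
  \<open>e\<close> of light elements. Discarding them ensures that an element lies in the coset on
  which its class is distributed.\<close>

lemma card_light_le:
  fixes m :: int and e :: real
  assumes A: "finite A" and q: "0 < q" "0 < m" and e: "0 \<le> e"
  shows "real (card {u \<in> A. ratio A q m u 0 \<le> e}) \<le> m * e * card A"
proof -
  let ?I = "\<lambda>u. if ratio A q m u 0 \<le> e then 1 else 0 :: real"
  have "real (card {u \<in> A. ratio A q m u 0 \<le> e}) = (\<Sum>u\<in>A. ?I u)"
    using A by (simp add: sum.If_cases Int_def)
  also have "\<dots> = (\<Sum>u\<in>A. (\<Sum>u'\<in>cls A q u. ?I u') / cnt A q u)"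
    by (rule sum_cls_average[OF A, symmetric])
  also have "\<dots> \<le> (\<Sum>u\<in>A. m * e)"
  proof (rule sum_mono)
    fix u assume u: "u \<in> A"
    have c: "0 < cnt A q u" by (rule cnt_pos[OF A u])
    have "(\<Sum>u'\<in>cls A q u. ?I u') = (\<Sum>j\<in>{0..<m}. \<Sum>u'\<in>cls A (q * m) (u + q * j). ?I u')"
      by (rule sum_cls_children[OF A q])
    also have "\<dots> \<le> (\<Sum>j\<in>{0..<m}. e * cnt A q u)"
    proof (rule sum_mono)
      fix j
      have eq: "ratio A q m u' 0 = ratio A q m u j" if "u' \<in> cls A (q * m) (u + q * j)" for u'
      proof -
        have 1: "[u' = u + q * j] (mod q * m)" using that by (simp add: cls_def)
        then have "[u' = u + q * j] (mod q)" by (rule cong_dvd_modulus) simp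
        then have "[u' = u] (mod q)" by (simp add: cong_def)
        then show ?thesis using cnt_cong[OF 1, of A] cnt_cong[of u' u q A] by (simp add: ratio_def)
      qed
      have "(\<Sum>u'\<in>cls A (q * m) (u + q * j). ?I u') = (\<Sum>u'\<in>cls A (q * m) (u + q * j). if ratio A q m u j \<le> e then 1 else 0)"
        by (rule sum.cong) (auto simp: eq)
      also have "\<dots> = (if ratio A q m u j \<le> e then cnt A (q * m) (u + q * j) else 0)" by (simp add: cnt_def)
      also have "\<dots> \<le> e * cnt A q u" using c e by (auto simp: ratio_def field_simps)
      finally show "(\<Sum>u'\<in>cls A (q * m) (u + q * j). ?I u') \<le> e * cnt A q u" .
    qed
    also have "\<dots> = m * e * cnt A q u" using q by simp
    finally show "(\<Sum>u'\<in>cls A q u. ?I u') / cnt A q u \<le> m * e" using c by (simp add: field_simps)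
  qed
  finally show ?thesis by (simp add: mult.commute)
qed

lemma sum_sols_rotate:
  fixes F :: "int \<Rightarrow> int \<Rightarrow> real"
  shows "(\<Sum>(u, v)\<in>sols A B C. F v (- u - v)) = (\<Sum>(v, w)\<in>sols B C A. F v w)"
  by (rule sum.reindex_bij_witness[where i = "\<lambda>(v, w). (- v - w, v)" and j = "\<lambda>(u, v). (v, - u - v)"])
     (auto simp: sols_def)

text \<open>\<open>L\<close> collects the losses in all three rotations. An element of
  \<open>U\<close> has only solutions with \<open>L\<close> above \<open>t ^ 3 / 8\<close>, and by
  richness each such element uses up at least \<open>\<rho> * N\<close> times that amount of the
  energy drop. Any other element has a solution to which the equality case applies; if it is not
  light, the coset obtained contains the index \<open>0\<close> of its own child, hence is the
  subgroup itself.\<close>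

lemma card_untyped_le:
  fixes m :: int and t :: real
  assumes fin: "finite A" "finite B" "finite C" and q: "0 < q" "0 < m"
    and N: "real (card A) \<le> N" "0 < N" and \<rho>: "0 < \<rho>" and rich: "rich A B C (\<rho> * N)"
    and loss: "energy3 A B C q - energy3 A B C (q * m) \<le> \<eta> * N\<^sup>2"
    and t: "0 < t" "t \<le> 1 / (8 * m)"
  shows "real (card {u \<in> A. \<nexists>d. typed A q m ((8 + m) * t) d u}) \<le> (8 * \<eta> / (t ^ 3 * \<rho>) + m * ((8 + m) * t)) * N"
proof -
  let ?e = "t ^ 3 / 8" and ?e1 = "(8 + m) * t"
  have ref: "refinement A B C q m" "refinement B C A q m" "refinement C A B q m"
    using fin q by unfold_locales
  define L where "L u v = loss A B C q m u v + (loss B C A q m v (- u - v) + loss C A B q m (- u - v) u)" for u v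
  have nn: "0 \<le> loss A B C q m u v" "0 \<le> loss B C A q m u v" "0 \<le> loss C A B q m u v" for u v
    using refinement.loss_nonneg ref by blast+
  have L0: "0 \<le> L u v" for u v unfolding L_def using nn by (simp add: add_nonneg_nonneg)
  have "(\<Sum>(u, v)\<in>sols A B C. L u v) = (\<Sum>(u, v)\<in>sols A B C. loss A B C q m u v)
     + ((\<Sum>(v, w)\<in>sols B C A. loss B C A q m v w) + (\<Sum>(w, u)\<in>sols C A B. loss C A B q m w u))"
  proof -
    have "(\<Sum>(u, v)\<in>sols A B C. loss C A B q m (- u - v) u) = (\<Sum>(v, w)\<in>sols B C A. loss C A B q m w (- v - w))"
      using sum_sols_rotate[where F = "\<lambda>v w. loss C A B q m w (- v - w)" and A = A and B = B and C = C] by simp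
    also have "\<dots> = (\<Sum>(w, u)\<in>sols C A B. loss C A B q m w u)"
      by (rule sum_sols_rotate)
    finally show ?thesis
      unfolding L_def using sum_sols_rotate[where F = "loss B C A q m" and A = A and B = B and C = C]
      by (simp add: case_prod_unfold sum.distrib)
  qed
  also have "\<dots> \<le> energy3 A B C q - energy3 A B C (q * m)"
    using refinement.sum_loss_le[OF ref(1)] refinement.sum_loss_le[OF ref(2)] refinement.sum_loss_le[OF ref(3)]
    by (simp add: energy3_def)
  finally have sumL: "(\<Sum>(u, v)\<in>sols A B C. L u v) \<le> \<eta> * N\<^sup>2" using loss by linarith
  define U where "U = {u \<in> A. \<forall>v\<in>B. - u - v \<in> C \<longrightarrow> ?e < L u v}"
  define W where "W = {u \<in> A. ratio A q m u 0 \<le> ?e1}"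
  let ?T = "\<lambda>u. {v \<in> B. - u - v \<in> C}"
  have e0: "0 < ?e" using t by simp
  have "real (card U) * (\<rho> * N * ?e) = (\<Sum>u\<in>U. \<rho> * N * ?e)" by simp
  also have "\<dots> \<le> (\<Sum>u\<in>U. \<Sum>v\<in>?T u. L u v)"
  proof (rule sum_mono)
    fix u assume u: "u \<in> U"
    have "\<rho> * N * ?e \<le> real (card (?T u)) * ?e"
      using rich u e0 by (intro mult_right_mono) (auto simp: rich_def U_def)
    also have "\<dots> = (\<Sum>v\<in>?T u. ?e)" by simp
    also have "\<dots> \<le> (\<Sum>v\<in>?T u. L u v)"
      by (rule sum_mono) (use u in \<open>auto simp: U_def intro: less_imp_le\<close>)
    finally show "\<rho> * N * ?e \<le> (\<Sum>v\<in>?T u. L u v)" .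
  qed
  also have "\<dots> = (\<Sum>(u, v)\<in>(SIGMA u:U. ?T u). L u v)"
    using fin by (intro sum.Sigma) (auto simp: U_def)
  also have "\<dots> \<le> (\<Sum>(u, v)\<in>sols A B C. L u v)"
    by (rule sum_mono2[OF finite_sols[OF fin(1,2)]]) (use L0 in \<open>auto simp: U_def sols_def\<close>)
  also have "\<dots> \<le> \<eta> * N\<^sup>2" by (rule sumL)
  finally have "real (card U) * (\<rho> * N * ?e) \<le> \<eta> * N\<^sup>2" .
  then have "(real (card U) * (\<rho> * ?e)) * N \<le> (\<eta> * N) * N" by (simp add: power2_eq_square mult_ac)
  then have "real (card U) * (\<rho> * ?e) \<le> \<eta> * N" using N by simp
  then have cU: "real (card U) \<le> 8 * \<eta> / (t ^ 3 * \<rho>) * N" using \<rho> t by (simp add: field_simps)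
  have e1: "0 \<le> ?e1" using t q by simp
  have cW: "real (card W) \<le> m * ?e1 * N"
    unfolding W_def using card_light_le[OF fin(1) q e1] N(1) e1 q
    by (meson mult_left_mono order_trans mult_nonneg_nonneg of_int_nonneg less_imp_le)
  have "{u \<in> A. \<nexists>d. typed A q m ?e1 d u} \<subseteq> U \<union> W"
  proof
    fix u assume u: "u \<in> {u \<in> A. \<nexists>d. typed A q m ?e1 d u}"
    show "u \<in> U \<union> W"
    proof (rule ccontr)
      assume "u \<notin> U \<union> W"
      then obtain v where v: "v \<in> B" "- u - v \<in> C" "L u v \<le> ?e" and heavy: "?e1 < ratio A q m u 0"
        using u by (auto simp: U_def W_def not_less not_le)
      have uA: "u \<in> A" using u by simp
      have pv: "prob_vec m (ratio A q m u)" "prob_vec m (ratio B q m v)" "prob_vec m (ratio C q m (- u - v))"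
        using prob_vec_ratio fin q cnt_pos uA v by auto
      have le: "loss A B C q m u v \<le> ?e" "loss B C A q m v (- u - v) \<le> ?e" "loss C A B q m (- u - v) u \<le> ?e"
        using v(3) nn(1)[of u v] nn(2)[of v "- u - v"] nn(3)[of "- u - v" u] by (simp_all add: L_def)
      have "\<exists>d>0. d dvd m \<and> (\<exists>c0. \<forall>i. \<bar>ratio A q m u i - (if [i = c0] (mod d) then d / m else 0)\<bar> \<le> ?e1)"
        by (rule defects_small_imp_cosets[where e = ?e, OF q(2) t _ _ pv])
           (use le t in \<open>simp_all add: loss_def power3_eq_cube power2_eq_square\<close>)
      then obtain d c0 where d: "0 < d" "d dvd m"
        "\<And>i. \<bar>ratio A q m u i - (if [i = c0] (mod d) then d / m else 0)\<bar> \<le> ?e1" by blast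
      have "[0 = c0] (mod d)"
      proof (rule ccontr)
        assume "\<not> [0 = c0] (mod d)"
        then show False using d(3)[of 0] heavy by simp
      qed
      then have "[i = c0] (mod d) \<longleftrightarrow> d dvd i" for i
        by (metis cong_0_iff cong_sym cong_trans)
      then have "typed A q m ?e1 d u" using d unfolding typed_def by simp
      with u show False by blast
    qed
  qed
  then have "card {u \<in> A. \<nexists>d. typed A q m ?e1 d u} \<le> card (U \<union> W)"
    using fin by (intro card_mono) (auto simp: U_def W_def)
  also have "\<dots> \<le> card U + card W" by (rule card_Un_le)
  finally have "real (card {u \<in> A. \<nexists>d. typed A q m ?e1 d u}) \<le> real (card U) + real (card W)" by linarith
  with cU cW show ?thesis by (simp add: algebra_simps)
qed

text \<open>The part of the class of \<open>u\<close> that stays together modulo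
  \<open>q * w\<close> is indexed by the multiples of \<open>w\<close> modulo \<open>m\<close>. Of
  these, \<open>m / lcm d w\<close> are multiples of \<open>d\<close>, each holding a share
  \<open>d / m\<close>, which makes \<open>gcd d w / w\<close>; the errors add up over at most
  \<open>m\<close> indices.\<close>

lemma typed_cnt:
  assumes A: "finite A" and q: "0 < q" "0 < m" and w: "0 < w" "w dvd m"
    and ty: "typed A q m e d u" and u: "u \<in> A"
  shows "\<bar>cnt A (q * w) u - gcd d w / w * cnt A q u\<bar> \<le> m * e * cnt A q u"
proof -
  obtain k where k: "m = w * k" using w by auto
  then have k0: "0 < k" using q w by (simp add: zero_less_mult_iff)
  have d: "0 < d" "d dvd m" and r: "\<And>i. \<bar>ratio A q m u i - (if d dvd i then d / m else 0)\<bar> \<le> e"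
    using ty by (auto simp: typed_def)
  have e0: "0 \<le> e" using r[of 0] by linarith
  have c: "0 < cnt A q u" by (rule cnt_pos[OF A u])
  define g where "g = gcd d w"
  have g: "0 < g" using d by (simp add: g_def)
  obtain d' w' where dw: "d = d' * g" "w = w' * g" "coprime d' w'"
    unfolding g_def using gcd_coprime_exists[of d w] d by (metis gcd_eq_0_iff less_irrefl)
  have d'0: "0 < d'" "0 < w'" using dw d w g by (simp_all add: zero_less_mult_iff)
  have dvd: "d dvd w * j \<longleftrightarrow> [j = 0] (mod d')" for j
  proof -
    have "d dvd w * j \<longleftrightarrow> d' dvd w' * j" using g dw by (simp add: mult.commute mult.left_commute)
    also have "\<dots> \<longleftrightarrow> d' dvd j" using dw(3) by (simp add: coprime_dvd_mult_right_iff)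
    finally show ?thesis by (simp add: cong_0_iff)
  qed
  have "d' dvd k"
  proof -
    have "d dvd w * k" using d k by simp
    then show ?thesis using dvd[of k] by (simp add: cong_0_iff)
  qed
  have "cnt A (q * w) u = (\<Sum>j\<in>{0..<k}. cnt A (q * w * k) (u + q * w * j))"
    by (rule cnt_children) (use A q w k0 in auto)
  also have "\<dots> = (\<Sum>j\<in>{0..<k}. ratio A q m u (w * j) * cnt A q u)"
    using c by (intro sum.cong refl) (simp add: ratio_def k mult.assoc)
  finally have eq: "cnt A (q * w) u / cnt A q u = (\<Sum>j\<in>{0..<k}. ratio A q m u (w * j))"
    using c by (simp flip: sum_distrib_right)
  have "(\<Sum>j\<in>{0..<k}. if d dvd w * j then d / m else 0) = real (card {j\<in>{0..<k}. [j = 0] (mod d')}) * (d / m)"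
    by (simp add: dvd sum.If_cases Int_def)
  also have "real (card {j\<in>{0..<k}. [j = 0] (mod d')}) = k / d'"
    by (rule card_multiples_atLeastLessThan) (use d'0 k0 \<open>d' dvd k\<close> in auto)
  also have "k / d' * (d / m) = g / w" using dw k g d'0 k0 w by simp
  finally have sum: "(\<Sum>j\<in>{0..<k}. if d dvd w * j then d / m else 0) = g / w" .
  have "\<bar>(\<Sum>j\<in>{0..<k}. ratio A q m u (w * j)) - g / w\<bar>
     = \<bar>\<Sum>j\<in>{0..<k}. ratio A q m u (w * j) - (if d dvd w * j then d / m else 0)\<bar>"
    by (simp add: sum_subtractf sum)
  also have "\<dots> \<le> (\<Sum>j\<in>{0..<k}. \<bar>ratio A q m u (w * j) - (if d dvd w * j then d / m else 0)\<bar>)" by (rule sum_abs)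
  also have "\<dots> \<le> (\<Sum>j\<in>{0..<k}. e)" by (intro sum_mono r)
  also have "\<dots> = k * e" using k0 by simp
  also have "\<dots> \<le> m * e" using k w k0 e0 by (intro mult_right_mono) auto
  finally have "\<bar>cnt A (q * w) u / cnt A q u - g / w\<bar> \<le> m * e" unfolding eq .
  then have "\<bar>cnt A (q * w) u / cnt A q u - g / w\<bar> * cnt A q u \<le> m * e * cnt A q u"
    using c by (intro mult_right_mono) auto
  moreover have "cnt A (q * w) u - g / w * cnt A q u = (cnt A (q * w) u / cnt A q u - g / w) * cnt A q u"
    using c by (simp add: left_diff_distrib)
  then have "\<bar>cnt A (q * w) u - g / w * cnt A q u\<bar> = \<bar>cnt A (q * w) u / cnt A q u - g / w\<bar> * cnt A q u"
    using c by (simp only: abs_mult abs_of_pos)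
  ultimately show ?thesis by (simp only: g_def)
qed

text \<open>For \<open>p\<close> dividing \<open>d\<close> the expected share of the child
  containing \<open>u\<close> is \<open>1\<close>, so it holds more than half of its class modulo
  \<open>q\<close>. Two different children cannot both do so.\<close>

lemma conc_typed:
  assumes A: "finite A" and q: "0 < q" "0 < m" and p: "0 < p" "p dvd m" and e: "m * e < 1 / 2"
  shows "conc A q (q * p) {u \<in> A. \<exists>d. typed A q m e d u \<and> p dvd d}"
  unfolding conc_def
proof (intro conjI ballI impI)
  have big: "cnt A q u / 2 < cnt A (q * p) u" if u: "u \<in> A" "typed A q m e d u" "p dvd d" for u d
  proof -
    have c: "0 < cnt A q u" by (rule cnt_pos[OF A u(1)])
    have "gcd d p = p" using u(3) p by (simp add: gcd_proj2_iff)
    then have "\<bar>cnt A (q * p) u - cnt A q u\<bar> \<le> m * e * cnt A q u"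
      using typed_cnt[OF A q p u(2,1)] p by simp
    moreover have "m * e * cnt A q u < 1 / 2 * cnt A q u" using e c by (intro mult_strict_right_mono) auto
    ultimately show ?thesis by linarith
  qed
  fix x y assume x: "x \<in> {u \<in> A. \<exists>d. typed A q m e d u \<and> p dvd d}" and y: "y \<in> {u \<in> A. \<exists>d. typed A q m e d u \<and> p dvd d}"
    and xy: "[x = y] (mod q)"
  show "[x = y] (mod q * p)"
  proof (rule ccontr)
    assume neq: "\<not> [x = y] (mod q * p)"
    have "cls A (q * p) x \<inter> cls A (q * p) y = {}" using neq by (auto simp: cls_def dest: cong_sym cong_trans)
    then have "card (cls A (q * p) x) + card (cls A (q * p) y) = card (cls A (q * p) x \<union> cls A (q * p) y)"
      using A by (simp add: card_Un_disjoint)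
    also have "\<dots> \<le> card (cls A q x)"
    proof (rule card_mono)
      have "[z = x] (mod q)" if "[z = x] (mod q * p)" for z using that by (rule cong_dvd_modulus) simp
      moreover have "[z = x] (mod q)" if "[z = y] (mod q * p)" for z
        using cong_dvd_modulus[OF that, of q] xy by (auto intro: cong_trans cong_sym)
      ultimately show "cls A (q * p) x \<union> cls A (q * p) y \<subseteq> cls A q x" by (auto simp: cls_def)
    qed (use A in simp)
    finally have "cnt A (q * p) x + cnt A (q * p) y \<le> cnt A q x" by (simp add: cnt_def)
    moreover have "cnt A q x = cnt A q y" using xy by (rule cnt_cong)
    moreover have "cnt A q x / 2 < cnt A (q * p) x" "cnt A q y / 2 < cnt A (q * p) y" using x y big by auto
    ultimately show False by linarith
  qed
qed auto

text \<open>The congruence confines \<open>y\<close> to \<open>gcd b W\<close> classes modulo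
  \<open>W\<close>, at most \<open>\<bar>b\<bar>\<close> of them, and each class that occurs has
  fewer than \<open>c\<close> elements.\<close>

lemma card_congruent_light_le:
  fixes b k :: int and c :: real
  assumes S: "finite S" and W: "0 < W" and b: "b \<noteq> 0" and c: "0 \<le> c"
  shows "real (card {y \<in> S. [b * y = k] (mod W) \<and> cnt S W y < c}) \<le> \<bar>b\<bar> * c"
proof (cases "{y \<in> S. [b * y = k] (mod W) \<and> cnt S W y < c} = {}")
  case True
  show ?thesis unfolding True using c by simp
next
  case False
  let ?Y = "{y \<in> S. [b * y = k] (mod W) \<and> cnt S W y < c}"
  obtain y0 where y0: "y0 \<in> ?Y" using False by blast
  define g where "g = gcd b W"
  have g0: "0 < g" using W by (simp add: g_def)
  have gb: "g \<le> \<bar>b\<bar>" using zdvd_imp_le[of g "\<bar>b\<bar>"] b by (simp add: g_def)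
  obtain b' W' where bW: "b = b' * g" "W = W' * g" "coprime b' W'"
    unfolding g_def using gcd_coprime_exists[of b W] W by (metis gcd_eq_0_iff less_irrefl)
  have W'0: "0 < W'" using bW W g0 by (simp add: zero_less_mult_iff)
  have sub: "?Y \<subseteq> (\<Union>j\<in>{0..<g}. ?Y \<inter> cls S W (y0 + W' * j))"
  proof
    fix y assume y: "y \<in> ?Y"
    then have "[b * y = b * y0] (mod W)" using y0 by (auto intro: cong_trans cong_sym)
    then have "W' * g dvd (b' * (y - y0)) * g" unfolding bW by (simp add: cong_iff_dvd_diff algebra_simps)
    then have "W' dvd b' * (y - y0)" using g0 by simp
    then have "W' dvd y - y0" using bW(3) by (simp add: coprime_dvd_mult_right_iff coprime_commute)
    then have "y \<in> cls S W' y0" using y by (simp add: cls_def cong_iff_dvd_diff)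
    then show "y \<in> (\<Union>j\<in>{0..<g}. ?Y \<inter> cls S W (y0 + W' * j))"
      using y cls_eq_Union_children[OF W'0 g0, of S y0] unfolding bW(2) by blast
  qed
  have piece: "real (card (?Y \<inter> cls S W z)) \<le> c" for z
  proof (cases "?Y \<inter> cls S W z = {}")
    case False
    then obtain y where y: "y \<in> ?Y" "y \<in> cls S W z" by blast
    then have "cnt S W z = cnt S W y" by (intro cnt_cong) (auto simp: cls_def cong_sym)
    moreover have "card (?Y \<inter> cls S W z) \<le> card (cls S W z)" using S by (intro card_mono) auto
    ultimately show ?thesis using y by (simp add: cnt_def)
  next
    case True
    show ?thesis unfolding True using c by simp
  qed
  have "card ?Y \<le> card (\<Union>j\<in>{0..<g}. ?Y \<inter> cls S W (y0 + W' * j))"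
    using S by (intro card_mono[OF _ sub]) auto
  also have "\<dots> \<le> (\<Sum>j\<in>{0..<g}. card (?Y \<inter> cls S W (y0 + W' * j)))" by (rule card_UN_le) simp
  finally have "real (card ?Y) \<le> (\<Sum>j\<in>{0..<g}. real (card (?Y \<inter> cls S W (y0 + W' * j))))"
    by (simp flip: of_nat_sum)
  also have "\<dots> \<le> (\<Sum>j\<in>{0..<g}. c)" by (intro sum_mono piece)
  also have "\<dots> \<le> \<bar>b\<bar> * c" using gb g0 c by (simp add: mult_right_mono)
  finally show ?thesis .
qed

text \<open>While \<open>x\<close> runs through one class, the solution is determined by
  \<open>y\<close>, and \<open>y\<close> lies in at most \<open>\<bar>b\<bar>\<close> classes, each
  smaller than that of \<open>x\<close> by the factor \<open>K\<close>. So every class of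
  \<open>x\<close> accounts for at most \<open>\<bar>b\<bar> / K\<close> times its own size.\<close>

lemma card_skewed_le:
  fixes a b k :: int and K :: real
  assumes S: "finite S" and W: "0 < W" and ab: "a \<noteq> 0" "b \<noteq> 0" and K: "0 < K"
  shows "real (card {(x, y) \<in> S \<times> S. a * x + b * y = k \<and> K * cnt S W y < cnt S W x}) \<le> \<bar>b\<bar> / K * card S"
proof -
  let ?P = "\<lambda>x. {y \<in> S. a * x + b * y = k \<and> K * cnt S W y < cnt S W x}"
  have "{(x, y) \<in> S \<times> S. a * x + b * y = k \<and> K * cnt S W y < cnt S W x} = (SIGMA x:S. ?P x)" by auto
  then have "real (card {(x, y) \<in> S \<times> S. a * x + b * y = k \<and> K * cnt S W y < cnt S W x}) = (\<Sum>x\<in>S. real (card (?P x)))"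
    using S by simp
  also have "\<dots> = (\<Sum>x\<in>S. (\<Sum>x'\<in>cls S W x. real (card (?P x'))) / cnt S W x)"
    by (rule sum_cls_average[OF S, symmetric])
  also have "\<dots> \<le> (\<Sum>x\<in>S. \<bar>b\<bar> / K)"
  proof (rule sum_mono)
    fix x assume x: "x \<in> S"
    have c: "0 < cnt S W x" by (rule cnt_pos[OF S x])
    let ?Y = "{y \<in> S. [b * y = k - a * x] (mod W) \<and> cnt S W y < cnt S W x / K}"
    have cK: "0 \<le> cnt S W x / K" using c K by simp
    have h1: "(\<Sum>x'\<in>cls S W x. real (card (?P x'))) = real (card (SIGMA x':cls S W x. ?P x'))" using S by simp
    have h2: "card (SIGMA x':cls S W x. ?P x') = card (snd ` (SIGMA x':cls S W x. ?P x'))"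
    proof (rule card_image[symmetric], rule inj_onI)
      fix p p' assume "p \<in> (SIGMA x':cls S W x. ?P x')" "p' \<in> (SIGMA x':cls S W x. ?P x')" "snd p = snd p'"
      then obtain x1 x2 y where p: "p = (x1, y)" "p' = (x2, y)" "a * x1 + b * y = k" "a * x2 + b * y = k"
        by (cases p, cases p') auto
      then have "a * x1 = a * x2" by linarith
      then show "p = p'" using p ab by simp
    qed
    have h3: "card (snd ` (SIGMA x':cls S W x. ?P x')) \<le> card ?Y"
    proof (rule card_mono)
      show "snd ` (SIGMA x':cls S W x. ?P x') \<subseteq> ?Y"
      proof
        fix y assume "y \<in> snd ` (SIGMA x':cls S W x. ?P x')"
        then obtain x' where x': "x' \<in> cls S W x" and y: "y \<in> S" "a * x' + b * y = k" "K * cnt S W y < cnt S W x'"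
          by auto
        have xx: "[x' = x] (mod W)" using x' by (simp add: cls_def)
        have "[k - a * x' = k - a * x] (mod W)" by (intro cong_diff cong_refl cong_scalar_left xx)
        moreover have "k - a * x' = b * y" using y by simp
        moreover have "cnt S W y < cnt S W x / K" using y K cnt_cong[OF xx, of S] by (simp add: field_simps)
        ultimately show "y \<in> ?Y" using y by simp
      qed
    qed (use S in auto)
    have h4: "real (card ?Y) \<le> \<bar>real_of_int b\<bar> * (cnt S W x / K)"
      using card_congruent_light_le[OF S W ab(2) cK, of "k - a * x"] by (simp only: of_int_abs)
    have "(\<Sum>x'\<in>cls S W x. real (card (?P x'))) \<le> \<bar>real_of_int b\<bar> * (cnt S W x / K)"
      using h1 h2 h3 h4 by linarith
    then have "(\<Sum>x'\<in>cls S W x. real (card (?P x'))) / cnt S W x \<le> \<bar>real_of_int b\<bar> * (cnt S W x / K) / cnt S W x"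
      using c by (intro divide_right_mono) auto
    also have "\<dots> = \<bar>b\<bar> / K" using c by simp
    finally show "(\<Sum>x'\<in>cls S W x. real (card (?P x'))) / cnt S W x \<le> \<bar>b\<bar> / K" .
  qed
  finally show ?thesis by (simp add: mult.commute)
qed

section \<open>Almost extremal sets\<close>

definition tri :: "int \<Rightarrow> int \<Rightarrow> int \<Rightarrow> int set \<Rightarrow> int set \<Rightarrow> int set \<Rightarrow> (int \<times> int \<times> int) set" where
  "tri a b c X Y Z = {(x, y, z). x \<in> X \<and> y \<in> Y \<and> z \<in> Z \<and> a * x + b * y + c * z = 0}"

lemma finite_tri [simp]: "finite X \<Longrightarrow> finite Y \<Longrightarrow> finite Z \<Longrightarrow> finite (tri a b c X Y Z)"
  by (rule finite_subset[of _ "X \<times> Y \<times> Z"]) (auto simp: tri_def)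

lemma num_solutions_eq_tri: "num_solutions a b c S = card (tri a b c S S S)"
  unfolding num_solutions_def tri_def by (rule arg_cong[where f = card]) auto

lemma card_tri_eq_sols:
  assumes "a \<noteq> 0" "b \<noteq> 0" "c \<noteq> 0"
  shows "card (tri a b c X Y Z) = card (sols ((*) a ` X) ((*) b ` Y) ((*) c ` Z))"
proof (rule bij_betw_same_card[of "\<lambda>(x, y, z). (a * x, b * y)"], unfold bij_betw_def, intro conjI)
  show "inj_on (\<lambda>(x, y, z). (a * x, b * y)) (tri a b c X Y Z)"
  proof (rule inj_onI)
    fix p p' assume "p \<in> tri a b c X Y Z" "p' \<in> tri a b c X Y Z"
      and eq: "(\<lambda>(x, y, z). (a * x, b * y)) p = (\<lambda>(x, y, z). (a * x, b * y)) p'"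
    then obtain x y z x' y' z' where p: "p = (x, y, z)" "p' = (x', y', z')"
      "a * x + b * y + c * z = 0" "a * x' + b * y' + c * z' = 0" by (auto simp: tri_def)
    then have xy: "a * x = a * x'" "b * y = b * y'" using eq by simp_all
    then have "c * z = c * z'" using p by linarith
    then show "p = p'" using xy assms p by simp
  qed
  show "(\<lambda>(x, y, z). (a * x, b * y)) ` tri a b c X Y Z = sols ((*) a ` X) ((*) b ` Y) ((*) c ` Z)"
  proof (intro equalityI subsetI)
    fix p assume "p \<in> (\<lambda>(x, y, z). (a * x, b * y)) ` tri a b c X Y Z"
    then obtain x y z where p: "p = (a * x, b * y)" "x \<in> X" "y \<in> Y" "z \<in> Z" "a * x + b * y + c * z = 0"
      by (auto simp: tri_def)
    then have "- (a * x) - b * y = c * z" by simp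
    with p show "p \<in> sols ((*) a ` X) ((*) b ` Y) ((*) c ` Z)" by (auto simp: sols_def)
  next
    fix p assume "p \<in> sols ((*) a ` X) ((*) b ` Y) ((*) c ` Z)"
    then obtain x y z where p: "p = (a * x, b * y)" "x \<in> X" "y \<in> Y" "z \<in> Z" "- (a * x) - b * y = c * z"
      by (auto simp: sols_def)
    then have "(x, y, z) \<in> tri a b c X Y Z" by (simp add: tri_def)
    with p show "p \<in> (\<lambda>(x, y, z). (a * x, b * y)) ` tri a b c X Y Z"
      by (intro image_eqI[of _ _ "(x, y, z)"]) auto
  qed
qed

lemma card_scaled [simp]: "a \<noteq> (0::int) \<Longrightarrow> card ((*) a ` X) = card X"
  by (rule card_image) (auto simp: inj_on_def)

lemma card_tri_le:
  assumes "a \<noteq> 0" "b \<noteq> 0" "c \<noteq> 0" "finite X" "finite Y" "finite Z"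
  shows "card (tri a b c X Y Z) \<le> card X * card Y" "card (tri a b c X Y Z) \<le> card Y * card Z"
    "card (tri a b c X Y Z) \<le> card X * card Z"
proof -
  let ?A = "(*) a ` X" and ?B = "(*) b ` Y" and ?C = "(*) c ` Z"
  have eq: "card (tri a b c X Y Z) = card (sols ?A ?B ?C)" by (rule card_tri_eq_sols) (use assms in auto)
  show "card (tri a b c X Y Z) \<le> card X * card Y"
    unfolding eq using card_sols_le[of ?A ?B ?C] assms by simp
  show "card (tri a b c X Y Z) \<le> card Y * card Z"
    unfolding eq using card_sols_le[of ?B ?C ?A] card_sols_rotate[of ?A ?B ?C] assms by simp
  show "card (tri a b c X Y Z) \<le> card X * card Z"
    unfolding eq using card_sols_le[of ?C ?A ?B] card_sols_rotate[of ?C ?A ?B] assms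
    by (simp add: mult.commute[of "card X" "card Z"])
qed

definition skew :: "int \<Rightarrow> int \<Rightarrow> int \<Rightarrow> int set \<Rightarrow> int \<Rightarrow> real \<Rightarrow> (int \<times> int \<times> int) set" where
  "skew a b c S W K = {(x, y, z). (x, y, z) \<in> tri a b c S S S \<and> K * cnt S W y < cnt S W x}"

lemma finite_skew [simp]: "finite S \<Longrightarrow> finite (skew a b c S W K)"
  by (rule finite_subset[of _ "tri a b c S S S"]) (auto simp: skew_def)

lemma card_skew_le:
  assumes S: "finite S" and W: "0 < W" and nz: "a \<noteq> 0" "b \<noteq> 0" "c \<noteq> 0" and K: "0 < K"
  shows "real (card (skew a b c S W K)) \<le> \<bar>b\<bar> / K * (real (card S))\<^sup>2"
proof -
  let ?P = "\<lambda>z. {(x, y) \<in> S \<times> S. a * x + b * y = - (c * z) \<and> K * cnt S W y < cnt S W x}"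
  have fP: "finite (?P z)" for z by (rule finite_subset[of _ "S \<times> S"]) (use S in auto)
  have "skew a b c S W K = (\<lambda>(z, x, y). (x, y, z)) ` (SIGMA z:S. ?P z)"
    by (auto simp: skew_def tri_def image_iff)
  then have "card (skew a b c S W K) \<le> card (SIGMA z:S. ?P z)"
    using S fP by (simp only: card_image_le finite_SigmaI)
  also have "\<dots> = (\<Sum>z\<in>S. card (?P z))" using S fP by (intro card_SigmaI) auto
  finally have "real (card (skew a b c S W K)) \<le> (\<Sum>z\<in>S. real (card (?P z)))" by (simp flip: of_nat_sum)
  also have "\<dots> \<le> (\<Sum>z\<in>S. \<bar>b\<bar> / K * card S)"
    by (intro sum_mono card_skewed_le S W nz K)
  also have "\<dots> = \<bar>b\<bar> / K * (real (card S))\<^sup>2" by (simp add: power2_eq_square)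
  finally show ?thesis by simp
qed

text \<open>A solution that avoids \<open>M\<close> and lies neither within \<open>L\<close> nor
  within \<open>H\<close> has one entry in each of them, so two of its class sizes have ratio above
  \<open>K\<close>. The six ordered choices of these two entries give the six permuted copies of
  \<open>skew\<close>.\<close>

lemma card_tri_split_le:
  fixes a b c D :: int and K \<theta> :: real
  assumes S: "finite S" and W: "0 < W" and nz: "a \<noteq> 0" "b \<noteq> 0" "c \<noteq> 0" and K: "1 \<le> K"
    and D: "\<bar>a\<bar> \<le> D" "\<bar>b\<bar> \<le> D" "\<bar>c\<bar> \<le> D"
    and LMH: "L = {x \<in> S. cnt S W x \<le> \<theta>}" "M = {x \<in> S. \<theta> < cnt S W x \<and> cnt S W x \<le> K * \<theta>}"
      "H = {x \<in> S. K * \<theta> < cnt S W x}"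
  shows "real (card (tri a b c S S S)) \<le> card (tri a b c L L L) + card (tri a b c H H H)
      + 3 * real (card M) * real (card S) + 6 * real_of_int D / K * (real (card S))\<^sup>2"
proof -
  let ?N = "real (card S)"
  let ?sk = "skew a b c S W K \<union> (\<lambda>(y, x, z). (x, y, z)) ` skew b a c S W K
     \<union> (\<lambda>(x, z, y). (x, y, z)) ` skew a c b S W K \<union> (\<lambda>(z, x, y). (x, y, z)) ` skew c a b S W K
     \<union> (\<lambda>(y, z, x). (x, y, z)) ` skew b c a S W K \<union> (\<lambda>(z, y, x). (x, y, z)) ` skew c b a S W K"
  have fin: "finite L" "finite M" "finite H" using S LMH by auto
  have lh: "K * cnt S W u < cnt S W v" if "u \<in> L" "v \<in> H" for u v
  proof -
    have "K * cnt S W u \<le> K * \<theta>" using that LMH K by (intro mult_left_mono) auto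
    then show ?thesis using that LMH by auto
  qed
  have SU: "S \<subseteq> L \<union> M \<union> H" using LMH by auto
  have sub: "tri a b c S S S \<subseteq> tri a b c L L L \<union> tri a b c H H H \<union>
     (tri a b c M S S \<union> tri a b c S M S \<union> tri a b c S S M) \<union> ?sk"
  proof
    fix p assume "p \<in> tri a b c S S S"
    then obtain x y z where p: "p = (x, y, z)" "(x, y, z) \<in> tri a b c S S S" "x \<in> S" "y \<in> S" "z \<in> S"
      "a * x + b * y + c * z = 0" by (auto simp: tri_def)
    have perm: "(y, x, z) \<in> tri b a c S S S" "(x, z, y) \<in> tri a c b S S S" "(z, x, y) \<in> tri c a b S S S"
      "(y, z, x) \<in> tri b c a S S S" "(z, y, x) \<in> tri c b a S S S"
      using p by (auto simp: tri_def algebra_simps)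
    consider "x \<in> M \<or> y \<in> M \<or> z \<in> M" | "x \<in> L" "y \<in> L" "z \<in> L" | "x \<in> H" "y \<in> H" "z \<in> H"
      | "x \<in> L" "y \<in> H" | "x \<in> L" "z \<in> H" | "y \<in> L" "x \<in> H" | "y \<in> L" "z \<in> H" | "z \<in> L" "x \<in> H" | "z \<in> L" "y \<in> H"
      using SU p(3-5) by blast
    then show "p \<in> tri a b c L L L \<union> tri a b c H H H \<union>
       (tri a b c M S S \<union> tri a b c S M S \<union> tri a b c S S M) \<union> ?sk"
    proof cases
      case 1 then show ?thesis using p by (auto simp: tri_def)
    next
      case 2 then show ?thesis using p by (auto simp: tri_def)
    next
      case 3 then show ?thesis using p by (auto simp: tri_def)
    next
      case 4
      then have "(y, x, z) \<in> skew b a c S W K" using perm lh by (simp add: skew_def)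
      then have "(x, y, z) \<in> (\<lambda>(y, x, z). (x, y, z)) ` skew b a c S W K"
        by (intro image_eqI[of _ _ "(y, x, z)"]) simp_all
      then show ?thesis unfolding p(1) by blast
    next
      case 5
      then have "(z, x, y) \<in> skew c a b S W K" using perm lh by (simp add: skew_def)
      then have "(x, y, z) \<in> (\<lambda>(z, x, y). (x, y, z)) ` skew c a b S W K"
        by (intro image_eqI[of _ _ "(z, x, y)"]) simp_all
      then show ?thesis unfolding p(1) by blast
    next
      case 6
      then have "(x, y, z) \<in> skew a b c S W K" using p lh by (simp add: skew_def)
      then show ?thesis using p(1) by blast
    next
      case 7
      then have "(z, y, x) \<in> skew c b a S W K" using perm lh by (simp add: skew_def)
      then have "(x, y, z) \<in> (\<lambda>(z, y, x). (x, y, z)) ` skew c b a S W K"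
        by (intro image_eqI[of _ _ "(z, y, x)"]) simp_all
      then show ?thesis unfolding p(1) by blast
    next
      case 8
      then have "(x, z, y) \<in> skew a c b S W K" using perm lh by (simp add: skew_def)
      then have "(x, y, z) \<in> (\<lambda>(x, z, y). (x, y, z)) ` skew a c b S W K"
        by (intro image_eqI[of _ _ "(x, z, y)"]) simp_all
      then show ?thesis unfolding p(1) by blast
    next
      case 9
      then have "(y, z, x) \<in> skew b c a S W K" using perm lh by (simp add: skew_def)
      then have "(x, y, z) \<in> (\<lambda>(y, z, x). (x, y, z)) ` skew b c a S W K"
        by (intro image_eqI[of _ _ "(y, z, x)"]) simp_all
      then show ?thesis unfolding p(1) by blast
    qed
  qed
  have img: "real (card (f ` skew a' b' c' S W K)) \<le> D / K * ?N\<^sup>2"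
    if "a' \<noteq> 0" "b' \<noteq> 0" "c' \<noteq> 0" "\<bar>b'\<bar> \<le> D" for f :: "int \<times> int \<times> int \<Rightarrow> int \<times> int \<times> int" and a' b' c'
  proof -
    have "real (card (f ` skew a' b' c' S W K)) \<le> real (card (skew a' b' c' S W K))"
      using S by (simp add: card_image_le)
    also have "\<dots> \<le> \<bar>b'\<bar> / K * ?N\<^sup>2" using card_skew_le[OF S W that(1-3), of K] K by simp
    also have "\<dots> \<le> D / K * ?N\<^sup>2" using that K by (intro mult_right_mono divide_right_mono) auto
    finally show ?thesis .
  qed
  let ?s1 = "skew a b c S W K" and ?s2 = "(\<lambda>(y, x, z). (x, y, z)) ` skew b a c S W K"
    and ?s3 = "(\<lambda>(x, z, y). (x, y, z)) ` skew a c b S W K" and ?s4 = "(\<lambda>(z, x, y). (x, y, z)) ` skew c a b S W K"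
    and ?s5 = "(\<lambda>(y, z, x). (x, y, z)) ` skew b c a S W K" and ?s6 = "(\<lambda>(z, y, x). (x, y, z)) ` skew c b a S W K"
  have "card ?sk \<le> card ?s1 + card ?s2 + card ?s3 + card ?s4 + card ?s5 + card ?s6"
    using card_Un_le[of "?s1 \<union> ?s2 \<union> ?s3 \<union> ?s4 \<union> ?s5" ?s6] card_Un_le[of "?s1 \<union> ?s2 \<union> ?s3 \<union> ?s4" ?s5]
      card_Un_le[of "?s1 \<union> ?s2 \<union> ?s3" ?s4] card_Un_le[of "?s1 \<union> ?s2" ?s3] card_Un_le[of ?s1 ?s2]
    by linarith
  then have "real (card ?sk) \<le> real (card ?s1) + real (card ?s2) + real (card ?s3) + real (card ?s4) + real (card ?s5) + real (card ?s6)"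
    by linarith
  also have "\<dots> \<le> D / K * ?N\<^sup>2 + D / K * ?N\<^sup>2 + D / K * ?N\<^sup>2 + D / K * ?N\<^sup>2 + D / K * ?N\<^sup>2 + D / K * ?N\<^sup>2"
    using img[OF nz D(2), of id] by (intro add_mono img nz D) simp
  finally have "real (card ?sk) \<le> D / K * ?N\<^sup>2 + D / K * ?N\<^sup>2 + D / K * ?N\<^sup>2 + D / K * ?N\<^sup>2 + D / K * ?N\<^sup>2 + D / K * ?N\<^sup>2" .
  then have sk: "real (card ?sk) \<le> 6 * real_of_int D / K * ?N\<^sup>2" by (simp add: field_simps)
  have "card (tri a b c M S S) \<le> card M * card S" "card (tri a b c S M S) \<le> card M * card S"
    "card (tri a b c S S M) \<le> card M * card S"
    using card_tri_le(1)[OF nz fin(2) S S] card_tri_le(2)[OF nz S fin(2) S] card_tri_le(2)[OF nz S S fin(2)]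
    by (simp_all add: mult.commute)
  then have mid: "card (tri a b c M S S \<union> tri a b c S M S \<union> tri a b c S S M) \<le> 3 * (card M * card S)"
    using card_Un_le[of "tri a b c M S S \<union> tri a b c S M S" "tri a b c S S M"]
      card_Un_le[of "tri a b c M S S" "tri a b c S M S"] by linarith
  have "card (tri a b c S S S) \<le> card (tri a b c L L L \<union> tri a b c H H H \<union>
     (tri a b c M S S \<union> tri a b c S M S \<union> tri a b c S S M) \<union> ?sk)"
    using fin S by (intro card_mono[OF _ sub]) auto
  also have "\<dots> \<le> card (tri a b c L L L) + card (tri a b c H H H) +
     card (tri a b c M S S \<union> tri a b c S M S \<union> tri a b c S S M) + card ?sk"
    by (intro order_trans[OF card_Un_le] add_mono card_Un_le order_refl)
  finally have "card (tri a b c S S S) \<le> card (tri a b c L L L) + card (tri a b c H H H) + 3 * (card M * card S) + card ?sk"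
    using mid by linarith
  then have "real (card (tri a b c S S S)) \<le> real (card (tri a b c L L L) + card (tri a b c H H H) + 3 * (card M * card S) + card ?sk)"
    by (simp only: of_nat_le_iff)
  then show ?thesis using sk by simp
qed

text \<open>Comparison with the empty subset shows that the count is at least
  \<open>\<kappa>\<close> times the square of \<open>card S\<close>. The last condition says that
  this is almost sharp.\<close>

definition extremal :: "int \<Rightarrow> int \<Rightarrow> int \<Rightarrow> real \<Rightarrow> real \<Rightarrow> int set \<Rightarrow> bool" where
  "extremal a b c \<kappa> \<delta> S \<longleftrightarrow> finite S \<and>
     (\<forall>S'\<subseteq>S. card (tri a b c S' S' S') - \<kappa> * (real (card S'))\<^sup>2 \<le> card (tri a b c S S S) - \<kappa> * (real (card S))\<^sup>2) \<and>
     card (tri a b c S S S) \<le> (\<kappa> + \<delta>) * (real (card S))\<^sup>2"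

text \<open>
  In an almost extremal set, two substantial parts whose residue classes have very different
  sizes would hardly interact, while the extremal count is superadditive.
\<close>

lemma extremal_not_split:
  fixes a b c D :: int and K \<theta> \<kappa> \<delta> e s :: real
  assumes ext: "extremal a b c \<kappa> \<delta> S" and W: "0 < W" and nz: "a \<noteq> 0" "b \<noteq> 0" "c \<noteq> 0" and K: "1 \<le> K"
    and D: "\<bar>a\<bar> \<le> D" "\<bar>b\<bar> \<le> D" "\<bar>c\<bar> \<le> D" and \<kappa>: "0 < \<kappa>" and e: "0 \<le> e" and ne: "S \<noteq> {}"
    and small: "\<delta> + 3 * s + 6 * real_of_int D / K < 2 * \<kappa> * e\<^sup>2"
    and mid: "real (card {x \<in> S. \<theta> < cnt S W x \<and> cnt S W x \<le> K * \<theta>}) \<le> s * card S"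
  shows "real (card {x \<in> S. cnt S W x \<le> \<theta>}) < e * card S \<or> real (card {x \<in> S. K * \<theta> < cnt S W x}) < e * card S"
proof (rule ccontr)
  assume neg: "\<not> ?thesis"
  define L M H where LMH: "L = {x \<in> S. cnt S W x \<le> \<theta>}" "M = {x \<in> S. \<theta> < cnt S W x \<and> cnt S W x \<le> K * \<theta>}"
      "H = {x \<in> S. K * \<theta> < cnt S W x}"
  let ?N = "real (card S)" and ?T = "\<lambda>X. real (card (tri a b c X X X))"
  have S: "finite S" using ext by (simp add: extremal_def)
  have N: "0 < ?N" using S ne by (simp add: card_gt_0_iff)
  have sub: "L \<subseteq> S" "H \<subseteq> S" using LMH by auto
  have big: "e * ?N \<le> card L" "e * ?N \<le> card H" using neg LMH by auto
  have "K * \<theta> \<ge> \<theta> \<or> L = {}"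
  proof (cases "0 \<le> \<theta>")
    case True
    then show ?thesis using K mult_right_mono[of 1 K \<theta>] by simp
  next
    case False
    then have "cnt S W x > \<theta>" for x using cnt_nonneg[of S W x] by linarith
    then show ?thesis using LMH by (auto simp: not_le)
  qed
  then have disj: "L \<inter> H = {}" using LMH by auto
  have "?T S \<le> ?T L + ?T H + 3 * real (card M) * ?N + 6 * real_of_int D / K * ?N\<^sup>2"
    using card_tri_split_le[OF S W nz K D LMH] by simp
  also have "3 * real (card M) * ?N \<le> 3 * s * ?N\<^sup>2"
    using mid N LMH(2) mult_right_mono[of "real (card M)" "s * ?N" "3 * ?N"] by (simp add: power2_eq_square mult_ac)
  finally have 1: "?T S \<le> ?T L + ?T H + 3 * s * ?N\<^sup>2 + 6 * real_of_int D / K * ?N\<^sup>2" by simp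
  have 2: "?T L - \<kappa> * (real (card L))\<^sup>2 \<le> ?T S - \<kappa> * ?N\<^sup>2" "?T H - \<kappa> * (real (card H))\<^sup>2 \<le> ?T S - \<kappa> * ?N\<^sup>2"
    "?T S \<le> (\<kappa> + \<delta>) * ?N\<^sup>2"
    using ext sub by (auto simp: extremal_def)
  have "card L + card H \<le> card S"
    using S sub disj card_mono[of S "L \<union> H"] finite_subset by (subst card_Un_disjoint[symmetric]) auto
  then have "real (card L) + real (card H) \<le> ?N" by (simp flip: of_nat_add)
  then have "(real (card L) + real (card H))\<^sup>2 \<le> ?N\<^sup>2" by (intro power_mono) auto
  then have "\<kappa> * (real (card L) + real (card H))\<^sup>2 \<le> \<kappa> * ?N\<^sup>2" using \<kappa> by simp
  then have 3: "\<kappa> * (real (card L))\<^sup>2 + \<kappa> * (real (card H))\<^sup>2 + 2 * \<kappa> * (card L * card H) \<le> \<kappa> * ?N\<^sup>2"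
    by (simp add: power2_sum algebra_simps)
  have "(e * ?N) * (e * ?N) \<le> real (card L) * real (card H)"
    using big e N by (intro mult_mono) auto
  then have 4: "2 * \<kappa> * e\<^sup>2 * ?N\<^sup>2 \<le> 2 * \<kappa> * (card L * card H)"
    using \<kappa> mult_left_mono[of "(e * ?N) * (e * ?N)" "real (card L) * real (card H)" "2 * \<kappa>"]
    by (simp add: power2_eq_square mult_ac)
  \<comment> \<open>Bounding the counts of \<open>L\<close> and \<open>H\<close> by maximality uses
    the surplus of \<open>S\<close> over its \<open>\<kappa>\<close>-term twice, but only one
    surplus is left after cancelling the count of \<open>S\<close>, and it is at most
    \<open>\<delta>\<close> times the square of \<open>?N\<close>. What remains on the other side
    contains the cross term \<open>2 * \<kappa> * card L * card H\<close>.\<close>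
  have "2 * \<kappa> * e\<^sup>2 * ?N\<^sup>2 \<le> (\<delta> + 3 * s + 6 * real_of_int D / K) * ?N\<^sup>2"
    using 1 2 3 4 by (simp add: algebra_simps)
  then show False using small N by (simp add: mult_le_cancel_right)
qed

text \<open>A wide spread of class sizes would contain \<open>J\<close> disjoint windows of ratio
  \<open>K\<close>, one of them holding at most a share \<open>1 / J\<close> of \<open>S\<close>,
  and there \<open>extremal_not_split\<close> applies. The factor \<open>K ^ J\<close> is the same
  for every modulus \<open>W\<close>, which is what permits comparing different moduli.\<close>

lemma extremal_homogeneous:
  fixes a b c D :: int and K \<kappa> \<delta> e :: real and J :: nat
  assumes ext: "extremal a b c \<kappa> \<delta> S" and W: "0 < W" and nz: "a \<noteq> 0" "b \<noteq> 0" "c \<noteq> 0" and K: "1 < K"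
    and D: "\<bar>a\<bar> \<le> D" "\<bar>b\<bar> \<le> D" "\<bar>c\<bar> \<le> D" and \<kappa>: "0 < \<kappa>" and e: "0 < e" "e < 1" and ne: "S \<noteq> {}" and J: "0 < J"
    and small: "\<delta> + 3 * (1 / J) + 6 * real_of_int D / K < 2 * \<kappa> * e\<^sup>2"
  shows "\<exists>\<mu>>0. real (card {x \<in> S. \<not> (\<mu> \<le> cnt S W x \<and> cnt S W x \<le> K ^ J * \<mu>)}) \<le> 2 * e * card S"
proof -
  let ?N = "real (card S)"
  have S: "finite S" using ext by (simp add: extremal_def)
  have N: "0 < ?N" using S ne by (simp add: card_gt_0_iff)
  define V where "V = {v \<in> cnt S W ` S. real (card {x \<in> S. cnt S W x < v}) \<le> e * ?N}"
  have fV: "finite V" using S by (simp add: V_def)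
  have "Min (cnt S W ` S) \<in> V"
  proof -
    have "{x \<in> S. cnt S W x < Min (cnt S W ` S)} = {}" using S by (auto simp: not_less)
    then have "real (card {x \<in> S. cnt S W x < Min (cnt S W ` S)}) \<le> e * ?N"
      using e by (simp only: card.empty) simp
    moreover have "Min (cnt S W ` S) \<in> cnt S W ` S" using S ne by (intro Min_in) auto
    ultimately show ?thesis unfolding V_def by blast
  qed
  then have V: "V \<noteq> {}" by blast
  \<comment> \<open>The largest class size with at most a share \<open>e\<close> of the elements in
    strictly smaller classes. By maximality the classes of size at most \<open>\<mu>\<close> already
    hold more than that share.\<close>
  define \<mu> where "\<mu> = Max V"
  have \<mu>V: "\<mu> \<in> V" using fV V by (simp add: \<mu>_def)
  then obtain x0 where "x0 \<in> S" "\<mu> = cnt S W x0" by (auto simp: V_def)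
  then have \<mu>0: "0 < \<mu>" using cnt_pos[OF S] by simp
  have low: "e * ?N < card {x \<in> S. cnt S W x \<le> \<mu>}"
  proof (cases "\<exists>v\<in>cnt S W ` S. \<mu> < v")
    case True
    define v where "v = Min {v \<in> cnt S W ` S. \<mu> < v}"
    have v: "v \<in> cnt S W ` S" "\<mu> < v" "\<And>x. x \<in> S \<Longrightarrow> \<mu> < cnt S W x \<Longrightarrow> v \<le> cnt S W x"
    proof -
      have f: "finite {v \<in> cnt S W ` S. \<mu> < v}" using S by simp
      have "v \<in> {v \<in> cnt S W ` S. \<mu> < v}" unfolding v_def by (rule Min_in[OF f]) (use True in auto)
      then show "v \<in> cnt S W ` S" "\<mu> < v" by auto
      show "v \<le> cnt S W x" if "x \<in> S" "\<mu> < cnt S W x" for x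
        unfolding v_def by (rule Min_le[OF f]) (use that in auto)
    qed
    have "v \<notin> V" using v(2) Max_ge[OF fV, of v] by (auto simp: \<mu>_def)
    then have "e * ?N < card {x \<in> S. cnt S W x < v}" using v(1) by (simp add: V_def)
    also have "{x \<in> S. cnt S W x < v} = {x \<in> S. cnt S W x \<le> \<mu>}" using v by force
    finally show ?thesis .
  next
    case False
    then have "{x \<in> S. cnt S W x \<le> \<mu>} = S" by force
    then show ?thesis using e N by simp
  qed
  have high: "real (card {x \<in> S. K ^ J * \<mu> < cnt S W x}) \<le> e * ?N"
  proof (rule ccontr)
    assume h: "\<not> ?thesis"
    \<comment> \<open>Every window separates the elements in classes of size at most
      \<open>\<mu>\<close> from those in classes above \<open>K ^ J * \<mu>\<close>. Both groups
      exceed the share \<open>e\<close>, so no window can be sparse.\<close>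
    let ?M = "\<lambda>j. {x \<in> S. K ^ j * \<mu> < cnt S W x \<and> cnt S W x \<le> K * (K ^ j * \<mu>)}"
    have Kpow: "K ^ i * \<mu> \<le> K ^ j * \<mu>" if "i \<le> j" for i j
      using K \<mu>0 that by (intro mult_right_mono power_increasing) auto
    have big: "1 / J * ?N < card (?M j)" if j: "j < J" for j
    proof (rule ccontr)
      assume "\<not> 1 / J * ?N < card (?M j)"
      then have "real (card {x \<in> S. cnt S W x \<le> K ^ j * \<mu>}) < e * ?N \<or> real (card {x \<in> S. K * (K ^ j * \<mu>) < cnt S W x}) < e * ?N"
        by (intro extremal_not_split[OF ext W nz _ D \<kappa> _ ne small]) (use K e in auto)
      moreover have "card {x \<in> S. cnt S W x \<le> \<mu>} \<le> card {x \<in> S. cnt S W x \<le> K ^ j * \<mu>}"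
        using S Kpow[of 0 j] by (intro card_mono) auto
      moreover have "card {x \<in> S. K ^ J * \<mu> < cnt S W x} \<le> card {x \<in> S. K * (K ^ j * \<mu>) < cnt S W x}"
        using S Kpow[of "Suc j" J] j by (intro card_mono) auto
      ultimately show False using low h by linarith
    qed
    have "?N < (\<Sum>j<J. real (card (?M j)))"
      using sum_strict_mono[of "{..<J}" "\<lambda>_. 1 / J * ?N" "\<lambda>j. real (card (?M j))"] big J by force
    also have "\<dots> = real (card (\<Union>j<J. ?M j))"
    proof -
      have dis: "?M i \<inter> ?M j = {}" if "i < j" for i j
      proof -
        have "K * (K ^ i * \<mu>) \<le> K ^ j * \<mu>" using Kpow[of "Suc i" j] that by (simp add: mult.assoc)
        then show ?thesis by auto
      qed
      have "\<forall>i\<in>{..<J}. \<forall>j\<in>{..<J}. i \<noteq> j \<longrightarrow> ?M i \<inter> ?M j = {}"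
      proof (intro ballI impI)
        fix i j :: nat assume "i \<noteq> j"
        then consider "i < j" | "j < i" by linarith
        then show "?M i \<inter> ?M j = {}" by cases (use dis in blast)+
      qed
      then have "card (\<Union>j<J. ?M j) = (\<Sum>j<J. card (?M j))" using S by (intro card_UN_disjoint) auto
      then show ?thesis by simp
    qed
    also have "\<dots> \<le> ?N" using S by (intro of_nat_mono card_mono) auto
    finally show False by simp
  qed
  have "{x \<in> S. \<not> (\<mu> \<le> cnt S W x \<and> cnt S W x \<le> K ^ J * \<mu>)} = {x \<in> S. cnt S W x < \<mu>} \<union> {x \<in> S. K ^ J * \<mu> < cnt S W x}"
    by auto
  then have "card {x \<in> S. \<not> (\<mu> \<le> cnt S W x \<and> cnt S W x \<le> K ^ J * \<mu>)} \<le> card {x \<in> S. cnt S W x < \<mu>} + card {x \<in> S. K ^ J * \<mu> < cnt S W x}"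
    by (simp add: card_Un_le)
  then have "real (card {x \<in> S. \<not> (\<mu> \<le> cnt S W x \<and> cnt S W x \<le> K ^ J * \<mu>)}) \<le> e * ?N + e * ?N"
    using \<mu>V high unfolding V_def by simp
  then show ?thesis using \<mu>0 by (intro exI[of _ \<mu>]) auto
qed

section \<open>Cores in which every element lies in many solutions\<close>

lemma card_sols_remove:
  assumes fin: "finite A" "finite B" and u: "u \<in> A"
  shows "card (sols A B C) = card (sols (A - {u}) B C) + card {v \<in> B. - u - v \<in> C}"
proof -
  have "sols A B C = sols (A - {u}) B C \<union> (\<lambda>v. (u, v)) ` {v \<in> B. - u - v \<in> C}"
    using u by (auto simp: sols_def)
  moreover have "sols (A - {u}) B C \<inter> (\<lambda>v. (u, v)) ` {v \<in> B. - u - v \<in> C} = {}" by (auto simp: sols_def)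
  moreover have "card ((\<lambda>v. (u, v)) ` {v \<in> B. - u - v \<in> C}) = card {v \<in> B. - u - v \<in> C}"
    by (rule card_image) (auto simp: inj_on_def)
  ultimately show ?thesis using fin by (simp add: card_Un_disjoint)
qed

lemma rich_of_maximal:
  assumes fin: "finite A" "finite B" and
    max: "\<And>u. u \<in> A \<Longrightarrow> real (card (sols (A - {u}) B C)) - r * (real (card (A - {u})) + s) \<le> real (card (sols A B C)) - r * (real (card A) + s)"
  shows "rich A B C r"
  unfolding rich_def
proof
  fix u assume u: "u \<in> A"
  have "card A = Suc (card (A - {u}))" using u fin by (metis card_Suc_Diff1)
  then have "real (card A) = real (card (A - {u})) + 1" by simp
  then show "r \<le> real (card {v \<in> B. - u - v \<in> C})"
    using max[OF u] card_sols_remove[OF fin u, of C] by (simp add: algebra_simps)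
qed

text \<open>Among all triples of subsets, one maximising the number of solutions minus
  \<open>r\<close> times the total size is taken. Deleting an element cannot increase this value, so
  the element lies in at least \<open>r\<close> solutions; comparison with the full triple bounds
  the solutions lost.\<close>

lemma exists_rich_core:
  assumes fin: "finite A" "finite B" "finite C" and r: "0 \<le> r"
  shows "\<exists>A' B' C'. A' \<subseteq> A \<and> B' \<subseteq> B \<and> C' \<subseteq> C \<and> rich A' B' C' r \<and> rich B' C' A' r \<and> rich C' A' B' r \<and>
     real (card (sols A B C)) \<le> real (card (sols A' B' C')) + r * (real (card A) + real (card B) + real (card C))"
proof -
  define \<Phi> where "\<Phi> p = (case p of (X, Y, Z) \<Rightarrow> real (card (sols X Y Z)) - r * (real (card X) + real (card Y) + real (card Z)))" for p
  let ?P = "Pow A \<times> Pow B \<times> Pow C"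
  have "finite ?P" "?P \<noteq> {}" using fin by auto
  from finite_has_greatest_value[OF this, of \<Phi>] obtain A' B' C' where
    sub: "A' \<subseteq> A" "B' \<subseteq> B" "C' \<subseteq> C" and max: "\<And>X Y Z. X \<subseteq> A \<Longrightarrow> Y \<subseteq> B \<Longrightarrow> Z \<subseteq> C \<Longrightarrow> \<Phi> (X, Y, Z) \<le> \<Phi> (A', B', C')"
    by auto
  have fin': "finite A'" "finite B'" "finite C'" using sub fin finite_subset by blast+
  have "rich A' B' C' r"
  proof (rule rich_of_maximal[OF fin'(1,2), where s = "real (card B') + real (card C')"])
    fix u assume "u \<in> A'"
    have "\<Phi> (A' - {u}, B', C') \<le> \<Phi> (A', B', C')" by (rule max) (use sub in auto)
    then show "real (card (sols (A' - {u}) B' C')) - r * (real (card (A' - {u})) + (real (card B') + real (card C')))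
        \<le> real (card (sols A' B' C')) - r * (real (card A') + (real (card B') + real (card C')))"
      unfolding \<Phi>_def prod.case by (simp only: add.assoc)
  qed
  moreover have "rich B' C' A' r"
  proof (rule rich_of_maximal[OF fin'(2,3), where s = "real (card A') + real (card C')"])
    fix u assume "u \<in> B'"
    have "\<Phi> (A', B' - {u}, C') \<le> \<Phi> (A', B', C')" by (rule max) (use sub in auto)
    then show "real (card (sols (B' - {u}) C' A')) - r * (real (card (B' - {u})) + (real (card A') + real (card C')))
        \<le> real (card (sols B' C' A')) - r * (real (card B') + (real (card A') + real (card C')))"
      unfolding \<Phi>_def prod.case
      using card_sols_rotate[of A' B' C'] card_sols_rotate[of A' "B' - {u}" C'] by (simp add: algebra_simps)
  qed
  moreover have "rich C' A' B' r"
  proof (rule rich_of_maximal[OF fin'(3,1), where s = "real (card A') + real (card B')"])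
    fix u assume "u \<in> C'"
    have "\<Phi> (A', B', C' - {u}) \<le> \<Phi> (A', B', C')" by (rule max) (use sub in auto)
    then show "real (card (sols (C' - {u}) A' B')) - r * (real (card (C' - {u})) + (real (card A') + real (card B')))
        \<le> real (card (sols C' A' B')) - r * (real (card C') + (real (card A') + real (card B')))"
      unfolding \<Phi>_def prod.case
      using card_sols_rotate[of C' A' B'] card_sols_rotate[of "C' - {u}" A' B'] by (simp add: algebra_simps)
  qed
  moreover have "real (card (sols A B C)) \<le> real (card (sols A' B' C')) + r * (real (card A) + real (card B) + real (card C))"
  proof -
    have "\<Phi> (A, B, C) \<le> \<Phi> (A', B', C')" by (rule max) auto
    moreover have "0 \<le> r * (real (card A') + real (card B') + real (card C'))" using r by simp
    ultimately show ?thesis unfolding \<Phi>_def prod.case by linarith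
  qed
  ultimately show ?thesis using sub by blast
qed

section \<open>Class sizes in a dilated subset compared with those in \<open>S\<close>\<close>

lemma cnt_scaled:
  assumes "a \<noteq> 0"
  shows "cnt ((*) a ` X) (\<bar>a\<bar> * w) (a * x) = cnt X w x"
proof -
  have "[a * y = a * x] (mod \<bar>a\<bar> * w) \<longleftrightarrow> [y = x] (mod w)" for y
    using assms by (simp add: cong_iff_dvd_diff flip: right_diff_distrib) (metis abs_dvd_iff abs_mult dvd_mult_cancel_left dvd_abs_iff)
  then have "cls ((*) a ` X) (\<bar>a\<bar> * w) (a * x) = (*) a ` cls X w x" by (auto simp: cls_def)
  then show ?thesis using assms by (simp add: cnt_def)
qed

text \<open>The quotient \<open>cnt S w x / cnt X w x\<close>, summed over the members of
  \<open>X\<close> in one class, gives the size of that class in \<open>S\<close>. The total is at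
  most \<open>card S\<close>, and Markov's inequality applies.\<close>

lemma card_sparse_le:
  assumes S: "finite S" "X \<subseteq> S" and e: "0 \<le> e"
  shows "real (card {x \<in> X. cnt X w x < e * cnt S w x}) \<le> e * card S"
proof -
  have X: "finite X" using S finite_subset by blast
  have "real (card {x \<in> X. cnt X w x < e * cnt S w x}) = (\<Sum>x\<in>X. if cnt X w x < e * cnt S w x then 1 else 0)"
    using X by (simp add: sum.If_cases Int_def)
  also have "\<dots> \<le> (\<Sum>x\<in>X. e * (cnt S w x / cnt X w x))"
  proof (rule sum_mono)
    fix x assume "x \<in> X"
    then have "0 < cnt X w x" by (rule cnt_pos[OF X])
    then show "(if cnt X w x < e * cnt S w x then 1 else 0) \<le> e * (cnt S w x / cnt X w x)"
      using e by (auto simp: field_simps)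
  qed
  also have "\<dots> = e * (\<Sum>x\<in>X. \<Sum>y\<in>S. if [y = x] (mod w) then 1 / cnt X w y else 0)"
  proof -
    have "cnt S w x / cnt X w x = (\<Sum>y\<in>S. if [y = x] (mod w) then 1 / cnt X w y else 0)" for x
      unfolding cnt_eq_sum[OF S(1)] sum_divide_distrib
    proof (rule sum.cong[OF refl])
      fix y
      show "(if [y = x] (mod w) then 1 else 0) / cnt X w x = (if [y = x] (mod w) then 1 / cnt X w y else 0)"
        by (cases "[y = x] (mod w)") (simp_all add: cnt_cong[of y x w X])
    qed
    then show ?thesis by (simp add: sum_distrib_left)
  qed
  also have "(\<Sum>x\<in>X. \<Sum>y\<in>S. if [y = x] (mod w) then 1 / cnt X w y else 0)
    = (\<Sum>y\<in>S. \<Sum>x\<in>X. if [y = x] (mod w) then 1 / cnt X w y else 0)" by (rule sum.swap)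
  also have "\<dots> \<le> (\<Sum>y\<in>S. 1)"
  proof (rule sum_mono)
    fix y
    have "(\<Sum>x\<in>X. if [y = x] (mod w) then 1 / cnt X w y else 0) = (\<Sum>x\<in>X. (if [x = y] (mod w) then 1 else 0) / cnt X w y)"
      by (rule sum.cong[OF refl]) (auto simp: cong_sym_eq)
    also have "\<dots> = cnt X w y / cnt X w y" unfolding sum_divide_distrib[symmetric] cnt_eq_sum[OF X, symmetric] ..
    also have "\<dots> \<le> 1" by simp
    finally show "(\<Sum>x\<in>X. if [y = x] (mod w) then 1 / cnt X w y else 0) \<le> 1" .
  qed
  finally show ?thesis using e by (simp add: mult_left_mono)
qed

text \<open>The expected share \<open>gcd d w / w\<close> is at least \<open>1 / a\<close>, and the
  hypothesis on \<open>e\<close> keeps the error below \<open>1 / (2 * m)\<close>, hence below half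
  of that share.\<close>

lemma typed_lower:
  fixes m :: int and e :: real
  assumes A: "finite A" and q: "0 < q" "0 < m" and w: "0 < w" "w dvd m"
    and ty: "typed A q m e d u" and u: "u \<in> A" and e: "2 * (real_of_int m)\<^sup>2 * e \<le> 1"
    and a: "0 < a" "w \<le> a * gcd d w" "a dvd m"
  shows "cnt A q u \<le> 2 * real_of_int a * cnt A (q * w) u"
proof -
  have c: "0 < cnt A q u" by (rule cnt_pos[OF A u])
  have "real_of_int w \<le> real_of_int (a * gcd d w)" using a by (simp only: of_int_le_iff)
  then have 1: "1 / a \<le> gcd d w / w" using w a by (simp add: field_simps)
  have am: "real_of_int a \<le> m" using a q by (simp add: zdvd_imp_le)
  have "m * (m * e) \<le> 1 / 2" using e by (simp add: power2_eq_square mult.assoc)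
  then have "m * e \<le> 1 / (2 * m)" using q by (simp add: field_simps)
  also have "\<dots> \<le> 1 / (2 * a)" using am a by (simp add: frac_le)
  finally have "1 / (2 * a) \<le> gcd d w / w - m * e" using 1 by (simp add: field_simps)
  then have "1 / (2 * a) * cnt A q u \<le> (gcd d w / w - m * e) * cnt A q u" using c by (intro mult_right_mono) auto
  also have "\<dots> \<le> cnt A (q * w) u"
    using typed_cnt[OF A q w ty u] by (simp add: abs_le_iff algebra_simps)
  finally show ?thesis using a by (simp add: field_simps)
qed

text \<open>Refinement by a \<open>w\<close> prime to \<open>d\<close> leaves a share of
  \<open>1 / w\<close>, at most doubled by the error, while the factor \<open>a\<close> alone leaves
  at least \<open>1 / (2 * a)\<close>. The factor \<open>a\<close> is present because dilation by
  \<open>a\<close> multiplies moduli by it.\<close>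

lemma typed_coprime_upper:
  fixes m :: int and e :: real
  assumes A: "finite A" and q: "0 < q" "0 < m" and w: "0 < w" "0 < a" "a * w dvd m"
    and ty: "typed A q m e d u" and u: "u \<in> A" and e: "2 * (real_of_int m)\<^sup>2 * e \<le> 1"
    and cop: "gcd d w = 1"
  shows "real_of_int w * cnt A (q * (a * w)) u \<le> 4 * real_of_int a * cnt A (q * a) u"
proof -
  have c: "0 < cnt A q u" by (rule cnt_pos[OF A u])
  have wm: "w dvd m" "a dvd m" using w by (auto intro: dvd_mult_left dvd_mult_right)
  have "cnt A q u \<le> 2 * real_of_int a * cnt A (q * a) u"
  proof (rule typed_lower[OF A q w(2) wm(2) ty u e w(2) _ wm(2)])
    have "0 < gcd d a" using w(2) by simp
    then have "1 \<le> gcd d a" by linarith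
    then show "a \<le> a * gcd d a" using w(2) mult_left_mono[of 1 "gcd d a" a] by simp
  qed
  moreover have "real_of_int w * cnt A (q * (a * w)) u \<le> 2 * cnt A q u"
  proof -
    have "cnt A (q * (a * w)) u \<le> cnt A (q * w) u" by (rule cnt_dvd_mono[OF A]) (simp add: dvd_def)
    also have "\<dots> \<le> (1 / w + m * e) * cnt A q u"
      using typed_cnt[OF A q w(1) wm(1) ty u] cop by (simp add: abs_le_iff algebra_simps)
    finally have "w * cnt A (q * (a * w)) u \<le> w * ((1 / w + m * e) * cnt A q u)" using w by simp
    also have "\<dots> = (1 + w * (m * e)) * cnt A q u" using w by (simp add: field_simps)
    also have "\<dots> \<le> 2 * cnt A q u"
    proof (rule mult_right_mono)
      have e0: "0 \<le> e"
      proof -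
        have "\<bar>ratio A q m u 0 - (if d dvd 0 then d / m else 0)\<bar> \<le> e" using ty unfolding typed_def by blast
        then show ?thesis by linarith
      qed
      have "real_of_int w \<le> m" using wm q by (simp add: zdvd_imp_le)
      then have "w * (m * e) \<le> m * (m * e)" using q e0 by (intro mult_right_mono) auto
      also have "\<dots> \<le> 1" using e by (simp add: power2_eq_square mult.assoc)
      finally show "1 + w * (m * e) \<le> 2" by simp
    qed (use c in simp)
    finally show ?thesis .
  qed
  ultimately show ?thesis by linarith
qed

text \<open>Every prime divides \<open>d\<close> fewer than \<open>l\<close> times, while a prime
  divisor of \<open>D\<close> divides \<open>D ^ l\<close> at least \<open>l\<close> times. This
  converts the absence of high prime powers into the divisibility needed for
  \<open>uniform\<close>.\<close>

lemma dvd_power_of_no_high_prime_power: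
  fixes d D :: int
  assumes D: "0 < D" and d: "0 < d" "d dvd D ^ Suc l" and no: "\<And>p. prime p \<Longrightarrow> p dvd D \<Longrightarrow> \<not> p ^ l dvd d"
  shows "d dvd D ^ l"
proof (rule multiplicity_le_imp_dvd)
  show "d \<noteq> 0" using d by simp
  fix p :: int assume p: "prime p"
  show "multiplicity p d \<le> multiplicity p (D ^ l)"
  proof (cases "p dvd D")
    case True
    have "\<not> l \<le> multiplicity p d" using no[OF p True] multiplicity_dvd' by blast
    moreover have "l \<le> multiplicity p (D ^ l)"
      using True D p by (intro multiplicity_geI) (auto intro: dvd_power_same)
    ultimately show ?thesis by linarith
  next
    case False
    then have "\<not> p dvd d" using d(2) p by (meson dvd_trans prime_dvd_power)
    then show ?thesis by (simp add: not_dvd_imp_multiplicity_0)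
  qed
qed

text \<open>One of the three roles, with \<open>a\<close> and \<open>X\<close> standing for a
  coefficient and its subset of \<open>S\<close>. As \<open>\<bar>a\<bar>\<close> divides
  \<open>D\<close>, the exponent \<open>Suc l\<close> leaves room to refine by
  \<open>\<bar>a\<bar> * p ^ l\<close> and \<open>\<bar>a\<bar> * D ^ l\<close>, moduli at which the
  classes of \<open>A\<close> are dilates of classes of \<open>X\<close>.\<close>

locale typed_role =
  fixes S X A :: "int set" and a D Q m :: int and e :: real and l :: nat
  assumes S: "finite S" and X: "X \<subseteq> S" and A: "A = (*) a ` X" and a: "a \<noteq> 0" "\<bar>a\<bar> dvd D" and D: "0 < D"
    and m: "m = D ^ Suc l" and Q: "0 < Q" and e: "2 * (real_of_int m)\<^sup>2 * e \<le> 1"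
begin

lemma finite_X: "finite X" using S X finite_subset by blast

lemma finite_A: "finite A" using A finite_X by simp

lemma m_pos: "0 < m" using D m by simp

lemma a_le: "real_of_int \<bar>a\<bar> \<le> D" using a D by (simp only: of_int_le_iff zdvd_imp_le)

lemma mult_dvd_m: "w dvd D ^ l \<Longrightarrow> \<bar>a\<bar> * w dvd m"
  unfolding m power_Suc using a by (intro mult_dvd_mono)

text \<open>If \<open>p\<close> does not divide \<open>d\<close>, the class of \<open>a * x\<close>
  spreads over all residues modulo \<open>p ^ l\<close>. The typical class size
  \<open>\<mu>'\<close> of \<open>S\<close> modulo \<open>Q * p ^ l\<close> is then smaller than
  \<open>\<mu>\<close> by a factor of order \<open>p ^ l\<close>.\<close>

lemma light:
  fixes \<tau> L \<mu> \<mu>' :: real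
  assumes p: "prime p" "p dvd D" and x: "x \<in> X" "typed A Q m e d (a * x)" "\<not> p dvd d"
    and \<tau>: "0 < \<tau>" and sparse: "\<tau> * cnt S (Q * p ^ l) x \<le> cnt X (Q * p ^ l) x"
    and hom: "cnt S Q x \<le> L * \<mu>" "\<mu>' \<le> cnt S (Q * p ^ l) x"
  shows "\<tau> * (real_of_int (p ^ l) * \<mu>') \<le> 4 * D * (L * \<mu>)"
proof -
  have p0: "0 < p ^ l" using p by (simp add: prime_gt_0_int)
  have eq: "cnt A (Q * (\<bar>a\<bar> * p ^ l)) (a * x) = cnt X (Q * p ^ l) x" "cnt A (Q * \<bar>a\<bar>) (a * x) = cnt X Q x"
    unfolding A using cnt_scaled[OF a(1), of X "Q * p ^ l" x] cnt_scaled[OF a(1), of X Q x] by (simp_all add: mult_ac)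
  have "coprime p d" using prime_imp_coprime p(1) x(3) by blast
  then have "coprime d (p ^ l)" by (simp add: coprime_commute)
  then have "real_of_int (p ^ l) * cnt A (Q * (\<bar>a\<bar> * p ^ l)) (a * x) \<le> 4 * real_of_int \<bar>a\<bar> * cnt A (Q * \<bar>a\<bar>) (a * x)"
    by (intro typed_coprime_upper[OF finite_A Q m_pos p0 _ _ x(2) _ e])
       (use a A x p in \<open>auto intro!: mult_dvd_m dvd_power_same\<close>)
  then have "real_of_int (p ^ l) * cnt X (Q * p ^ l) x \<le> 4 * real_of_int \<bar>a\<bar> * cnt X Q x" by (simp only: eq)
  also have "\<dots> \<le> 4 * D * cnt S Q x"
    using a_le cnt_mono[OF S X, of Q x] D by (intro mult_mono) auto
  also have "\<dots> \<le> 4 * D * (L * \<mu>)" using hom D by (intro mult_left_mono) auto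
  finally have 1: "real_of_int (p ^ l) * cnt X (Q * p ^ l) x \<le> 4 * D * (L * \<mu>)" .
  have "\<tau> * \<mu>' \<le> \<tau> * cnt S (Q * p ^ l) x" using hom \<tau> by (intro mult_left_mono) auto
  also have "\<dots> \<le> cnt X (Q * p ^ l) x" by (rule sparse)
  moreover have "0 \<le> real_of_int (p ^ l)" using p0 by (simp only: of_int_0_le_iff less_imp_le)
  ultimately have "real_of_int (p ^ l) * (\<tau> * \<mu>') \<le> real_of_int (p ^ l) * cnt X (Q * p ^ l) x"
    by (intro mult_left_mono) auto
  then show ?thesis using 1 by (simp add: mult_ac)
qed

text \<open>If \<open>p ^ l\<close> divides \<open>d\<close>, refining by \<open>p ^ l\<close>
  splits the class only by the bounded factor coming from \<open>\<bar>a\<bar>\<close>, so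
  \<open>\<mu>\<close> is not much larger than \<open>\<mu>'\<close>. For large \<open>l\<close>
  this is incompatible with the conclusion of \<open>light\<close>, even in another role.\<close>

lemma heavy:
  fixes \<tau> L \<mu> \<mu>' :: real
  assumes p: "prime p" "p dvd D" and x: "x \<in> X" "typed A Q m e d (a * x)" "p ^ l dvd d"
    and \<tau>: "0 < \<tau>" and sparse: "\<tau> * cnt S Q x \<le> cnt X Q x"
    and hom: "\<mu> \<le> cnt S Q x" "cnt S (Q * p ^ l) x \<le> L * \<mu>'"
  shows "\<tau> * \<mu> \<le> 2 * D * (L * \<mu>')"
proof -
  have p0: "0 < p ^ l" using p by (simp add: prime_gt_0_int)
  have eq: "cnt A (Q * (\<bar>a\<bar> * p ^ l)) (a * x) = cnt X (Q * p ^ l) x" "cnt A (Q * \<bar>a\<bar>) (a * x) = cnt X Q x"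
    unfolding A using cnt_scaled[OF a(1), of X "Q * p ^ l" x] cnt_scaled[OF a(1), of X Q x] by (simp_all add: mult_ac)
  have d0: "0 < d" using x(2) by (simp add: typed_def)
  have "p ^ l dvd gcd d (\<bar>a\<bar> * p ^ l)" using x(3) by simp
  then have g: "p ^ l \<le> gcd d (\<bar>a\<bar> * p ^ l)" using d0 by (intro zdvd_imp_le) auto
  have dvd: "\<bar>a\<bar> * p ^ l dvd m" using p by (auto intro!: mult_dvd_m dvd_power_same)
  have "\<tau> * \<mu> \<le> \<tau> * cnt S Q x" using hom \<tau> by (intro mult_left_mono) auto
  also have "\<dots> \<le> cnt A (Q * \<bar>a\<bar>) (a * x)" using sparse eq by simp
  also have "\<dots> \<le> cnt A Q (a * x)" by (rule cnt_dvd_mono[OF finite_A]) simp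
  also have "\<dots> \<le> 2 * real_of_int \<bar>a\<bar> * cnt A (Q * (\<bar>a\<bar> * p ^ l)) (a * x)"
    by (rule typed_lower[OF finite_A Q m_pos _ dvd x(2) _ e])
       (use a A x p0 g dvd in \<open>auto intro: dvd_mult_left mult_left_mono\<close>)
  also have "\<dots> = 2 * real_of_int \<bar>a\<bar> * cnt X (Q * p ^ l) x" by (simp only: eq)
  also have "\<dots> \<le> 2 * D * cnt S (Q * p ^ l) x"
    using a_le cnt_mono[OF S X, of "Q * p ^ l" x] D by (intro mult_mono) auto
  also have "\<dots> \<le> 2 * D * (L * \<mu>')" using hom D by (intro mult_left_mono) auto
  finally show ?thesis .
qed

text \<open>Since \<open>d\<close> divides both refinements \<open>D ^ Suc l\<close> and
  \<open>\<bar>a\<bar> * D ^ l\<close>, the expected shares are \<open>d / m\<close> and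
  \<open>d / (\<bar>a\<bar> * D ^ l)\<close>, whose ratio is \<open>\<bar>a\<bar> / D\<close>. The
  errors in both counts are absorbed by the factor \<open>1 + \<xi>\<close>.\<close>

lemma uniform:
  fixes \<xi> :: real
  assumes x: "x \<in> X" "typed A Q m e d (a * x)" "d dvd D ^ l" and \<xi>: "0 < \<xi>" "\<xi> \<le> 1" "3 * (real_of_int m)\<^sup>2 * e \<le> \<xi>"
  shows "cnt A (Q * D ^ l * D) (a * x) \<le> (1 + \<xi>) * (real_of_int \<bar>a\<bar> / D) * cnt X (Q * D ^ l) x"
proof -
  have u: "a * x \<in> A" unfolding A using x(1) by blast
  let ?c = "cnt A Q (a * x)"
  have c: "0 < ?c" by (rule cnt_pos[OF finite_A u])
  have d0: "0 < d" using x(2) by (simp add: typed_def)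
  have e0: "0 \<le> e"
  proof -
    have "\<bar>ratio A Q m (a * x) 0 - (if d dvd 0 then d / m else 0)\<bar> \<le> e" using x(2) unfolding typed_def by blast
    then show ?thesis by linarith
  qed
  have Dl: "0 < D ^ l" using D by simp
  have g1: "gcd d m = d" "gcd d (\<bar>a\<bar> * D ^ l) = d" using x(3) d0 by (simp_all add: m gcd_proj1_iff)
  have dvd: "\<bar>a\<bar> * D ^ l dvd m" by (rule mult_dvd_m) simp
  have "\<bar>cnt A (Q * m) (a * x) - gcd d m / m * ?c\<bar> \<le> m * e * ?c"
    by (rule typed_cnt[OF finite_A Q m_pos m_pos _ x(2) u]) simp
  then have up: "cnt A (Q * m) (a * x) \<le> d / m * ?c + m * e * ?c" unfolding g1 by linarith
  have "\<bar>cnt A (Q * (\<bar>a\<bar> * D ^ l)) (a * x) - gcd d (\<bar>a\<bar> * D ^ l) / (\<bar>a\<bar> * D ^ l) * ?c\<bar> \<le> m * e * ?c"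
    by (rule typed_cnt[OF finite_A Q m_pos _ dvd x(2) u]) (use a Dl in simp)
  then have low: "d / (\<bar>a\<bar> * D ^ l) * ?c - m * e * ?c \<le> cnt A (Q * (\<bar>a\<bar> * D ^ l)) (a * x)" unfolding g1 by linarith
  have eq: "cnt A (Q * (\<bar>a\<bar> * D ^ l)) (a * x) = cnt X (Q * D ^ l) x"
    unfolding A using cnt_scaled[OF a(1), of X "Q * D ^ l" x] by (simp add: mult_ac)
  let ?r = "real_of_int \<bar>a\<bar> / D"
  have r: "0 < ?r" "?r \<le> 1" using a D a_le by (simp_all add: field_simps)
  have rd: "?r * (d / (\<bar>a\<bar> * D ^ l)) = d / m" using a D by (simp add: m)
  have m0: "0 < real_of_int m" using m_pos by simp
  have "3 * (m * e) \<le> \<xi> / m" using \<xi>(3) m0 by (simp add: power2_eq_square field_simps)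
  also have "\<dots> \<le> \<xi> * (d / m)" using d0 \<xi> m0 by (simp add: field_simps)
  finally have small: "3 * (m * e) \<le> \<xi> * (d / m)" .
  have me0: "0 \<le> m * e" using m0 e0 by simp
  have "(1 + \<xi>) * ?r * (m * e) \<le> 2 * (m * e)"
    using \<xi> r me0 mult_mono[of "1 + \<xi>" 2 ?r 1] by (intro mult_right_mono) auto
  moreover have "(1 + \<xi>) * (d / m) = d / m + \<xi> * (d / m)" by (simp only: distrib_right mult_1)
  ultimately have "d / m + m * e \<le> (1 + \<xi>) * (d / m) - (1 + \<xi>) * ?r * (m * e)" using small by linarith
  also have "\<dots> = (1 + \<xi>) * ?r * (d / (\<bar>a\<bar> * D ^ l) - m * e)"
  proof -
    have "(1 + \<xi>) * ?r * (d / (\<bar>a\<bar> * D ^ l) - m * e) = (1 + \<xi>) * (?r * (d / (\<bar>a\<bar> * D ^ l))) - (1 + \<xi>) * ?r * (m * e)"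
      by (simp only: right_diff_distrib mult.assoc)
    then show ?thesis by (simp only: rd)
  qed
  finally have "(d / m + m * e) * ?c \<le> (1 + \<xi>) * ?r * (d / (\<bar>a\<bar> * D ^ l) - m * e) * ?c"
    using c by (intro mult_right_mono) auto
  also have "\<dots> = (1 + \<xi>) * ?r * ((d / (\<bar>a\<bar> * D ^ l) - m * e) * ?c)" by (simp only: mult.assoc)
  also have "\<dots> \<le> (1 + \<xi>) * ?r * cnt X (Q * D ^ l) x"
  proof (rule mult_left_mono)
    show "(d / (\<bar>a\<bar> * D ^ l) - m * e) * ?c \<le> cnt X (Q * D ^ l) x"
      using low unfolding eq by (simp only: left_diff_distrib)
    show "0 \<le> (1 + \<xi>) * ?r" using r \<xi> by (intro mult_nonneg_nonneg) auto
  qed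
  finally have "d / m * ?c + m * e * ?c \<le> (1 + \<xi>) * ?r * cnt X (Q * D ^ l) x" by (simp only: distrib_right)
  moreover have "Q * D ^ l * D = Q * m" by (simp add: m)
  ultimately show ?thesis using up by (simp only:)
qed

end

section \<open>Choice of the modulus for an almost extremal set\<close>

lemma card_primes_dvd_le:
  fixes D :: int
  assumes "0 < D"
  shows "finite {p. prime p \<and> p dvd D}" "real (card {p. prime p \<and> p dvd D}) \<le> D"
proof -
  have sub: "{p. prime p \<and> p dvd D} \<subseteq> {1..D}"
    using assms by (auto simp: zdvd_imp_le dest: prime_gt_1_int)
  then show "finite {p. prime p \<and> p dvd D}" by (rule finite_subset) simp
  have "card {p. prime p \<and> p dvd D} \<le> card {1..D}" using sub by (intro card_mono) auto
  then show "real (card {p. prime p \<and> p dvd D}) \<le> D" using assms by simp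
qed

lemma dsmooth_power: "0 < D \<Longrightarrow> dsmooth D (D ^ k)"
  by (auto simp: dsmooth_def dest: prime_dvd_power)

lemma energy3_rotate: "energy3 B C A q = energy3 A B C q"
  by (simp add: energy3_def)

text \<open>At the stable modulus no prime \<open>p\<close> dividing \<open>D\<close> has all three
  sets concentrated, so some role contains an element to which \<open>light\<close> applies, and the
  typical class size of \<open>S\<close> falls by order \<open>p ^ l\<close>. A subgroup index
  divisible by \<open>p ^ l\<close> in any role would give the opposite by \<open>heavy\<close>.
  Hence almost all indices divide \<open>D ^ l\<close>, and \<open>q = Q * D ^ l\<close> makes the
  classes almost uniform.\<close>

lemma exists_uniform_modulus:
  fixes a1 a2 a3 D m :: int and S :: "int set" and \<kappa> \<delta> \<xi> \<epsilon> \<tau> \<eta> t K :: real and J l n :: nat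
  assumes D: "D = \<bar>a1 * a2 * a3\<bar>" and m: "m = D ^ Suc l"
    and ext: "extremal a1 a2 a3 \<kappa> \<delta> S" and nz: "a1 \<noteq> 0" "a2 \<noteq> 0" "a3 \<noteq> 0" and \<kappa>: "0 < \<kappa>" and ne: "S \<noteq> {}"
    and \<xi>: "0 < \<xi>" "\<xi> \<le> 1" "3 * \<xi> < \<kappa>" and \<epsilon>: "0 < \<epsilon>" "128 * \<epsilon> \<le> \<xi>"
    and \<tau>: "0 < \<tau>" "16 * D * \<tau> \<le> \<epsilon>" and K: "1 < K" and J: "0 < J"
    and small: "\<delta> + 3 * (1 / J) + 6 * real_of_int D / K < 2 * \<kappa> * \<tau>\<^sup>2"
    and l: "8 * (real_of_int D)\<^sup>2 * (K ^ J)\<^sup>2 < \<tau>\<^sup>2 * 2 ^ l"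
    and t: "0 < t" "t \<le> 1 / (8 * m)" "6 * (real_of_int m)\<^sup>2 * ((8 + m) * t) \<le> \<xi>" "m * ((8 + m) * t) \<le> \<tau> / 2"
    and \<eta>: "0 < \<eta>" "4 * \<eta> \<le> \<epsilon> * \<xi>" "8 * \<eta> / (t ^ 3 * \<xi>) \<le> \<tau> / 2"
    and n: "6 / \<eta> \<le> real n" and large: "real (cell_bound (nat m) n) < \<xi> * card S"
  shows "\<exists>S1 S2 S3 q. S1 \<subseteq> S \<and> S2 \<subseteq> S \<and> S3 \<subseteq> S \<and> dsmooth D q \<and>
     real (card (tri a1 a2 a3 S S S)) \<le> real (card (tri a1 a2 a3 S1 S2 S3)) + 3 * \<xi> * (real (card S))\<^sup>2 \<and>
     (\<forall>(a, X) \<in> {(a1, S1), (a2, S2), (a3, S3)}.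
        ncls ((*) a ` X) (q * D) \<le> nat m * cell_bound (nat m) n \<and>
        real (card {x \<in> X. \<not> cnt ((*) a ` X) (q * D) (a * x) \<le> (1 + \<xi>) * (real_of_int \<bar>a\<bar> / D) * cnt X q x}) \<le> \<xi> * card S)"
proof -
  let ?N = "real (card S)" and ?e = "(8 + m) * t" and ?L = "K ^ J"
  have S: "finite S" using ext by (simp add: extremal_def)
  have N: "0 < ?N" using S ne by (simp add: card_gt_0_iff)
  have D0: "0 < D" using nz by (simp add: D)
  have D1: "1 \<le> real_of_int D" using D0 by simp
  have m0: "0 < m" using D0 m by simp
  have aD: "\<bar>a1\<bar> dvd D" "\<bar>a2\<bar> dvd D" "\<bar>a3\<bar> dvd D" by (simp_all add: D)
  then have aD': "\<bar>a1\<bar> \<le> D" "\<bar>a2\<bar> \<le> D" "\<bar>a3\<bar> \<le> D" using D0 zdvd_imp_le by blast+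
  have \<tau>\<epsilon>: "16 * \<tau> \<le> \<epsilon>"
  proof -
    have "16 * \<tau> * 1 \<le> 16 * \<tau> * D" using \<tau> D1 by (intro mult_left_mono) auto
    then show ?thesis using \<tau>(2) by (simp add: mult_ac)
  qed
  have \<tau>1: "\<tau> < 1" using \<tau>\<epsilon> \<epsilon> \<xi> by linarith
  define hom where "hom W \<mu> \<longleftrightarrow> 0 < \<mu> \<and> real (card {x \<in> S. \<not> (\<mu> \<le> cnt S W x \<and> cnt S W x \<le> ?L * \<mu>)}) \<le> 2 * \<tau> * ?N" for W \<mu>
  \<comment> \<open>One typical size per modulus, chosen for \<open>S\<close> alone; it is the only
    quantity shared by the three roles.\<close>
  define \<mu> where "\<mu> W = (SOME \<mu>. hom W \<mu>)" for W
  have hom: "hom W (\<mu> W)" if "0 < W" for W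
    unfolding \<mu>_def
  proof (rule someI_ex)
    show "\<exists>\<mu>. hom W \<mu>"
      unfolding hom_def by (rule extremal_homogeneous[OF ext that nz K aD' \<kappa> \<tau>(1) \<tau>1 ne J small])
  qed
  have \<mu>: "\<And>W. 0 < W \<Longrightarrow> 0 < \<mu> W"
    "\<And>W. 0 < W \<Longrightarrow> real (card {x \<in> S. \<not> (\<mu> W \<le> cnt S W x \<and> cnt S W x \<le> ?L * \<mu> W)}) \<le> 2 * \<tau> * ?N"
    using hom unfolding hom_def by blast+
  define bad where "bad W = {x \<in> S. \<not> (\<mu> W \<le> cnt S W x \<and> cnt S W x \<le> ?L * \<mu> W)}" for W
  have cbad: "real (card (bad W)) \<le> 2 * \<tau> * ?N" if "0 < W" for W using \<mu>(2)[OF that] by (simp add: bad_def)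
  have \<xi>N: "0 \<le> \<xi> * ?N" using \<xi> by simp
  obtain A1 A2 A3 where core: "A1 \<subseteq> (*) a1 ` S" "A2 \<subseteq> (*) a2 ` S" "A3 \<subseteq> (*) a3 ` S"
    "rich A1 A2 A3 (\<xi> * ?N)" "rich A2 A3 A1 (\<xi> * ?N)" "rich A3 A1 A2 (\<xi> * ?N)"
    "real (card (sols ((*) a1 ` S) ((*) a2 ` S) ((*) a3 ` S))) \<le> real (card (sols A1 A2 A3))
       + \<xi> * ?N * (real (card ((*) a1 ` S)) + real (card ((*) a2 ` S)) + real (card ((*) a3 ` S)))"
    using exists_rich_core[OF finite_imageI[OF S, of "(*) a1"] finite_imageI[OF S, of "(*) a2"] finite_imageI[OF S, of "(*) a3"] \<xi>N]
    by blast
  obtain S1 where S1: "S1 \<subseteq> S" "A1 = (*) a1 ` S1" using core(1) by (rule subset_imageE)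
  obtain S2 where S2: "S2 \<subseteq> S" "A2 = (*) a2 ` S2" using core(2) by (rule subset_imageE)
  obtain S3 where S3: "S3 \<subseteq> S" "A3 = (*) a3 ` S3" using core(3) by (rule subset_imageE)
  note S123 = S1 S2 S3
  have fS: "finite S1" "finite S2" "finite S3" using S S123 finite_subset by blast+
  have fA: "finite A1" "finite A2" "finite A3" using S123 fS by auto
  have T: "real (card (tri a1 a2 a3 S S S)) \<le> real (card (tri a1 a2 a3 S1 S2 S3)) + 3 * \<xi> * ?N\<^sup>2"
    using core(7) nz by (simp add: card_tri_eq_sols S123 power2_eq_square)
  have cA: "real (card A1) \<le> ?N" "real (card A2) \<le> ?N" "real (card A3) \<le> ?N"
    using S S123 nz by (simp_all add: card_mono)
  have A1ne: "A1 \<noteq> {}"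
  proof
    assume "A1 = {}"
    then have "card (tri a1 a2 a3 S1 S2 S3) = 0" using nz S123 by (simp add: card_tri_eq_sols sols_def)
    then have "real (card (tri a1 a2 a3 S S S)) \<le> 3 * \<xi> * ?N\<^sup>2" using T by simp
    also have "\<dots> < \<kappa> * ?N\<^sup>2" using \<xi>(3) N by (intro mult_strict_right_mono) auto
    also have "\<dots> \<le> real (card (tri a1 a2 a3 S S S))"
    proof -
      have "real (card (tri a1 a2 a3 {} {} {})) - \<kappa> * (real (card ({}::int set)))\<^sup>2 \<le> real (card (tri a1 a2 a3 S S S)) - \<kappa> * ?N\<^sup>2"
        using ext unfolding extremal_def by blast
      moreover have "tri a1 a2 a3 {} {} {} = {}" by (auto simp: tri_def)
      ultimately show ?thesis by simp
    qed
    finally show False by simp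
  qed
  have Ds: "dsmooth D m" unfolding m by (rule dsmooth_power[OF D0])
  obtain Q where Q: "dsmooth D Q" "ncls A1 Q \<le> cell_bound (nat m) n" "ncls A2 Q \<le> cell_bound (nat m) n"
      "ncls A3 Q \<le> cell_bound (nat m) n" "energy3 A1 A2 A3 Q - energy3 A1 A2 A3 (Q * m) \<le> \<eta> * ?N\<^sup>2"
     and nc: "\<And>p. prime p \<Longrightarrow> p dvd m \<Longrightarrow> \<not> (conc_le A1 Q (Q * p) (\<epsilon> * ?N) \<and> conc_le A2 Q (Q * p) (\<epsilon> * ?N) \<and> conc_le A3 Q (Q * p) (\<epsilon> * ?N))"
    using exists_stable_modulus[OF fA cA Ds \<xi>(1) \<epsilon>(1) \<eta>(1) N \<epsilon>(2) \<eta>(2) n large core(4-6) A1ne] by blast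
  have Q0: "0 < Q" using Q by (simp add: dsmooth_def)
  have e1: "2 * (real_of_int m)\<^sup>2 * ?e \<le> 1" using t(3) \<xi>(2) by simp
  have e2: "3 * (real_of_int m)\<^sup>2 * ?e \<le> \<xi>"
  proof -
    have "0 \<le> (real_of_int m)\<^sup>2 * ?e" using t(1) m0 by simp
    then show ?thesis using t(3) by linarith
  qed
  have me: "m * ?e < 1 / 2" using t(4) \<tau>1 by linarith
  have bnd: "(8 * \<eta> / (t ^ 3 * \<xi>) + m * ?e) * ?N \<le> \<tau> * ?N"
    using t(4) \<eta>(3) N by (intro mult_right_mono) auto
  have role: "typed_role S X ((*) a ` X) a D Q m ?e l" if "X \<subseteq> S" "a \<noteq> 0" "\<bar>a\<bar> dvd D" for X a
    using that S D0 m Q0 e1 by unfold_locales auto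
  define unty where "unty A = {u \<in> A. \<nexists>d. typed A Q m ?e d u}" for A
  have U: "real (card (unty A1)) \<le> \<tau> * ?N" "real (card (unty A2)) \<le> \<tau> * ?N" "real (card (unty A3)) \<le> \<tau> * ?N"
  proof -
    have E: "energy3 A2 A3 A1 Q - energy3 A2 A3 A1 (Q * m) \<le> \<eta> * ?N\<^sup>2" "energy3 A3 A1 A2 Q - energy3 A3 A1 A2 (Q * m) \<le> \<eta> * ?N\<^sup>2"
      using Q(5) energy3_rotate[of A2 A3 A1] energy3_rotate[of A3 A1 A2] by simp_all
    show "real (card (unty A1)) \<le> \<tau> * ?N" unfolding unty_def
      using card_untyped_le[OF fA Q0 m0 cA(1) N \<xi>(1) core(4) Q(5) t(1,2)] bnd by linarith
    show "real (card (unty A2)) \<le> \<tau> * ?N" unfolding unty_def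
      using card_untyped_le[OF fA(2,3,1) Q0 m0 cA(2) N \<xi>(1) core(5) E(1) t(1,2)] bnd by linarith
    show "real (card (unty A3)) \<le> \<tau> * ?N" unfolding unty_def
      using card_untyped_le[OF fA(3,1,2) Q0 m0 cA(3) N \<xi>(1) core(6) E(2) t(1,2)] bnd by linarith
  qed
  let ?R = "{(a1, S1), (a2, S2), (a3, S3)}"
  have R: "X \<subseteq> S \<and> a \<noteq> 0 \<and> \<bar>a\<bar> dvd D \<and> finite X \<and> ncls ((*) a ` X) Q \<le> cell_bound (nat m) n \<and>
      real (card (unty ((*) a ` X))) \<le> \<tau> * ?N" if "(a, X) \<in> ?R" for a X
    using that S123 nz aD fS Q(2-4) U by auto
  \<comment> \<open>In the role that is not concentrated, more than \<open>\<epsilon> * ?N\<close>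
    elements lack a type divisible by \<open>p\<close>. At most \<open>6 * \<tau> * ?N\<close> are
    untyped (\<open>\<tau>\<close>), of atypical class size modulo \<open>Q\<close> or
    \<open>Q * p ^ l\<close> (\<open>2 * \<tau>\<close> each) or sparse (\<open>\<tau>\<close>), so
    \<open>light\<close> finds an element among the rest.\<close>
  have bound: "\<tau> * (real_of_int (p ^ l) * \<mu> (Q * p ^ l)) \<le> 4 * D * (?L * \<mu> Q)" if p: "prime p" "p dvd D" for p
  proof -
    have p0: "0 < p" using p(1) by (simp add: prime_gt_0_int)
    have Qp: "0 < Q * p ^ l" using p0 Q0 by simp
    have pm: "p dvd m" using p(2) by (simp add: m)
    have "\<exists>a X. (a, X) \<in> ?R \<and> \<not> conc_le ((*) a ` X) Q (Q * p) (\<epsilon> * ?N)"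
      using nc[OF p(1) pm] S123 by auto
    then obtain a X where aX: "(a, X) \<in> ?R" "\<not> conc_le ((*) a ` X) Q (Q * p) (\<epsilon> * ?N)" by blast
    have X: "X \<subseteq> S" "a \<noteq> 0" "\<bar>a\<bar> dvd D" "finite X" "real (card (unty ((*) a ` X))) \<le> \<tau> * ?N" using R[OF aX(1)] by auto
    let ?A = "(*) a ` X"
    let ?M = "{u \<in> ?A. \<exists>d. typed ?A Q m ?e d u \<and> p dvd d}"
    let ?sp = "{x \<in> X. cnt X (Q * p ^ l) x < \<tau> * cnt S (Q * p ^ l) x}"
    let ?bd = "unty ?A \<union> (*) a ` (bad Q \<union> bad (Q * p ^ l) \<union> ?sp)"
    have fA': "finite ?A" using X by simp
    have fb: "finite (bad W)" for W using S by (simp add: bad_def)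
    have "conc ?A Q (Q * p) ?M" by (rule conc_typed[OF fA' Q0 m0 p0 pm me])
    then have big: "\<epsilon> * ?N < real (card (?A - ?M))" using aX(2) by (auto simp: conc_le_def not_le)
    have "card ?bd \<le> card (unty ?A) + card (bad Q \<union> bad (Q * p ^ l) \<union> ?sp)"
      using card_Un_le[of "unty ?A" "(*) a ` (bad Q \<union> bad (Q * p ^ l) \<union> ?sp)"] X(2) by simp
    also have "card (bad Q \<union> bad (Q * p ^ l) \<union> ?sp) \<le> card (bad Q) + card (bad (Q * p ^ l)) + card ?sp"
      using card_Un_le[of "bad Q \<union> bad (Q * p ^ l)" ?sp] card_Un_le[of "bad Q" "bad (Q * p ^ l)"] by linarith
    finally have "real (card ?bd) \<le> real (card (unty ?A)) + real (card (bad Q)) + real (card (bad (Q * p ^ l))) + real (card ?sp)"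
      by linarith
    moreover have "real (card ?sp) \<le> \<tau> * ?N" by (rule card_sparse_le) (use S X \<tau> in auto)
    ultimately have "real (card ?bd) \<le> 6 * \<tau> * ?N"
      using X(5) cbad[OF Q0] cbad[OF Qp] by linarith
    also have "\<dots> \<le> \<epsilon> * ?N" using \<tau>\<epsilon> \<tau> N by (intro mult_right_mono) auto
    finally have "real (card ?bd) < real (card (?A - ?M))" using big by linarith
    then have "\<not> ?A - ?M \<subseteq> ?bd"
      using card_mono[of ?bd "?A - ?M"] fA' fb X(4) by (auto simp: unty_def)
    then obtain x where x: "x \<in> X" "a * x \<notin> ?M" "a * x \<notin> ?bd" by blast
    then obtain d where d: "typed ?A Q m ?e d (a * x)" by (auto simp: unty_def)
    have "\<not> p dvd d" using x d by auto
    have nb: "x \<notin> bad Q" "x \<notin> bad (Q * p ^ l)" "x \<notin> ?sp" using x(3) by blast+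
    interpret typed_role S X ?A a D Q m ?e l by (rule role) (use X in auto)
    show ?thesis
      by (rule light[OF p x(1) d \<open>\<not> p dvd d\<close> \<tau>(1)]) (use nb x(1) X(1) in \<open>auto simp: bad_def not_less\<close>)
  qed
  have final: "real (card {x \<in> X. \<not> cnt ((*) a ` X) (Q * D ^ l * D) (a * x) \<le> (1 + \<xi>) * (real_of_int \<bar>a\<bar> / D) * cnt X (Q * D ^ l) x}) \<le> \<xi> * ?N"
    if aX: "(a, X) \<in> ?R" for a X
  proof -
    have Xf: "X \<subseteq> S" "a \<noteq> 0" "\<bar>a\<bar> dvd D" "finite X" "real (card (unty ((*) a ` X))) \<le> \<tau> * ?N" using R[OF aX] by auto
    let ?A = "(*) a ` X"
    interpret typed_role S X ?A a D Q m ?e l by (rule role) (use Xf in auto)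
    let ?P = "{p. prime p \<and> p dvd D}"
    let ?sp = "{x \<in> X. cnt X Q x < \<tau> * cnt S Q x}"
    let ?bd = "\<lambda>p. bad Q \<union> bad (Q * p ^ l) \<union> ?sp"
    let ?un = "{x \<in> X. a * x \<in> unty ?A}"
    have fb: "finite (bad W)" for W using S by (simp add: bad_def)
    have good: "cnt ?A (Q * D ^ l * D) (a * x) \<le> (1 + \<xi>) * (real_of_int \<bar>a\<bar> / D) * cnt X (Q * D ^ l) x"
      if x: "x \<in> X" "x \<notin> ?un" "x \<notin> (\<Union>p\<in>?P. ?bd p)" for x
    proof -
      have "a * x \<in> ?A" using x(1) by blast
      then obtain d where d: "typed ?A Q m ?e d (a * x)" using x(1,2) by (auto simp: unty_def)
      have "d dvd D ^ l"
      proof (rule dvd_power_of_no_high_prime_power[OF D0])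
        show "0 < d" "d dvd D ^ Suc l" using d by (auto simp: typed_def m)
        fix p assume p: "prime p" "p dvd D"
        show "\<not> p ^ l dvd d"
        proof
          assume pd: "p ^ l dvd d"
          have p2: "2 \<le> p" using p(1) prime_ge_2_int by blast
          have Qp: "0 < Q * p ^ l" using p2 Q0 by simp
          have nb: "x \<notin> bad Q" "x \<notin> bad (Q * p ^ l)" "x \<notin> ?sp" using x(3) p by blast+
          have h: "\<tau> * \<mu> Q \<le> 2 * D * (?L * \<mu> (Q * p ^ l))"
            by (rule heavy[OF p x(1) d pd \<tau>(1)]) (use nb x(1) Xf(1) in \<open>auto simp: bad_def not_less\<close>)
          let ?pl = "real_of_int (p ^ l)"
          have pl: "2 ^ l \<le> ?pl" using p2 power_mono[of "2::real" "real_of_int p" l] by simp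
          have L0: "0 < ?L" using K by simp
          \<comment> \<open>\<open>heavy\<close> in this role followed by \<open>bound\<close>,
            which may stem from a different role, bounds \<open>p ^ l\<close> by a quantity that
            \<open>l\<close> was chosen to exceed.\<close>
          have "\<tau>\<^sup>2 * ?pl * \<mu> Q = \<tau> * ?pl * (\<tau> * \<mu> Q)" by (simp add: power2_eq_square mult_ac)
          also have "\<dots> \<le> \<tau> * ?pl * (2 * D * (?L * \<mu> (Q * p ^ l)))"
            using h \<tau> p2 by (intro mult_left_mono) auto
          also have "\<dots> = 2 * D * ?L * (\<tau> * (?pl * \<mu> (Q * p ^ l)))" by (simp add: mult_ac)
          also have "\<dots> \<le> 2 * D * ?L * (4 * D * (?L * \<mu> Q))"
            using bound[OF p] D0 L0 by (intro mult_left_mono) auto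
          also have "\<dots> = 8 * (real_of_int D)\<^sup>2 * ?L\<^sup>2 * \<mu> Q" by (simp add: power2_eq_square mult_ac)
          finally have "\<tau>\<^sup>2 * ?pl \<le> 8 * (real_of_int D)\<^sup>2 * ?L\<^sup>2" using \<mu>(1)[OF Q0] by simp
          also have "\<dots> < \<tau>\<^sup>2 * 2 ^ l" by (rule l)
          also have "\<dots> \<le> \<tau>\<^sup>2 * ?pl" using pl by (intro mult_left_mono) auto
          finally show False by simp
        qed
      qed
      then show ?thesis by (rule uniform[OF x(1) d _ \<xi>(1,2) e2])
    qed
    let ?B = "?un \<union> (\<Union>p\<in>?P. ?bd p)"
    have fP: "finite ?P" "real (card ?P) \<le> D" by (rule card_primes_dvd_le[OF D0])+
    have "{x \<in> X. \<not> cnt ?A (Q * D ^ l * D) (a * x) \<le> (1 + \<xi>) * (real_of_int \<bar>a\<bar> / D) * cnt X (Q * D ^ l) x} \<subseteq> ?B"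
      using good by blast
    then have "card {x \<in> X. \<not> cnt ?A (Q * D ^ l * D) (a * x) \<le> (1 + \<xi>) * (real_of_int \<bar>a\<bar> / D) * cnt X (Q * D ^ l) x} \<le> card ?B"
      using Xf(4) fb fP by (intro card_mono) auto
    also have "\<dots> \<le> card ?un + (\<Sum>p\<in>?P. card (?bd p))"
      by (intro order_trans[OF card_Un_le] add_left_mono card_UN_le fP)
    finally have "real (card {x \<in> X. \<not> cnt ?A (Q * D ^ l * D) (a * x) \<le> (1 + \<xi>) * (real_of_int \<bar>a\<bar> / D) * cnt X (Q * D ^ l) x})
       \<le> real (card ?un + (\<Sum>p\<in>?P. card (?bd p)))" by (simp only: of_nat_le_iff)
    also have "\<dots> = real (card ?un) + (\<Sum>p\<in>?P. real (card (?bd p)))" by simp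
    \<comment> \<open>Untyped elements count once, the other exceptions once per prime:
      \<open>2 * \<tau>\<close> for each of the two moduli and \<open>\<tau>\<close> for
      sparseness.\<close>
    also have "\<dots> \<le> \<tau> * ?N + (\<Sum>p\<in>?P. 5 * \<tau> * ?N)"
    proof (intro add_mono sum_mono)
      have "(*) a ` ?un \<subseteq> unty ?A" by auto
      then have "card ((*) a ` ?un) \<le> card (unty ?A)" using Xf(4) by (intro card_mono) (auto simp: unty_def)
      then show "real (card ?un) \<le> \<tau> * ?N" using Xf(2,5) by simp
      fix p assume p: "p \<in> ?P"
      then have Qp: "0 < Q * p ^ l" using Q0 by (simp add: prime_gt_0_int)
      have "card (?bd p) \<le> card (bad Q) + card (bad (Q * p ^ l)) + card ?sp"
        using card_Un_le[of "bad Q \<union> bad (Q * p ^ l)" ?sp] card_Un_le[of "bad Q" "bad (Q * p ^ l)"] by linarith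
      moreover have "real (card ?sp) \<le> \<tau> * ?N" by (rule card_sparse_le) (use S Xf \<tau> in auto)
      ultimately show "real (card (?bd p)) \<le> 5 * \<tau> * ?N" using cbad[OF Q0] cbad[OF Qp] by linarith
    qed
    also have "\<dots> = \<tau> * ?N + card ?P * (5 * \<tau> * ?N)" by simp
    also have "\<dots> \<le> D * (\<tau> * ?N) + D * (5 * \<tau> * ?N)"
    proof (intro add_mono mult_right_mono fP)
      have "1 * (\<tau> * ?N) \<le> D * (\<tau> * ?N)" using D1 \<tau> by (intro mult_right_mono) auto
      then show "\<tau> * ?N \<le> D * (\<tau> * ?N)" by simp
    qed (use \<tau> in auto)
    also have "\<dots> = (6 * D * \<tau>) * ?N" by (simp add: algebra_simps)
    also have "\<dots> \<le> \<xi> * ?N"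
    proof (rule mult_right_mono)
      have "6 * D * \<tau> \<le> 16 * D * \<tau>" using D0 \<tau> by simp
      then show "6 * D * \<tau> \<le> \<xi>" using \<tau>(2) \<epsilon> by linarith
    qed simp
    finally show ?thesis .
  qed
  have nc: "ncls ((*) a ` X) (Q * D ^ l * D) \<le> nat m * cell_bound (nat m) n" if aX: "(a, X) \<in> ?R" for a X
  proof -
    have eq: "Q * D ^ l * D = Q * m" by (simp add: m)
    have fX: "finite ((*) a ` X)" using R[OF aX] by simp
    have "ncls ((*) a ` X) (Q * D ^ l * D) \<le> nat m * ncls ((*) a ` X) Q"
      unfolding eq by (rule ncls_mult_le[OF fX m0])
    also have "\<dots> \<le> nat m * cell_bound (nat m) n" using R[OF aX] by (intro mult_le_mono) auto
    finally show ?thesis .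
  qed
  have ds: "dsmooth D (Q * D ^ l)"
    by (rule dsmooth_mult[OF Q(1) dsmooth_power[OF D0]])
  have all: "\<forall>(a, X) \<in> ?R. ncls ((*) a ` X) (Q * D ^ l * D) \<le> nat m * cell_bound (nat m) n \<and>
      real (card {x \<in> X. \<not> cnt ((*) a ` X) (Q * D ^ l * D) (a * x) \<le> (1 + \<xi>) * (real_of_int \<bar>a\<bar> / D) * cnt X (Q * D ^ l) x}) \<le> \<xi> * ?N"
  proof (rule ballI)
    fix p assume p: "p \<in> ?R"
    obtain a X where aX: "p = (a, X)" by (cases p)
    show "case p of (a, X) \<Rightarrow> ncls ((*) a ` X) (Q * D ^ l * D) \<le> nat m * cell_bound (nat m) n \<and>
      real (card {x \<in> X. \<not> cnt ((*) a ` X) (Q * D ^ l * D) (a * x) \<le> (1 + \<xi>) * (real_of_int \<bar>a\<bar> / D) * cnt X (Q * D ^ l) x}) \<le> \<xi> * ?N"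
      unfolding aX prod.case using nc final p unfolding aX by blast
  qed
  show ?thesis
    by (intro exI[of _ S1] exI[of _ S2] exI[of _ S3] exI[of _ "Q * D ^ l"] conjI S123 ds T all)
qed

section \<open>Solutions in almost uniform sets\<close>

text \<open>Adding the Bezout vector \<open>(b1, b2, b3)\<close> componentwise, modulo the side
  lengths, maps the solutions for \<open>c\<close> injectively to those for \<open>c + 1\<close>;
  the divisibility of \<open>ai * ni\<close> makes the wrap-around harmless. Going once around the
  residues modulo \<open>D\<close>, all fibres have the same size.\<close>

lemma card_linear_congruence:
  fixes a1 a2 a3 b1 b2 b3 n1 n2 n3 D c :: int
  assumes D: "0 < D" and n: "0 < n1" "0 < n2" "0 < n3" and dvd: "D dvd a1 * n1" "D dvd a2 * n2" "D dvd a3 * n3"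
    and b: "a1 * b1 + a2 * b2 + a3 * b3 = 1"
  shows "D * int (card {(s1, s2, s3). s1 \<in> {0..<n1} \<and> s2 \<in> {0..<n2} \<and> s3 \<in> {0..<n3} \<and> [a1 * s1 + a2 * s2 + a3 * s3 = c] (mod D)})
    = n1 * n2 * n3"
proof -
  let ?B = "{0..<n1} \<times> {0..<n2} \<times> {0..<n3}"
  define F where "F c = {(s1, s2, s3). s1 \<in> {0..<n1} \<and> s2 \<in> {0..<n2} \<and> s3 \<in> {0..<n3} \<and> [a1 * s1 + a2 * s2 + a3 * s3 = c] (mod D)}" for c
  have FB: "F c \<subseteq> ?B" for c by (auto simp: F_def)
  have finF: "finite (F c)" for c by (rule finite_subset[OF FB]) simp
  have modn: "[a * (s mod n) = a * s] (mod D)" if "D dvd a * n" for a s n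
  proof -
    have "a * s - a * (s mod n) = a * n * (s div n)"
      by (simp add: minus_mod_eq_mult_div mult.assoc flip: right_diff_distrib)
    then have "D dvd a * s - a * (s mod n)" using that by simp
    then show ?thesis by (simp add: cong_iff_dvd_diff dvd_diff_commute)
  qed
  have step: "card (F c) \<le> card (F (c + 1))" for c
  proof (rule card_inj_on_le[OF _ _ finF])
    let ?f = "\<lambda>(s1, s2, s3). ((s1 + b1) mod n1, (s2 + b2) mod n2, (s3 + b3) mod n3)"
    have inj: "s = s'" if "s \<in> {0..<n}" "s' \<in> {0..<n}" "(s + b) mod n = (s' + b) mod n" for s s' b n :: int
    proof -
      have "[s + b = s' + b] (mod n)" using that by (simp add: cong_def)
      then have "[s = s'] (mod n)" by (simp add: cong_add_rcancel)
      then show ?thesis using that by (simp add: cong_def)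
    qed
    show "inj_on ?f (F c)"
    proof (rule inj_onI)
      fix p p' assume "p \<in> F c" "p' \<in> F c" "?f p = ?f p'"
      moreover obtain s1 s2 s3 t1 t2 t3 where "p = (s1, s2, s3)" "p' = (t1, t2, t3)" by (cases p, cases p') auto
      ultimately show "p = p'" using inj[of s1 n1 t1 b1] inj[of s2 n2 t2 b2] inj[of s3 n3 t3 b3] by (auto simp: F_def)
    qed
    show "?f ` F c \<subseteq> F (c + 1)"
    proof
      fix p assume "p \<in> ?f ` F c"
      then obtain s1 s2 s3 where s: "p = ((s1 + b1) mod n1, (s2 + b2) mod n2, (s3 + b3) mod n3)"
        "[a1 * s1 + a2 * s2 + a3 * s3 = c] (mod D)" by (auto simp: F_def)
      have "[a1 * ((s1 + b1) mod n1) + a2 * ((s2 + b2) mod n2) + a3 * ((s3 + b3) mod n3)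
         = a1 * (s1 + b1) + a2 * (s2 + b2) + a3 * (s3 + b3)] (mod D)"
        by (intro cong_add modn dvd)
      also have "a1 * (s1 + b1) + a2 * (s2 + b2) + a3 * (s3 + b3) = a1 * s1 + a2 * s2 + a3 * s3 + 1"
        using b by (simp add: algebra_simps)
      also have "[a1 * s1 + a2 * s2 + a3 * s3 + 1 = c + 1] (mod D)" by (intro cong_add s cong_refl)
      finally show "p \<in> F (c + 1)" using n by (simp add: F_def s(1))
    qed
  qed
  have steps: "card (F c) \<le> card (F (c + int k))" for c k
  proof (induction k)
    case (Suc k)
    have "card (F (c + int k)) \<le> card (F (c + int k + 1))" by (rule step)
    then show ?case using Suc by (simp add: add.commute add.left_commute)
  qed simp
  have per: "F c = F c'" if "[c = c'] (mod D)" for c c'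
    unfolding F_def using that by (auto intro: cong_trans cong_sym)
  have le: "card (F c) \<le> card (F c')" for c c'
  proof -
    have "card (F c) \<le> card (F (c + int (nat ((c' - c) mod D))))" by (rule steps)
    also have "F (c + int (nat ((c' - c) mod D))) = F c'"
    proof (rule per)
      have "c + (c' - c) mod D - c' = - (D * ((c' - c) div D))" by (simp add: minus_mult_div_eq_mod[symmetric])
      then have "D dvd c + (c' - c) mod D - c'" by (simp add: dvd_def) (metis mult_minus_right)
      then show "[c + int (nat ((c' - c) mod D)) = c'] (mod D)" using D by (simp add: cong_iff_dvd_diff)
    qed
    finally show ?thesis .
  qed
  then have eq: "card (F c) = card (F c')" for c c' by (simp add: le_antisym)
  have "?B = (\<Union>c\<in>{0..<D}. F c)"
  proof (intro equalityI subsetI)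
    fix p assume "p \<in> ?B"
    then obtain s1 s2 s3 where p: "p = (s1, s2, s3)" "s1 \<in> {0..<n1}" "s2 \<in> {0..<n2}" "s3 \<in> {0..<n3}" by auto
    then have "p \<in> F ((a1 * s1 + a2 * s2 + a3 * s3) mod D)" by (simp add: F_def cong_def)
    moreover have "(a1 * s1 + a2 * s2 + a3 * s3) mod D \<in> {0..<D}" using D by simp
    ultimately show "p \<in> (\<Union>c\<in>{0..<D}. F c)" by blast
  qed (use FB in auto)
  then have "card ?B = card (\<Union>c\<in>{0..<D}. F c)" by simp
  also have "\<dots> = (\<Sum>c\<in>{0..<D}. card (F c))"
  proof (rule card_UN_disjoint)
    show "\<forall>i\<in>{0..<D}. \<forall>j\<in>{0..<D}. i \<noteq> j \<longrightarrow> F i \<inter> F j = {}"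
    proof (intro ballI impI, rule ccontr)
      fix i j assume ij: "i \<in> {0..<D}" "j \<in> {0..<D}" "i \<noteq> j" "F i \<inter> F j \<noteq> {}"
      then obtain p where p: "p \<in> F i" "p \<in> F j" by blast
      obtain s1 s2 s3 where s: "p = (s1, s2, s3)" by (cases p) auto
      have "[i = a1 * s1 + a2 * s2 + a3 * s3] (mod D)" using p(1) unfolding s F_def by (simp add: cong_sym)
      also have "[a1 * s1 + a2 * s2 + a3 * s3 = j] (mod D)" using p(2) unfolding s F_def by simp
      finally show False using ij by (simp add: cong_def)
    qed
  qed (use finF in auto)
  also have "\<dots> = (\<Sum>c'\<in>{0..<D}. card (F c))" by (rule sum.cong[OF refl]) (rule eq)
  also have "\<dots> = nat D * card (F c)" by simp
  finally have "int (card ?B) = D * int (card (F c))" using D by simp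
  moreover have "int (card ?B) = n1 * n2 * n3" using n by (simp add: card_cartesian_product)
  ultimately show ?thesis by (simp add: F_def)
qed

definition zero_triples :: "int \<Rightarrow> int \<Rightarrow> int \<Rightarrow> int \<Rightarrow> (int \<times> int \<times> int) set" where
  "zero_triples a1 a2 a3 q = {(r1, r2, r3). r1 \<in> {0..<q} \<and> r2 \<in> {0..<q} \<and> r3 \<in> {0..<q} \<and> [a1 * r1 + a2 * r2 + a3 * r3 = 0] (mod q)}"

lemma finite_zero_triples [simp]: "finite (zero_triples a1 a2 a3 q)"
  by (rule finite_subset[of _ "{0..<q} \<times> {0..<q} \<times> {0..<q}"]) (auto simp: zero_triples_def)

lemma weight_density_eq:
  "weight_density a1 a2 a3 q g = 1 / real_of_int \<bar>a1 * a2 * a3\<bar> *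
     (\<Sum>(r1, r2, r3)\<in>zero_triples a1 a2 a3 (int q). hexagon_area (\<bar>a1\<bar> * g r1) (\<bar>a2\<bar> * g r2) (\<bar>a3\<bar> * g r3))"
proof -
  have "{(r1, r2, r3) \<in> {0..<int q} \<times> {0..<int q} \<times> {0..<int q}. [a1 * r1 + a2 * r2 + a3 * r3 = 0] (mod int q)}
     = zero_triples a1 a2 a3 (int q)" by (auto simp: zero_triples_def)
  then show ?thesis by (simp only: weight_density_def)
qed

text \<open>The classes of the first two entries determine that of the third, so Pollard's bound
  applies cell by cell. Summing only over pairs that occur keeps the number of terms
  \<open>1 / 4\<close> under control.\<close>

lemma card_sols_le_sum_cells:
  fixes W :: int
  assumes fin: "finite A" "finite B" "finite C"
  defines "P \<equiv> (\<lambda>(u, v). (u mod W, v mod W)) ` sols A B C"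
  shows "real (card (sols A B C)) \<le> (\<Sum>(c1, c2)\<in>P. hexagon_area (cnt A W c1) (cnt B W c2) (cnt C W (- c1 - c2)) + 1 / 4)"
proof -
  have fP: "finite P" using fin by (simp add: P_def)
  have "sols A B C \<subseteq> (\<Union>(c1, c2)\<in>P. sols (cls A W c1) (cls B W c2) (cls C W (- c1 - c2)))"
  proof
    fix p assume p: "p \<in> sols A B C"
    obtain u v where uv: "p = (u, v)" by (cases p) auto
    have "[- u - v = - (u mod W) - v mod W] (mod W)"
    proof -
      have "- u - v - (- (u mod W) - v mod W) = W * (- (u div W) - v div W)"
        by (simp add: right_diff_distrib minus_mult_div_eq_mod[symmetric])
      then show ?thesis by (simp add: cong_iff_dvd_diff)
    qed
    then have "p \<in> sols (cls A W (u mod W)) (cls B W (v mod W)) (cls C W (- (u mod W) - v mod W))"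
      using p uv by (simp add: sols_def cls_def cong_def)
    moreover have "(u mod W, v mod W) \<in> P" using p uv by (force simp: P_def)
    ultimately show "p \<in> (\<Union>(c1, c2)\<in>P. sols (cls A W c1) (cls B W c2) (cls C W (- c1 - c2)))" by force
  qed
  then have "card (sols A B C) \<le> card (\<Union>(c1, c2)\<in>P. sols (cls A W c1) (cls B W c2) (cls C W (- c1 - c2)))"
    using fP fin by (intro card_mono) auto
  also have "\<dots> \<le> (\<Sum>p\<in>P. card (case p of (c1, c2) \<Rightarrow> sols (cls A W c1) (cls B W c2) (cls C W (- c1 - c2))))"
    by (rule card_UN_le[OF fP])
  finally have "real (card (sols A B C)) \<le> (\<Sum>p\<in>P. real (card (case p of (c1, c2) \<Rightarrow> sols (cls A W c1) (cls B W c2) (cls C W (- c1 - c2)))))"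
    by (simp flip: of_nat_sum)
  also have "\<dots> \<le> (\<Sum>(c1, c2)\<in>P. hexagon_area (cnt A W c1) (cnt B W c2) (cnt C W (- c1 - c2)) + 1 / 4)"
    by (rule sum_mono) (use fin in \<open>auto simp: cnt_def intro!: card_sols_le_hexagon_area\<close>)
  finally show ?thesis .
qed

lemma sum_le_sum_fibres:
  fixes F :: "'b \<Rightarrow> real" and H :: "'c \<Rightarrow> real"
  assumes fin: "finite P" "finite R" and \<Psi>: "\<And>p. p \<in> P \<Longrightarrow> \<Psi> p \<in> R \<and> F p \<le> H (\<Psi> p)"
    and H: "\<And>r. r \<in> R \<Longrightarrow> 0 \<le> H r" and fib: "\<And>r. r \<in> R \<Longrightarrow> real (card {p \<in> P. \<Psi> p = r}) \<le> D"
  shows "(\<Sum>p\<in>P. F p) \<le> D * (\<Sum>r\<in>R. H r)"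
proof -
  have "(\<Sum>p\<in>P. F p) \<le> (\<Sum>p\<in>P. H (\<Psi> p))" using \<Psi> by (intro sum_mono) auto
  also have "\<dots> = (\<Sum>r\<in>R. \<Sum>p\<in>{p \<in> P. \<Psi> p = r}. H (\<Psi> p))"
    by (rule sum.group[symmetric]) (use fin \<Psi> in auto)
  also have "\<dots> = (\<Sum>r\<in>R. real (card {p \<in> P. \<Psi> p = r}) * H r)" by (intro sum.cong refl) simp
  also have "\<dots> \<le> (\<Sum>r\<in>R. D * H r)" using fib H by (intro sum_mono mult_right_mono) auto
  finally show ?thesis by (simp add: sum_distrib_left)
qed

text \<open>Over a residue triple modulo \<open>q\<close> lie at most \<open>D\<close> occupied
  pairs of classes modulo \<open>q * D\<close>, each worth at most the hexagon area scaled by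
  \<open>k = (1 + \<xi>) * card S / D\<close>. The factor \<open>D\<close> times the square of
  \<open>k\<close> leaves \<open>1 / D\<close>, the normalisation of the weight density. The last
  term is \<open>1 / 4\<close> for each of at most \<open>M\<close> times \<open>M\<close>
  pairs.\<close>

lemma card_tri_uniform_le:
  fixes a1 a2 a3 D q :: int and \<xi> :: real and S :: "int set"
  assumes nz: "a1 \<noteq> 0" "a2 \<noteq> 0" "a3 \<noteq> 0" and D: "D = \<bar>a1 * a2 * a3\<bar>" and b: "a1 * b1 + a2 * b2 + a3 * b3 = 1"
    and S: "finite S" "S \<noteq> {}" and q: "0 < q" and \<xi>: "0 \<le> \<xi>"
    and sub: "G1 \<subseteq> S" "G2 \<subseteq> S" "G3 \<subseteq> S"
    and M: "ncls ((*) a1 ` G1) (q * D) \<le> M" "ncls ((*) a2 ` G2) (q * D) \<le> M"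
    and G: "\<And>x. x \<in> G1 \<Longrightarrow> cnt ((*) a1 ` G1) (q * D) (a1 * x) \<le> (1 + \<xi>) * (real_of_int \<bar>a1\<bar> / D) * cnt S q x"
      "\<And>x. x \<in> G2 \<Longrightarrow> cnt ((*) a2 ` G2) (q * D) (a2 * x) \<le> (1 + \<xi>) * (real_of_int \<bar>a2\<bar> / D) * cnt S q x"
      "\<And>x. x \<in> G3 \<Longrightarrow> cnt ((*) a3 ` G3) (q * D) (a3 * x) \<le> (1 + \<xi>) * (real_of_int \<bar>a3\<bar> / D) * cnt S q x"
  shows "real (card (tri a1 a2 a3 G1 G2 G3)) \<le> (1 + \<xi>)\<^sup>2 * (real (card S))\<^sup>2 * weight_density a1 a2 a3 (nat q) (\<lambda>r. cnt S q r / card S)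
     + (real M)\<^sup>2 / 4"
proof -
  let ?A = "(*) a1 ` G1" and ?B = "(*) a2 ` G2" and ?C = "(*) a3 ` G3" and ?W = "q * D" and ?N = "real (card S)"
  let ?g = "\<lambda>r. cnt S q r / card S"
  have N: "0 < ?N" using S by (simp add: card_gt_0_iff)
  have D0: "0 < D" using nz by (simp add: D)
  have W0: "0 < ?W" using q D0 by simp
  have finG: "finite G1" "finite G2" "finite G3" using sub S finite_subset by blast+
  have fin: "finite ?A" "finite ?B" "finite ?C" using finG by auto
  define P where "P = (\<lambda>(u, v). (u mod ?W, v mod ?W)) ` sols ?A ?B ?C"
  have fP: "finite P" using fin by (simp add: P_def)
  let ?F = "\<lambda>p. case p of (c1, c2) \<Rightarrow> hexagon_area (cnt ?A ?W c1) (cnt ?B ?W c2) (cnt ?C ?W (- c1 - c2))"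
  have "P \<subseteq> ((\<lambda>u. u mod ?W) ` ?A) \<times> ((\<lambda>u. u mod ?W) ` ?B)" by (auto simp: P_def sols_def)
  then have "card P \<le> ncls ?A ?W * ncls ?B ?W"
    unfolding ncls_def card_cartesian_product[symmetric] using fin by (intro card_mono) auto
  also have "\<dots> \<le> M * M" using M by (intro mult_le_mono)
  finally have cP: "real (card P) \<le> (real M)\<^sup>2" by (simp add: power2_eq_square flip: of_nat_mult)
  have "real (card (tri a1 a2 a3 G1 G2 G3)) = real (card (sols ?A ?B ?C))" using nz by (simp add: card_tri_eq_sols)
  also have "\<dots> \<le> (\<Sum>(c1, c2)\<in>P. hexagon_area (cnt ?A ?W c1) (cnt ?B ?W c2) (cnt ?C ?W (- c1 - c2)) + 1 / 4)"
    unfolding P_def by (rule card_sols_le_sum_cells[OF fin])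
  also have "\<dots> = (\<Sum>p\<in>P. ?F p) + card P / 4" by (simp add: case_prod_unfold sum.distrib)
  finally have 1: "real (card (tri a1 a2 a3 G1 G2 G3)) \<le> (\<Sum>p\<in>P. ?F p) + (real M)\<^sup>2 / 4" using cP by linarith
  define rep where "rep p t \<longleftrightarrow> (case t of (x1, x2, x3) \<Rightarrow> x1 \<in> G1 \<and> x2 \<in> G2 \<and> x3 \<in> G3 \<and> a1 * x1 + a2 * x2 + a3 * x3 = 0
      \<and> p = ((a1 * x1) mod ?W, (a2 * x2) mod ?W))" for p t
  have ex_rep: "\<exists>t. rep p t" if p: "p \<in> P" for p
  proof -
    obtain u v where "p = (u mod ?W, v mod ?W)" "(u, v) \<in> sols ?A ?B ?C" using p by (auto simp: P_def)
    then obtain x1 x2 x3 where "p = ((a1 * x1) mod ?W, (a2 * x2) mod ?W)" "x1 \<in> G1" "x2 \<in> G2" "x3 \<in> G3" "- (a1 * x1) - a2 * x2 = a3 * x3"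
      by (auto simp: sols_def)
    then have "rep p (x1, x2, x3)" by (simp add: rep_def)
    then show ?thesis by blast
  qed
  \<comment> \<open>A solution is fixed for every occupied pair, so that residues and quotients
    modulo \<open>q\<close> can be read off from actual integers.\<close>
  define X where "X p = (SOME t. rep p t)" for p
  have X: "(case X p of (x1, x2, x3) \<Rightarrow> x1 \<in> G1 \<and> x2 \<in> G2 \<and> x3 \<in> G3 \<and> a1 * x1 + a2 * x2 + a3 * x3 = 0
      \<and> p = ((a1 * x1) mod ?W, (a2 * x2) mod ?W))" if "p \<in> P" for p
  proof -
    have "rep p (X p)" unfolding X_def by (rule someI_ex[OF ex_rep[OF that]])
    then show ?thesis by (simp only: rep_def)
  qed
  define \<Psi> where "\<Psi> p = (case X p of (x1, x2, x3) \<Rightarrow> (x1 mod q, x2 mod q, x3 mod q))" for p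
  define k where "k = (1 + \<xi>) * ?N / D"
  have k0: "0 < k" using \<xi> N D0 by (simp add: k_def)
  let ?H = "\<lambda>r. case r of (r1, r2, r3) \<Rightarrow> k\<^sup>2 * hexagon_area (\<bar>a1\<bar> * ?g r1) (\<bar>a2\<bar> * ?g r2) (\<bar>a3\<bar> * ?g r3)"
  let ?R = "zero_triples a1 a2 a3 q"
  have "(\<Sum>p\<in>P. ?F p) \<le> D * (\<Sum>r\<in>?R. ?H r)"
  proof (rule sum_le_sum_fibres[OF fP finite_zero_triples])
    fix p assume p: "p \<in> P"
    obtain x1 x2 x3 where Xp: "X p = (x1, x2, x3)" by (cases "X p") auto
    have x: "x1 \<in> G1" "x2 \<in> G2" "x3 \<in> G3" "a1 * x1 + a2 * x2 + a3 * x3 = 0" "p = ((a1 * x1) mod ?W, (a2 * x2) mod ?W)"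
      using X[OF p] by (simp_all add: Xp)
    have "[a1 * (x1 mod q) + a2 * (x2 mod q) + a3 * (x3 mod q) = a1 * x1 + a2 * x2 + a3 * x3] (mod q)"
      by (intro cong_add cong_mult cong_refl) (simp_all add: cong_def)
    then have \<Psi>R: "\<Psi> p \<in> ?R" using q x(4) by (simp add: \<Psi>_def Xp zero_triples_def)
    have bnd: "cnt ((*) a ` Y) ?W c \<le> k * (\<bar>a\<bar> * ?g (x mod q))"
      if "cnt ((*) a ` Y) ?W (a * x) \<le> (1 + \<xi>) * (real_of_int \<bar>a\<bar> / D) * cnt S q x" "[c = a * x] (mod ?W)" for a Y x c
    proof -
      have "cnt S q x = cnt S q (x mod q)" by (rule cnt_cong) (simp add: cong_def)
      then show ?thesis using that(1) cnt_cong[OF that(2)] N by (simp add: k_def mult_ac)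
    qed
    have c3: "[- ((a1 * x1) mod ?W) - (a2 * x2) mod ?W = a3 * x3] (mod ?W)"
    proof -
      have "[- ((a1 * x1) mod ?W) - (a2 * x2) mod ?W = - (a1 * x1) - a2 * x2] (mod ?W)"
        by (intro cong_diff) (simp_all add: cong_def mod_minus_eq)
      moreover have "- (a1 * x1) - a2 * x2 = a3 * x3" using x(4) by simp
      ultimately show ?thesis by simp
    qed
    have "?F p \<le> hexagon_area (k * (\<bar>a1\<bar> * ?g (x1 mod q))) (k * (\<bar>a2\<bar> * ?g (x2 mod q))) (k * (\<bar>a3\<bar> * ?g (x3 mod q)))"
      unfolding x(5) prod.case
    proof (rule hexagon_area_mono)
      show "cnt ?A ?W (a1 * x1 mod ?W) \<le> k * (\<bar>a1\<bar> * ?g (x1 mod q))" using bnd[OF G(1)[OF x(1)] cong_mod_left[THEN iffD2, OF cong_refl]] by simp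
      show "cnt ?B ?W (a2 * x2 mod ?W) \<le> k * (\<bar>a2\<bar> * ?g (x2 mod q))" using bnd[OF G(2)[OF x(2)] cong_mod_left[THEN iffD2, OF cong_refl]] by simp
      show "cnt ?C ?W (- (a1 * x1 mod ?W) - a2 * x2 mod ?W) \<le> k * (\<bar>a3\<bar> * ?g (x3 mod q))" using bnd[OF G(3)[OF x(3)] c3] by simp
    qed
    also have "\<dots> = ?H (\<Psi> p)" unfolding hexagon_area_scale[OF k0] by (simp add: \<Psi>_def Xp)
    finally show "\<Psi> p \<in> ?R \<and> ?F p \<le> ?H (\<Psi> p)" using \<Psi>R by blast
  next
    fix r show "0 \<le> ?H r" by (cases r) simp
  next
    fix r assume r: "r \<in> ?R"
    obtain r1 r2 r3 where rr: "r = (r1, r2, r3)" by (cases r) auto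
    \<comment> \<open>Chosen so that \<open>D\<close> divides \<open>ai * ni\<close>: then
      \<open>ai * x\<close> modulo \<open>q * D\<close> depends only on \<open>x mod q\<close> and
      on \<open>x div q\<close> modulo \<open>ni\<close>. Their product is \<open>D * D\<close>, so
      the congruence satisfied by the quotients has exactly \<open>D\<close> solutions in the
      box.\<close>
    define n1 n2 n3 where n: "n1 = \<bar>a2 * a3\<bar>" "n2 = \<bar>a1 * a3\<bar>" "n3 = \<bar>a1 * a2\<bar>"
    have n0: "0 < n1" "0 < n2" "0 < n3" using nz by (auto simp: n)
    have an: "\<bar>a1\<bar> * n1 = D" "\<bar>a2\<bar> * n2 = D" "\<bar>a3\<bar> * n3 = D" by (simp_all add: n D abs_mult mult_ac)
    have dvd: "D dvd a1 * n1" "D dvd a2 * n2" "D dvd a3 * n3"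
    proof -
      have "D dvd a * n" if "\<bar>a\<bar> * n = D" "0 < n" for a n
      proof -
        have "\<bar>a * n\<bar> = D" using that by (simp add: abs_mult)
        then show ?thesis by auto
      qed
      then show "D dvd a1 * n1" "D dvd a2 * n2" "D dvd a3 * n3" using an n0 by auto
    qed
    define c where "c = - ((a1 * r1 + a2 * r2 + a3 * r3) div q)"
    have c: "a1 * r1 + a2 * r2 + a3 * r3 = - (q * c)"
      using r unfolding rr zero_triples_def by (simp add: c_def cong_0_iff)
    let ?E = "{(s1, s2, s3). s1 \<in> {0..<n1} \<and> s2 \<in> {0..<n2} \<and> s3 \<in> {0..<n3} \<and> [a1 * s1 + a2 * s2 + a3 * s3 = c] (mod D)}"
    have fE: "finite ?E" by (rule finite_subset[of _ "{0..<n1} \<times> {0..<n2} \<times> {0..<n3}"]) auto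
    have "D * int (card ?E) = n1 * n2 * n3" by (rule card_linear_congruence[OF D0 n0 dvd b])
    also have "\<dots> = D * D" by (simp add: n D abs_mult mult_ac)
    finally have cE: "int (card ?E) = D" using D0 by simp
    define \<Sigma> where "\<Sigma> p = (case X p of (x1, x2, x3) \<Rightarrow> ((x1 div q) mod n1, (x2 div q) mod n2, (x3 div q) mod n3))" for p
    have modn: "[a * (s mod n) = a * s] (mod D)" if "D dvd a * n" for a s n
    proof -
      have "a * s - a * (s mod n) = a * n * (s div n)"
        by (simp add: minus_mod_eq_mult_div mult.assoc flip: right_diff_distrib)
      then have "D dvd a * s - a * (s mod n)" using that by simp
      then show ?thesis by (simp add: cong_iff_dvd_diff dvd_diff_commute)
    qed
    have "card {p \<in> P. \<Psi> p = r} \<le> card ?E"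
    proof (rule card_inj_on_le[OF _ _ fE])
      show "inj_on \<Sigma> {p \<in> P. \<Psi> p = r}"
      proof (rule inj_onI)
        fix p p' assume p: "p \<in> {p \<in> P. \<Psi> p = r}" "p' \<in> {p \<in> P. \<Psi> p = r}" "\<Sigma> p = \<Sigma> p'"
        obtain x1 x2 x3 where Xp: "X p = (x1, x2, x3)" by (cases "X p") auto
        obtain y1 y2 y3 where Yp: "X p' = (y1, y2, y3)" by (cases "X p'") auto
        have same: "(a * x) mod ?W = (a * y) mod ?W" if "D dvd a * n" "x mod q = y mod q" "(x div q) mod n = (y div q) mod n" for a x y n
        proof -
          have "[a * (x div q) = a * (y div q)] (mod D)"
            using modn[OF that(1), of "x div q"] modn[OF that(1), of "y div q"] that(3) by (metis cong_sym cong_trans)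
          then have "D dvd a * (x div q) - a * (y div q)" by (simp add: cong_iff_dvd_diff)
          then have "q * D dvd q * (a * (x div q) - a * (y div q))" by (rule mult_dvd_mono[OF dvd_refl])
          moreover have "a * x - a * y = q * (a * (x div q) - a * (y div q))"
          proof -
            have "a * x = a * (x mod q + q * (x div q))" "a * y = a * (y mod q + q * (y div q))" by simp_all
            then have "a * x = a * (x mod q) + a * (q * (x div q))" "a * y = a * (x mod q) + a * (q * (y div q))"
              unfolding that(2)[symmetric] by (simp_all only: distrib_left)
            moreover have "q * (a * (x div q) - a * (y div q)) = a * (q * (x div q)) - a * (q * (y div q))"
              by (simp add: algebra_simps)
            ultimately show ?thesis by linarith
          qed
          ultimately have "?W dvd a * x - a * y" by simp
          then show ?thesis by (simp add: mod_eq_dvd_iff)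
        qed
        have "p = ((a1 * x1) mod ?W, (a2 * x2) mod ?W)" using X[of p] p(1) by (simp add: Xp)
        moreover have "p' = ((a1 * y1) mod ?W, (a2 * y2) mod ?W)" using X[of p'] p(2) by (simp add: Yp)
        moreover have "(a1 * x1) mod ?W = (a1 * y1) mod ?W"
          by (rule same[OF dvd(1)]) (use p in \<open>simp_all add: \<Psi>_def \<Sigma>_def Xp Yp rr\<close>)
        moreover have "(a2 * x2) mod ?W = (a2 * y2) mod ?W"
          by (rule same[OF dvd(2)]) (use p in \<open>simp_all add: \<Psi>_def \<Sigma>_def Xp Yp rr\<close>)
        ultimately show "p = p'" by simp
      qed
      show "\<Sigma> ` {p \<in> P. \<Psi> p = r} \<subseteq> ?E"
      proof
        fix s assume "s \<in> \<Sigma> ` {p \<in> P. \<Psi> p = r}"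
        then obtain p where p: "p \<in> P" "\<Psi> p = r" "s = \<Sigma> p" by blast
        obtain x1 x2 x3 where Xp: "X p = (x1, x2, x3)" by (cases "X p") auto
        have x: "a1 * x1 + a2 * x2 + a3 * x3 = 0" using X[OF p(1)] by (simp add: Xp)
        have r': "r1 = x1 mod q" "r2 = x2 mod q" "r3 = x3 mod q" using p(2) by (simp_all add: \<Psi>_def Xp rr)
        have xd: "x = x mod q + q * (x div q)" for x by simp
        have "0 = a1 * (r1 + q * (x1 div q)) + a2 * (r2 + q * (x2 div q)) + a3 * (r3 + q * (x3 div q))"
          unfolding r' using x by simp
        also have "\<dots> = (a1 * r1 + a2 * r2 + a3 * r3) + q * (a1 * (x1 div q) + a2 * (x2 div q) + a3 * (x3 div q))"
          by (simp add: algebra_simps)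
        finally have "q * c = q * (a1 * (x1 div q) + a2 * (x2 div q) + a3 * (x3 div q))" using c by linarith
        then have "c = a1 * (x1 div q) + a2 * (x2 div q) + a3 * (x3 div q)" using q by simp
        moreover have "[a1 * (x1 div q mod n1) + a2 * (x2 div q mod n2) + a3 * (x3 div q mod n3)
           = a1 * (x1 div q) + a2 * (x2 div q) + a3 * (x3 div q)] (mod D)"
          by (intro cong_add modn dvd)
        ultimately show "s \<in> ?E" using n0 by (simp add: p(3) \<Sigma>_def Xp)
      qed
    qed
    then show "real (card {p \<in> P. \<Psi> p = r}) \<le> D" using cE by linarith
  qed
  also have "\<dots> = (1 + \<xi>)\<^sup>2 * ?N\<^sup>2 * weight_density a1 a2 a3 (nat q) ?g"
  proof -
    have "(\<Sum>r\<in>?R. ?H r) = k\<^sup>2 * (\<Sum>(r1, r2, r3)\<in>?R. hexagon_area (\<bar>a1\<bar> * ?g r1) (\<bar>a2\<bar> * ?g r2) (\<bar>a3\<bar> * ?g r3))"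
      unfolding sum_distrib_left by (rule sum.cong) auto
    moreover have "D * (k\<^sup>2 * z) = (1 + \<xi>)\<^sup>2 * ?N\<^sup>2 * (1 / D * z)" for z
      using D0 by (simp add: k_def power2_eq_square field_simps)
    ultimately show ?thesis using q unfolding weight_density_eq D[symmetric] by simp
  qed
  finally show ?thesis using 1 by simp
qed

lemma residue_weight_cnt:
  assumes S: "finite S" "S \<noteq> {}" and q: "0 < q"
  shows "residue_weight (nat q) (\<lambda>r. cnt S q r / card S)"
proof -
  have N: "0 < real (card S)" using S by (simp add: card_gt_0_iff)
  have "cnt S 1 0 = (\<Sum>j\<in>{0..<q}. cnt S (1 * q) (0 + 1 * j))" by (rule cnt_children) (use S q in auto)
  moreover have "cls S 1 0 = S" by (auto simp: cls_def)
  ultimately have "(\<Sum>r\<in>{0..<q}. cnt S q r) = card S" by (simp add: cnt_def)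
  then have "(\<Sum>r\<in>{0..<q}. cnt S q r / card S) = 1" using N by (simp flip: sum_divide_distrib)
  moreover have "cnt S q r \<le> card S" for r
    unfolding cnt_def using S by (simp add: card_mono cls_subset)
  ultimately show ?thesis using q N by (simp add: residue_weight_def)
qed

section \<open>Sets modelled on a weight\<close>

text \<open>In the coordinates \<open>(a1 * n1, a2 * n2)\<close> the plane is cut into squares of
  side \<open>D\<close>. Every square meeting the reduced hexagon yields \<open>D\<close> lattice
  points, each coordinate of which is within \<open>D\<close> of a hexagon point; the reductions by
  \<open>2 * D\<close>, \<open>2 * D\<close> and \<open>4 * D + 2 * \<bar>c\<bar>\<close> pay for
  this displacement. Area \<open>D * D\<close> against \<open>D\<close> points gives the factor
  \<open>D\<close>.\<close>

lemma card_lattice_points_pos_ge: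
  fixes a1 a2 a3 b1 b2 b3 c D :: int and A1 A2 A3 :: real
  assumes a: "0 < a1" "0 < a2" "0 < a3" and b: "a1 * b1 + a2 * b2 + a3 * b3 = 1" and D_def: "D = a1 * a2 * a3"
  defines "L \<equiv> {(n1, n2, n3). \<bar>real_of_int n1\<bar> \<le> A1 / 2 \<and> \<bar>real_of_int n2\<bar> \<le> A2 / 2 \<and> \<bar>real_of_int n3\<bar> \<le> A3 / 2 \<and> a1 * n1 + a2 * n2 + a3 * n3 = c}"
  shows "finite L" "hexagon_area (a1 * A1 - 2 * D) (a2 * A2 - 2 * D) (a3 * A3 - 4 * D - 2 * \<bar>c\<bar>) \<le> D * card L"
proof -
  have D0: "0 < D" using a by (simp add: D_def)
  have bd: "n \<in> {- \<lceil>A\<rceil>..\<lceil>A\<rceil>}" if "\<bar>real_of_int n\<bar> \<le> A / 2" for n A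
  proof -
    have "real_of_int n \<le> A" "- A \<le> real_of_int n" using that by linarith+
    then show ?thesis by (auto simp: le_ceiling_iff ceiling_le_iff) linarith+
  qed
  show finL: "finite L"
  proof (rule finite_subset)
    show "L \<subseteq> {- \<lceil>A1\<rceil>..\<lceil>A1\<rceil>} \<times> {- \<lceil>A2\<rceil>..\<lceil>A2\<rceil>} \<times> {- \<lceil>A3\<rceil>..\<lceil>A3\<rceil>}" unfolding L_def using bd by blast
  qed simp
  let ?H = "hexset (a1 * A1 - 2 * D) (a2 * A2 - 2 * D) (a3 * A3 - 4 * D - 2 * \<bar>c\<bar>)"
  define I where "I = (\<lambda>(x, y). (\<lfloor>x / D\<rfloor>, \<lfloor>y / D\<rfloor>)) ` ?H"
  define box where "box p = (case p of (i, j) \<Rightarrow> {real_of_int (D * i)..real_of_int (D * (i + 1))} \<times> {real_of_int (D * j)..real_of_int (D * (j + 1))})" for p :: "int \<times> int"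
  have fl: "real_of_int (D * \<lfloor>x / D\<rfloor>) \<le> x" "x < real_of_int (D * (\<lfloor>x / D\<rfloor> + 1))" for x :: real
  proof -
    show "real_of_int (D * \<lfloor>x / D\<rfloor>) \<le> x" "x < real_of_int (D * (\<lfloor>x / D\<rfloor> + 1))"
      using floor_divide_lower[of "real_of_int D" x] floor_divide_upper[of "real_of_int D" x] D0
      by (simp_all add: mult.commute)
  qed
  have finI: "finite I"
  proof (rule finite_subset)
    have "\<lfloor>x / D\<rfloor> \<in> {\<lfloor>- B / D\<rfloor>..\<lfloor>B / D\<rfloor>}" if "\<bar>x\<bar> \<le> B" for x B :: real
    proof -
      have "- B \<le> x" "x \<le> B" using that by linarith+
      then have "- B / D \<le> x / D" "x / D \<le> B / D" using D0 by (intro divide_right_mono; simp)+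
      then show ?thesis unfolding atLeastAtMost_iff by (intro conjI floor_mono)
    qed
    note rng = this
    show "I \<subseteq> {\<lfloor>- ((a1 * A1 - 2 * D) / 2) / D\<rfloor>..\<lfloor>((a1 * A1 - 2 * D) / 2) / D\<rfloor>} \<times> {\<lfloor>- ((a2 * A2 - 2 * D) / 2) / D\<rfloor>..\<lfloor>((a2 * A2 - 2 * D) / 2) / D\<rfloor>}"
    proof
      fix p assume "p \<in> I"
      then obtain z where z: "z \<in> ?H" "p = (\<lambda>(x, y). (\<lfloor>x / D\<rfloor>, \<lfloor>y / D\<rfloor>)) z" unfolding I_def by blast
      obtain x y where xy: "z = (x, y)" by (cases z)
      have "\<bar>x\<bar> \<le> (a1 * A1 - 2 * D) / 2" "\<bar>y\<bar> \<le> (a2 * A2 - 2 * D) / 2" using z(1) unfolding xy hexset_def by simp_all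
      from rng[OF this(1)] rng[OF this(2)]
      show "p \<in> {\<lfloor>- ((a1 * A1 - 2 * D) / 2) / D\<rfloor>..\<lfloor>((a1 * A1 - 2 * D) / 2) / D\<rfloor>} \<times> {\<lfloor>- ((a2 * A2 - 2 * D) / 2) / D\<rfloor>..\<lfloor>((a2 * A2 - 2 * D) / 2) / D\<rfloor>}"
        unfolding z(2) xy prod.case by (intro SigmaI)
    qed
  qed simp
  have "?H \<subseteq> (\<Union>p\<in>I. box p)"
  proof
    fix z assume z: "z \<in> ?H"
    obtain x y where xy: "z = (x, y)" by (cases z)
    have "z \<in> box (\<lfloor>x / D\<rfloor>, \<lfloor>y / D\<rfloor>)"
      unfolding xy box_def using fl[of x] fl[of y] by (simp only: prod.case mem_Times_iff fst_conv snd_conv atLeastAtMost_iff less_imp_le)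
    moreover have "(\<lfloor>x / D\<rfloor>, \<lfloor>y / D\<rfloor>) \<in> I" unfolding I_def using z xy by force
    ultimately show "z \<in> (\<Union>p\<in>I. box p)" by blast
  qed
  have boxm: "box p \<in> sets lborel" for p unfolding box_def by (cases p) (simp add: borel_closed closed_Times)
  have boxe: "emeasure lborel (box p) = ennreal (real_of_int (D * D))" for p
  proof -
    obtain i j where p: "p = (i, j)" by (cases p)
    have "real_of_int (D * (k + 1)) - real_of_int (D * k) = D" "real_of_int (D * k) \<le> real_of_int (D * (k + 1))" for k
      using D0 by (simp_all add: algebra_simps)
    then have "emeasure lborel {real_of_int (D * k)..real_of_int (D * (k + 1))} = ennreal D" for k by simp
    then show ?thesis unfolding p box_def prod.case
      using D0 by (simp flip: lborel_prod add: lborel.emeasure_pair_measure_Times ennreal_mult)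
  qed
  have "emeasure lborel ?H \<le> emeasure lborel (\<Union>p\<in>I. box p)"
    using boxm finI by (intro emeasure_mono \<open>?H \<subseteq> _\<close> sets.finite_UN) auto
  also have "\<dots> \<le> (\<Sum>p\<in>I. emeasure lborel (box p))"
    using boxm finI by (intro emeasure_subadditive_finite) auto
  also have "\<dots> = of_nat (card I) * ennreal (real_of_int (D * D))" unfolding boxe by simp
  also have "\<dots> = ennreal (card I * real_of_int (D * D))" using D0 by (simp add: ennreal_mult ennreal_of_nat_eq_real_of_nat)
  finally have G: "hexagon_area (a1 * A1 - 2 * D) (a2 * A2 - 2 * D) (a3 * A3 - 4 * D - 2 * \<bar>c\<bar>) \<le> card I * real_of_int (D * D)"
    unfolding hexagon_area_eq using D0 by (intro measure_le_of_emeasure_le) auto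
  let ?n1 = "a2 * a3" and ?n2 = "a1 * a3"
  \<comment> \<open>Offsets within a square for which \<open>n3\<close> is an integer. The one-point
    range of \<open>s3\<close> is a dummy that makes the count for three variables applicable modulo
    \<open>a3\<close>; it yields \<open>D\<close> offsets.\<close>
  let ?F = "{(s1, s2, s3). s1 \<in> {0..<?n1} \<and> s2 \<in> {0..<?n2} \<and> s3 \<in> {0..<1} \<and> [a1 * s1 + a2 * s2 + a3 * s3 = c] (mod a3)}"
  have "a3 * int (card ?F) = ?n1 * ?n2 * 1"
    by (rule card_linear_congruence[OF a(3) _ _ _ _ _ _ b]) (use a in auto)
  also have "\<dots> = a3 * D" by (simp add: D_def)
  finally have cF: "int (card ?F) = D" using a by simp
  have finF: "finite ?F" by (rule finite_subset[of _ "{0..<?n1} \<times> {0..<?n2} \<times> {0..<1}"]) auto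
  define \<phi> where "\<phi> = (\<lambda>((i, j), (s1, s2, s3::int)). (?n1 * i + s1, ?n2 * j + s2, (c - a1 * (?n1 * i + s1) - a2 * (?n2 * j + s2)) div a3))"
  have "card (I \<times> ?F) \<le> card L"
  proof (rule card_inj_on_le[OF _ _ finL])
    show "inj_on \<phi> (I \<times> ?F)"
    proof (rule inj_onI)
      fix p p' assume p: "p \<in> I \<times> ?F" "p' \<in> I \<times> ?F" "\<phi> p = \<phi> p'"
      obtain i j s1 s2 s3 where pp: "p = ((i, j), (s1, s2, s3))" by (cases p) auto
      obtain i' j' t1 t2 t3 where pp': "p' = ((i', j'), (t1, t2, t3))" by (cases p') auto
      have s: "0 \<le> s1" "s1 < ?n1" "0 \<le> s2" "s2 < ?n2" "s3 = 0" "0 \<le> t1" "t1 < ?n1" "0 \<le> t2" "t2 < ?n2" "t3 = 0"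
        using p(1,2) by (auto simp: pp pp')
      have eq: "?n1 * i + s1 = ?n1 * i' + t1" "?n2 * j + s2 = ?n2 * j' + t2" using p(3) by (simp_all add: pp pp' \<phi>_def)
      have div: "i = i' \<and> s = t" if "n * i + s = n * i' + t" "0 \<le> s" "s < n" "0 \<le> t" "t < n" for n i i' s t :: int
      proof -
        have d: "(n * i + s) div n = i" "(n * i' + t) div n = i'" using that(2-5) by simp_all
        have "i = i'" using d that(1) by metis
        then show ?thesis using that(1) by simp
      qed
      show "p = p'" using div[OF eq(1) s(1,2,6,7)] div[OF eq(2) s(3,4,8,9)] s by (simp add: pp pp')
    qed
    show "\<phi> ` (I \<times> ?F) \<subseteq> L"
    proof
      fix z assume "z \<in> \<phi> ` (I \<times> ?F)"
      then obtain p where p: "p \<in> I \<times> ?F" "z = \<phi> p" by blast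
      obtain i j s1 s2 s3 where pp: "p = ((i, j), (s1, s2, s3))" by (cases p) auto
      have s': "0 \<le> s1" "s1 < ?n1" "0 \<le> s2" "s2 < ?n2" "s3 = 0" "[a1 * s1 + a2 * s2 + a3 * s3 = c] (mod a3)"
        using p(1) by (auto simp: pp)
      have s: "0 \<le> s1" "s1 < ?n1" "0 \<le> s2" "s2 < ?n2" "s3 = 0" "[a1 * s1 + a2 * s2 = c] (mod a3)"
        using s' by simp_all
      have "(i, j) \<in> I" using p(1) by (simp add: pp)
      then obtain x y where xy: "(x, y) \<in> ?H" "i = \<lfloor>x / D\<rfloor>" "j = \<lfloor>y / D\<rfloor>" by (auto simp: I_def)
      define n1 n2 n3 where n: "n1 = ?n1 * i + s1" "n2 = ?n2 * j + s2" "n3 = (c - a1 * n1 - a2 * n2) div a3"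
      have z: "z = (n1, n2, n3)" by (simp add: p(2) pp \<phi>_def n)
      have an: "a1 * n1 = D * i + a1 * s1" "a2 * n2 = D * j + a2 * s2" by (simp_all add: n D_def algebra_simps)
      have "a3 dvd c - (a1 * s1 + a2 * s2)" using s(6) by (simp add: cong_iff_dvd_diff dvd_diff_commute)
      moreover have "c - a1 * n1 - a2 * n2 = (c - (a1 * s1 + a2 * s2)) - a3 * (a1 * a2 * (i + j))"
        unfolding an by (simp add: D_def algebra_simps)
      ultimately have "a3 dvd c - a1 * n1 - a2 * n2" by (simp only: dvd_diff dvd_triv_left)
      then have eq: "a3 * n3 = c - a1 * n1 - a2 * n2" by (simp add: n(3))
      have as: "0 \<le> a1 * s1" "a1 * s1 \<le> D" "0 \<le> a2 * s2" "a2 * s2 \<le> D"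
      proof -
        have "a1 * s1 \<le> a1 * ?n1" "a2 * s2 \<le> a2 * ?n2" using s a by (auto intro!: mult_left_mono)
        then show "a1 * s1 \<le> D" "a2 * s2 \<le> D" by (simp_all add: D_def mult_ac)
      qed (use s a in auto)
      have "D * i \<le> a1 * n1" "a1 * n1 \<le> D * (i + 1)" "D * j \<le> a2 * n2" "a2 * n2 \<le> D * (j + 1)"
        using as an by (simp_all add: distrib_left)
      then have "real_of_int (D * i) \<le> real_of_int (a1 * n1)" "real_of_int (a1 * n1) \<le> real_of_int (D * (i + 1))"
        "real_of_int (D * j) \<le> real_of_int (a2 * n2)" "real_of_int (a2 * n2) \<le> real_of_int (D * (j + 1))"
        by (simp_all only: of_int_le_iff)
      moreover have "real_of_int (D * (i + 1)) = real_of_int (D * i) + D" "real_of_int (D * (j + 1)) = real_of_int (D * j) + D"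
        by (simp_all add: distrib_left)
      ultimately have near: "\<bar>real_of_int (a1 * n1) - x\<bar> \<le> D" "\<bar>real_of_int (a2 * n2) - y\<bar> \<le> D"
        using fl[of x] fl[of y] unfolding xy(2,3)[symmetric] by linarith+
      have h: "\<bar>x\<bar> \<le> (a1 * A1 - 2 * D) / 2" "\<bar>y\<bar> \<le> (a2 * A2 - 2 * D) / 2" "\<bar>x + y\<bar> \<le> (a3 * A3 - 4 * D - 2 * \<bar>c\<bar>) / 2"
        using xy(1) by (auto simp: hexset_def)
      have pert: "\<bar>u\<bar> \<le> Q / 2" if "\<bar>u - x\<bar> \<le> d" "\<bar>x\<bar> \<le> (Q - 2 * d) / 2" for u x d Q :: real
        using that by (simp add: field_simps)
      have pert2: "\<bar>e - u - v\<bar> \<le> Q / 2" if "\<bar>u - x\<bar> \<le> d" "\<bar>v - y\<bar> \<le> d" "\<bar>x + y\<bar> \<le> (Q - 4 * d - 2 * \<bar>e\<bar>) / 2"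
        for u v x y d e Q :: real
      proof -
        have "2 * \<bar>x + y\<bar> \<le> Q - 4 * d - 2 * \<bar>e\<bar>" using that(3) by (simp add: field_simps)
        moreover have "\<bar>u + v\<bar> \<le> \<bar>x + y\<bar> + 2 * d" using that(1,2) by linarith
        moreover have "\<bar>e - u - v\<bar> \<le> \<bar>e\<bar> + \<bar>u + v\<bar>" by linarith
        moreover have "s \<le> Q / 2" if "2 * p \<le> Q - 4 * d - 2 * f" "r \<le> p + 2 * d" "s \<le> f + r" for p f r s :: real
          using that by linarith
        ultimately show ?thesis by blast
      qed
      have dc: "real_of_int (2 * D) = 2 * real_of_int D" "real_of_int (4 * D) = 4 * real_of_int D" "real_of_int (2 * \<bar>c\<bar>) = 2 * \<bar>real_of_int c\<bar>"
        by simp_all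
      note h = h[unfolded dc]
      have "\<bar>real_of_int (a1 * n1)\<bar> \<le> a1 * A1 / 2" "\<bar>real_of_int (a2 * n2)\<bar> \<le> a2 * A2 / 2"
        by (rule pert[OF near(1) h(1)], rule pert[OF near(2) h(2)])
      moreover have "\<bar>real_of_int (a3 * n3)\<bar> \<le> a3 * A3 / 2"
      proof -
        have "real_of_int (a3 * n3) = c - real_of_int (a1 * n1) - real_of_int (a2 * n2)" unfolding eq by simp
        then show ?thesis using pert2[OF near h(3)] by (simp only:)
      qed
      note bounds = calculation this
      have red: "\<bar>real_of_int m\<bar> \<le> A / 2" if "\<bar>real_of_int (a * m)\<bar> \<le> a * A / 2" "0 < a" for a m A
      proof -
        have "real_of_int a * \<bar>real_of_int m\<bar> \<le> real_of_int a * (A / 2)" using that by (simp add: abs_mult)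
        then show ?thesis using that(2) by simp
      qed
      have "\<bar>real_of_int n1\<bar> \<le> A1 / 2" "\<bar>real_of_int n2\<bar> \<le> A2 / 2" "\<bar>real_of_int n3\<bar> \<le> A3 / 2"
        by (intro red[OF bounds(1) a(1)] red[OF bounds(2) a(2)] red[OF bounds(3) a(3)])+
      then show "z \<in> L" unfolding z L_def using eq by simp
    qed
  qed
  then have "real (card I) * D \<le> card L"
  proof -
    have "card I * card ?F \<le> card L" using \<open>card (I \<times> ?F) \<le> card L\<close> by (simp only: card_cartesian_product)
    then have "real (card I) * real (card ?F) \<le> card L" by (simp only: of_nat_mult[symmetric] of_nat_le_iff)
    moreover have "real (card ?F) = real_of_int D" unfolding cF[symmetric] by simp
    ultimately show ?thesis by (simp only:)
  qed
  then have "real (card I) * D * D \<le> real (card L) * D" using D0 by (intro mult_right_mono) auto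
  then show "hexagon_area (a1 * A1 - 2 * D) (a2 * A2 - 2 * D) (a3 * A3 - 4 * D - 2 * \<bar>c\<bar>) \<le> D * card L"
    using G by (simp add: mult_ac)
qed

lemma card_lattice_points_ge:
  fixes a1 a2 a3 b1 b2 b3 c D :: int and A1 A2 A3 :: real
  assumes nz: "a1 \<noteq> 0" "a2 \<noteq> 0" "a3 \<noteq> 0" and b: "a1 * b1 + a2 * b2 + a3 * b3 = 1" and D: "D = \<bar>a1 * a2 * a3\<bar>"
  defines "L \<equiv> {(n1, n2, n3). \<bar>real_of_int n1\<bar> \<le> A1 / 2 \<and> \<bar>real_of_int n2\<bar> \<le> A2 / 2 \<and> \<bar>real_of_int n3\<bar> \<le> A3 / 2 \<and> a1 * n1 + a2 * n2 + a3 * n3 = c}"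
  shows "finite L" "hexagon_area (\<bar>a1\<bar> * A1 - 2 * D) (\<bar>a2\<bar> * A2 - 2 * D) (\<bar>a3\<bar> * A3 - 4 * D - 2 * \<bar>c\<bar>) \<le> D * card L"
proof -
  define L' where "L' = {(n1, n2, n3). \<bar>real_of_int n1\<bar> \<le> A1 / 2 \<and> \<bar>real_of_int n2\<bar> \<le> A2 / 2 \<and> \<bar>real_of_int n3\<bar> \<le> A3 / 2 \<and> \<bar>a1\<bar> * n1 + \<bar>a2\<bar> * n2 + \<bar>a3\<bar> * n3 = c}"
  let ?f = "\<lambda>(n1, n2, n3). (sgn a1 * n1, sgn a2 * n2, sgn a3 * n3)"
  have sg: "a * (sgn a * n) = \<bar>a\<bar> * n" "\<bar>a\<bar> * (sgn a * n) = a * n" for a n :: int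
    by (auto simp: sgn_if abs_if)
  have sgs: "a \<noteq> 0 \<Longrightarrow> sgn a * (sgn a * n) = n" "a \<noteq> 0 \<Longrightarrow> \<bar>real_of_int (sgn a * n)\<bar> = \<bar>real_of_int n\<bar>" for a n :: int
    by (auto simp: sgn_if)
  have bij: "bij_betw ?f L' L"
    by (rule bij_betw_byWitness[where f' = ?f]) (use nz in \<open>auto simp: L_def L'_def sg sgs simp del: of_int_mult\<close>)
  have b': "\<bar>a1\<bar> * (sgn a1 * b1) + \<bar>a2\<bar> * (sgn a2 * b2) + \<bar>a3\<bar> * (sgn a3 * b3) = 1" using b by (simp add: sg)
  have D': "D = \<bar>a1\<bar> * \<bar>a2\<bar> * \<bar>a3\<bar>" by (simp add: D abs_mult)
  have pos: "0 < \<bar>a1\<bar>" "0 < \<bar>a2\<bar>" "0 < \<bar>a3\<bar>" using nz by auto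
  note main = card_lattice_points_pos_ge[OF pos b' D', of A1 A2 A3 c, folded L'_def]
  show "finite L" using bij main(1) bij_betw_finite by blast
  show "hexagon_area (\<bar>a1\<bar> * A1 - 2 * D) (\<bar>a2\<bar> * A2 - 2 * D) (\<bar>a3\<bar> * A3 - 4 * D - 2 * \<bar>c\<bar>) \<le> D * card L"
    using main(2) bij_betw_same_card[OF bij] by simp
qed

lemma residue_set_card:
  fixes q :: nat and g :: "int \<Rightarrow> real" and N :: real
  assumes q: "0 < q" and g: "residue_weight q g" and N: "0 \<le> N"
  defines "S \<equiv> {x :: int. \<bar>real_of_int (x div int q)\<bar> \<le> N * g (x mod int q) / 2}"
  shows "finite S" "N - q \<le> real (card S)" "real (card S) \<le> N + q"
proof -
  let ?k = "\<lambda>r. \<lfloor>N * g r / 2\<rfloor>"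
  let ?I = "\<lambda>r. {- ?k r..?k r}"
  have gn: "0 \<le> N * g r / 2" if "r \<in> {0..<int q}" for r using g that N by (auto simp: residue_weight_def)
  have I: "n \<in> ?I r \<longleftrightarrow> \<bar>real_of_int n\<bar> \<le> N * g r / 2" for n r
  proof -
    have "n \<in> ?I r \<longleftrightarrow> \<bar>n\<bar> \<le> ?k r" by auto
    also have "\<dots> \<longleftrightarrow> \<bar>real_of_int n\<bar> \<le> N * g r / 2" by (simp add: le_floor_iff)
    finally show ?thesis .
  qed
  have S_eq: "S = (\<lambda>(r, n). int q * n + r) ` (SIGMA r:{0..<int q}. ?I r)"
  proof (intro equalityI subsetI)
    fix x assume "x \<in> S"
    then have "(x mod int q, x div int q) \<in> (SIGMA r:{0..<int q}. ?I r)" using I q by (simp add: S_def)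
    moreover have "x = int q * (x div int q) + x mod int q" by simp
    ultimately show "x \<in> (\<lambda>(r, n). int q * n + r) ` (SIGMA r:{0..<int q}. ?I r)" by (intro image_eqI[of _ _ "(x mod int q, x div int q)"]) auto
  next
    fix x assume "x \<in> (\<lambda>(r, n). int q * n + r) ` (SIGMA r:{0..<int q}. ?I r)"
    then obtain r n where rn: "x = int q * n + r" "0 \<le> r" "r < int q" "n \<in> ?I r" by auto
    then have "x div int q = n" "x mod int q = r" by simp_all
    then show "x \<in> S" using rn(4) I by (simp add: S_def)
  qed
  have inj: "inj_on (\<lambda>(r, n). int q * n + r) (SIGMA r:{0..<int q}. ?I r)"
  proof (rule inj_onI)
    fix p p' assume p: "p \<in> (SIGMA r:{0..<int q}. ?I r)" "p' \<in> (SIGMA r:{0..<int q}. ?I r)"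
      "(\<lambda>(r, n). int q * n + r) p = (\<lambda>(r, n). int q * n + r) p'"
    obtain r n r' n' where pp: "p = (r, n)" "p' = (r', n')" by (cases p, cases p') auto
    have b: "0 \<le> r" "r < int q" "0 \<le> r'" "r' < int q" using p(1,2) by (auto simp: pp)
    have e: "int q * n + r = int q * n' + r'" using p(3) by (simp add: pp)
    have "n = (int q * n + r) div int q" "n' = (int q * n' + r') div int q" using b by simp_all
    then have "n = n'" using e by simp
    then show "p = p'" using e pp by simp
  qed
  show "finite S" unfolding S_eq by simp
  have "card S = (\<Sum>r\<in>{0..<int q}. card (?I r))" unfolding S_eq card_image[OF inj] by simp
  then have cS: "real (card S) = (\<Sum>r\<in>{0..<int q}. 2 * real_of_int (?k r) + 1)"
  proof -
    have "real (card (?I r)) = 2 * real_of_int (?k r) + 1" if "r \<in> {0..<int q}" for r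
    proof -
      have "0 \<le> ?k r" using gn[OF that] by simp
      then show ?thesis by simp
    qed
    then show ?thesis using \<open>card S = _\<close> by simp
  qed
  have gs: "(\<Sum>r\<in>{0..<int q}. N * g r) = N" using g by (simp add: residue_weight_def flip: sum_distrib_left)
  have "(\<Sum>r\<in>{0..<int q}. N * g r - 1) \<le> real (card S)" unfolding cS by (rule sum_mono) linarith
  then show "N - q \<le> real (card S)" by (simp add: sum_subtractf gs)
  have "real (card S) \<le> (\<Sum>r\<in>{0..<int q}. N * g r + 1)" unfolding cS by (rule sum_mono) linarith
  then show "real (card S) \<le> N + q" by (simp add: sum.distrib gs)
qed

text \<open>With \<open>xi = q * ni + ri\<close>, solutions with given residues correspond to
  lattice points on a plane whose constant is the carry of the residues, at most
  \<open>\<bar>a1\<bar> + \<bar>a2\<bar> + \<bar>a3\<bar>\<close> in absolute value. The hexagon is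
  thus reduced by a bounded amount, costing area of order \<open>N\<close> for each of at most
  \<open>q ^ 3\<close> triples.\<close>

lemma num_solutions_residue_set_ge:
  fixes a1 a2 a3 b1 b2 b3 D :: int and q :: nat and g :: "int \<Rightarrow> real" and N :: real
  assumes nz: "a1 \<noteq> 0" "a2 \<noteq> 0" "a3 \<noteq> 0" and b: "a1 * b1 + a2 * b2 + a3 * b3 = 1" and D: "D = \<bar>a1 * a2 * a3\<bar>"
    and q: "0 < q" and g: "residue_weight q g" and N: "0 < N"
  defines "S \<equiv> {x :: int. \<bar>real_of_int (x div int q)\<bar> \<le> N * g (x mod int q) / 2}"
  defines "E \<equiv> 18 * real_of_int D * (2 * D + \<bar>a1\<bar> + \<bar>a2\<bar> + \<bar>a3\<bar>)"
  shows "N\<^sup>2 * weight_density a1 a2 a3 q g - E * real q ^ 3 * N \<le> num_solutions a1 a2 a3 S"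
proof -
  let ?R = "zero_triples a1 a2 a3 (int q)"
  let ?c = "\<lambda>(r1, r2, r3). - ((a1 * r1 + a2 * r2 + a3 * r3) div int q)"
  let ?L = "\<lambda>(r1, r2, r3). {(n1, n2, n3). \<bar>real_of_int n1\<bar> \<le> N * g r1 / 2 \<and> \<bar>real_of_int n2\<bar> \<le> N * g r2 / 2 \<and> \<bar>real_of_int n3\<bar> \<le> N * g r3 / 2 \<and> a1 * n1 + a2 * n2 + a3 * n3 = ?c (r1, r2, r3)}"
  let ?G = "\<lambda>(r1, r2, r3). hexagon_area (\<bar>a1\<bar> * g r1) (\<bar>a2\<bar> * g r2) (\<bar>a3\<bar> * g r3)"
  have D0: "0 < D" using nz by (simp add: D)
  have D1: "1 \<le> real_of_int D" using D0 by simp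
  have S: "finite S" unfolding S_def using residue_set_card(1)[OF q g] N by simp
  have finL: "finite (?L r)" for r
    using card_lattice_points_ge(1)[OF nz b D] by (cases r) simp
  let ?\<phi> = "\<lambda>((r1, r2, r3), (n1, n2, n3)). (int q * n1 + r1, int q * n2 + r2, int q * n3 + r3)"
  have "card (SIGMA r:?R. ?L r) \<le> card (tri a1 a2 a3 S S S)"
  proof (rule card_inj_on_le[of ?\<phi>])
    have div: "(int q * n + r) div int q = n \<and> (int q * n + r) mod int q = r" if "0 \<le> r" "r < int q" for n r
      using that by simp
    show "inj_on ?\<phi> (SIGMA r:?R. ?L r)"
    proof (rule inj_onI)
      fix p p' assume p: "p \<in> (SIGMA r:?R. ?L r)" "p' \<in> (SIGMA r:?R. ?L r)" "?\<phi> p = ?\<phi> p'"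
      obtain r1 r2 r3 n1 n2 n3 where pp: "p = ((r1, r2, r3), (n1, n2, n3))" by (cases p) auto
      obtain s1 s2 s3 m1 m2 m3 where pp': "p' = ((s1, s2, s3), (m1, m2, m3))" by (cases p') auto
      have rb: "0 \<le> r1" "r1 < int q" "0 \<le> r2" "r2 < int q" "0 \<le> r3" "r3 < int q"
        "0 \<le> s1" "s1 < int q" "0 \<le> s2" "s2 < int q" "0 \<le> s3" "s3 < int q"
        using p(1,2) by (auto simp: pp pp' zero_triples_def)
      have e: "int q * n1 + r1 = int q * m1 + s1" "int q * n2 + r2 = int q * m2 + s2" "int q * n3 + r3 = int q * m3 + s3"
        using p(3) by (simp_all add: pp pp')
      have "n = m \<and> r = s" if "int q * n + r = int q * m + s" "0 \<le> r" "r < int q" "0 \<le> s" "s < int q" for n m r s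
        using div[OF that(2,3), of n] div[OF that(4,5), of m] that(1) by simp
      from this[OF e(1)] this[OF e(2)] this[OF e(3)] show "p = p'" using rb by (simp add: pp pp')
    qed
    show "?\<phi> ` (SIGMA r:?R. ?L r) \<subseteq> tri a1 a2 a3 S S S"
    proof
      fix z assume "z \<in> ?\<phi> ` (SIGMA r:?R. ?L r)"
      then obtain p where p: "p \<in> (SIGMA r:?R. ?L r)" "z = ?\<phi> p" by blast
      obtain r1 r2 r3 n1 n2 n3 where pp: "p = ((r1, r2, r3), (n1, n2, n3))" by (cases p) auto
      have r: "(r1, r2, r3) \<in> ?R" and n: "\<bar>real_of_int n1\<bar> \<le> N * g r1 / 2" "\<bar>real_of_int n2\<bar> \<le> N * g r2 / 2"
         "\<bar>real_of_int n3\<bar> \<le> N * g r3 / 2" "a1 * n1 + a2 * n2 + a3 * n3 = - ((a1 * r1 + a2 * r2 + a3 * r3) div int q)"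
        using p(1) by (simp_all add: pp)
      have rb: "0 \<le> r1" "r1 < int q" "0 \<le> r2" "r2 < int q" "0 \<le> r3" "r3 < int q" and dv: "int q dvd a1 * r1 + a2 * r2 + a3 * r3"
        using r by (auto simp: zero_triples_def cong_0_iff)
      have "a1 * (int q * n1 + r1) + a2 * (int q * n2 + r2) + a3 * (int q * n3 + r3)
         = int q * (a1 * n1 + a2 * n2 + a3 * n3) + (a1 * r1 + a2 * r2 + a3 * r3)" by (simp add: algebra_simps)
      also have "\<dots> = 0" unfolding n(4) using dv by simp
      finally have "a1 * (int q * n1 + r1) + a2 * (int q * n2 + r2) + a3 * (int q * n3 + r3) = 0" .
      moreover have "int q * n1 + r1 \<in> S" "int q * n2 + r2 \<in> S" "int q * n3 + r3 \<in> S"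
        unfolding S_def using div[OF rb(1,2)] div[OF rb(3,4)] div[OF rb(5,6)] n by simp_all
      ultimately show "z \<in> tri a1 a2 a3 S S S" by (simp add: p(2) pp tri_def)
    qed
  qed (use S in simp)
  then have "(\<Sum>r\<in>?R. card (?L r)) \<le> num_solutions a1 a2 a3 S"
    using finL by (simp add: num_solutions_eq_tri)
  then have 1: "(\<Sum>r\<in>?R. real (card (?L r))) \<le> num_solutions a1 a2 a3 S" by (simp flip: of_nat_sum)
  let ?C = "2 * D + \<bar>a1\<bar> + \<bar>a2\<bar> + \<bar>a3\<bar>"
  have E0: "0 \<le> E" using D0 by (simp add: E_def)
  have piece: "N\<^sup>2 * (1 / D * ?G r) - E * N \<le> real (card (?L r))" if r: "r \<in> ?R" for r
  proof -
    obtain r1 r2 r3 where rr: "r = (r1, r2, r3)" by (cases r) auto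
    have rb: "r1 \<in> {0..<int q}" "r2 \<in> {0..<int q}" "r3 \<in> {0..<int q}" and dv: "int q dvd a1 * r1 + a2 * r2 + a3 * r3"
      using r by (auto simp: rr zero_triples_def cong_0_iff)
    define c where "c = - ((a1 * r1 + a2 * r2 + a3 * r3) div int q)"
    have gb: "0 \<le> g r1" "g r1 \<le> 1" "0 \<le> g r2" "g r2 \<le> 1" "0 \<le> g r3" "g r3 \<le> 1" using g rb by (auto simp: residue_weight_def)
    have cb: "\<bar>c\<bar> \<le> \<bar>a1\<bar> + \<bar>a2\<bar> + \<bar>a3\<bar>"
    proof -
      have "int q * c = - (a1 * r1 + a2 * r2 + a3 * r3)" using dv by (simp add: c_def)
      then have "int q * \<bar>c\<bar> = \<bar>a1 * r1 + a2 * r2 + a3 * r3\<bar>" by (metis abs_minus_cancel abs_mult abs_of_nat)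
      also have "\<dots> \<le> \<bar>a1\<bar> * r1 + \<bar>a2\<bar> * r2 + \<bar>a3\<bar> * r3"
        using abs_triangle_ineq[of "a1 * r1 + a2 * r2" "a3 * r3"] abs_triangle_ineq[of "a1 * r1" "a2 * r2"] rb by (simp add: abs_mult)
      also have "\<dots> \<le> \<bar>a1\<bar> * int q + \<bar>a2\<bar> * int q + \<bar>a3\<bar> * int q"
        using rb by (intro add_mono mult_left_mono) auto
      finally have "int q * \<bar>c\<bar> \<le> int q * (\<bar>a1\<bar> + \<bar>a2\<bar> + \<bar>a3\<bar>)" by (simp add: algebra_simps)
      then show ?thesis using q by simp
    qed
    let ?a = "\<bar>a1\<bar> * (N * g r1)" and ?b = "\<bar>a2\<bar> * (N * g r2)" and ?d = "\<bar>a3\<bar> * (N * g r3)"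
    have aD: "\<bar>a1\<bar> \<le> D" "\<bar>a2\<bar> \<le> D" "\<bar>a3\<bar> \<le> D"
      using D0 by (auto intro!: zdvd_imp_le simp: D)
    have ab: "?a \<le> D * N" "?b \<le> D * N" "0 \<le> ?a" "0 \<le> ?b" "0 \<le> ?d"
    proof -
      have Ng: "0 \<le> N * g r1" "N * g r1 \<le> N" "0 \<le> N * g r2" "N * g r2 \<le> N" "0 \<le> N * g r3"
        using gb N by (simp_all add: mult_left_le)
      have "real_of_int \<bar>a1\<bar> \<le> D" "real_of_int \<bar>a2\<bar> \<le> D" using aD by (simp_all only: of_int_le_iff)
      then show "?a \<le> D * N" "?b \<le> D * N" using Ng by (intro mult_mono; simp)+
      show "0 \<le> ?a" "0 \<le> ?b" "0 \<le> ?d" using Ng by simp_all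
    qed
    have "hexagon_area ?a ?b ?d \<le> hexagon_area (?a - 2 * D) (?b - 2 * D) (?d - 4 * D - 2 * \<bar>c\<bar>)
       + (?a - (?a - 2 * D)) * ?b + (?b - (?b - 2 * D)) * ?a + (?d - (?d - 4 * D - 2 * \<bar>c\<bar>)) * ?b"
      using ab D0 by (intro hexagon_area_shrink) auto
    also have "\<dots> \<le> hexagon_area (?a - 2 * D) (?b - 2 * D) (?d - 4 * D - 2 * \<bar>c\<bar>) + D * E * N"
    proof -
      define X where "X = real_of_int D * N"
      define Cr where "Cr = real_of_int ?C"
      have DD: "1 \<le> real_of_int D" using D1 by (simp only: of_int_1_le_iff)
      have C: "0 \<le> Cr" using D0 by (simp add: Cr_def)
      have X: "0 \<le> X" "?a \<le> X" "?b \<le> X" using ab DD N by (auto simp: X_def)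
      have EC: "E = 18 * real_of_int D * Cr" by (simp add: E_def Cr_def)
      have cr: "real_of_int \<bar>c\<bar> \<le> real_of_int (\<bar>a1\<bar> + \<bar>a2\<bar> + \<bar>a3\<bar>)" using cb by (simp only: of_int_le_iff)
      have "2 * real_of_int D \<le> 2 * Cr" "4 * real_of_int D + 2 * real_of_int \<bar>c\<bar> \<le> 2 * Cr"
        using cr DD unfolding Cr_def by simp_all
      then have "(2 * real_of_int D) * ?b \<le> (2 * Cr) * X" "(2 * real_of_int D) * ?a \<le> (2 * Cr) * X"
        "(4 * real_of_int D + 2 * real_of_int \<bar>c\<bar>) * ?b \<le> (2 * Cr) * X"
        using ab X C DD by (intro mult_mono; linarith)+
      moreover have "3 * ((2 * Cr) * X) \<le> D * E * N"
      proof -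
        have "6 * (Cr * X) * 1 \<le> 18 * (Cr * X) * real_of_int D"
          using C X DD by (intro mult_mono mult_nonneg_nonneg) simp_all
        then show ?thesis by (simp add: EC X_def mult_ac)
      qed
      moreover have "?a - (?a - 2 * D) = 2 * real_of_int D" "?b - (?b - 2 * D) = 2 * real_of_int D"
        "?d - (?d - 4 * D - 2 * \<bar>c\<bar>) = 4 * real_of_int D + 2 * real_of_int \<bar>c\<bar>" by simp_all
      moreover have "h + u + v + w \<le> h + Z" if "u \<le> Y" "v \<le> Y" "w \<le> Y" "3 * Y \<le> Z" for h u v w Y Z :: real
        using that by linarith
      ultimately show ?thesis by (simp only:)
    qed
    also have "hexagon_area (?a - 2 * D) (?b - 2 * D) (?d - 4 * D - 2 * \<bar>c\<bar>) \<le> D * card (?L r)"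
      using card_lattice_points_ge(2)[OF nz b D, of "N * g r1" "N * g r2" "N * g r3" c] by (simp add: rr c_def)
    finally have "hexagon_area ?a ?b ?d \<le> D * (card (?L r) + E * N)" by (simp add: algebra_simps)
    moreover have "hexagon_area ?a ?b ?d = N\<^sup>2 * ?G r"
      using hexagon_area_scale[OF N, of "\<bar>a1\<bar> * g r1" "\<bar>a2\<bar> * g r2" "\<bar>a3\<bar> * g r3"] by (simp add: rr mult_ac)
    ultimately have "N\<^sup>2 * ?G r / D \<le> card (?L r) + E * N" using D0 by (simp add: field_simps)
    then show ?thesis by simp
  qed
  have "N\<^sup>2 * weight_density a1 a2 a3 q g = (\<Sum>r\<in>?R. N\<^sup>2 * (1 / D * ?G r))"
    unfolding weight_density_eq D[symmetric] by (simp add: sum_distrib_left case_prod_unfold)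
  moreover have "(\<Sum>r\<in>?R. E * N) \<le> E * real q ^ 3 * N"
  proof -
    have "card ?R \<le> card ({0..<int q} \<times> {0..<int q} \<times> {0..<int q})"
      by (rule card_mono) (auto simp: zero_triples_def)
    then have "real (card ?R) \<le> real q ^ 3" by (simp add: card_cartesian_product power3_eq_cube flip: of_nat_mult)
    then have "real (card ?R) * (E * N) \<le> real q ^ 3 * (E * N)" using E0 N by (intro mult_right_mono) auto
    then show ?thesis by (simp add: mult_ac)
  qed
  moreover have "(\<Sum>r\<in>?R. N\<^sup>2 * (1 / D * ?G r) - E * N) \<le> (\<Sum>r\<in>?R. real (card (?L r)))" by (intro sum_mono piece)
  ultimately show ?thesis using 1 by (simp add: sum_subtractf)
qed

lemma weight_density_le_limsup:
  assumes nz: "a1 \<noteq> 0" "a2 \<noteq> 0" "a3 \<noteq> 0" and b: "a1 * b1 + a2 * b2 + a3 * b3 = 1"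
    and q: "0 < q" and g: "residue_weight q g"
  shows "ereal (weight_density a1 a2 a3 q g) \<le> limsup_density a1 a2 a3"
proof -
  define S where "S N = {x :: int. \<bar>real_of_int (x div int q)\<bar> \<le> real N * g (x mod int q) / 2}" for N :: nat
  define D where "D = \<bar>a1 * a2 * a3\<bar>"
  define E where "E = 18 * real_of_int D * (2 * D + \<bar>a1\<bar> + \<bar>a2\<bar> + \<bar>a3\<bar>) * real q ^ 3"
  let ?w = "weight_density a1 a2 a3 q g" and ?Q = "real q"
  let ?f = "\<lambda>S. ereal (real (num_solutions a1 a2 a3 S) / (real (card S))\<^sup>2)"
  let ?F = "inf (filtercomap card at_top) (principal {S :: int set. finite S})"
  have S: "finite (S N)" "real N - ?Q \<le> card (S N)" "card (S N) \<le> real N + ?Q" for N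
    unfolding S_def using residue_set_card[OF q g, of "real N"] by simp_all
  have lb: "((real N)\<^sup>2 * ?w - E * N) / (real N + ?Q)\<^sup>2 \<le> real (num_solutions a1 a2 a3 (S N)) / (real (card (S N)))\<^sup>2" if N: "q < N" for N
  proof -
    have "(real N)\<^sup>2 * ?w - E * N \<le> num_solutions a1 a2 a3 (S N)"
      unfolding S_def E_def using num_solutions_residue_set_ge[OF nz b D_def q g, of "real N"] N by simp
    then have "((real N)\<^sup>2 * ?w - E * N) / (real N + ?Q)\<^sup>2 \<le> num_solutions a1 a2 a3 (S N) / (real N + ?Q)\<^sup>2"
      by (intro divide_right_mono) auto
    also have "\<dots> \<le> num_solutions a1 a2 a3 (S N) / (real (card (S N)))\<^sup>2"
    proof (rule divide_left_mono)
      have "0 < real (card (S N))" using S(2)[of N] N by linarith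
      then show "(real (card (S N)))\<^sup>2 \<le> (real N + ?Q)\<^sup>2" "0 < (real N + ?Q)\<^sup>2 * (real (card (S N)))\<^sup>2"
        using S(3)[of N] N by (auto intro: power_mono)
    qed simp
    finally show ?thesis .
  qed
  have lim: "(\<lambda>N. ((real N)\<^sup>2 * ?w - E * N) / (real N + ?Q)\<^sup>2) \<longlonglongrightarrow> ?w"
  proof (rule Lim_transform_eventually)
    show "(\<lambda>N. (?w - E / real N) / (1 + ?Q / real N)\<^sup>2) \<longlonglongrightarrow> ?w"
    proof -
      have "(\<lambda>N. (?w - E / real N) / (1 + ?Q / real N)\<^sup>2) \<longlonglongrightarrow> (?w - 0) / (1 + 0)\<^sup>2"
        by (intro tendsto_intros lim_const_over_n) simp
      then show ?thesis by simp
    qed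
    show "\<forall>\<^sub>F N in sequentially. (?w - E / real N) / (1 + ?Q / real N)\<^sup>2 = ((real N)\<^sup>2 * ?w - E * N) / (real N + ?Q)\<^sup>2"
    proof (rule eventually_mono[OF eventually_gt_at_top[of 0]])
      fix N :: nat assume N: "0 < N"
      have "(?w - E / real N) / (1 + ?Q / real N)\<^sup>2 = ((real N)\<^sup>2 * (?w - E / real N)) / ((real N)\<^sup>2 * (1 + ?Q / real N)\<^sup>2)"
        using N by simp
      also have "(real N)\<^sup>2 * (?w - E / real N) = (real N)\<^sup>2 * ?w - E * N" using N by (simp add: right_diff_distrib power2_eq_square)
      also have "(real N)\<^sup>2 * (1 + ?Q / real N)\<^sup>2 = (real N + ?Q)\<^sup>2"
        using N by (simp add: distrib_left flip: power_mult_distrib)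
      finally show "(?w - E / real N) / (1 + ?Q / real N)\<^sup>2 = ((real N)\<^sup>2 * ?w - E * N) / (real N + ?Q)\<^sup>2" .
    qed
  qed
  have "filterlim (\<lambda>N. card (S N)) at_top sequentially"
  proof (rule filterlim_at_top_mono)
    show "filterlim (\<lambda>N. N - q) at_top sequentially" by (rule filterlim_minus_const_nat_at_top)
    have "N - q \<le> card (S N)" for N using S(2)[of N] by linarith
    then show "\<forall>\<^sub>F N in sequentially. N - q \<le> card (S N)" by simp
  qed
  then have FS: "filterlim S ?F sequentially"
    unfolding filterlim_inf filterlim_principal filterlim_filtercomap_iff by (simp add: S(1) comp_def)
  have "ereal ?w = Limsup sequentially (\<lambda>N. ereal (((real N)\<^sup>2 * ?w - E * N) / (real N + ?Q)\<^sup>2))"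
    using lim by (intro lim_imp_Limsup[symmetric]) auto
  also have "\<dots> \<le> Limsup sequentially (\<lambda>N. ?f (S N))"
    by (rule Limsup_mono, rule eventually_mono[OF eventually_gt_at_top[of q]]) (use lb in auto)
  also have "\<dots> \<le> Limsup (filtermap S sequentially) ?f" by (rule Limsup_filtermap_ge)
  also have "\<dots> \<le> Limsup ?F ?f"
  proof (rule Limsup_greatest)
    fix P assume "eventually P ?F"
    then have "eventually P (filtermap S sequentially)" using FS by (auto simp: filterlim_def le_filter_def)
    then show "Limsup (filtermap S sequentially) ?f \<le> (SUP x\<in>Collect P. ?f x)"
      unfolding Limsup_def by (intro INF_lower) auto
  qed
  finally show ?thesis by (simp add: limsup_density_def)
qed

section \<open>The maximum over all weights\<close>

text \<open>Both areas are compared with the one at the componentwise minima of the parameters,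
  where the one-sided bound \<open>hexagon_area_shrink\<close> applies.\<close>

lemma hexagon_area_diff_abs_le:
  assumes "0 \<le> a" "0 \<le> b" "0 \<le> c" "0 \<le> a'" "0 \<le> b'" "0 \<le> c'"
  shows "\<bar>hexagon_area a' b' c' - hexagon_area a b c\<bar> \<le> \<bar>a' - a\<bar> * (b + b') + \<bar>b' - b\<bar> * (a + a') + \<bar>c' - c\<bar> * (b + b')"
proof -
  have le: "hexagon_area a b c \<le> hexagon_area a' b' c' + (\<bar>a' - a\<bar> * (b + b') + \<bar>b' - b\<bar> * (a + a') + \<bar>c' - c\<bar> * (b + b'))"
    if "0 \<le> a" "0 \<le> b" "0 \<le> c" "0 \<le> a'" "0 \<le> b'" "0 \<le> c'" for a b c a' b' c'
  proof -
    have "hexagon_area a b c \<le> hexagon_area (min a a') (min b b') (min c c') + (a - min a a') * b + (b - min b b') * a + (c - min c c') * b"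
      using that by (intro hexagon_area_shrink) auto
    moreover have "hexagon_area (min a a') (min b b') (min c c') \<le> hexagon_area a' b' c'" by (intro hexagon_area_mono) auto
    moreover have "(a - min a a') * b \<le> \<bar>a' - a\<bar> * (b + b')" "(b - min b b') * a \<le> \<bar>b' - b\<bar> * (a + a')" "(c - min c c') * b \<le> \<bar>c' - c\<bar> * (b + b')"
      using that by (intro mult_mono; simp)+
    ultimately show ?thesis by linarith
  qed
  have sym: "\<bar>a - a'\<bar> * (b' + b) + \<bar>b - b'\<bar> * (a' + a) + \<bar>c - c'\<bar> * (b' + b)
      = \<bar>a' - a\<bar> * (b + b') + \<bar>b' - b\<bar> * (a + a') + \<bar>c' - c\<bar> * (b + b')"
    by (simp add: abs_minus_commute add.commute)
  show ?thesis using le[of a b c a' b' c'] le[of a' b' c' a b c] assms unfolding sym by (simp add: abs_le_iff)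
qed

lemma continuous_on_hexagon_area:
  assumes cont: "continuous_on X f" "continuous_on X g" "continuous_on X h"
    and nonneg: "\<And>x. x \<in> X \<Longrightarrow> 0 \<le> f x" "\<And>x. x \<in> X \<Longrightarrow> 0 \<le> g x" "\<And>x. x \<in> X \<Longrightarrow> 0 \<le> h x"
  shows "continuous_on X (\<lambda>x. hexagon_area (f x) (g x) (h x))"
  unfolding continuous_on_def
proof
  fix x assume x: "x \<in> X"
  have lim: "(f \<longlongrightarrow> f x) (at x within X)" "(g \<longlongrightarrow> g x) (at x within X)" "(h \<longlongrightarrow> h x) (at x within X)"
    using cont x by (auto simp: continuous_on_def)
  have "((\<lambda>y. \<bar>f y - f x\<bar> * (g x + g y) + \<bar>g y - g x\<bar> * (f x + f y) + \<bar>h y - h x\<bar> * (g x + g y)) \<longlongrightarrow>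
      \<bar>f x - f x\<bar> * (g x + g x) + \<bar>g x - g x\<bar> * (f x + f x) + \<bar>h x - h x\<bar> * (g x + g x)) (at x within X)"
    by (intro tendsto_intros lim)
  then have "((\<lambda>y. \<bar>f y - f x\<bar> * (g x + g y) + \<bar>g y - g x\<bar> * (f x + f y) + \<bar>h y - h x\<bar> * (g x + g y)) \<longlongrightarrow> 0) (at x within X)"
    by simp
  then have "((\<lambda>y. hexagon_area (f y) (g y) (h y) - hexagon_area (f x) (g x) (h x)) \<longlongrightarrow> 0) (at x within X)"
  proof (rule Lim_null_comparison[rotated])
    show "\<forall>\<^sub>F y in at x within X. norm (hexagon_area (f y) (g y) (h y) - hexagon_area (f x) (g x) (h x))
        \<le> \<bar>f y - f x\<bar> * (g x + g y) + \<bar>g y - g x\<bar> * (f x + f y) + \<bar>h y - h x\<bar> * (g x + g y)"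
      unfolding eventually_at_filter real_norm_def
      by (rule always_eventually) (use nonneg x in \<open>blast intro: hexagon_area_diff_abs_le\<close>)
  qed
  then show "((\<lambda>x. hexagon_area (f x) (g x) (h x)) \<longlongrightarrow> hexagon_area (f x) (g x) (h x)) (at x within X)"
    by (rule LIM_zero_cancel)
qed

lemma weight_density_cong:
  assumes "\<And>r. r \<in> {0..<int q} \<Longrightarrow> g r = g' r"
  shows "weight_density a1 a2 a3 q g = weight_density a1 a2 a3 q g'"
proof -
  have "(\<Sum>(r1, r2, r3)\<in>zero_triples a1 a2 a3 (int q). hexagon_area (\<bar>a1\<bar> * g r1) (\<bar>a2\<bar> * g r2) (\<bar>a3\<bar> * g r3))
      = (\<Sum>(r1, r2, r3)\<in>zero_triples a1 a2 a3 (int q). hexagon_area (\<bar>a1\<bar> * g' r1) (\<bar>a2\<bar> * g' r2) (\<bar>a3\<bar> * g' r3))"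
  proof (rule sum.cong[OF refl])
    fix p assume p: "p \<in> zero_triples a1 a2 a3 (int q)"
    obtain r1 r2 r3 where "p = (r1, r2, r3)" by (cases p) auto
    moreover from this p have "r1 \<in> {0..<int q}" "r2 \<in> {0..<int q}" "r3 \<in> {0..<int q}" by (simp_all add: zero_triples_def)
    ultimately show "(case p of (r1, r2, r3) \<Rightarrow> hexagon_area (\<bar>a1\<bar> * g r1) (\<bar>a2\<bar> * g r2) (\<bar>a3\<bar> * g r3))
      = (case p of (r1, r2, r3) \<Rightarrow> hexagon_area (\<bar>a1\<bar> * g' r1) (\<bar>a2\<bar> * g' r2) (\<bar>a3\<bar> * g' r3))"
      by (simp only: prod.case assms)
  qed
  then show ?thesis by (simp add: weight_density_eq)
qed

text \<open>Fixing the irrelevant values to zero makes the set a closed subset of a product of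
  compact sets, so that compactness holds in the product topology on all functions.\<close>

lemma compact_residue_weights:
  "compact {g. residue_weight q g \<and> (\<forall>r. r \<notin> {0..<int q} \<longrightarrow> g r = 0)}"
proof -
  let ?B = "\<lambda>r. if r \<in> {0..<int q} then {0..1::real} else {0}"
  have "compactin (product_topology (\<lambda>_. euclidean) UNIV) (PiE UNIV ?B)"
    unfolding compactin_PiE by (auto simp: compactin_euclidean_iff)
  then have 1: "compact (PiE UNIV ?B)" by (simp add: euclidean_product_topology compactin_euclidean_iff)
  have 2: "closed {g :: int \<Rightarrow> real. (\<Sum>r\<in>{0..<int q}. g r) = 1}"
    by (intro closed_Collect_eq continuous_intros continuous_on_product_coordinates)
  have "{g. residue_weight q g \<and> (\<forall>r. r \<notin> {0..<int q} \<longrightarrow> g r = 0)} = PiE UNIV ?B \<inter> {g. (\<Sum>r\<in>{0..<int q}. g r) = 1}"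
  proof (intro set_eqI iffI)
    fix g assume g: "g \<in> PiE UNIV ?B \<inter> {g. (\<Sum>r\<in>{0..<int q}. g r) = 1}"
    then have m: "g r \<in> ?B r" for r by blast
    have "0 \<le> g r \<and> g r \<le> 1" if "r \<in> {0..<int q}" for r using m[of r] that by simp
    moreover have "g r = 0" if "r \<notin> {0..<int q}" for r using m[of r] that by (simp only: if_False singleton_iff)
    ultimately show "g \<in> {g. residue_weight q g \<and> (\<forall>r. r \<notin> {0..<int q} \<longrightarrow> g r = 0)}"
      using g by (simp add: residue_weight_def)
  qed (auto simp: residue_weight_def)
  then show ?thesis using compact_Int_closed[OF 1 2] by simp
qed

lemma exists_maximal_weight:
  assumes q: "0 < q"
  shows "\<exists>g0. residue_weight q g0 \<and> (\<forall>g. residue_weight q g \<longrightarrow> weight_density a1 a2 a3 q g \<le> weight_density a1 a2 a3 q g0)"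
proof -
  let ?X = "{g. residue_weight q g \<and> (\<forall>r. r \<notin> {0..<int q} \<longrightarrow> g r = 0)}"
  have "(\<lambda>r. if r = 0 then 1 else 0) \<in> ?X" using q by (auto simp: residue_weight_def)
  then have ne: "?X \<noteq> {}" by blast
  have c: "continuous_on ?X (\<lambda>g. \<bar>a\<bar> * g r)" for a r :: int
    by (intro continuous_on_mult_left continuous_on_subset[OF continuous_on_product_coordinates subset_UNIV])
  have "continuous_on ?X (\<lambda>g. hexagon_area (\<bar>a1\<bar> * g r1) (\<bar>a2\<bar> * g r2) (\<bar>a3\<bar> * g r3))" for r1 r2 r3
  proof (rule continuous_on_hexagon_area[OF c c c])
    fix g assume g: "g \<in> ?X"
    have "0 \<le> g r" for r using g by (cases "r \<in> {0..<int q}") (simp_all add: residue_weight_def)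
    then show "0 \<le> real_of_int \<bar>a1\<bar> * g r1" "0 \<le> real_of_int \<bar>a2\<bar> * g r2" "0 \<le> real_of_int \<bar>a3\<bar> * g r3"
      by (simp_all only: mult_nonneg_nonneg of_int_0_le_iff abs_ge_zero)
  qed
  then have "continuous_on ?X (weight_density a1 a2 a3 q)"
    unfolding weight_density_eq case_prod_unfold by (intro continuous_intros) simp
  then obtain g0 where g0: "g0 \<in> ?X" "\<And>g. g \<in> ?X \<Longrightarrow> weight_density a1 a2 a3 q g \<le> weight_density a1 a2 a3 q g0"
    using continuous_attains_sup[OF compact_residue_weights ne] by blast
  have "weight_density a1 a2 a3 q g \<le> weight_density a1 a2 a3 q g0" if g: "residue_weight q g" for g
  proof -
    let ?g = "\<lambda>r. if r \<in> {0..<int q} then g r else 0"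
    have "?g \<in> ?X" using g by (simp add: residue_weight_def)
    moreover have "weight_density a1 a2 a3 q g = weight_density a1 a2 a3 q ?g" by (rule weight_density_cong) simp
    ultimately show ?thesis using g0(2) by simp
  qed
  then show ?thesis using g0(1) by blast
qed

lemma max_weight_density:
  assumes q: "0 < q"
  shows max_weight_density_attained: "\<exists>g. residue_weight q g \<and> max_weight_density a1 a2 a3 q = weight_density a1 a2 a3 q g"
    and weight_density_le_max: "residue_weight q g \<Longrightarrow> weight_density a1 a2 a3 q g \<le> max_weight_density a1 a2 a3 q"
proof -
  obtain g0 where g0: "residue_weight q g0" "\<And>g. residue_weight q g \<Longrightarrow> weight_density a1 a2 a3 q g \<le> weight_density a1 a2 a3 q g0"
    using exists_maximal_weight[OF q] by blast
  have "max_weight_density a1 a2 a3 q = weight_density a1 a2 a3 q g0"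
    unfolding max_weight_density_def by (rule Greatest_equality) (use g0 in blast)+
  then show "\<exists>g. residue_weight q g \<and> max_weight_density a1 a2 a3 q = weight_density a1 a2 a3 q g"
    "residue_weight q g \<Longrightarrow> weight_density a1 a2 a3 q g \<le> max_weight_density a1 a2 a3 q"
    using g0 by auto
qed

lemma weight_density_nonneg: "0 \<le> weight_density a1 a2 a3 q g"
  unfolding weight_density_eq by (intro mult_nonneg_nonneg sum_nonneg) (simp_all add: case_prod_unfold)

section \<open>The limit superior\<close>

lemma eventually_finite_card:
  "eventually P (inf (filtercomap card at_top) (principal {S :: int set. finite S}))
     \<longleftrightarrow> (\<exists>N. \<forall>S. finite S \<longrightarrow> N \<le> card S \<longrightarrow> P S)"
  unfolding eventually_inf_principal eventually_filtercomap_at_top_linorder mem_Collect_eq by (rule ex_cong1) blast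

lemma num_solutions_le:
  assumes "a1 \<noteq> 0" "a2 \<noteq> 0" "a3 \<noteq> 0" "finite S"
  shows "real (num_solutions a1 a2 a3 S) \<le> (real (card S))\<^sup>2"
proof -
  have "num_solutions a1 a2 a3 S \<le> card S * card S"
    unfolding num_solutions_eq_tri by (rule card_tri_le(1)) (use assms in auto)
  then have "real (num_solutions a1 a2 a3 S) \<le> real (card S * card S)" by (simp only: of_nat_le_iff)
  then show ?thesis by (simp add: power2_eq_square)
qed

text \<open>A large \<open>S0\<close> of density above \<open>\<gamma> - \<delta> / 4\<close> has
  value \<open>?v\<close> at least \<open>\<delta> / 4\<close> times its squared size, and the
  maximiser \<open>S\<close> of \<open>?v\<close> among its subsets is no worse. As
  \<open>?v S\<close> is at most the square of \<open>card S\<close>, this forces \<open>S\<close>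
  to be large too, so that the eventual bound \<open>\<gamma> + \<delta> / 2\<close> on the density
  holds for \<open>S\<close>.\<close>

lemma exists_extremal:
  assumes nz: "a1 \<noteq> 0" "a2 \<noteq> 0" "a3 \<noteq> 0" and \<gamma>: "limsup_density a1 a2 a3 = ereal \<gamma>" and \<delta>: "0 < \<delta>" "\<delta> / 2 < \<gamma>"
  shows "\<exists>S. extremal a1 a2 a3 (\<gamma> - \<delta> / 2) \<delta> S \<and> N0 \<le> card S"
proof -
  let ?F = "inf (filtercomap card at_top) (principal {S :: int set. finite S})"
  let ?T = "\<lambda>S. real (num_solutions a1 a2 a3 S)" and ?N = "\<lambda>S. real (card S)"
  let ?f = "\<lambda>S. ereal (?T S / (?N S)\<^sup>2)"
  define \<kappa> where "\<kappa> = \<gamma> - \<delta> / 2"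
  have \<kappa>0: "0 < \<kappa>" using \<delta> by (simp add: \<kappa>_def)
  have L: "Limsup ?F ?f = ereal \<gamma>" using \<gamma> by (simp add: limsup_density_def)
  have "eventually (\<lambda>S. ?f S < ereal (\<gamma> + \<delta> / 2)) ?F"
    by (rule Limsup_lessD) (use L \<delta> in simp)
  then obtain N1 where N1: "\<And>S. finite S \<Longrightarrow> N1 \<le> card S \<Longrightarrow> ?f S < ereal (\<gamma> + \<delta> / 2)"
    unfolding eventually_finite_card by blast
  have "\<not> eventually (\<lambda>S. ?f S \<le> ereal (\<gamma> - \<delta> / 4)) ?F"
  proof
    assume "eventually (\<lambda>S. ?f S \<le> ereal (\<gamma> - \<delta> / 4)) ?F"
    then have "Limsup ?F ?f \<le> ereal (\<gamma> - \<delta> / 4)" by (rule Limsup_bounded)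
    then show False using L \<delta> by simp
  qed
  then have many: "\<exists>S. finite S \<and> N \<le> card S \<and> \<gamma> - \<delta> / 4 < ?T S / (?N S)\<^sup>2" for N
    unfolding eventually_finite_card by (auto simp: not_le)
  define N2 where "N2 = max (max N0 N1) 1"
  obtain N :: nat where N: "(real N2)\<^sup>2 / (\<delta> / 4) < real N" using reals_Archimedean2 by blast
  obtain S0 where S0: "finite S0" "max N 1 \<le> card S0" "\<gamma> - \<delta> / 4 < ?T S0 / (?N S0)\<^sup>2" using many by blast
  let ?v = "\<lambda>S. ?T S - \<kappa> * (?N S)\<^sup>2"
  have S0pos: "1 \<le> ?N S0" "real N \<le> ?N S0" using S0(2) by auto
  have big: "(real N2)\<^sup>2 \<le> ?v S0"
  proof -
    have "(real N2)\<^sup>2 \<le> \<delta> / 4 * real N" using N \<delta> by (simp add: field_simps)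
    also have "\<dots> \<le> \<delta> / 4 * (?N S0)\<^sup>2"
    proof -
      have "real N \<le> ?N S0 * ?N S0" using S0pos mult_mono[of 1 "?N S0" "real N" "?N S0"] by simp
      then show ?thesis using \<delta> by (intro mult_left_mono) (auto simp: power2_eq_square)
    qed
    also have "\<dots> \<le> ?v S0"
    proof -
      have "(\<gamma> - \<delta> / 4) * (?N S0)\<^sup>2 \<le> ?T S0" using S0(3) S0pos by (simp add: field_simps)
      then show ?thesis by (simp add: \<kappa>_def algebra_simps)
    qed
    finally show ?thesis .
  qed
  have fP: "finite (?v ` Pow S0)" using S0(1) by simp
  have "Max (?v ` Pow S0) \<in> ?v ` Pow S0" by (rule Max_in[OF fP]) blast
  then obtain S where "Max (?v ` Pow S0) = ?v S" "S \<in> Pow S0" by (rule imageE)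
  then have S: "S \<subseteq> S0" "?v S = Max (?v ` Pow S0)" by simp_all
  have max: "?v S' \<le> ?v S" if "S' \<subseteq> S0" for S'
    unfolding S(2) by (rule Max_ge[OF fP]) (use that in blast)
  have finS: "finite S" using S(1) S0(1) by (rule finite_subset)
  have "(real N2)\<^sup>2 \<le> ?v S" using big max[of S0] by simp
  moreover have "?v S \<le> (?N S)\<^sup>2"
  proof -
    have "0 \<le> \<kappa> * (?N S)\<^sup>2" using \<kappa>0 by simp
    then show ?thesis using num_solutions_le[OF nz finS] by linarith
  qed
  ultimately have "(real N2)\<^sup>2 \<le> (?N S)\<^sup>2" by (rule order_trans)
  then have "real N2 \<le> ?N S" by (rule power2_le_imp_le) simp
  then have "N2 \<le> card S" by (simp only: of_nat_le_iff)
  then have NS: "N0 \<le> card S" "N1 \<le> card S" "1 \<le> card S" unfolding N2_def by linarith+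
  have "?T S \<le> (\<kappa> + \<delta>) * (?N S)\<^sup>2"
  proof -
    have "?T S / (?N S)\<^sup>2 < \<kappa> + \<delta>" using N1[OF finS NS(2)] by (simp add: \<kappa>_def)
    moreover have "0 < (?N S)\<^sup>2" using NS(3) by simp
    ultimately show ?thesis by (simp add: pos_divide_less_eq)
  qed
  moreover have "?v S' \<le> ?v S" if "S' \<subseteq> S" for S' using that S(1) by (intro max) blast
  ultimately have "extremal a1 a2 a3 \<kappa> \<delta> S"
    using finS unfolding extremal_def num_solutions_eq_tri by blast
  then show ?thesis using NS(1) unfolding \<kappa>_def by blast
qed

section \<open>The upper bound for the limit superior\<close>

lemma ncls_mono:
  assumes "finite B" "A \<subseteq> B"
  shows "ncls A q \<le> ncls B q"
  unfolding ncls_def using assms by (intro card_mono image_mono) auto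

text \<open>Each role has at most \<open>\<xi> * card S\<close> exceptional elements, each in at
  most \<open>card S\<close> solutions. After their removal the hypothesis of
  \<open>card_tri_uniform_le\<close> survives, because counts in a smaller set only
  decrease.\<close>

lemma card_tri_le_weight_density:
  fixes a1 a2 a3 D q :: int and \<xi> :: real and S :: "int set"
  assumes nz: "a1 \<noteq> 0" "a2 \<noteq> 0" "a3 \<noteq> 0" and D: "D = \<bar>a1 * a2 * a3\<bar>" and b: "a1 * b1 + a2 * b2 + a3 * b3 = 1"
    and S: "finite S" "S \<noteq> {}" and q: "0 < q" and \<xi>: "0 \<le> \<xi>" and sub: "S1 \<subseteq> S" "S2 \<subseteq> S" "S3 \<subseteq> S"
    and X: "\<forall>(a, X) \<in> {(a1, S1), (a2, S2), (a3, S3)}. ncls ((*) a ` X) (q * D) \<le> M \<and>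
        real (card {x \<in> X. \<not> cnt ((*) a ` X) (q * D) (a * x) \<le> (1 + \<xi>) * (real_of_int \<bar>a\<bar> / D) * cnt X q x}) \<le> \<xi> * card S"
  shows "real (card (tri a1 a2 a3 S1 S2 S3)) \<le> (1 + \<xi>)\<^sup>2 * (real (card S))\<^sup>2 * weight_density a1 a2 a3 (nat q) (\<lambda>r. cnt S q r / card S)
     + (real M)\<^sup>2 / 4 + 3 * \<xi> * (real (card S))\<^sup>2"
proof -
  let ?N = "real (card S)"
  define good where "good a X x \<longleftrightarrow> cnt ((*) a ` X) (q * D) (a * x) \<le> (1 + \<xi>) * (real_of_int \<bar>a\<bar> / D) * cnt X q x" for a X x
  define G where "G a X = {x \<in> X. good a X x}" for a X
  define B where "B a X = {x \<in> X. \<not> good a X x}" for a X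
  have fin: "finite S1" "finite S2" "finite S3" using sub S(1) finite_subset by blast+
  have ncl: "ncls ((*) a1 ` S1) (q * D) \<le> M" "ncls ((*) a2 ` S2) (q * D) \<le> M"
    using X by simp_all
  have bad: "real (card (B a1 S1)) \<le> \<xi> * ?N" "real (card (B a2 S2)) \<le> \<xi> * ?N" "real (card (B a3 S3)) \<le> \<xi> * ?N"
    using X unfolding B_def good_def by simp_all
  have GX: "G a X \<subseteq> X" "B a X \<subseteq> X" "X = G a X \<union> B a X" for a X by (auto simp: G_def B_def)
  have D0: "0 < D" using nz by (simp add: D)
  have good: "cnt ((*) a ` G a X) (q * D) (a * x) \<le> (1 + \<xi>) * (real_of_int \<bar>a\<bar> / D) * cnt S q x"
    if "X \<subseteq> S" "x \<in> G a X" for a X x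
  proof -
    have fX: "finite X" using that(1) S(1) finite_subset by blast
    have "cnt ((*) a ` G a X) (q * D) (a * x) \<le> cnt ((*) a ` X) (q * D) (a * x)"
      by (intro cnt_mono image_mono GX finite_imageI fX)
    moreover have "cnt ((*) a ` X) (q * D) (a * x) \<le> (1 + \<xi>) * (real_of_int \<bar>a\<bar> / D) * cnt X q x"
      using that(2) by (simp add: G_def good_def)
    moreover have "(1 + \<xi>) * (real_of_int \<bar>a\<bar> / D) * cnt X q x \<le> (1 + \<xi>) * (real_of_int \<bar>a\<bar> / D) * cnt S q x"
      using \<xi> D0 by (intro mult_left_mono cnt_mono S that(1)) simp
    ultimately show ?thesis by linarith
  qed
  have nclG: "ncls ((*) a1 ` G a1 S1) (q * D) \<le> M" "ncls ((*) a2 ` G a2 S2) (q * D) \<le> M"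
    using ncl order_trans[OF ncls_mono[OF finite_imageI[OF fin(1)] image_mono[OF GX(1)]]]
      order_trans[OF ncls_mono[OF finite_imageI[OF fin(2)] image_mono[OF GX(1)]]] by blast+
  have GS: "G a1 S1 \<subseteq> S" "G a2 S2 \<subseteq> S" "G a3 S3 \<subseteq> S" using GX(1) sub by blast+
  have main: "real (card (tri a1 a2 a3 (G a1 S1) (G a2 S2) (G a3 S3)))
     \<le> (1 + \<xi>)\<^sup>2 * ?N\<^sup>2 * weight_density a1 a2 a3 (nat q) (\<lambda>r. cnt S q r / card S) + (real M)\<^sup>2 / 4"
    by (rule card_tri_uniform_le[OF nz D b S q \<xi> GS nclG good[OF sub(1)] good[OF sub(2)] good[OF sub(3)]])
  have finB: "finite (B a1 S1)" "finite (B a2 S2)" "finite (B a3 S3)" using GX(2) fin finite_subset by blast+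
  have finG: "finite (G a1 S1)" "finite (G a2 S2)" "finite (G a3 S3)" using GX(1) fin finite_subset by blast+
  let ?T = "tri a1 a2 a3"
  let ?G = "?T (G a1 S1) (G a2 S2) (G a3 S3)"
  have "?T S1 S2 S3 \<subseteq> ?G \<union> ?T (B a1 S1) S S \<union> ?T S (B a2 S2) S \<union> ?T S S (B a3 S3)"
  proof
    fix p assume p: "p \<in> ?T S1 S2 S3"
    obtain x y z where xyz: "p = (x, y, z)" by (cases p) auto
    have "x \<in> S1" "y \<in> S2" "z \<in> S3" and eq: "a1 * x + a2 * y + a3 * z = 0" using p by (simp_all add: xyz tri_def)
    then have "x \<in> G a1 S1 \<or> x \<in> B a1 S1" "y \<in> G a2 S2 \<or> y \<in> B a2 S2" "z \<in> G a3 S3 \<or> z \<in> B a3 S3" "x \<in> S" "y \<in> S" "z \<in> S"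
      using GX(3) sub by blast+
    then show "p \<in> ?G \<union> ?T (B a1 S1) S S \<union> ?T S (B a2 S2) S \<union> ?T S S (B a3 S3)"
      using eq by (simp add: xyz tri_def) blast
  qed
  then have "card (?T S1 S2 S3) \<le> card (?G \<union> ?T (B a1 S1) S S \<union> ?T S (B a2 S2) S \<union> ?T S S (B a3 S3))"
    using finB finG S(1) by (intro card_mono) auto
  moreover have "card (?G \<union> ?T (B a1 S1) S S \<union> ?T S (B a2 S2) S \<union> ?T S S (B a3 S3))
      \<le> card ?G + card (?T (B a1 S1) S S) + card (?T S (B a2 S2) S) + card (?T S S (B a3 S3))"
    using card_Un_le[of "?G \<union> ?T (B a1 S1) S S \<union> ?T S (B a2 S2) S" "?T S S (B a3 S3)"]
      card_Un_le[of "?G \<union> ?T (B a1 S1) S S" "?T S (B a2 S2) S"] card_Un_le[of ?G "?T (B a1 S1) S S"] by linarith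
  moreover have "card (?T (B a1 S1) S S) \<le> card (B a1 S1) * card S" by (rule card_tri_le(1)[OF nz finB(1) S(1) S(1)])
  moreover have "card (?T S (B a2 S2) S) \<le> card (B a2 S2) * card S" by (rule card_tri_le(2)[OF nz S(1) finB(2) S(1)])
  moreover have "card (?T S S (B a3 S3)) \<le> card (B a3 S3) * card S"
    using card_tri_le(2)[OF nz S(1) S(1) finB(3)] by (simp only: mult.commute)
  ultimately have "card (?T S1 S2 S3) \<le> card ?G + card (B a1 S1) * card S + card (B a2 S2) * card S + card (B a3 S3) * card S"
    by linarith
  then have "real (card (?T S1 S2 S3)) \<le> real (card ?G + card (B a1 S1) * card S + card (B a2 S2) * card S + card (B a3 S3) * card S)"
    by (simp only: of_nat_le_iff)
  then have 1: "real (card (?T S1 S2 S3)) \<le> real (card ?G) + real (card (B a1 S1)) * ?N + real (card (B a2 S2)) * ?N + real (card (B a3 S3)) * ?N"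
    by simp
  have "real (card (B a1 S1)) * ?N \<le> \<xi> * ?N\<^sup>2" "real (card (B a2 S2)) * ?N \<le> \<xi> * ?N\<^sup>2" "real (card (B a3 S3)) * ?N \<le> \<xi> * ?N\<^sup>2"
    using bad mult_right_mono[of _ "\<xi> * ?N" ?N] by (simp_all add: power2_eq_square mult.assoc)
  then show ?thesis using 1 main by linarith
qed

text \<open>The constants are fixed in the order of their definitions, each depending only on
  earlier ones, and \<open>S\<close> is taken after all of them. The decisive dependence is that of
  \<open>l\<close> on \<open>K ^ J\<close>; it is possible because the homogeneity of class sizes
  holds with one factor for all moduli.\<close>

lemma limsup_density_upper_bound:
  fixes a1 a2 a3 b1 b2 b3 D :: int and \<gamma> s :: real
  assumes nz: "a1 \<noteq> 0" "a2 \<noteq> 0" "a3 \<noteq> 0" and b: "a1 * b1 + a2 * b2 + a3 * b3 = 1" and D: "D = \<bar>a1 * a2 * a3\<bar>"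
    and \<gamma>: "limsup_density a1 a2 a3 = ereal \<gamma>" "\<gamma> \<le> 1" and s: "0 \<le> s"
    and bound: "\<And>q g. dsmooth D q \<Longrightarrow> residue_weight (nat q) g \<Longrightarrow> weight_density a1 a2 a3 (nat q) g \<le> s"
  shows "\<gamma> \<le> s"
proof (rule ccontr)
  assume "\<not> \<gamma> \<le> s"
  then have gs: "s < \<gamma>" by simp
  have D0: "0 < D" using nz by (simp add: D)
  have D1: "1 \<le> real_of_int D" using D0 by simp
  \<comment> \<open>Half of the gap \<open>\<gamma> - s\<close> is \<open>18 * \<xi>\<close>. The
    errors, relative to the squared size of \<open>S\<close>, are \<open>3 * \<xi>\<close> each from
    the rich core, the exceptional elements and the factor \<open>1 + \<xi>\<close>, plus at most
    \<open>\<xi> / 4\<close> from the cells.\<close>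
  define \<xi> where "\<xi> = (\<gamma> - s) / 36"
  define \<epsilon> where "\<epsilon> = \<xi> / 128"
  define \<tau> where "\<tau> = \<epsilon> / (16 * real_of_int D)"
  \<comment> \<open>A lower bound for the right-hand side of \<open>small\<close>;
    \<open>\<delta>\<close>, \<open>3 / J\<close> and \<open>6 * D / K\<close> each take at most a
    quarter of it.\<close>
  define \<beta> where "\<beta> = (s + \<gamma>) * \<tau>\<^sup>2"
  define \<delta> where "\<delta> = min (\<gamma> - s) (\<beta> / 4)"
  define K where "K = 1 + 24 * real_of_int D / \<beta>"
  have \<xi>: "0 < \<xi>" "\<xi> \<le> 1" using gs \<gamma>(2) s by (simp_all add: \<xi>_def)
  have \<epsilon>: "0 < \<epsilon>" "128 * \<epsilon> \<le> \<xi>" using \<xi> by (simp_all add: \<epsilon>_def)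
  have \<tau>: "0 < \<tau>" "16 * D * \<tau> \<le> \<epsilon>" using \<epsilon> D0 by (simp_all add: \<tau>_def)
  have \<beta>: "0 < \<beta>" using gs s \<tau> by (simp add: \<beta>_def)
  have \<delta>: "0 < \<delta>" "\<delta> \<le> \<gamma> - s" "\<delta> \<le> \<beta> / 4" using gs \<beta> unfolding \<delta>_def by (simp, linarith+)
  have K: "1 < K" using D1 \<beta> by (simp add: K_def)
  obtain J :: nat where "12 / \<beta> < real J" using reals_Archimedean2 by blast
  moreover have "0 < 12 / \<beta>" using \<beta> by simp
  ultimately have J: "12 / \<beta> < real J" "0 < real J" by linarith+
  obtain l :: nat where l0: "8 * (real_of_int D)\<^sup>2 * (K ^ J)\<^sup>2 / \<tau>\<^sup>2 < 2 ^ l" using real_arch_pow[of 2] by auto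
  have l: "8 * (real_of_int D)\<^sup>2 * (K ^ J)\<^sup>2 < \<tau>\<^sup>2 * 2 ^ l"
    using l0 \<tau>(1) by (simp add: pos_divide_less_eq mult.commute)
  define m where "m = D ^ Suc l"
  have m0: "0 < m" using D0 by (simp add: m_def)
  have m1: "0 < real_of_int m" using m0 by simp
  \<comment> \<open>The three bounds serve the equality case of Cauchy-Schwarz, the accuracy
    \<open>(8 + m) * t\<close> of class counts, and the proportion of light elements.\<close>
  define t where "t = min (1 / (8 * real_of_int m)) (min (\<xi> / (6 * (real_of_int m)\<^sup>2 * (8 + real_of_int m))) (\<tau> / (2 * real_of_int m * (8 + real_of_int m))))"
  have t: "0 < t" "t \<le> 1 / (8 * real_of_int m)" "t \<le> \<xi> / (6 * (real_of_int m)\<^sup>2 * (8 + real_of_int m))" "t \<le> \<tau> / (2 * real_of_int m * (8 + real_of_int m))"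
    using m1 \<xi> \<tau> unfolding t_def by (simp, linarith+)
  have t3: "6 * (real_of_int m)\<^sup>2 * ((8 + real_of_int m) * t) \<le> \<xi>"
  proof -
    have "0 < 6 * (real_of_int m)\<^sup>2 * (8 + real_of_int m)" using m1 by simp
    then show ?thesis using t(3) by (simp only: pos_le_divide_eq mult_ac)
  qed
  have t4: "real_of_int m * ((8 + real_of_int m) * t) \<le> \<tau> / 2"
  proof -
    have "0 < 2 * real_of_int m * (8 + real_of_int m)" using m1 by simp
    then have "t * (2 * real_of_int m * (8 + real_of_int m)) \<le> \<tau>" using t(4) by (simp only: pos_le_divide_eq)
    then show ?thesis by (simp add: mult_ac)
  qed
  \<comment> \<open>The first bound makes concentration self-improving, the second keeps the
    elements that lie only in solutions of large loss below a share
    \<open>\<tau> / 2\<close>.\<close>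
  define \<eta> where "\<eta> = min (\<epsilon> * \<xi> / 4) (\<tau> * (t ^ 3 * \<xi>) / 16)"
  have \<eta>: "0 < \<eta>" "4 * \<eta> \<le> \<epsilon> * \<xi>" "16 * \<eta> \<le> \<tau> * (t ^ 3 * \<xi>)"
    using \<epsilon> \<xi> \<tau> t(1) unfolding \<eta>_def by (simp, linarith+)
  have \<eta>3: "8 * \<eta> / (t ^ 3 * \<xi>) \<le> \<tau> / 2"
  proof -
    have "0 < t ^ 3 * \<xi>" using t \<xi> by simp
    then show ?thesis using \<eta>(3) by (simp add: pos_divide_le_eq)
  qed
  obtain n :: nat where n: "6 / \<eta> \<le> real n" using real_arch_simple by blast
  define M where "M = nat m * cell_bound (nat m) n"
  obtain N0 :: nat where N0: "max (real M) 1 / \<xi> < real N0" using reals_Archimedean2 by blast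
  define \<kappa> where "\<kappa> = \<gamma> - \<delta> / 2"
  have \<kappa>: "(s + \<gamma>) / 2 \<le> \<kappa>" "0 < \<kappa>" using \<delta> gs s by (simp_all add: \<kappa>_def)
  obtain S where ext: "extremal a1 a2 a3 \<kappa> \<delta> S" and NS: "N0 \<le> card S"
    unfolding \<kappa>_def using exists_extremal[OF nz \<gamma>(1) \<delta>(1), of N0] \<kappa>(2) by (auto simp: \<kappa>_def)
  let ?N = "real (card S)"
  have S: "finite S" using ext by (simp add: extremal_def)
  have "max (real M) 1 / \<xi> < ?N" using N0 NS by linarith
  then have NM: "max (real M) 1 < \<xi> * ?N" using \<xi> by (simp add: pos_divide_less_eq mult.commute)
  then have "0 < \<xi> * ?N" by linarith
  then have Npos: "0 < ?N" using \<xi> by (simp add: zero_less_mult_iff)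
  then have ne: "S \<noteq> {}" by auto
  have large: "real (cell_bound (nat m) n) < \<xi> * ?N"
  proof -
    have "1 * cell_bound (nat m) n \<le> nat m * cell_bound (nat m) n" using m0 by (intro mult_right_mono) auto
    then have "real (cell_bound (nat m) n) \<le> real M" unfolding M_def by (simp only: of_nat_le_iff mult_1)
    then show ?thesis using NM by linarith
  qed
  have small: "\<delta> + 3 * (1 / J) + 6 * real_of_int D / K < 2 * \<kappa> * \<tau>\<^sup>2"
  proof -
    have "3 * (1 / J) < \<beta> / 4" using J \<beta> by (simp add: field_simps)
    moreover have "6 * real_of_int D / K < \<beta> / 4"
    proof -
      have "K * (\<beta> / 4) = \<beta> / 4 + 6 * real_of_int D" using \<beta> by (simp add: K_def field_simps)
      then have "6 * real_of_int D < \<beta> / 4 * K" using \<beta> by (simp add: mult.commute)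
      then show ?thesis using K by (simp add: pos_divide_less_eq)
    qed
    moreover have "\<beta> \<le> 2 * \<kappa> * \<tau>\<^sup>2" unfolding \<beta>_def using \<kappa> by (intro mult_right_mono) auto
    ultimately show ?thesis using \<delta>(3) \<beta> by linarith
  qed
  have tm: "t \<le> 1 / (8 * m)" "6 * (real_of_int m)\<^sup>2 * ((8 + m) * t) \<le> \<xi>" "m * ((8 + m) * t) \<le> \<tau> / 2"
    unfolding of_int_mult of_int_add of_int_numeral by (rule t(2) t3 t4)+
  have \<xi>\<kappa>: "3 * \<xi> < \<kappa>" using \<kappa>(1) gs s by (simp add: \<xi>_def)
  have J0: "0 < J" using J(2) by simp
  obtain S1 S2 S3 q where sub: "S1 \<subseteq> S" "S2 \<subseteq> S" "S3 \<subseteq> S" and q: "dsmooth D q"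
    and T: "real (card (tri a1 a2 a3 S S S)) \<le> real (card (tri a1 a2 a3 S1 S2 S3)) + 3 * \<xi> * ?N\<^sup>2"
    and X: "\<forall>(a, X) \<in> {(a1, S1), (a2, S2), (a3, S3)}. ncls ((*) a ` X) (q * D) \<le> M \<and>
        real (card {x \<in> X. \<not> cnt ((*) a ` X) (q * D) (a * x) \<le> (1 + \<xi>) * (real_of_int \<bar>a\<bar> / D) * cnt X q x}) \<le> \<xi> * card S"
    using exists_uniform_modulus[OF D m_def ext nz \<kappa>(2) ne \<xi> \<xi>\<kappa> \<epsilon> \<tau> K J0 small l t(1) tm \<eta>(1,2) \<eta>3 n large]
    unfolding M_def by blast
  have q0: "0 < q" using q by (simp add: dsmooth_def)
  let ?w = "weight_density a1 a2 a3 (nat q) (\<lambda>r. cnt S q r / card S)"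
  have w: "?w \<le> s" by (rule bound[OF q residue_weight_cnt[OF S ne q0]])
  have T2: "real (card (tri a1 a2 a3 S1 S2 S3)) \<le> (1 + \<xi>)\<^sup>2 * ?N\<^sup>2 * ?w + (real M)\<^sup>2 / 4 + 3 * \<xi> * ?N\<^sup>2"
    by (rule card_tri_le_weight_density[OF nz D b S ne q0 less_imp_le[OF \<xi>(1)] sub X])
  have "(1 + \<xi>)\<^sup>2 * ?w \<le> s + 3 * \<xi>"
  proof -
    have "(1 + \<xi>)\<^sup>2 * ?w \<le> (1 + \<xi>)\<^sup>2 * s" using w by (intro mult_left_mono) auto
    moreover have "(1 + \<xi>)\<^sup>2 * s \<le> (1 + 3 * \<xi>) * s"
    proof (rule mult_right_mono[OF _ s])
      have "\<xi> * \<xi> \<le> \<xi> * 1" using \<xi> by (intro mult_left_mono) auto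
      then show "(1 + \<xi>)\<^sup>2 \<le> 1 + 3 * \<xi>" by (simp add: power2_eq_square algebra_simps)
    qed
    moreover have "(1 + 3 * \<xi>) * s = s + 3 * \<xi> * s" by (simp add: algebra_simps)
    moreover have "3 * \<xi> * s \<le> 3 * \<xi> * 1" using gs \<gamma>(2) \<xi> by (intro mult_left_mono) auto
    ultimately show ?thesis by linarith
  qed
  then have "(1 + \<xi>)\<^sup>2 * ?w * ?N\<^sup>2 \<le> (s + 3 * \<xi>) * ?N\<^sup>2" by (rule mult_right_mono) simp
  then have 1: "(1 + \<xi>)\<^sup>2 * ?N\<^sup>2 * ?w \<le> s * ?N\<^sup>2 + 3 * \<xi> * ?N\<^sup>2" by (simp add: algebra_simps)
  have 2: "(real M)\<^sup>2 \<le> \<xi> * ?N\<^sup>2"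
  proof -
    have "(real M)\<^sup>2 \<le> (\<xi> * ?N)\<^sup>2" using NM by (intro power_mono) auto
    also have "\<dots> = \<xi> * (\<xi> * ?N\<^sup>2)" by (simp add: power2_eq_square mult_ac)
    also have "\<dots> \<le> 1 * (\<xi> * ?N\<^sup>2)" using \<xi> by (intro mult_right_mono) auto
    finally show ?thesis by simp
  qed
  have "\<kappa> * ?N\<^sup>2 \<le> real (card (tri a1 a2 a3 S S S))"
  proof -
    have "real (card (tri a1 a2 a3 {} {} {})) - \<kappa> * (real (card ({} :: int set)))\<^sup>2 \<le> real (card (tri a1 a2 a3 S S S)) - \<kappa> * ?N\<^sup>2"
      using ext unfolding extremal_def by blast
    moreover have "tri a1 a2 a3 {} {} {} = {}" by (simp add: tri_def)
    ultimately show ?thesis by simp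
  qed
  moreover have "(s + \<gamma>) / 2 * ?N\<^sup>2 \<le> \<kappa> * ?N\<^sup>2" using \<kappa>(1) by (intro mult_right_mono) auto
  moreover have "(s + \<gamma>) / 2 * ?N\<^sup>2 = s * ?N\<^sup>2 + 18 * (\<xi> * ?N\<^sup>2)" by (simp add: \<xi>_def field_simps)
  moreover have "0 < \<xi> * ?N\<^sup>2" using \<xi> Npos by simp
  ultimately show False using T T2 1 2 by linarith
qed

lemma dsmooth_nat_iff:
  assumes "0 < q"
  shows "dsmooth \<bar>D\<bar> q \<longleftrightarrow> (\<forall>p :: nat. prime p \<and> p dvd nat q \<longrightarrow> int p dvd D)"
proof
  assume q: "dsmooth \<bar>D\<bar> q"
  show "\<forall>p :: nat. prime p \<and> p dvd nat q \<longrightarrow> int p dvd D"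
  proof (intro allI impI)
    fix p :: nat assume p: "prime p \<and> p dvd nat q"
    then have "int p dvd q" using assms by (simp add: nat_dvd_iff flip: int_dvd_int_iff)
    then show "int p dvd D" using q p by (simp add: dsmooth_def)
  qed
next
  assume *: "\<forall>p :: nat. prime p \<and> p dvd nat q \<longrightarrow> int p dvd D"
  have "p dvd \<bar>D\<bar>" if p: "prime p" "p dvd q" for p :: int
  proof -
    have p0: "0 \<le> p" using p(1) prime_ge_0_int by blast
    then have "prime (nat p)" "nat p dvd nat q" using p assms by (simp_all add: nat_dvd_iff)
    then have "int (nat p) dvd D" using * by blast
    then show ?thesis using p0 by simp
  qed
  then show "dsmooth \<bar>D\<bar> q" using assms by (simp add: dsmooth_def)
qed

lemma bezout_three:
  fixes a1 a2 a3 :: int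
  assumes "Gcd {a1, a2, a3} = 1"
  shows "\<exists>b1 b2 b3. a1 * b1 + a2 * b2 + a3 * b3 = 1"
proof -
  obtain u v where uv: "u * a1 + v * gcd a2 a3 = gcd a1 (gcd a2 a3)" using bezout_int by blast
  obtain x y where xy: "x * a2 + y * a3 = gcd a2 a3" using bezout_int by blast
  have "gcd a1 (gcd a2 a3) = 1" using assms by simp
  then have "a1 * u + a2 * (v * x) + a3 * (v * y) = 1" using uv unfolding xy[symmetric] by (simp add: algebra_simps)
  then show ?thesis by blast
qed

theorem theorem1p4:
  fixes a1 a2 a3 :: int
  assumes "a1 \<noteq> 0" "a2 \<noteq> 0" "a3 \<noteq> 0"
    and "Gcd {a1, a2, a3} = 1"
  shows "limsup_density a1 a2 a3 =
           (SUP q \<in> {q :: nat. q > 0}. ereal (max_weight_density a1 a2 a3 q)) \<and>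
         limsup_density a1 a2 a3 =
           (SUP q \<in> {q :: nat. q > 0 \<and> (\<forall>p :: nat. prime p \<and> p dvd q \<longrightarrow> int p dvd a1 * a2 * a3)}.
              ereal (max_weight_density a1 a2 a3 q))"
proof -
  note nz = assms(1-3)
  obtain b1 b2 b3 where b: "a1 * b1 + a2 * b2 + a3 * b3 = 1" using bezout_three[OF assms(4)] by blast
  define smooth where "smooth q \<longleftrightarrow> 0 < q \<and> (\<forall>p :: nat. prime p \<and> p dvd q \<longrightarrow> int p dvd a1 * a2 * a3)" for q :: nat
  let ?L = "limsup_density a1 a2 a3" and ?m = "\<lambda>q. ereal (max_weight_density a1 a2 a3 q)"
  let ?all = "SUP q \<in> {q. 0 < q}. ?m q" and ?smooth = "SUP q \<in> {q. smooth q}. ?m q"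
  have "?all \<le> ?L"
  proof (rule SUP_least)
    fix q :: nat assume "q \<in> {q. 0 < q}"
    then have q: "0 < q" by simp
    obtain g where "residue_weight q g" "max_weight_density a1 a2 a3 q = weight_density a1 a2 a3 q g"
      using max_weight_density_attained[OF q] by blast
    then show "?m q \<le> ?L" using weight_density_le_limsup[OF nz b q] by simp
  qed
  moreover have "?smooth \<le> ?all" by (rule SUP_subset_mono) (auto simp: smooth_def)
  moreover have "?L \<le> ?smooth"
  proof (rule ccontr)
    assume "\<not> ?L \<le> ?smooth"
    then have "?smooth < ?L" by simp
    then obtain s where s: "?smooth < ereal s" "ereal s < ?L" using ereal_dense2 by blast
    \<comment> \<open>Two entries determine a solution, so the limit superior is finite and can be
      handled as a real number.\<close>
    have "?L \<le> ereal 1"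
      unfolding limsup_density_def
    proof (rule Limsup_bounded, unfold eventually_finite_card, intro exI allI impI)
      fix S :: "int set" assume S: "finite S" "1 \<le> card S"
      then have "0 < real (card S)" by linarith
      then have "0 < (real (card S))\<^sup>2" by (rule zero_less_power)
      then show "ereal (real (num_solutions a1 a2 a3 S) / (real (card S))\<^sup>2) \<le> ereal 1"
        using num_solutions_le[OF nz S(1)] by (simp add: pos_divide_le_eq)
    qed
    then obtain \<gamma> where \<gamma>: "?L = ereal \<gamma>" "\<gamma> \<le> 1" using s(2) by (cases ?L) auto
    have le: "max_weight_density a1 a2 a3 q \<le> s" if "smooth q" for q
    proof -
      have "?m q \<le> ?smooth" by (rule SUP_upper) (use that in simp)
      then have "?m q < ereal s" using s(1) by (rule le_less_trans)
      then show ?thesis by simp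
    qed
    have wd: "weight_density a1 a2 a3 (nat q) g \<le> s" if "dsmooth \<bar>a1 * a2 * a3\<bar> q" "residue_weight (nat q) g" for q g
    proof -
      have q: "0 < q" using that(1) by (simp add: dsmooth_def)
      then have "smooth (nat q)" using dsmooth_nat_iff[of q "a1 * a2 * a3"] that(1) by (simp add: smooth_def)
      then show ?thesis using le weight_density_le_max[of "nat q" g a1 a2 a3] that(2) q by force
    qed
    have "0 \<le> s"
    proof -
      have "smooth 1" by (auto simp: smooth_def)
      moreover have "residue_weight 1 (\<lambda>_. 1)" by (simp add: residue_weight_def)
      ultimately show ?thesis
        using le[of 1] weight_density_le_max[of 1 "\<lambda>_. 1" a1 a2 a3] weight_density_nonneg[of a1 a2 a3 1 "\<lambda>_. 1"] by simp
    qed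
    then have "\<gamma> \<le> s" by (rule limsup_density_upper_bound[OF nz b refl \<gamma>]) (rule wd)
    then show False using s(2) \<gamma>(1) by simp
  qed
  ultimately have "?L = ?all \<and> ?L = ?smooth" by (metis order_antisym order_trans)
  then show ?thesis unfolding smooth_def .
qed

end
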